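(* Let $\Omega\subset\mathbb{R}^n$ be open with smooth boundary $\partial\Omega\in C^\infty$ of nonnegative mean curvature $H[\partial\Omega]\ge 0$. Let $u\colon\overline{\Omega}\times[0,\infty)\to[-\infty,\infty]$ be continuous and smooth in the set $\{(x,t)\in\Omega\times(0,\infty)\colon |u(x,t)|<\infty\}$, and suppose that $u$ satisfies \[ \frac{\partial u}{\partial t}=\sqrt{1+|Du|^2}\,\operatorname{div}\left(\frac{Du}{\sqrt{1+|Du|^2}}\right) \] in this set. For $t\in[0,\infty)$ define $A_t$ to be the projection of $\operatorname{graph}u(\cdot,t)\cap\mathbb{R}^{n+1}$ onto $\overline{\Omega}$, that is, \[ A_t=\{x\in\overline{\Omega}\colon |u(x,t)|<\infty\}. \] Then $(A_t)_{t\in[0,\infty)}$ is a weak solution of mean curvature flow (in $\overline{\Omega}$) with boundary values $\big(\{x\in\partial\Omega\colon |u(x,t)|<\infty\}\big)_{t\in[0,\infty)}$.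
   Context: $D$ and $\operatorname{div}$ are taken in the spatial variable. The sign convention is that balls have boundary of positive mean curvature. A family $(M_t)$ of smooth hypersurfaces of $\mathbb{R}^n$ is a classical solution to mean curvature flow if there are a manifold $M$ and a smooth map $X$ on $M\times I$ ($I$ the time interval) such that each $X(\cdot,t)$ is an immersion with $X(M,t)=M_t$ and $\frac{d}{dt}X=-H\nu$, where $-H\nu$ is the mean curvature vector of $M_t$. Definition (weak solutions in $\overline{\Omega}$). A family $(A_t)_{t\in[0,\infty)}$ of (relatively) open subsets of $\overline{\Omega}$ is called (1) a supersolution to mean curvature flow if for any family $(B_t)_{t\in[a,b]}$ (with $[a,b]\subset[0,\infty)$) of open sets $B_t\Subset\Omega$ with $\partial B_t\in C^\infty$ such that $(\partial B_t)_{t\in[a,b]}$ is a classical solution to mean curvature flow, one has: $\overline{B_a}\subset A_a$ implies $B_b\subset A_b$; (2) a subsolution to mean curvature flow if $(\overline{\Omega}\setminus\overline{A_t})_{t\in[0,\infty)}$ is a supersolution; (3) a weak solution of mean curvature flow if it is both a supersolution and a subsolution. The family $(\partial\Omega\cap A_t)_{t\in[0,\infty)}$ is called the boundary values of $(A_t)_{t\in[0,\infty)}$. *)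

theory Defs
  imports "HOL-Analysis.Analysis"
begin

section \<open>Smooth functions and vector calculus\<close>

primrec Ck_on :: "nat \<Rightarrow> 'a::euclidean_space set \<Rightarrow> ('a \<Rightarrow> 'b::real_normed_vector) \<Rightarrow> bool" where
  "Ck_on 0 S f \<longleftrightarrow> continuous_on S f"
| "Ck_on (Suc k) S f \<longleftrightarrow>
     (\<forall>x\<in>S. f differentiable (at x)) \<and> (\<forall>v. Ck_on k S (\<lambda>x. frechet_derivative f (at x) v))"

text \<open>
  Smoothness on an arbitrary subset of a Euclidean space: local existence of smooth extensions.
  It is needed for sets that are not open, namely (open subset of a hyperplane) \<open>\<times>\<close>
  (compact time interval); for open \<open>S\<close> it just says that \<open>f\<close> is \<open>C\<^sup>k\<close> on \<open>S\<close> for all \<open>k\<close>.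
\<close>

definition smooth_on :: "'a::euclidean_space set \<Rightarrow> ('a \<Rightarrow> 'b::real_normed_vector) \<Rightarrow> bool" where
  "smooth_on S f \<longleftrightarrow>
     (\<forall>x\<in>S. \<exists>U g. open U \<and> x \<in> U \<and> (\<forall>k. Ck_on k U g) \<and> (\<forall>y\<in>S \<inter> U. f y = g y))"

definition gradient :: "('a::euclidean_space \<Rightarrow> real) \<Rightarrow> 'a \<Rightarrow> 'a" where
  "gradient f x = (\<Sum>b\<in>Basis. frechet_derivative f (at x) b *\<^sub>R b)"

definition divergence :: "('a::euclidean_space \<Rightarrow> 'a) \<Rightarrow> 'a \<Rightarrow> real" where
  "divergence F x = (\<Sum>b\<in>Basis. frechet_derivative F (at x) b \<bullet> b)"


section \<open>Immersed hypersurfaces and their mean curvature\<close>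

text \<open>
  The model space for hypersurfaces of an \<open>n\<close>-dimensional space: \<open>\<real>\<^sup>n\<^sup>-\<^sup>1\<close>, realised as a
  coordinate hyperplane of the ambient space, so that \<open>n = 1\<close> needs no separate treatment.
\<close>

definition model_hyperplane :: "'a::euclidean_space set" where
  "model_hyperplane = {y. y \<bullet> (SOME b. b \<in> Basis) = 0}"

text \<open>
  Directional derivative. For \<open>F\<close> given on a relatively open subset of the model hyperplane and
  \<open>v\<close> in the hyperplane it only depends on the values of \<open>F\<close> on that subset.
\<close>

definition dir_deriv :: "('a::real_normed_vector \<Rightarrow> 'b::real_normed_vector) \<Rightarrow> 'a \<Rightarrow> 'a \<Rightarrow> 'b" where
  "dir_deriv F y v = vector_derivative (\<lambda>s. F (y + s *\<^sub>R v)) (at 0)"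

definition immersion_at :: "('a::euclidean_space \<Rightarrow> 'a) \<Rightarrow> 'a \<Rightarrow> bool" where
  "immersion_at F y \<longleftrightarrow> inj_on (dir_deriv F y) model_hyperplane"

definition unit_normal :: "('a::euclidean_space \<Rightarrow> 'a) \<Rightarrow> 'a \<Rightarrow> 'a \<Rightarrow> bool" where
  "unit_normal F y \<nu> \<longleftrightarrow> norm \<nu> = 1 \<and> (\<forall>v\<in>model_hyperplane. dir_deriv F y v \<bullet> \<nu> = 0)"

text \<open>A basis of the model hyperplane that is orthonormal for the induced metric of \<open>F\<close> at \<open>y\<close>.\<close>

definition orthonormal_frame :: "('a::euclidean_space \<Rightarrow> 'a) \<Rightarrow> 'a \<Rightarrow> 'a set \<Rightarrow> bool" where
  "orthonormal_frame F y E \<longleftrightarrow>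
     finite E \<and> E \<subseteq> model_hyperplane \<and> card E = dim (model_hyperplane :: 'a set) \<and>
     (\<forall>v\<in>E. \<forall>w\<in>E. dir_deriv F y v \<bullet> dir_deriv F y w = (if v = w then 1 else 0))"

text \<open>
  The second fundamental form with respect to the unit normal \<open>\<nu>\<close>, and its trace for the
  induced metric (which does not depend on the frame). The sign is such that
  \<open>- mean_curvature F y \<nu> *\<^sub>R \<nu>\<close> is the mean curvature vector and spheres of radius \<open>r\<close>
  have mean curvature \<open>(n - 1) / r\<close> with respect to the outer normal.
\<close>

definition second_fundamental_form ::
    "('a::euclidean_space \<Rightarrow> 'a) \<Rightarrow> 'a \<Rightarrow> 'a \<Rightarrow> 'a \<Rightarrow> 'a \<Rightarrow> real" where
  "second_fundamental_form F y \<nu> v w = - (dir_deriv (\<lambda>z. dir_deriv F z v) y w \<bullet> \<nu>)"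

definition mean_curvature :: "('a::euclidean_space \<Rightarrow> 'a) \<Rightarrow> 'a \<Rightarrow> 'a \<Rightarrow> real" where
  "mean_curvature F y \<nu> =
     (\<Sum>v\<in>(SOME E. orthonormal_frame F y E). second_fundamental_form F y \<nu> v v)"


section \<open>Smooth boundaries\<close>

definition local_defining_function ::
    "'a::euclidean_space set \<Rightarrow> 'a set \<Rightarrow> ('a \<Rightarrow> real) \<Rightarrow> bool" where
  "local_defining_function \<Omega> U \<rho> \<longleftrightarrow>
     open U \<and> smooth_on U \<rho> \<and> (\<forall>x\<in>U. gradient \<rho> x \<noteq> 0) \<and> \<Omega> \<inter> U = {x\<in>U. \<rho> x < 0}"

definition smooth_boundary :: "'a::euclidean_space set \<Rightarrow> bool" where
  "smooth_boundary \<Omega> \<longleftrightarrow> (\<forall>p\<in>frontier \<Omega>. \<exists>U \<rho>. p \<in> U \<and> local_defining_function \<Omega> U \<rho>)"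

definition outer_normal :: "'a::euclidean_space set \<Rightarrow> 'a \<Rightarrow> 'a" where
  "outer_normal \<Omega> p =
     (THE \<nu>. \<exists>U \<rho>. p \<in> U \<and> local_defining_function \<Omega> U \<rho> \<and>
        \<nu> = gradient \<rho> p /\<^sub>R norm (gradient \<rho> p))"

text \<open>
  The mean curvature of \<open>\<partial>\<Omega>\<close> at \<open>p\<close>, computed in an arbitrary local parametrisation of
  \<open>\<partial>\<Omega>\<close>. Both descriptions are only meaningful for sets with smooth boundary.
\<close>

definition boundary_mean_curvature :: "'a::euclidean_space set \<Rightarrow> 'a \<Rightarrow> real" where
  "boundary_mean_curvature \<Omega> p =
     (THE h. \<exists>V F y. openin (top_of_set model_hyperplane) V \<and> smooth_on V F \<and>
        (\<forall>z\<in>V. immersion_at F z) \<and> F ` V \<subseteq> frontier \<Omega> \<and> y \<in> V \<and> F y = p \<and>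
        h = mean_curvature F y (outer_normal \<Omega> p))"


section \<open>Abstract smooth manifolds\<close>

text \<open>
  A second countable Hausdorff manifold (without boundary, not necessarily connected) modelled on
  \<open>model_hyperplane\<close>. Points are taken from an arbitrary type \<open>'m\<close>; \<open>A\<close> is a smooth atlas.
\<close>

definition second_countable_space :: "'m topology \<Rightarrow> bool" where
  "second_countable_space T \<longleftrightarrow>
     (\<exists>\<B>. countable \<B> \<and> (\<forall>V\<in>\<B>. openin T V) \<and>
        (\<forall>U x. openin T U \<and> x \<in> U \<longrightarrow> (\<exists>V\<in>\<B>. x \<in> V \<and> V \<subseteq> U)))"

definition smooth_manifold ::
    "'m topology \<Rightarrow> ('m set \<times> ('m \<Rightarrow> 'a::euclidean_space)) set \<Rightarrow> bool" where
  "smooth_manifold T A \<longleftrightarrow>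
     Hausdorff_space T \<and> second_countable_space T \<and>
     topspace T = \<Union> (fst ` A) \<and>
     (\<forall>(U, \<phi>)\<in>A. openin T U \<and> openin (top_of_set model_hyperplane) (\<phi> ` U) \<and>
        homeomorphic_map (subtopology T U) (top_of_set (\<phi> ` U)) \<phi>) \<and>
     (\<forall>(U, \<phi>)\<in>A. \<forall>(V, \<psi>)\<in>A. smooth_on (\<phi> ` (U \<inter> V)) (\<psi> \<circ> inv_into U \<phi>))"


section \<open>Mean curvature flow\<close>

text \<open>
  Classical solutions on a time interval \<open>I\<close>. Every second countable Hausdorff manifold has at
  most the cardinality of the continuum, so it is no restriction to take the points of the
  parameter manifold from the type \<open>real\<close>, equipped with an arbitrary topology on a subset of it.
  The velocity \<open>- H \<nu>\<close> does not depend on the choice between the two unit normals.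
\<close>

definition classical_mcf :: "real set \<Rightarrow> (real \<Rightarrow> 'a::euclidean_space set) \<Rightarrow> bool" where
  "classical_mcf I M \<longleftrightarrow>
     (\<exists>(T :: real topology) (A :: (real set \<times> (real \<Rightarrow> 'a)) set) (X :: real \<Rightarrow> real \<Rightarrow> 'a).
        smooth_manifold T A \<and>
        (\<forall>(U, \<phi>)\<in>A. smooth_on (\<phi> ` U \<times> I) (\<lambda>(y, t). X (inv_into U \<phi> y) t)) \<and>
        (\<forall>t\<in>I. (\<lambda>q. X q t) ` topspace T = M t) \<and>
        (\<forall>(U, \<phi>)\<in>A. \<forall>q\<in>U. \<forall>t\<in>I.
           let F = (\<lambda>y. X (inv_into U \<phi> y) t) in
             immersion_at F (\<phi> q) \<and>
             (\<forall>\<nu>. unit_normal F (\<phi> q) \<nu> \<longrightarrow>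
                (X q has_vector_derivative - mean_curvature F (\<phi> q) \<nu> *\<^sub>R \<nu>) (at t within I))))"

text \<open>
  Families \<open>(A t)\<close> are functions on \<open>real\<close> of which only the values for \<open>t \<ge> 0\<close> matter.
  Degenerate intervals \<open>a = b\<close> are left out: for them the implication is trivial.
\<close>

definition relatively_open_family :: "'a::euclidean_space set \<Rightarrow> (real \<Rightarrow> 'a set) \<Rightarrow> bool" where
  "relatively_open_family \<Omega> A \<longleftrightarrow> (\<forall>t\<ge>0. openin (top_of_set (closure \<Omega>)) (A t))"

definition mcf_supersolution :: "'a::euclidean_space set \<Rightarrow> (real \<Rightarrow> 'a set) \<Rightarrow> bool" where
  "mcf_supersolution \<Omega> A \<longleftrightarrow>
     relatively_open_family \<Omega> A \<and>
     (\<forall>a b B. 0 \<le> a \<and> a < b \<and>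
        (\<forall>t\<in>{a..b}. open (B t) \<and> compact (closure (B t)) \<and> closure (B t) \<subseteq> \<Omega> \<and>
           smooth_boundary (B t)) \<and>
        classical_mcf {a..b} (\<lambda>t. frontier (B t)) \<longrightarrow>
        closure (B a) \<subseteq> A a \<longrightarrow> B b \<subseteq> A b)"

definition mcf_subsolution :: "'a::euclidean_space set \<Rightarrow> (real \<Rightarrow> 'a set) \<Rightarrow> bool" where
  "mcf_subsolution \<Omega> A \<longleftrightarrow>
     relatively_open_family \<Omega> A \<and> mcf_supersolution \<Omega> (\<lambda>t. closure \<Omega> - closure (A t))"

definition mcf_weak_solution :: "'a::euclidean_space set \<Rightarrow> (real \<Rightarrow> 'a set) \<Rightarrow> bool" where
  "mcf_weak_solution \<Omega> A \<longleftrightarrow> mcf_supersolution \<Omega> A \<and> mcf_subsolution \<Omega> A"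

definition boundary_values :: "'a::euclidean_space set \<Rightarrow> (real \<Rightarrow> 'a set) \<Rightarrow> real \<Rightarrow> 'a set" where
  "boundary_values \<Omega> A t = frontier \<Omega> \<inter> A t"

end

theory Submission
  imports Defs
begin

text \<open>
  Let \<open>T\<close> be the first time at which a classical flow \<open>\<partial>B\<^sub>t\<close> touches, at a point \<open>p\<close>, the set where
  \<open>u\<close> is infinite (or the closure of the set where \<open>u\<close> is finite). Then \<open>\<bar>u(p, T)\<bar> = \<infinity>\<close>, and points with
  finite \<open>u\<close> accumulate at \<open>(p, T)\<close>. Perturbing the height over \<open>\<partial>B\<^sub>t\<close> gives a function \<open>W\<close> near
  \<open>(p, T)\<close> whose level sets move strictly in the wrong direction and for which \<open>W < W(p, T)\<close> away
  from \<open>(p, T)\<close> on the set where \<open>u\<close> blows up. For finite points \<open>z\<^sub>k\<close> tending to \<open>(p, T)\<close>, with \<open>h\<^sub>k = u(z\<^sub>k)\<close> and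
  \<open>\<eta>\<^sub>k = 1 / (1 + \<bar>h\<^sub>k\<bar>)\<close>, maximise \<open>W - \<eta>\<^sub>k (u - h\<^sub>k)\<^sup>2\<close>. At the maximum \<open>DW = l\<^sub>k Du\<close> with \<open>l\<^sub>k \<longlonglongrightarrow> 0\<close>, and the
  graph equation for \<open>u\<close> turns the second derivative test into the level set inequality for \<open>W\<close> in
  the limit, a contradiction.

  To make the barrier available one has to know that \<open>\<partial>B\<^sub>t\<close> is locally a single moving graph even
  though the flow is only given as a family of immersions: two sheets that agree at one time agree
  at all earlier times by the same kind of barrier, and for a short later time
  because their distance satisfies a linear parabolic inequality.
\<close>

section \<open>Calculus of \<open>C\<^sup>k\<close> functions\<close>

text \<open>The penalty answers three demands. It must place the maximum where \<open>u\<close> is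
  finite. Its multiplier must vanish: if DW = l q with l nonzero, the graph term D^2W(q,q) / (1 +
  |q|^2) equals D^2W(DW,DW) / (l^2 + |DW|^2), which becomes the level set term as l tends to 0. And
  the maxima must not drift to bounded values of \<open>u\<close>: with |W| \<le> C the maximum
  obeys (u - h)^2 \<le> 2C / \<eta> = 2C (1 + |h|), so \<open>u\<close> leaves h by an amount of
  order sqrt |h| only, while l^2 \<le> 8C \<eta> tends to 0. The other obstacle is how little is
  given about the competitors: each \<open>B t\<close> has a smooth boundary, but neither continuity
  of t \<mapsto> \<open>B t\<close> nor compactness of the parameter manifold is assumed.
  Trajectories that meet at the final time agree at all earlier times, so finitely many compact
  pieces covering the last boundary cover the whole flow. Continuity of the enclosed sets then
  follows by a connectedness argument over the whole space, started far away, where no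
  \<open>B t\<close> reaches.\<close>

lemma Ck_on_subset: "Ck_on k S f \<Longrightarrow> T \<subseteq> S \<Longrightarrow> Ck_on k T f"
proof (induction k arbitrary: f)
  case 0
  then show ?case using continuous_on_subset by auto
next
  case (Suc k)
  then show ?case by (auto intro: Suc.IH)
qed

lemma Ck_on_cong:
  assumes "open S" "\<And>x. x \<in> S \<Longrightarrow> f x = g x" "Ck_on k S f"
  shows "Ck_on k S g"
  using assms
proof (induction k arbitrary: f g)
  case 0
  then show ?case by (auto cong: continuous_on_cong)
next
  case (Suc k)
  have fg: "(g has_derivative frechet_derivative f (at x)) (at x)" if "x \<in> S" for x
  proof (rule has_derivative_transform_within_open[of f _ _ _ S])
    show "(f has_derivative frechet_derivative f (at x)) (at x)"
      using Suc.prems(3) that by (simp add: frechet_derivative_works)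
  qed (use Suc.prems that in auto)
  then have eq: "frechet_derivative g (at x) = frechet_derivative f (at x)" if "x \<in> S" for x
    using frechet_derivative_at that by metis
  show ?case
  proof (simp, intro conjI ballI allI)
    show "g differentiable at x" if "x \<in> S" for x
      using fg[OF that] by (auto simp: differentiable_def)
    show "Ck_on k S (\<lambda>x. frechet_derivative g (at x) v)" for v
      by (rule Suc.IH[of "\<lambda>x. frechet_derivative f (at x) v"]) (use Suc.prems eq in auto)
  qed
qed

text \<open>Allows an explicit formula for the derivative in place of
  \<open>frechet_derivative\<close>; the inductive smoothness proofs below all go through this
  rule.\<close>

lemma Ck_on_SucI:
  assumes "open S" "\<And>x. x \<in> S \<Longrightarrow> (f has_derivative f' x) (at x)"
    and "\<And>v. Ck_on k S (\<lambda>x. f' x v)"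
  shows "Ck_on (Suc k) S f"
proof (simp, intro conjI ballI allI)
  show "f differentiable at x" if "x \<in> S" for x
    using assms(2)[OF that] by (auto simp: differentiable_def)
  show "Ck_on k S (\<lambda>x. frechet_derivative f (at x) v)" for v
    by (rule Ck_on_cong[OF assms(1) _ assms(3)[of v]])
      (use assms(2) frechet_derivative_at in metis)
qed

lemma Ck_on_has_derivative:
  "Ck_on (Suc k) S f \<Longrightarrow> x \<in> S \<Longrightarrow> (f has_derivative frechet_derivative f (at x)) (at x)"
  by (simp add: frechet_derivative_works)

lemma Ck_on_Suc_D: "Ck_on (Suc k) S f \<Longrightarrow> Ck_on k S f"
proof (induction k arbitrary: f)
  case 0
  then show ?case
    by (auto intro!: continuous_at_imp_continuous_on differentiable_imp_continuous_within)
next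
  case (Suc k)
  then show ?case by (auto intro: Suc.IH)
qed

lemma Ck_on_continuous: "Ck_on k S f \<Longrightarrow> continuous_on S f"
proof (induction k arbitrary: f)
  case (Suc k)
  then show ?case using Ck_on_Suc_D by blast
qed auto

lemma Ck_on_const: "Ck_on k S (\<lambda>x. c)"
proof (induction k arbitrary: c)
  case (Suc k)
  have "frechet_derivative (\<lambda>x. c) (at x) v = 0" for x v
    by simp
  then show ?case using Suc by simp
qed simp

lemma Ck_on_linear:
  assumes "bounded_linear f" "open S"
  shows "Ck_on k S f"
proof (cases k)
  case 0
  then show ?thesis using assms by (simp add: linear_continuous_on)
next
  case (Suc j)
  show ?thesis unfolding Suc
    by (rule Ck_on_SucI[where f' = "\<lambda>x. f"])
      (use assms in \<open>auto intro: bounded_linear_imp_has_derivative Ck_on_const\<close>)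
qed

lemma Ck_on_add:
  assumes "open S" "Ck_on k S f" "Ck_on k S g"
  shows "Ck_on k S (\<lambda>x. f x + g x)"
  using assms(2,3)
proof (induction k arbitrary: f g)
  case 0
  then show ?case by (auto intro: continuous_intros)
next
  case (Suc k)
  show ?case
    by (rule Ck_on_SucI[OF assms(1)], rule has_derivative_add[OF Ck_on_has_derivative Ck_on_has_derivative])
      (use Suc in auto)
qed

lemma Ck_on_bilinear:
  assumes "bounded_bilinear p" "open S" "Ck_on k S f" "Ck_on k S g"
  shows "Ck_on k S (\<lambda>x. p (f x) (g x))"
  using assms(3,4)
proof (induction k arbitrary: f g)
  case 0
  then show ?case by (auto intro: bounded_bilinear.continuous_on[OF assms(1)])
next
  case (Suc k)
  show ?case
    by (rule Ck_on_SucI[OF assms(2)],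
        rule bounded_bilinear.FDERIV[OF assms(1) Ck_on_has_derivative Ck_on_has_derivative])
      (use Suc in \<open>auto intro!: Ck_on_add assms Suc.IH Ck_on_Suc_D[of k S f] Ck_on_Suc_D[of k S g]\<close>)
qed

lemmas Ck_on_scaleR = Ck_on_bilinear[OF bounded_bilinear_scaleR]
lemmas Ck_on_mult = Ck_on_bilinear[OF bounded_bilinear_mult]
lemmas Ck_on_inner = Ck_on_bilinear[OF bounded_bilinear_inner]

lemma Ck_on_sum:
  assumes "open S" "\<And>i. i \<in> I \<Longrightarrow> Ck_on k S (f i)"
  shows "Ck_on k S (\<lambda>x. \<Sum>i\<in>I. f i x)"
  using assms(2)
  by (induction I rule: infinite_finite_induct) (auto intro: Ck_on_const Ck_on_add assms(1))

lemma Ck_on_bounded_linear: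
  assumes "bounded_linear h" "open S" "Ck_on k S f"
  shows "Ck_on k S (\<lambda>x. h (f x))"
  using assms(3)
proof (induction k arbitrary: f)
  case 0
  then show ?case by (auto intro: bounded_linear.continuous_on[OF assms(1)])
next
  case (Suc k)
  show ?case
    by (rule Ck_on_SucI[OF assms(2)],
        rule bounded_linear.has_derivative[OF assms(1) Ck_on_has_derivative])
      (use Suc in auto)
qed

lemma linear_sum_Basis:
  fixes f :: "'a::euclidean_space \<Rightarrow> 'b::real_vector"
  assumes "linear f"
  shows "f x = (\<Sum>b\<in>Basis. (x \<bullet> b) *\<^sub>R f b)"
proof -
  have "f x = f (\<Sum>b\<in>Basis. (x \<bullet> b) *\<^sub>R b)"
    by (simp add: euclidean_representation)
  also have "\<dots> = (\<Sum>b\<in>Basis. (x \<bullet> b) *\<^sub>R f b)"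
    using assms by (simp add: linear_sum linear_cmul)
  finally show ?thesis .
qed

text \<open>The chain rule differentiates \<open>f\<close> in the direction h'(x) v, which varies
  with \<open>x\<close>, whereas \<open>Ck_on\<close> speaks of fixed directions. Expanding that
  direction in \<open>Basis\<close> leaves partial derivatives of \<open>f\<close> along basis
  vectors, to which the induction hypothesis applies.\<close>

lemma Ck_on_compose:
  fixes f :: "'b::euclidean_space \<Rightarrow> 'c::real_normed_vector" and h :: "'a::euclidean_space \<Rightarrow> 'b"
  assumes "open S" "open T" "h ` S \<subseteq> T" "Ck_on k T f" "Ck_on k S h"
  shows "Ck_on k S (\<lambda>x. f (h x))"
  using assms(4,5)
proof (induction k arbitrary: f)
  case 0
  then show ?case using assms(3) by (auto intro: continuous_on_compose2)
next
  case (Suc k)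
  show ?case
  proof (rule Ck_on_SucI[OF assms(1)])
    fix x assume x: "x \<in> S"
    have d: "(f has_derivative frechet_derivative f (at (h x))) (at (h x))"
      by (rule Ck_on_has_derivative[OF Suc.prems(1)]) (use x assms in auto)
    have "((\<lambda>x. f (h x)) has_derivative (\<lambda>v. frechet_derivative f (at (h x)) (frechet_derivative h (at x) v))) (at x)"
      by (rule has_derivative_compose[OF Ck_on_has_derivative[OF Suc.prems(2)] d]) (use x in auto)
    then show "((\<lambda>x. f (h x)) has_derivative (\<lambda>v. \<Sum>b\<in>Basis. (frechet_derivative h (at x) v \<bullet> b) *\<^sub>R
        frechet_derivative f (at (h x)) b)) (at x)"
      by (rule has_derivative_eq_rhs)
        (use d in \<open>auto intro!: linear_sum_Basis simp: fun_eq_iff has_derivative_linear\<close>)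
  next
    fix v
    have "Ck_on k S (\<lambda>x. frechet_derivative f (at (h x)) b)" for b
      by (rule Suc.IH[of "\<lambda>y. frechet_derivative f (at y) b"])
        (use Suc.prems Ck_on_Suc_D[of k S h] in auto)
    moreover have "Ck_on k S (\<lambda>x. frechet_derivative h (at x) v \<bullet> b)" for b
      by (rule Ck_on_inner[OF assms(1) _ Ck_on_const]) (use Suc.prems in auto)
    ultimately show "Ck_on k S (\<lambda>x. \<Sum>b\<in>Basis. (frechet_derivative h (at x) v \<bullet> b) *\<^sub>R
        frechet_derivative f (at (h x)) b)"
      by (intro Ck_on_sum Ck_on_scaleR assms(1)) auto
  qed
qed

lemma Ck_on_components:
  fixes f :: "'a::euclidean_space \<Rightarrow> 'b::euclidean_space"
  assumes "open S" "\<And>b. b \<in> Basis \<Longrightarrow> Ck_on k S (\<lambda>x. f x \<bullet> b)"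
  shows "Ck_on k S f"
proof -
  have "Ck_on k S (\<lambda>x. \<Sum>b\<in>Basis. (f x \<bullet> b) *\<^sub>R b)"
    by (intro Ck_on_sum Ck_on_scaleR Ck_on_const assms)
  then show ?thesis by (simp add: euclidean_representation)
qed

lemma Ck_on_real_polynomial_function:
  "real_polynomial_function f \<Longrightarrow> open S \<Longrightarrow> Ck_on k S f"
proof (induction f rule: real_polynomial_function.induct)
  case (linear f) then show ?case by (rule Ck_on_linear)
next
  case (const c) then show ?case by (simp add: Ck_on_const)
next
  case (add f g) then show ?case by (simp add: Ck_on_add)
next
  case (mult f g) then show ?case by (simp add: Ck_on_mult)
qed

text \<open>Polynomial maps serve later as smooth vector fields transversal to a boundary.\<close>

lemma Ck_on_polynomial_function:
  fixes f :: "'a::euclidean_space \<Rightarrow> 'b::euclidean_space"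
  assumes "polynomial_function f" "open S"
  shows "Ck_on k S f"
proof (rule Ck_on_components[OF assms(2)])
  fix b :: 'b assume "b \<in> Basis"
  have "real_polynomial_function ((\<lambda>y. y \<bullet> b) \<circ> f)"
    using assms(1) bounded_linear_inner_left unfolding polynomial_function_def by blast
  then show "Ck_on k S (\<lambda>x. f x \<bullet> b)"
    using Ck_on_real_polynomial_function[OF _ assms(2)] by (force simp: o_def)
qed

section \<open>Smoothness of inverse linear maps and of local inverses\<close>

text \<open>A product rule in which the scalar factor is merely continuous: the vector factor
  vanishes at \<open>x\<close>, so the increment of \<open>a\<close> contributes only o(|z - x|). It
  is needed where the coefficients are themselves the unknown whose differentiability is being
  proved.\<close>

lemma has_derivative_scaleR_vanishing:
  fixes a :: "'a::real_normed_vector \<Rightarrow> real" and \<psi> :: "'a \<Rightarrow> 'b::real_normed_vector"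
  assumes a: "isCont a x" and "\<psi> x = 0" and der: "(\<psi> has_derivative \<psi>') (at x)"
  shows "((\<lambda>z. a z *\<^sub>R \<psi> z) has_derivative (\<lambda>v. a x *\<^sub>R \<psi>' v)) (at x)"
proof -
  have 1: "((\<lambda>z. a x *\<^sub>R \<psi> z) has_derivative (\<lambda>v. a x *\<^sub>R \<psi>' v)) (at x)"
    by (intro derivative_intros der)
  have 2: "((\<lambda>z. (a z - a x) *\<^sub>R \<psi> z) has_derivative (\<lambda>v. 0)) (at x)"
    unfolding has_derivative_at
  proof (intro conjI)
    obtain e K where eK: "e > 0" "K > 0" and K: "\<And>z. norm (z - x) < e \<Longrightarrow> norm (\<psi> z) \<le> K * norm (z - x)"
    proof -
      obtain B where B: "\<And>v. norm (\<psi>' v) \<le> norm v * B" "B > 0"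
        using bounded_linear.pos_bounded[OF has_derivative_bounded_linear[OF der]] by blast
      obtain d where d: "d > 0" "\<And>y. norm (y - x) < d \<Longrightarrow> norm (\<psi> y - \<psi> x - \<psi>' (y - x)) \<le> 1 * norm (y - x)"
        using der unfolding has_derivative_at_alt by (meson zero_less_one)
      have "norm (\<psi> z) \<le> (1 + B) * norm (z - x)" if "norm (z - x) < d" for z
      proof -
        have "norm (\<psi> z) \<le> norm (\<psi> z - \<psi> x - \<psi>' (z - x)) + norm (\<psi>' (z - x))"
          using norm_triangle_ineq[of "\<psi> z - \<psi> x - \<psi>' (z - x)" "\<psi>' (z - x)"] assms(2) by simp
        then show ?thesis using d(2)[OF that] B(1)[of "z - x"] by (simp add: algebra_simps)
      qed
      then show ?thesis using that[of d "1 + B"] d(1) B(2) by auto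
    qed
    have "((\<lambda>h. \<bar>a (x + h) - a x\<bar> * K) \<longlongrightarrow> 0) (at 0)"
      using a by (auto simp: isCont_iff intro!: tendsto_eq_intros)
    moreover have "eventually (\<lambda>h. norm (norm ((a (x + h) - a x) *\<^sub>R \<psi> (x + h) - (a x - a x) *\<^sub>R \<psi> x - 0) / norm h)
        \<le> \<bar>a (x + h) - a x\<bar> * K) (at 0)"
      unfolding eventually_at
    proof (intro exI[of _ e] conjI ballI impI)
      fix h :: 'a assume h: "h \<noteq> 0 \<and> dist h 0 < e"
      then have "norm (\<psi> (x + h)) \<le> K * norm h" using K[of "x + h"] by simp
      then have "\<bar>a (x + h) - a x\<bar> * norm (\<psi> (x + h)) \<le> \<bar>a (x + h) - a x\<bar> * (K * norm h)"
        by (intro mult_left_mono) auto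
      then show "norm (norm ((a (x + h) - a x) *\<^sub>R \<psi> (x + h) - (a x - a x) *\<^sub>R \<psi> x - 0) / norm h)
        \<le> \<bar>a (x + h) - a x\<bar> * K"
        using h by (simp add: divide_simps mult.assoc)
    qed (use eK in auto)
    ultimately show "(\<lambda>h. norm ((a (x + h) - a x) *\<^sub>R \<psi> (x + h) - (a x - a x) *\<^sub>R \<psi> x - 0) / norm h) \<midarrow>0\<rightarrow> 0"
      by (rule Lim_null_comparison[rotated])
  qed simp
  show ?thesis
    using has_derivative_add[OF 1 2] by (simp add: algebra_simps)
qed

text \<open>Resolvent identity: with u z = inv (L z) v and R = inv (L x) one has u z - u x = - R ((L
  z - L x) (u z)). It yields continuity of u; after that the right-hand side is differentiable by
  the preceding product rule, because L z - L x vanishes at \<open>x\<close>.\<close>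

lemma has_derivative_inv_linear:
  fixes L :: "'a::euclidean_space \<Rightarrow> 'b::euclidean_space \<Rightarrow> 'b"
  assumes S: "open S" "x \<in> S"
    and lin: "\<And>z. z \<in> S \<Longrightarrow> linear (L z)" and bij: "\<And>z. z \<in> S \<Longrightarrow> bij (L z)"
    and der: "\<And>b. ((\<lambda>z. L z b) has_derivative L' b) (at x)"
  shows "((\<lambda>z. inv (L z) v) has_derivative
      (\<lambda>\<xi>. - (\<Sum>b\<in>Basis. (inv (L x) v \<bullet> b) *\<^sub>R inv (L x) (L' b \<xi>)))) (at x)"
proof -
  define u where "u = (\<lambda>z. inv (L z) v)"
  define R where "R = inv (L x)"
  have Lu: "L z (u z) = v" if "z \<in> S" for z
    using bij[OF that] by (simp add: u_def bij_is_surj surj_f_inv_f)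
  have linR: "linear R"
    unfolding R_def using lin bij S(2)
    by (metis bij_betw_def inj_linear_imp_inv_linear)
  have RL: "R (L x w) = w" for w
    using bij[OF S(2)] by (simp add: R_def bij_is_inj)
  have eq: "u z - u x = - R (\<Sum>b\<in>Basis. (u z \<bullet> b) *\<^sub>R (L z b - L x b))" if z: "z \<in> S" for z
  proof -
    have "(\<Sum>b\<in>Basis. (u z \<bullet> b) *\<^sub>R (L z b - L x b)) = L z (u z) - L x (u z)"
      unfolding linear_sum_Basis[OF lin[OF z], of "u z"] linear_sum_Basis[OF lin[OF S(2)], of "u z"]
      by (simp add: sum_subtractf scaleR_diff_right)
    also have "\<dots> = L x (u x) - L x (u z)" using Lu z S(2) by simp
    also have "\<dots> = L x (u x - u z)" using lin[OF S(2)] by (simp add: linear_diff)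
    finally show ?thesis using RL[of "u x - u z"] by simp
  qed
  define \<omega> where "\<omega> = (\<lambda>z. (\<Sum>b\<in>Basis. norm (R (L z b - L x b))))"
  have blR: "bounded_linear R" using linR linear_conv_bounded_linear by blast
  have contL: "isCont (\<lambda>z. L z b) x" for b using der has_derivative_continuous by blast
  have "isCont \<omega> x"
    unfolding \<omega>_def by (intro continuous_intros bounded_linear.isCont[OF blR] contL)
  then have \<omega>0: "(\<omega> \<longlongrightarrow> 0) (at x)"
    unfolding isCont_def \<omega>_def by (simp add: linear_0[OF linR])
  have est: "norm (u z - u x) \<le> \<omega> z * norm (u z)" if z: "z \<in> S" for z
  proof -
    have "norm (u z - u x) = norm (\<Sum>b\<in>Basis. (u z \<bullet> b) *\<^sub>R R (L z b - L x b))"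
      unfolding eq[OF z] norm_minus_cancel by (simp add: linear_sum[OF linR] linear_cmul[OF linR])
    also have "\<dots> \<le> (\<Sum>b\<in>Basis. norm (u z) * norm (R (L z b - L x b)))"
      by (rule sum_norm_le) (auto intro!: mult_right_mono Basis_le_norm)
    finally show ?thesis by (simp add: \<omega>_def sum_distrib_left mult.commute)
  qed
  have evS: "eventually (\<lambda>z. z \<in> S) (at x)"
    using S by (simp add: eventually_at_in_open')
  \<comment> \<open>Where \<omega> < 1/2, the factor norm (u z) on the right of \<open>est\<close>
    can be absorbed, which bounds it by 2 norm (u x).\<close>
  have "eventually (\<lambda>z. \<omega> z < 1/2) (at x)"
    using order_tendstoD(2)[OF \<omega>0, of "1/2"] by simp
  with evS have "eventually (\<lambda>z. norm (u z - u x) \<le> \<omega> z * (2 * norm (u x))) (at x)"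
  proof eventually_elim
    case (elim z)
    have \<omega>nn: "\<omega> z \<ge> 0" by (auto simp: \<omega>_def intro: sum_nonneg)
    have "norm (u z) \<le> norm (u x) + norm (u z - u x)"
      using norm_triangle_ineq[of "u x" "u z - u x"] by simp
    also have "norm (u z - u x) \<le> 1/2 * norm (u z)"
      using est[of z] elim mult_right_mono[of "\<omega> z" "1/2" "norm (u z)"] by auto
    finally have "norm (u z) \<le> 2 * norm (u x)" by simp
    then show ?case
      using est[of z] elim \<omega>nn mult_left_mono[of "norm (u z)" "2 * norm (u x)" "\<omega> z"] by auto
  qed
  moreover have "((\<lambda>z. \<omega> z * (2 * norm (u x))) \<longlongrightarrow> 0) (at x)"
    using \<omega>0 by (auto intro: tendsto_eq_intros)
  ultimately have "((\<lambda>z. u z - u x) \<longlongrightarrow> 0) (at x)"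
    by (rule Lim_null_comparison)
  then have contu: "isCont u x"
    unfolding isCont_def using LIM_zero_iff by blast
  have "((\<lambda>z. \<Sum>b\<in>Basis. (u z \<bullet> b) *\<^sub>R (L z b - L x b)) has_derivative
      (\<lambda>\<xi>. \<Sum>b\<in>Basis. (u x \<bullet> b) *\<^sub>R L' b \<xi>)) (at x)"
    by (intro has_derivative_sum has_derivative_scaleR_vanishing)
      (use contu der in \<open>auto intro!: continuous_intros derivative_eq_intros\<close>)
  from has_derivative_minus[OF bounded_linear.has_derivative[OF blR this]]
  have "((\<lambda>z. u x + - R (\<Sum>b\<in>Basis. (u z \<bullet> b) *\<^sub>R (L z b - L x b))) has_derivative
      (\<lambda>\<xi>. - R (\<Sum>b\<in>Basis. (u x \<bullet> b) *\<^sub>R L' b \<xi>))) (at x)"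
    using has_derivative_add[OF has_derivative_const] by fastforce
  then have "(u has_derivative (\<lambda>\<xi>. - R (\<Sum>b\<in>Basis. (u x \<bullet> b) *\<^sub>R L' b \<xi>))) (at x)"
    by (rule has_derivative_transform_within_open[OF _ S]) (use eq in \<open>simp add: algebra_simps\<close>)
  then show ?thesis
    by (simp add: u_def R_def[symmetric] linear_sum[OF linR] linear_cmul[OF linR])
qed

text \<open>The derivative of inv (L z) v involves only values of the same inverse and derivatives
  of \<open>L\<close>, so the induction runs over all \<open>v\<close> at once. The argument of the
  outer inverse depends on the point; expanding it in \<open>Basis\<close> restores fixed
  arguments.\<close>

lemma Ck_on_inv_linear:
  fixes L :: "'a::euclidean_space \<Rightarrow> 'b::euclidean_space \<Rightarrow> 'b"
  assumes S: "open S"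
    and lin: "\<And>z. z \<in> S \<Longrightarrow> linear (L z)" and bij: "\<And>z. z \<in> S \<Longrightarrow> bij (L z)"
    and Ck: "\<And>b k. Ck_on k S (\<lambda>z. L z b)"
  shows "Ck_on k S (\<lambda>z. inv (L z) v)"
proof (induction k arbitrary: v)
  case (Suc k)
  show ?case
  proof (rule Ck_on_SucI[OF S])
    fix x assume x: "x \<in> S"
    have linR: "linear (inv (L x))"
      using lin bij x by (metis bij_betw_def inj_linear_imp_inv_linear)
    have "((\<lambda>z. inv (L z) v) has_derivative
      (\<lambda>\<xi>. - (\<Sum>b\<in>Basis. (inv (L x) v \<bullet> b) *\<^sub>R inv (L x) (frechet_derivative (\<lambda>z. L z b) (at x) \<xi>)))) (at x)"
      by (rule has_derivative_inv_linear[OF S x lin bij]) (auto intro!: Ck_on_has_derivative[OF Ck[of "Suc 0"]] x)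
    then show "((\<lambda>z. inv (L z) v) has_derivative
      (\<lambda>\<xi>. - (\<Sum>b\<in>Basis. (inv (L x) v \<bullet> b) *\<^sub>R (\<Sum>c\<in>Basis. (frechet_derivative (\<lambda>z. L z b) (at x) \<xi> \<bullet> c) *\<^sub>R inv (L x) c)))) (at x)"
      by (subst (asm) linear_sum_Basis[OF linR])
  next
    fix \<xi>
    have "Ck_on k S (\<lambda>z. frechet_derivative (\<lambda>z. L z b) (at z) \<xi>)" for b
      using Ck[of "Suc k" b] by simp
    then show "Ck_on k S (\<lambda>x. - (\<Sum>b\<in>Basis. (inv (L x) v \<bullet> b) *\<^sub>R
        (\<Sum>c\<in>Basis. (frechet_derivative (\<lambda>z. L z b) (at x) \<xi> \<bullet> c) *\<^sub>R inv (L x) c)))"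
      by (intro Ck_on_bounded_linear[of uminus] bounded_linear_minus[OF bounded_linear_ident]
          Ck_on_sum Ck_on_scaleR Ck_on_inner Ck_on_const Suc.IH S)
  qed
next
  case 0
  have "isCont (\<lambda>z. inv (L z) v) x" if "x \<in> S" for x
  proof (rule has_derivative_continuous)
    show "((\<lambda>z. inv (L z) v) has_derivative
      (\<lambda>\<xi>. - (\<Sum>b\<in>Basis. (inv (L x) v \<bullet> b) *\<^sub>R inv (L x) (frechet_derivative (\<lambda>z. L z b) (at x) \<xi>)))) (at x)"
      by (rule has_derivative_inv_linear[OF S that lin bij]) (auto intro!: Ck_on_has_derivative[OF Ck[of "Suc 0"]] that)
  qed
  then show ?case by (simp add: continuous_at_imp_continuous_on)
qed

text \<open>Bootstrapping: the C^1 inverse function theorem gives g' y = inv (f' (g y)). If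
  \<open>g\<close> is C^k, the right-hand side is C^k as a composition with the smooth map z
  \<mapsto> inv (f' z), hence \<open>g\<close> is C^(k+1).\<close>

theorem smooth_inverse_function:
  fixes f :: "'a::euclidean_space \<Rightarrow> 'a"
  assumes U: "open U" "x0 \<in> U" and Ck: "\<And>k. Ck_on k U f"
    and inj: "inj (frechet_derivative f (at x0))"
  obtains U' V g where "open U'" "U' \<subseteq> U" "x0 \<in> U'" "open V" "f x0 \<in> V" "homeomorphism U' V f g"
    "\<And>k. Ck_on k V g"
proof -
  define f' where "f' = (\<lambda>x. Blinfun (frechet_derivative f (at x)))"
  have der: "(f has_derivative frechet_derivative f (at x)) (at x)" if "x \<in> U" for x
    using Ck_on_has_derivative[OF Ck[of "Suc 0"]] that by blast
  have f': "blinfun_apply (f' x) = frechet_derivative f (at x)" if "x \<in> U" for x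
    unfolding f'_def using has_derivative_bounded_linear[OF der[OF that]] by (rule bounded_linear_Blinfun_apply)
  have lin: "linear (frechet_derivative f (at x))" if "x \<in> U" for x
    using der[OF that] has_derivative_linear by blast
  have bij0: "bij (frechet_derivative f (at x0))"
    using lin[OF U(2)] inj eucl.linear_inj_imp_surj bij_def by (metis linear_injective_imp_surjective)
  have blinv: "bounded_linear (inv (frechet_derivative f (at x0)))"
    using lin[OF U(2)] inj by (simp add: inj_linear_imp_inv_linear bij0 bij_is_surj linear_conv_bounded_linear[symmetric])
  obtain U' V g g' where *: "open U'" "U' \<subseteq> U" "x0 \<in> U'" "open V" "f x0 \<in> V" and hom: "homeomorphism U' V f g"
    and derg: "\<And>y. y \<in> V \<Longrightarrow> (g has_derivative (g' y)) (at y)"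
    and g': "\<And>y. y \<in> V \<Longrightarrow> g' y = inv (blinfun_apply (f'(g y)))"
    and bij: "\<And>y. y \<in> V \<Longrightarrow> bij (blinfun_apply (f'(g y)))"
  proof (rule inverse_function_theorem[of U f f' x0 "Blinfun (inv (frechet_derivative f (at x0)))"])
    show "(f has_derivative blinfun_apply (f' x)) (at x)" if "x \<in> U" for x
      using der[OF that] f'[OF that] by simp
    show "continuous_on U f'"
    proof (rule continuous_on_blinfun_componentwise)
      fix i :: 'a
      show "continuous_on U (\<lambda>x. blinfun_apply (f' x) i)"
        using Ck[of "Suc 0"] by (auto simp: f' cong: continuous_on_cong)
    qed
    show "Blinfun (inv (frechet_derivative f (at x0))) o\<^sub>L f' x0 = id_blinfun"
      by (rule blinfun_eqI) (simp add: f' U bounded_linear_Blinfun_apply[OF blinv] inj)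
  qed (use U in auto)
  have gU: "g y \<in> U'" if "y \<in> V" for y
    using hom that by (auto simp: homeomorphism_def)
  have g2: "g' y = inv (frechet_derivative f (at (g y)))" "bij (frechet_derivative f (at (g y)))" if "y \<in> V" for y
    using g'[OF that] bij[OF that] f' gU[OF that] *(2) by auto
  have bijU': "bij (frechet_derivative f (at x))" if "x \<in> U'" for x
  proof -
    have "f x \<in> V" "g (f x) = x" using hom that by (auto simp: homeomorphism_def)
    then show ?thesis using g2(2)[of "f x"] by simp
  qed
  have "Ck_on k V g" for k
  proof (induction k)
    case 0
    then show ?case using hom by (simp add: homeomorphism_def)
  next
    case (Suc k)
    show ?case
    proof (rule Ck_on_SucI[OF *(4) derg])
      fix v
      have "Ck_on k U' (\<lambda>z. inv (frechet_derivative f (at z)) v)"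
      proof (rule Ck_on_inv_linear[OF *(1) lin bijU'])
        show "Ck_on k U' (\<lambda>z. frechet_derivative f (at z) b)" for b k
          by (rule Ck_on_subset[OF _ *(2)]) (use Ck[of "Suc k"] in simp)
      qed (use *(2) in auto)
      then have "Ck_on k V (\<lambda>y. inv (frechet_derivative f (at (g y))) v)"
        by (rule Ck_on_compose[OF *(4,1), rotated]) (use gU Suc in auto)
      then show "Ck_on k V (\<lambda>y. g' y v)"
        by (rule Ck_on_cong[OF *(4), rotated]) (simp add: g2)
    qed
  qed
  then show thesis using that * hom by blast
qed

section \<open>Space-time jets\<close>

text \<open>
  \<open>g\<close> is the spatial gradient, \<open>\<tau>\<close> the time derivative and \<open>g' z (\<xi>, 0)\<close> the Hessian of \<open>W\<close>
  at \<open>z\<close> applied to \<open>\<xi>\<close>.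
\<close>

definition jet_on :: "('a::euclidean_space \<times> real) set \<Rightarrow> ('a \<times> real \<Rightarrow> real) \<Rightarrow> ('a \<times> real \<Rightarrow> 'a) \<Rightarrow>
    ('a \<times> real \<Rightarrow> real) \<Rightarrow> ('a \<times> real \<Rightarrow> 'a \<times> real \<Rightarrow> 'a) \<Rightarrow> bool" where
  "jet_on S W g \<tau> g' \<longleftrightarrow>
     (\<forall>z\<in>S. (W has_derivative (\<lambda>(\<xi>, s). g z \<bullet> \<xi> + \<tau> z * s)) (at z) \<and> (g has_derivative g' z) (at z))"

definition hessian_trace :: "('a::euclidean_space \<times> real \<Rightarrow> 'a) \<Rightarrow> real" where
  "hessian_trace A = (\<Sum>b\<in>Basis. A (b, 0) \<bullet> b)"

lemma jet_on_subset: "jet_on S W g \<tau> g' \<Longrightarrow> T \<subseteq> S \<Longrightarrow> jet_on T W g \<tau> g'"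
  by (auto simp: jet_on_def)

lemma jet_onD:
  assumes "jet_on S W g \<tau> g'" "z \<in> S"
  shows "(W has_derivative (\<lambda>(\<xi>, s). g z \<bullet> \<xi> + \<tau> z * s)) (at z)" "(g has_derivative g' z) (at z)"
    "linear (g' z)"
  using assms has_derivative_linear by (auto simp: jet_on_def)

definition space_gradient :: "('a::euclidean_space \<times> real \<Rightarrow> real) \<Rightarrow> 'a \<times> real \<Rightarrow> 'a" where
  "space_gradient W z = (\<Sum>b\<in>Basis. frechet_derivative W (at z) (b, 0) *\<^sub>R b)"

lemma Ck_on_space_gradient: "open S \<Longrightarrow> Ck_on (Suc k) S W \<Longrightarrow> Ck_on k S (space_gradient W)"
  unfolding space_gradient_def by (intro Ck_on_sum Ck_on_scaleR Ck_on_const) auto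

lemma jet_on_Ck:
  assumes "open S" "Ck_on 2 S W"
  shows "jet_on S W (space_gradient W) (\<lambda>z. frechet_derivative W (at z) (0, 1))
    (\<lambda>z. frechet_derivative (space_gradient W) (at z))"
  unfolding jet_on_def
proof (intro ballI conjI)
  fix z assume z: "z \<in> S"
  have C: "Ck_on (Suc (Suc 0)) S W" using assms(2) by (simp add: numeral_2_eq_2)
  have d: "(W has_derivative frechet_derivative W (at z)) (at z)"
    by (rule Ck_on_has_derivative[OF C z])
  have lin: "linear (frechet_derivative W (at z))" using d has_derivative_linear by blast
  have "frechet_derivative W (at z) (\<xi>, s) = space_gradient W z \<bullet> \<xi> + frechet_derivative W (at z) (0, 1) * s" for \<xi> s
  proof -
    have l1: "linear (\<lambda>v. frechet_derivative W (at z) (v, 0))"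
      using linear_compose[OF _ lin, of "\<lambda>v. (v, 0)"] by (simp add: o_def linear_iff)
    have "frechet_derivative W (at z) (\<xi>, s) = frechet_derivative W (at z) ((\<xi>, 0) + s *\<^sub>R (0, 1))"
      by simp
    also have "\<dots> = frechet_derivative W (at z) (\<xi>, 0) + s * frechet_derivative W (at z) (0, 1)"
      using lin by (simp only: linear_add linear_cmul real_scaleR_def)
    also have "frechet_derivative W (at z) (\<xi>, 0) = space_gradient W z \<bullet> \<xi>"
      unfolding linear_sum_Basis[OF l1, of \<xi>] space_gradient_def
      by (simp add: inner_sum_left inner_sum_right inner_commute mult.commute)
    finally show ?thesis by (simp add: mult.commute)
  qed
  then have "frechet_derivative W (at z) = (\<lambda>(\<xi>, s). space_gradient W z \<bullet> \<xi> + frechet_derivative W (at z) (0, 1) * s)"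
    unfolding fun_eq_iff split_paired_All case_prod_conv by blast
  then show "(W has_derivative (\<lambda>(\<xi>, s). space_gradient W z \<bullet> \<xi> + frechet_derivative W (at z) (0, 1) * s)) (at z)"
    using d by simp
  show "(space_gradient W has_derivative frechet_derivative (space_gradient W) (at z)) (at z)"
    by (rule Ck_on_has_derivative[OF Ck_on_space_gradient[OF assms(1) C] z])
qed

lemma jet_space_line:
  assumes "jet_on S W g \<tau> g'" "(x + s *\<^sub>R v, t) \<in> S"
  shows "((\<lambda>s. W (x + s *\<^sub>R v, t)) has_real_derivative g (x + s *\<^sub>R v, t) \<bullet> v) (at s)"
    and "((\<lambda>s. g (x + s *\<^sub>R v, t)) has_vector_derivative g' (x + s *\<^sub>R v, t) (v, 0)) (at s)"
proof -
  have c: "((\<lambda>s. (x + s *\<^sub>R v, t)) has_derivative (\<lambda>h. (h *\<^sub>R v, 0))) (at s)"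
    by (auto intro!: derivative_eq_intros)
  show "((\<lambda>s. W (x + s *\<^sub>R v, t)) has_real_derivative g (x + s *\<^sub>R v, t) \<bullet> v) (at s)"
    using has_derivative_compose[OF c jet_onD(1)[OF assms]]
    by (simp add: has_field_derivative_def mult_commute_abs)
  have "((\<lambda>s. g (x + s *\<^sub>R v, t)) has_derivative (\<lambda>h. g' (x + s *\<^sub>R v, t) (h *\<^sub>R v, 0))) (at s)"
    using has_derivative_compose[OF c jet_onD(2)[OF assms]] .
  also have "(\<lambda>h. g' (x + s *\<^sub>R v, t) (h *\<^sub>R v, 0)) = (\<lambda>h. h *\<^sub>R g' (x + s *\<^sub>R v, t) (v, 0))"
  proof
    fix h
    have "(h *\<^sub>R v, 0) = h *\<^sub>R (v, 0::real)" by simp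
    then show "g' (x + s *\<^sub>R v, t) (h *\<^sub>R v, 0) = h *\<^sub>R g' (x + s *\<^sub>R v, t) (v, 0)"
      using linear_cmul[OF jet_onD(3)[OF assms], of h "(v, 0)"] by simp
  qed
  finally show "((\<lambda>s. g (x + s *\<^sub>R v, t)) has_vector_derivative g' (x + s *\<^sub>R v, t) (v, 0)) (at s)"
    by (simp add: has_vector_derivative_def)
qed

lemma jet_time_line:
  assumes "jet_on S W g \<tau> g'" "(x, t) \<in> S"
  shows "((\<lambda>s. W (x, s)) has_real_derivative \<tau> (x, t)) (at t)"
proof -
  have c: "((\<lambda>s. (x, s)) has_derivative (\<lambda>h. (0, h))) (at t)"
    by (auto intro!: derivative_eq_intros)
  show ?thesis
    using has_derivative_compose[OF c jet_onD(1)[OF assms]]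
    by (simp add: has_field_derivative_def mult.commute[of "\<tau> (x, t)"]) (simp add: mult_commute_abs)
qed

text \<open>Uses the second derivative at the single point 0: if \<open>f2\<close> were positive,
  \<open>f1\<close> would be positive just to the right of 0 and \<open>f\<close> would increase
  there.\<close>

lemma second_derivative_test_max:
  fixes f f1 :: "real \<Rightarrow> real"
  assumes "d > 0" and der: "\<And>s. \<bar>s\<bar> < d \<Longrightarrow> (f has_real_derivative f1 s) (at s)"
    and der2: "(f1 has_real_derivative f2) (at 0)"
    and max: "\<And>s. \<bar>s\<bar> < d \<Longrightarrow> f s \<le> f 0"
  shows "f1 0 = 0" "f2 \<le> 0"
proof -
  show 0: "f1 0 = 0"
    by (rule DERIV_local_max[of f _ 0 d]) (use assms in auto)
  show "f2 \<le> 0"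
  proof (rule ccontr)
    assume "\<not> f2 \<le> 0"
    then obtain e where e: "e > 0" "\<And>h. 0 < h \<Longrightarrow> h < e \<Longrightarrow> f1 0 < f1 (0 + h)"
      using DERIV_pos_inc_right[OF der2] by (auto simp: not_le)
    define h where "h = min d e / 2"
    have h: "0 < h" "h < d" "h < e" using e(1) assms(1) by (auto simp: h_def)
    have "f 0 < f h"
    proof (rule DERIV_pos_imp_increasing_open[of 0 h f])
      show "\<exists>y. (f has_real_derivative y) (at x) \<and> y > 0" if "0 < x" "x < h" for x
        using der[of x] e(2)[of x] 0 that h by auto
      show "continuous_on {0..h} f"
        using h by (intro continuous_at_imp_continuous_on ballI DERIV_isCont[OF der]) auto
    qed (use h in auto)
    then show False using max[of h] h by auto
  qed
qed

text \<open>The time half of the parabolic maximum principle: competitors live at past times, so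
  only the sign of the derivative is obtained.\<close>

lemma one_sided_max_derivative_nonneg:
  fixes f :: "real \<Rightarrow> real"
  assumes "(f has_real_derivative D) (at t)" "d > 0" "\<And>s. t - d < s \<Longrightarrow> s \<le> t \<Longrightarrow> f s \<le> f t"
  shows "D \<ge> 0"
proof (rule ccontr)
  assume "\<not> D \<ge> 0"
  then obtain e where e: "e > 0" "\<And>h. 0 < h \<Longrightarrow> h < e \<Longrightarrow> f t < f (t - h)"
    using DERIV_neg_dec_left[OF assms(1)] by (auto simp: not_le)
  have "f t < f (t - min d e / 2)" using e assms(2) by (intro e(2)) auto
  moreover have "f (t - min d e / 2) \<le> f t" by (rule assms(3)) (use e assms(2) in auto)
  ultimately show False by simp
qed

text \<open>
  The matrix \<open>I - q q\<^sup>T / (1 + |q|\<^sup>2)\<close> has the square root \<open>I - \<kappa> q q\<^sup>T\<close> with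
  \<open>\<kappa> = 1 / (w (w + 1))\<close> and \<open>w = sqrt (1 + |q|\<^sup>2)\<close>.
\<close>

lemma graph_trace_nonpos:
  fixes N :: "'a::euclidean_space \<Rightarrow> 'a"
  assumes lin: "linear N" and neg: "\<And>v. N v \<bullet> v \<le> 0"
  shows "(\<Sum>b\<in>Basis. N b \<bullet> b) - (N q \<bullet> q) / (1 + q \<bullet> q) \<le> 0"
proof -
  define w where "w = sqrt (1 + q \<bullet> q)"
  define \<kappa> where "\<kappa> = 1 / (w * (w + 1))"
  have w: "w > 0" "q \<bullet> q = w\<^sup>2 - 1"
    by (auto simp: w_def add_pos_nonneg)
  have k: "2 * \<kappa> - \<kappa>\<^sup>2 * (q \<bullet> q) = 1 / (1 + q \<bullet> q)"
    unfolding w(2) \<kappa>_def using w(1)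
    by (simp add: divide_simps) (simp add: algebra_simps power2_eq_square)
  have "(\<Sum>b\<in>Basis. N (b - (\<kappa> * (q \<bullet> b)) *\<^sub>R q) \<bullet> (b - (\<kappa> * (q \<bullet> b)) *\<^sub>R q)) \<le> 0"
    by (intro sum_nonpos neg)
  also have "(\<Sum>b\<in>Basis. N (b - (\<kappa> * (q \<bullet> b)) *\<^sub>R q) \<bullet> (b - (\<kappa> * (q \<bullet> b)) *\<^sub>R q)) =
    (\<Sum>b\<in>Basis. N b \<bullet> b - \<kappa> * ((q \<bullet> b) * (N q \<bullet> b)) - \<kappa> * ((q \<bullet> b) * (N b \<bullet> q)) + \<kappa>\<^sup>2 * (N q \<bullet> q) * ((q \<bullet> b) * (q \<bullet> b)))"
    by (rule sum.cong) (auto simp: linear_diff[OF lin] linear_cmul[OF lin] inner_diff_left inner_diff_right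
        power2_eq_square algebra_simps)
  also have "\<dots> = (\<Sum>b\<in>Basis. N b \<bullet> b) - \<kappa> * (\<Sum>b\<in>Basis. (q \<bullet> b) * (N q \<bullet> b))
      - \<kappa> * (\<Sum>b\<in>Basis. (q \<bullet> b) * (N b \<bullet> q)) + \<kappa>\<^sup>2 * (N q \<bullet> q) * (\<Sum>b\<in>Basis. (q \<bullet> b) * (q \<bullet> b))"
    by (simp add: sum.distrib sum_subtractf sum_distrib_left)
  also have "(\<Sum>b\<in>Basis. (q \<bullet> b) * (N q \<bullet> b)) = N q \<bullet> q"
    by (simp add: euclidean_inner[of "N q" q] mult.commute)
  also have "(\<Sum>b\<in>Basis. (q \<bullet> b) * (N b \<bullet> q)) = N q \<bullet> q"
    using arg_cong[OF linear_sum_Basis[OF lin, of q], of "\<lambda>z. z \<bullet> q"] by (simp add: inner_sum_left)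
  also have "(\<Sum>b\<in>Basis. (q \<bullet> b) * (q \<bullet> b)) = q \<bullet> q"
    by (simp add: euclidean_inner[of q q])
  finally have "(\<Sum>b\<in>Basis. N b \<bullet> b) - (2 * \<kappa> - \<kappa>\<^sup>2 * (q \<bullet> q)) * (N q \<bullet> q) \<le> 0"
    by (simp add: algebra_simps)
  then show ?thesis unfolding k by simp
qed


section \<open>The graph as a barrier at infinity\<close>

text \<open>Put q = Du and \<gamma> = 2\<eta>(U - h). The Hessian of the penalised function, N =
  D^2W - 2\<eta> q q^T - \<gamma> D^2U, is nonpositive at the maximum. Tracing it against I - q q^T
  / (1 + |q|^2) turns the last term into \<gamma> \<mu> by the graph equation, and the time
  derivative gives \<tau> \<ge> \<gamma> \<mu>, so every derivative of U beyond the first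
  disappears. The rank one term leaves the error 2\<eta>.\<close>

lemma graph_max_inequality:
  fixes x :: "'a::euclidean_space"
  assumes W: "jet_on S W g \<tau> g'" "open S" "(x, t) \<in> S"
    and U: "jet_on F U p \<mu> p'" "open F" "(x, t) \<in> F"
    and eq: "\<mu> (x, t) = hessian_trace (p' (x, t)) - p' (x, t) (p (x, t), 0) \<bullet> p (x, t) / (1 + p (x, t) \<bullet> p (x, t))"
    and "d > 0" "\<eta> \<ge> 0"
    and max: "\<And>y s. (y, s) \<in> F \<Longrightarrow> dist y x < d \<Longrightarrow> t - d < s \<Longrightarrow> s \<le> t \<Longrightarrow>
      W (y, s) - \<eta> * (U (y, s) - h)\<^sup>2 \<le> W (x, t) - \<eta> * (U (x, t) - h)\<^sup>2"
  shows "g (x, t) = (2 * \<eta> * (U (x, t) - h)) *\<^sub>R p (x, t)"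
    and "\<tau> (x, t) \<ge> hessian_trace (g' (x, t)) - g' (x, t) (p (x, t), 0) \<bullet> p (x, t) / (1 + p (x, t) \<bullet> p (x, t)) - 2 * \<eta>"
proof -
  define \<gamma> where "\<gamma> = 2 * \<eta> * (U (x, t) - h)"
  define q where "q = p (x, t)"
  obtain e where e: "e > 0" "e \<le> d" "ball (x, t) e \<subseteq> S \<inter> F"
  proof -
    have "open (S \<inter> F)" "(x, t) \<in> S \<inter> F" using W U by auto
    then obtain e where "e > 0" "ball (x, t) e \<subseteq> S \<inter> F" by (meson openE)
    moreover have "ball (x, t) (min e d) \<subseteq> ball (x, t) e" by (rule subset_ball) simp
    ultimately show ?thesis using that[of "min e d"] assms(8) by auto
  qed
  define f1 where "f1 = (\<lambda>v s. g (x + s *\<^sub>R v, t) \<bullet> v - 2 * \<eta> * (U (x + s *\<^sub>R v, t) - h) * (p (x + s *\<^sub>R v, t) \<bullet> v))"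
  define N where "N = (\<lambda>v. g' (x, t) (v, 0) - (2 * \<eta> * (q \<bullet> v)) *\<^sub>R q - \<gamma> *\<^sub>R p' (x, t) (v, 0))"
  have test: "f1 v 0 = 0 \<and> N v \<bullet> v \<le> 0" for v
  proof -
    define d' where "d' = e / (norm v + 1)"
    have d': "d' > 0" using e by (simp add: d'_def add_nonneg_pos)
    have in_ball: "(x + s *\<^sub>R v, t) \<in> ball (x, t) e" if "\<bar>s\<bar> < d'" for s
    proof -
      have "\<bar>s\<bar> * norm v \<le> \<bar>s\<bar> * (norm v + 1)" by (intro mult_left_mono) auto
      also have "\<dots> < e" using that by (simp add: d'_def pos_less_divide_eq add_nonneg_pos)
      finally show ?thesis by (simp add: dist_Pair_Pair dist_norm)
    qed
    have der1: "((\<lambda>s. W (x + s *\<^sub>R v, t) - \<eta> * (U (x + s *\<^sub>R v, t) - h)\<^sup>2) has_real_derivative f1 v s) (at s)"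
      if "\<bar>s\<bar> < d'" for s
      unfolding f1_def using in_ball[OF that] e(3)
      by (auto intro!: derivative_eq_intros jet_space_line(1)[OF W(1)] jet_space_line(1)[OF U(1)])
    have gd: "((\<lambda>s. g (x + s *\<^sub>R v, t)) has_derivative (\<lambda>h. h *\<^sub>R g' (x, t) (v, 0))) (at 0)"
      using jet_space_line(2)[OF W(1), of x 0 v t] W(3) by (simp add: has_vector_derivative_def)
    have pd: "((\<lambda>s. p (x + s *\<^sub>R v, t)) has_derivative (\<lambda>h. h *\<^sub>R p' (x, t) (v, 0))) (at 0)"
      using jet_space_line(2)[OF U(1), of x 0 v t] U(3) by (simp add: has_vector_derivative_def)
    have Ud: "((\<lambda>s. U (x + s *\<^sub>R v, t)) has_derivative (\<lambda>h. h * (q \<bullet> v))) (at 0)"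
      using jet_space_line(1)[OF U(1), of x 0 v t] U(3) by (simp add: has_field_derivative_def q_def mult_commute_abs)
    have "(f1 v has_derivative (\<lambda>h. h * (N v \<bullet> v))) (at 0)"
      unfolding f1_def
      by (rule derivative_eq_intros gd pd Ud refl)+
        (auto simp: fun_eq_iff N_def q_def \<gamma>_def inner_diff_left algebra_simps)
    then have der2: "(f1 v has_real_derivative N v \<bullet> v) (at 0)"
      by (simp add: has_field_derivative_def mult_commute_abs)
    have "W (x + s *\<^sub>R v, t) - \<eta> * (U (x + s *\<^sub>R v, t) - h)\<^sup>2 \<le> W (x + 0 *\<^sub>R v, t) - \<eta> * (U (x + 0 *\<^sub>R v, t) - h)\<^sup>2"
      if "\<bar>s\<bar> < d'" for s
    proof -
      have "(x + s *\<^sub>R v, t) \<in> F" using in_ball[OF that] e(3) by blast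
      then show ?thesis
        using max[of "x + s *\<^sub>R v" t] in_ball[OF that] e assms(8) by (auto simp: dist_Pair_Pair dist_commute)
    qed
    from second_derivative_test_max[OF d' der1 der2 this] show ?thesis by simp
  qed
  have "(g (x, t) - \<gamma> *\<^sub>R q) \<bullet> v = 0" for v
    using test[of v] by (simp add: f1_def q_def \<gamma>_def inner_diff_left)
  from this[of "g (x, t) - \<gamma> *\<^sub>R q"] have "g (x, t) - \<gamma> *\<^sub>R q = 0" by simp
  then show "g (x, t) = (2 * \<eta> * (U (x, t) - h)) *\<^sub>R p (x, t)"
    by (simp add: \<gamma>_def q_def)
  have linN: "linear N"
  proof -
    have "linear (\<lambda>v. g' (x, t) (v, 0))" "linear (\<lambda>v. p' (x, t) (v, 0))"
      using linear_compose[OF _ jet_onD(3)[OF W(1,3)], of "\<lambda>v. (v, 0)"]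
        linear_compose[OF _ jet_onD(3)[OF U(1,3)], of "\<lambda>v. (v, 0)"] by (auto simp: o_def linear_iff)
    then show ?thesis unfolding N_def linear_iff
      by (auto simp: algebra_simps inner_add_right)
  qed
  have trN: "(\<Sum>b\<in>Basis. N b \<bullet> b) = hessian_trace (g' (x, t)) - 2 * \<eta> * (q \<bullet> q) - \<gamma> * hessian_trace (p' (x, t))"
    unfolding N_def hessian_trace_def
    by (simp add: inner_diff_left sum_subtractf sum_distrib_left euclidean_inner[of q q] mult.assoc)
  have "(\<Sum>b\<in>Basis. N b \<bullet> b) - (N q \<bullet> q) / (1 + q \<bullet> q) \<le> 0"
    by (rule graph_trace_nonpos[OF linN]) (use test in auto)
  then have ineq: "hessian_trace (g' (x, t)) - g' (x, t) (q, 0) \<bullet> q / (1 + q \<bullet> q)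
      - 2 * \<eta> * (q \<bullet> q - (q \<bullet> q)\<^sup>2 / (1 + q \<bullet> q)) - \<gamma> * \<mu> (x, t) \<le> 0"
    unfolding trN eq q_def[symmetric]
    by (simp add: N_def inner_diff_left diff_divide_distrib add_divide_distrib algebra_simps power2_eq_square)
  \<comment> \<open>A bound independent of the slope q: the graph operator damps second derivatives
    in the gradient direction, so the steepness of \<open>u\<close> near the blow-up set does no
    harm.\<close>
  have "1 + q \<bullet> q > 0" by (simp add: add_pos_nonneg)
  then have "q \<bullet> q - (q \<bullet> q)\<^sup>2 / (1 + q \<bullet> q) \<le> 1"
    by (simp add: divide_simps power2_eq_square algebra_simps)
  then have "2 * \<eta> * (q \<bullet> q - (q \<bullet> q)\<^sup>2 / (1 + q \<bullet> q)) \<le> 2 * \<eta>"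
    using mult_left_mono[of _ 1 "2 * \<eta>"] assms(9) by simp
  with ineq have i2: "\<gamma> * \<mu> (x, t) \<ge> hessian_trace (g' (x, t)) - g' (x, t) (q, 0) \<bullet> q / (1 + q \<bullet> q) - 2 * \<eta>"
    by linarith
  have "((\<lambda>s. W (x, s) - \<eta> * (U (x, s) - h)\<^sup>2) has_real_derivative \<tau> (x, t) - \<gamma> * \<mu> (x, t)) (at t)"
    unfolding \<gamma>_def
    by (auto intro!: derivative_eq_intros jet_time_line[OF W(1,3)] jet_time_line[OF U(1,3)])
  then have "\<tau> (x, t) - \<gamma> * \<mu> (x, t) \<ge> 0"
  proof (rule one_sided_max_derivative_nonneg[of _ _ _ e])
    fix s assume s: "t - e < s" "s \<le> t"
    then have "(x, s) \<in> ball (x, t) e" by (simp add: dist_Pair_Pair dist_real_def)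
    then have "(x, s) \<in> F" using e(3) by blast
    then show "W (x, s) - \<eta> * (U (x, s) - h)\<^sup>2 \<le> W (x, t) - \<eta> * (U (x, t) - h)\<^sup>2"
      by (rule max) (use s e assms(8) in auto)
  qed (use e in auto)
  with i2 show "\<tau> (x, t) \<ge> hessian_trace (g' (x, t)) - g' (x, t) (p (x, t), 0) \<bullet> p (x, t) / (1 + p (x, t) \<bullet> p (x, t)) - 2 * \<eta>"
    unfolding q_def by linarith
qed


text \<open>The hypothesis \<open>lim\<close> is imposed exactly at the possible limits Y of the
  penalised maxima: points where \<open>u\<close> is infinite, that are approached by finite points,
  and at which \<open>W\<close> is at least \<open>W z0\<close>. Such a Y must avoid the lateral
  boundary. If it lies at the bottom time, \<open>u\<close> must be infinite on the whole bottom
  disc, which forces the maxima themselves to lie strictly above it. Finally \<open>W\<close> must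
  satisfy, near Y and with a gap c, the inequality opposite to the one that
  \<open>graph_max_inequality\<close> gives at a maximum, for every q with DW = l q and small
  l.\<close>

lemma graph_comparison:
  fixes u :: "'a::euclidean_space \<times> real \<Rightarrow> ereal" and x0 :: 'a and r t1 t2 :: real
  defines "K \<equiv> cball x0 r \<times> {t1..t2}"
  assumes u: "continuous_on K u"
    and U: "jet_on F (\<lambda>z. real_of_ereal (u z)) p \<mu> p'" "open F"
    and KF: "\<And>z. z \<in> K \<Longrightarrow> \<bar>u z\<bar> \<noteq> \<infinity> \<Longrightarrow> dist (fst z) x0 < r \<Longrightarrow> t1 < snd z \<Longrightarrow> z \<in> F"
    and Fu: "\<And>z. z \<in> F \<Longrightarrow> \<bar>u z\<bar> \<noteq> \<infinity>"
    and eq: "\<And>z. z \<in> F \<Longrightarrow> \<mu> z = hessian_trace (p' z) - p' z (p z, 0) \<bullet> p z / (1 + p z \<bullet> p z)"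
    and W: "jet_on S W g \<tau> g'" "open S" "K \<subseteq> S"
    and z0: "z0 \<in> K" "\<bar>u z0\<bar> = \<infinity>" "z0 \<in> closure {z \<in> K. \<bar>u z\<bar> \<noteq> \<infinity>}"
    and lim: "\<And>Y. Y \<in> K \<Longrightarrow> \<bar>u Y\<bar> = \<infinity> \<Longrightarrow> Y \<in> closure {z \<in> K. \<bar>u z\<bar> \<noteq> \<infinity>} \<Longrightarrow> W z0 \<le> W Y \<Longrightarrow>
      dist (fst Y) x0 < r \<and> (snd Y = t1 \<longrightarrow> (\<forall>x\<in>cball x0 r. \<bar>u (x, t1)\<bar> = \<infinity>)) \<and>
      (\<exists>c>0. \<exists>\<delta>>0. \<forall>Y'\<in>K. dist Y' Y < \<delta> \<longrightarrow> (\<forall>q l. g Y' = l *\<^sub>R q \<and> \<bar>l\<bar> \<le> \<delta> \<longrightarrow>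
        \<tau> Y' + c \<le> hessian_trace (g' Y') - g' Y' (q, 0) \<bullet> q / (1 + q \<bullet> q)))"
  shows False
proof -
  define U where "U = (\<lambda>z. real_of_ereal (u z))"
  define fin where "fin = {z \<in> K. \<bar>u z\<bar> \<noteq> \<infinity>}"
  have uU: "u z = ereal (U z)" if "\<bar>u z\<bar> \<noteq> \<infinity>" for z
    using that by (simp add: U_def ereal_real)
  have cK: "compact K" by (auto simp: K_def intro: compact_Times)
  have contW: "continuous_on K W"
    using W by (auto intro!: continuous_at_imp_continuous_on has_derivative_continuous jet_onD(1))
  obtain C where C: "C > 0" "\<And>z. z \<in> K \<Longrightarrow> \<bar>W z\<bar> \<le> C"
  proof -
    have "bounded (W ` K)" using cK contW by (intro compact_imp_bounded compact_continuous_image)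
    then obtain C where "\<forall>y\<in>W ` K. norm y \<le> C" by (auto simp: bounded_iff)
    then show ?thesis using that[of "max C 1"] by fastforce
  qed
  obtain zs where zs: "\<And>k. zs k \<in> fin" "zs \<longlonglongrightarrow> z0"
    using z0(3) unfolding fin_def closure_sequential by blast
  define h where "h = (\<lambda>k. U (zs k))"
  have uh: "u (zs k) = ereal (h k)" for k using zs(1)[of k] uU[of "zs k"] by (simp add: h_def fin_def)
  have blowup: "filterlim (\<lambda>k. \<bar>f k\<bar>) at_top sequentially"
    if "\<And>k. y k \<in> K" "\<And>k. u (y k) = ereal (f k)" "y \<longlonglongrightarrow> Y" "Y \<in> K" "\<bar>u Y\<bar> = \<infinity>" for y f Y
  proof -
    have "(\<lambda>k. u (y k)) \<longlonglongrightarrow> u Y"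
      by (rule continuous_on_tendsto_compose[OF u that(3,4)]) (use that(1) in auto)
    then have l: "(\<lambda>k. ereal (f k)) \<longlonglongrightarrow> u Y" using that(2) by simp
    show ?thesis
    proof (cases "u Y = \<infinity>")
      case True
      have "filterlim f at_top sequentially"
        unfolding filterlim_at_top
      proof
        fix B :: real
        show "eventually (\<lambda>k. B \<le> f k) sequentially"
          using l True order_tendstoD(1)[OF l, of "ereal B"] by (auto elim!: eventually_mono)
      qed
      then show ?thesis by (rule filterlim_at_top_mono) (auto intro: always_eventually)
    next
      case False
      then have m: "u Y = - \<infinity>" using that(5) by auto
      have "filterlim (\<lambda>k. - f k) at_top sequentially"
        unfolding filterlim_at_top
      proof
        fix B :: real
        show "eventually (\<lambda>k. B \<le> - f k) sequentially"
          using order_tendstoD(2)[OF l, of "ereal (- B)"] m by (auto elim!: eventually_mono)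
      qed
      then show ?thesis by (rule filterlim_at_top_mono) (auto intro: always_eventually)
    qed
  qed
  have hinf: "filterlim (\<lambda>k. \<bar>h k\<bar>) at_top sequentially"
    by (rule blowup[of zs]) (use zs uh z0 in \<open>auto simp: fin_def\<close>)
  \<comment> \<open>Two requirements meet here: \<eta> tends to 0, which makes the multiplier
    \<open>l\<close> vanish, and 1 / \<eta> grows only linearly in |h|, which keeps \<open>u\<close>
    at the maxima close to h relative to |h|.\<close>
  define \<eta> where "\<eta> = (\<lambda>k. 1 / (1 + \<bar>h k\<bar>))"
  have \<eta>: "\<eta> k > 0" "\<eta> k \<le> 1" for k by (auto simp: \<eta>_def)
  have \<eta>0: "\<eta> \<longlonglongrightarrow> 0"
  proof -
    have "filterlim (\<lambda>k. 1 + \<bar>h k\<bar>) at_top sequentially"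
      by (rule filterlim_at_top_mono[OF hinf]) auto
    then show ?thesis unfolding \<eta>_def
      by (intro tendsto_divide_0[OF tendsto_const] filterlim_at_top_imp_at_infinity)
  qed
  define \<Psi> where "\<Psi> = (\<lambda>k z. W z - \<eta> k * (U z - h k)\<^sup>2)"
  \<comment> \<open>The set \<open>fin\<close> is not compact. Outside the band |U| \<le> R the
    penalty is at least 2C, the largest possible oscillation of \<open>W\<close>, so such points
    lose against \<open>zs k\<close>, where the penalty vanishes. The band itself is compact, as a
    closed preimage in the compact cylinder \<open>K\<close>.\<close>
  have ex: "\<exists>Y\<in>fin. \<forall>z\<in>fin. \<Psi> k z \<le> \<Psi> k Y" for k
  proof -
    define R where "R = \<bar>h k\<bar> + sqrt (2 * C / \<eta> k)"
    define K' where "K' = {z \<in> K. u z \<in> {ereal (- R)..ereal R}}"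
    have R: "\<bar>h k\<bar> \<le> R" "R \<ge> 0" unfolding R_def using C(1) \<eta>(1)[of k] by auto
    have K'fin: "K' \<subseteq> fin" by (auto simp: K'_def fin_def)
    have "closed (K \<inter> u -` {ereal (- R)..ereal R})"
      by (rule continuous_closed_preimage[OF u compact_imp_closed[OF cK] closed_atLeastAtMost])
    then have "compact (K \<inter> (K \<inter> u -` {ereal (- R)..ereal R}))"
      by (rule compact_Int_closed[OF cK])
    moreover have "K \<inter> (K \<inter> u -` {ereal (- R)..ereal R}) = K'" by (auto simp: K'_def)
    ultimately have cK': "compact K'" by simp
    have "continuous_on K' (real_of_ereal \<circ> u)"
    proof (subst continuous_on_iff_real[symmetric])
      show "\<bar>u z\<bar> \<noteq> \<infinity>" if "z \<in> K'" for z using that K'fin by (auto simp: fin_def)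
      show "continuous_on K' u" by (rule continuous_on_subset[OF u]) (auto simp: K'_def)
    qed
    then have "continuous_on K' U" by (simp add: U_def o_def)
    then have "continuous_on K' (\<Psi> k)"
      unfolding \<Psi>_def by (intro continuous_intros continuous_on_subset[OF contW]) (auto simp: K'_def)
    moreover have zK': "zs k \<in> K'" using zs(1)[of k] uh[of k] R by (auto simp: K'_def fin_def)
    ultimately obtain Y where Y: "Y \<in> K'" "\<And>z. z \<in> K' \<Longrightarrow> \<Psi> k z \<le> \<Psi> k Y"
      using continuous_attains_sup[OF cK', of "\<Psi> k"] by blast
    have "\<Psi> k z \<le> \<Psi> k Y" if z: "z \<in> fin" for z
    proof (cases "z \<in> K'")
      case False
      then have "\<bar>U z\<bar> > R" using z uU[of z] by (auto simp: K'_def fin_def)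
      then have "\<bar>U z - h k\<bar> \<ge> sqrt (2 * C / \<eta> k)" unfolding R_def by linarith
      then have "(U z - h k)\<^sup>2 \<ge> 2 * C / \<eta> k"
        by (metis real_sqrt_abs real_sqrt_le_iff)
      then have "\<eta> k * (U z - h k)\<^sup>2 \<ge> 2 * C" using \<eta>(1)[of k] by (simp add: field_simps)
      then have "\<Psi> k z \<le> W (zs k)"
        using C(2)[of z] C(2)[of "zs k"] z zs(1)[of k] unfolding \<Psi>_def fin_def by auto
      also have "W (zs k) = \<Psi> k (zs k)" by (simp add: \<Psi>_def h_def)
      also have "\<dots> \<le> \<Psi> k Y" by (rule Y(2)[OF zK'])
      finally show ?thesis .
    qed (use Y in auto)
    then show ?thesis using Y(1) K'fin by blast
  qed
  define Y where "Y = (\<lambda>k. SOME Y. Y \<in> fin \<and> (\<forall>z\<in>fin. \<Psi> k z \<le> \<Psi> k Y))"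
  have Y: "Y k \<in> fin" "\<And>z. z \<in> fin \<Longrightarrow> \<Psi> k z \<le> \<Psi> k (Y k)" for k
    using someI_ex[of "\<lambda>Y. Y \<in> fin \<and> (\<forall>z\<in>fin. \<Psi> k z \<le> \<Psi> k Y)"] ex[of k] unfolding Y_def by blast+
  have Wz: "W (zs k) \<le> W (Y k) - \<eta> k * (U (Y k) - h k)\<^sup>2" for k
    using Y(2)[OF zs(1), of k k] by (simp add: \<Psi>_def h_def)
  have WY: "W (zs k) \<le> W (Y k)" for k
    using Wz[of k] \<eta>(1)[of k] by (smt (verit) mult_nonneg_nonneg zero_le_power2)
  have pen: "\<eta> k * (U (Y k) - h k)\<^sup>2 \<le> 2 * C" for k
    using Wz[of k] C(2)[of "Y k"] C(2)[of "zs k"] Y(1)[of k] zs(1)[of k] by (auto simp: fin_def)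
  define l where "l = (\<lambda>k. 2 * \<eta> k * (U (Y k) - h k))"
  have l2: "(l k)\<^sup>2 \<le> 8 * C * \<eta> k" for k
  proof -
    have "(l k)\<^sup>2 = 4 * \<eta> k * (\<eta> k * (U (Y k) - h k)\<^sup>2)" by (simp add: l_def power2_eq_square)
    also have "\<dots> \<le> 4 * \<eta> k * (2 * C)" by (rule mult_left_mono[OF pen]) (use \<eta>(1)[of k] in auto)
    finally show ?thesis by (simp add: mult_ac)
  qed
  have l0: "l \<longlonglongrightarrow> 0"
  proof -
    have "(\<lambda>k. (l k)\<^sup>2) \<longlonglongrightarrow> 0"
      by (rule Lim_null_comparison[where g = "\<lambda>k. 8 * C * \<eta> k"])
        (use l2 \<eta>0 in \<open>auto intro!: tendsto_eq_intros\<close>)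
    then show ?thesis by (simp add: tendsto_null_power)
  qed
  have UYinf: "filterlim (\<lambda>k. \<bar>U (Y k)\<bar>) at_top sequentially"
  proof -
    \<comment> \<open>Completing the square in
      \<open>D\<^sup>2 \<le> 2 * C * (1 + \<bar>h k\<bar>)\<close> gives D \<le> |h| / 2 + 4C + 1,
      so at least half of |h| survives in the value of U at the maximum, up to a constant.\<close>
    have b: "\<bar>h k\<bar> / 2 - (4 * C + 1) \<le> \<bar>U (Y k)\<bar>" for k
    proof -
      define D where "D = \<bar>U (Y k) - h k\<bar>"
      have "D\<^sup>2 \<le> 2 * C * (1 + \<bar>h k\<bar>)"
        using pen[of k] by (simp add: \<eta>_def D_def pos_divide_le_eq add_pos_nonneg)
      also have "\<dots> \<le> (\<bar>h k\<bar> / 2)\<^sup>2 + 4 * C\<^sup>2 + 2 * C * (1 + \<bar>h k\<bar>)" by simp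
      also have "\<dots> = (\<bar>h k\<bar> / 2 + 2 * C)\<^sup>2 + 2 * C"
        by (simp add: power2_eq_square algebra_simps)
      also have "\<dots> \<le> (\<bar>h k\<bar> / 2 + 2 * C + (2 * C + 1))\<^sup>2"
        using C(1) by (simp add: power2_eq_square algebra_simps add_nonneg_nonneg)
      finally have "D \<le> \<bar>h k\<bar> / 2 + 2 * C + (2 * C + 1)"
        by (rule power2_le_imp_le) (use C(1) in simp)
      then show ?thesis unfolding D_def by linarith
    qed
    have "filterlim (\<lambda>k. \<bar>h k\<bar> / 2 - (4 * C + 1)) at_top sequentially"
      using hinf unfolding filterlim_at_top
    proof (intro allI)
      fix Z :: real
      assume "\<forall>Z. \<forall>\<^sub>F k in sequentially. Z \<le> \<bar>h k\<bar>"
      then have "\<forall>\<^sub>F k in sequentially. 2 * (Z + 4 * C + 1) \<le> \<bar>h k\<bar>" by blast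
      then show "\<forall>\<^sub>F k in sequentially. Z \<le> \<bar>h k\<bar> / 2 - (4 * C + 1)"
        by eventually_elim auto
    qed
    then show ?thesis by (rule filterlim_at_top_mono) (use b in auto)
  qed
  obtain Y0 \<rho> where Y0: "Y0 \<in> K" "strict_mono \<rho>" "(Y \<circ> \<rho>) \<longlonglongrightarrow> Y0"
  proof -
    have "\<forall>k. Y k \<in> K" using Y(1) by (auto simp: fin_def)
    then show ?thesis using cK that unfolding compact_def by blast
  qed
  have Y0cl: "Y0 \<in> closure {z \<in> K. \<bar>u z\<bar> \<noteq> \<infinity>}"
    unfolding closure_sequential
    by (rule exI[of _ "Y \<circ> \<rho>"]) (use Y0(3) Y(1) in \<open>auto simp: fin_def\<close>)
  have Y0inf: "\<bar>u Y0\<bar> = \<infinity>"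
  proof (rule ccontr)
    assume f: "\<bar>u Y0\<bar> \<noteq> \<infinity>"
    have "(\<lambda>k. u ((Y \<circ> \<rho>) k)) \<longlonglongrightarrow> u Y0"
      by (rule continuous_on_tendsto_compose[OF u Y0(3,1)]) (use Y(1) in \<open>auto simp: fin_def\<close>)
    then have "(\<lambda>k. U (Y (\<rho> k))) \<longlonglongrightarrow> U Y0"
    proof -
      assume l: "(\<lambda>k. u ((Y \<circ> \<rho>) k)) \<longlonglongrightarrow> u Y0"
      have "u ((Y \<circ> \<rho>) k) = ereal (U (Y (\<rho> k)))" for k
        using uU[of "Y (\<rho> k)"] Y(1)[of "\<rho> k"] by (simp add: fin_def)
      then show ?thesis using l unfolding uU[OF f] by simp
    qed
    then have "(\<lambda>k. \<bar>U (Y (\<rho> k))\<bar>) \<longlonglongrightarrow> \<bar>U Y0\<bar>" by (rule tendsto_rabs)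
    moreover have "filterlim (\<lambda>k. \<bar>U (Y (\<rho> k))\<bar>) at_top sequentially"
      using filterlim_compose[OF UYinf filterlim_subseq[OF Y0(2)]] by (simp add: o_def)
    ultimately show False
      using filterlim_at_top_imp_at_infinity not_tendsto_and_filterlim_at_infinity sequentially_bot by blast
  qed
  have W0: "W z0 \<le> W Y0"
  proof (rule LIMSEQ_le)
    show "(\<lambda>k. W (zs (\<rho> k))) \<longlonglongrightarrow> W z0"
      by (rule continuous_on_tendsto_compose[OF contW _ z0(1)])
        (use LIMSEQ_subseq_LIMSEQ[OF zs(2) Y0(2)] zs(1) in \<open>auto simp: fin_def o_def\<close>)
    show "(\<lambda>k. W (Y (\<rho> k))) \<longlonglongrightarrow> W Y0"
      by (rule continuous_on_tendsto_compose[OF contW _ Y0(1)]) (use Y0(3) Y(1) in \<open>auto simp: fin_def o_def\<close>)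
  qed (use WY in auto)
  obtain c \<delta> where L: "dist (fst Y0) x0 < r" "snd Y0 = t1 \<Longrightarrow> \<forall>x\<in>cball x0 r. \<bar>u (x, t1)\<bar> = \<infinity>" "c > 0" "\<delta> > 0"
    and ineq: "\<And>Y' q l. Y' \<in> K \<Longrightarrow> dist Y' Y0 < \<delta> \<Longrightarrow> g Y' = l *\<^sub>R q \<Longrightarrow> \<bar>l\<bar> \<le> \<delta> \<Longrightarrow>
        \<tau> Y' + c \<le> hessian_trace (g' Y') - g' Y' (q, 0) \<bullet> q / (1 + q \<bullet> q)"
    using lim[OF Y0(1) Y0inf Y0cl W0] by blast
  \<comment> \<open>If the limit lies above the bottom, closeness within \<open>snd Y0 - t1\<close>
    keeps the maxima above the bottom too; if it lies on the bottom, the infinite bottom disc does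
    this instead and the radius \<delta> is enough.\<close>
  have "eventually (\<lambda>k. dist (Y (\<rho> k)) Y0 < min \<delta> (if snd Y0 = t1 then \<delta> else snd Y0 - t1)) sequentially"
    using Y0(1,3) L(4) by (intro tendstoD) (auto simp: o_def K_def)
  moreover have "eventually (\<lambda>k. dist (fst (Y (\<rho> k))) x0 < r) sequentially"
    using tendsto_dist[OF tendsto_fst[OF Y0(3)] tendsto_const[of x0]] L(1)
    by (auto dest!: order_tendstoD(2) simp: o_def)
  moreover have "eventually (\<lambda>k. \<bar>l (\<rho> k)\<bar> < \<delta>) sequentially"
    using LIMSEQ_subseq_LIMSEQ[OF l0 Y0(2)] L(4) by (auto dest!: tendstoD[of _ _ _ \<delta>] simp: o_def dist_real_def)
  moreover have "eventually (\<lambda>k. \<eta> (\<rho> k) < c / 2) sequentially"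
    using LIMSEQ_subseq_LIMSEQ[OF \<eta>0 Y0(2)] L(3) order_tendstoD(2)[of "\<lambda>k. \<eta> (\<rho> k)" 0 _ "c / 2"] by (auto simp: o_def)
  ultimately have "eventually (\<lambda>k. False) sequentially"
  proof eventually_elim
    case (elim j)
    define k where "k = \<rho> j"
    define x t where "x = fst (Y k)" and "t = snd (Y k)"
    have xt: "Y k = (x, t)" by (simp add: x_def t_def)
    have inK: "(x, t) \<in> K" and infin: "(x, t) \<in> fin" using Y(1)[of k] xt by (auto simp: fin_def)
    have d: "dist x x0 < r" using elim(2) by (simp add: x_def k_def)
    have t: "t1 < t"
    proof (cases "snd Y0 = t1")
      case True
      have "\<bar>u (x, t1)\<bar> = \<infinity>" by (rule bspec[OF L(2)[OF True]]) (use d in \<open>simp add: dist_commute\<close>)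
      then have "t \<noteq> t1" using infin by (auto simp: fin_def)
      then show ?thesis using inK by (auto simp: K_def)
    next
      case False
      then have "dist (snd (Y k)) (snd Y0) < snd Y0 - t1"
        using elim(1) dist_snd_le[of "Y k" Y0] by (auto simp: k_def)
      then show ?thesis by (auto simp: t_def dist_real_def)
    qed
    have inF: "(x, t) \<in> F" by (rule KF) (use inK infin d t in \<open>auto simp: fin_def\<close>)
    \<comment> \<open>With this radius, competitors at past times remain in the cylinder
      \<open>K\<close>, so the global maximum over \<open>fin\<close> is a local one in
      \<open>F\<close>.\<close>
    define e where "e = min (r - dist x x0) (t - t1)"
    have e: "e > 0" using d t by (simp add: e_def)
    have mx: "W (y, s) - \<eta> k * (U (y, s) - h k)\<^sup>2 \<le> W (x, t) - \<eta> k * (U (x, t) - h k)\<^sup>2"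
      if "(y, s) \<in> F" "dist y x < e" "t - e < s" "s \<le> t" for y s
    proof -
      have "dist y x0 \<le> r" using that(2) dist_triangle[of y x0 x] by (simp add: e_def)
      moreover have "t1 \<le> s" "s \<le> t2" using that inK by (auto simp: e_def K_def)
      ultimately have "(y, s) \<in> fin" using Fu[OF that(1)] by (auto simp: fin_def K_def dist_commute)
      from Y(2)[OF this, of k] show ?thesis by (simp add: \<Psi>_def xt)
    qed
    have S: "(x, t) \<in> S" using inK W(3) by auto
    note I = graph_max_inequality[OF W(1,2) S U(1)[folded U_def] U(2) inF eq[OF inF] e less_imp_le[OF \<eta>(1)[of k]] mx]
    have "\<tau> (x, t) + c \<le> hessian_trace (g' (x, t)) - g' (x, t) (p (x, t), 0) \<bullet> p (x, t) / (1 + p (x, t) \<bullet> p (x, t))"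
    proof (rule ineq[OF inK])
      show "dist (x, t) Y0 < \<delta>" using elim(1) xt by (simp add: k_def)
      show "g (x, t) = l k *\<^sub>R p (x, t)" using I(1) xt by (simp add: l_def)
      show "\<bar>l k\<bar> \<le> \<delta>" using elim(3) by (simp add: k_def)
    qed
    with I(2) elim(4) show False by (simp add: k_def)
  qed
  then show False by simp
qed

section \<open>From the divergence form of the equation to jets\<close>

lemma Ck_on_local:
  assumes "\<And>x. x \<in> S \<Longrightarrow> \<exists>T. open T \<and> x \<in> T \<and> Ck_on k (S \<inter> T) f" "open S"
  shows "Ck_on k S f"
  using assms(1)
proof (induction k arbitrary: f)
  case 0
  show ?case
  proof (simp add: continuous_on_eq_continuous_at[OF assms(2)], intro ballI)
    fix x assume x: "x \<in> S"
    then obtain T where T: "open T" "x \<in> T" "continuous_on (S \<inter> T) f" using 0 by force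
    then show "isCont f x"
      using continuous_on_eq_continuous_at[of "S \<inter> T" f] assms(2) x by auto
  qed
next
  case (Suc k)
  show ?case
  proof (simp, intro conjI ballI allI)
    fix x assume "x \<in> S"
    then obtain T where "open T" "x \<in> T" "Ck_on (Suc k) (S \<inter> T) f" using Suc.prems by blast
    then show "f differentiable at x" using \<open>x \<in> S\<close> by auto
  next
    fix v
    show "Ck_on k S (\<lambda>x. frechet_derivative f (at x) v)"
    proof (rule Suc.IH)
      fix x assume "x \<in> S"
      then obtain T where "open T" "x \<in> T" "Ck_on (Suc k) (S \<inter> T) f" using Suc.prems by blast
      then show "\<exists>T. open T \<and> x \<in> T \<and> Ck_on k (S \<inter> T) (\<lambda>x. frechet_derivative f (at x) v)" by auto
    qed
  qed
qed

text \<open>On an open set a local smooth extension agrees with \<open>f\<close> in a full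
  neighbourhood, so it has the same derivatives.\<close>

lemma smooth_on_open_Ck:
  assumes "open S" "smooth_on S f"
  shows "Ck_on k S f"
proof (rule Ck_on_local[OF _ assms(1)])
  fix x assume "x \<in> S"
  then have "\<exists>U g. open U \<and> x \<in> U \<and> (\<forall>k. Ck_on k U g) \<and> (\<forall>y\<in>S \<inter> U. f y = g y)"
    using assms(2) unfolding smooth_on_def by (rule bspec[rotated])
  then obtain U g where "open U \<and> x \<in> U \<and> (\<forall>k. Ck_on k U g) \<and> (\<forall>y\<in>S \<inter> U. f y = g y)"
    by (elim exE)
  then have U: "open U" "x \<in> U" "\<And>k. Ck_on k U g" "\<And>y. y \<in> S \<inter> U \<Longrightarrow> f y = g y"
    by simp_all
  have "Ck_on k (S \<inter> U) f"
  proof (rule Ck_on_cong)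
    show "Ck_on k (S \<inter> U) g" by (rule Ck_on_subset[OF U(3)]) simp
    show "g y = f y" if "y \<in> S \<inter> U" for y using U(4)[OF that] by simp
  qed (use U(1) assms(1) in auto)
  then show "\<exists>T. open T \<and> x \<in> T \<and> Ck_on k (S \<inter> T) f"
    by (intro exI[of _ U] conjI U(1,2))
qed

text \<open>With q = Du, A = D^2u and w = sqrt (1 + |q|^2), the field Du / w has derivative v
  \<mapsto> A v / w - (q . A v) q / w^3. Its trace, multiplied by w, is tr A - (A q . q) /
  w^2.\<close>

lemma graph_equation_jet:
  fixes U :: "'a::euclidean_space \<times> real \<Rightarrow> real"
  assumes F: "open F" "Ck_on 2 F U" "(x, t) \<in> F"
    and eq: "((\<lambda>s. U (x, s)) has_real_derivative
               sqrt (1 + (norm (gradient (\<lambda>y. U (y, t)) x))\<^sup>2) *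
               divergence (\<lambda>y. gradient (\<lambda>y. U (y, t)) y /\<^sub>R sqrt (1 + (norm (gradient (\<lambda>y. U (y, t)) y))\<^sup>2)) x) (at t)"
  defines "p \<equiv> space_gradient U" and "p' \<equiv> \<lambda>z. frechet_derivative (space_gradient U) (at z)"
  shows "frechet_derivative U (at (x, t)) (0, 1) =
    hessian_trace (p' (x, t)) - p' (x, t) (p (x, t), 0) \<bullet> p (x, t) / (1 + p (x, t) \<bullet> p (x, t))"
proof -
  have J: "jet_on F U p (\<lambda>z. frechet_derivative U (at z) (0, 1)) p'"
    unfolding p_def p'_def by (rule jet_on_Ck[OF F(1,2)])
  have grad: "gradient (\<lambda>y. U (y, t)) y = p (y, t)" if y: "(y, t) \<in> F" for y
  proof -
    have c: "((\<lambda>y. (y, t)) has_derivative (\<lambda>h. (h, 0))) (at y)"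
      by (auto intro!: derivative_eq_intros)
    have "((\<lambda>y. U (y, t)) has_derivative (\<lambda>h. p (y, t) \<bullet> h)) (at y)"
      using has_derivative_compose[OF c jet_onD(1)[OF J y]] by simp
    then have "frechet_derivative (\<lambda>y. U (y, t)) (at y) = (\<lambda>h. p (y, t) \<bullet> h)"
      using frechet_derivative_at by metis
    then show ?thesis
      unfolding gradient_def by (simp add: euclidean_representation)
  qed
  define q where "q = p (x, t)"
  define w where "w = sqrt (1 + (norm q)\<^sup>2)"
  define A where "A = (\<lambda>v. p' (x, t) (v, 0))"
  have w: "w > 0" "w\<^sup>2 = 1 + q \<bullet> q" by (auto simp: w_def add_pos_nonneg power2_norm_eq_inner)
  have linp': "linear (p' (x, t))" using jet_onD(3)[OF J F(3)] .
  have linA: "linear A" unfolding A_def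
    using linear_compose[OF _ linp', of "\<lambda>v. (v, 0)"] by (auto simp: o_def linear_iff)
  have pd: "((\<lambda>y. p (y, t)) has_derivative A) (at x)"
  proof -
    have "((\<lambda>y. (y, t)) has_derivative (\<lambda>h. (h, 0))) (at x)"
      by (auto intro!: derivative_eq_intros)
    from has_derivative_compose[OF this jet_onD(2)[OF J F(3)]] show ?thesis by (simp add: A_def)
  qed
  have wd: "((\<lambda>y. sqrt (1 + p (y, t) \<bullet> p (y, t))) has_derivative (\<lambda>v. (q \<bullet> A v) / w)) (at x)"
  proof -
    have "((\<lambda>y. 1 + p (y, t) \<bullet> p (y, t)) has_derivative (\<lambda>v. 2 * (q \<bullet> A v))) (at x)"
      using has_derivative_add[OF has_derivative_const has_derivative_inner[OF pd pd]]
      by (simp add: q_def inner_commute)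
    moreover have "(sqrt has_derivative (*) (inverse (sqrt (1 + q \<bullet> q)) / 2)) (at (1 + p (x, t) \<bullet> p (x, t)))"
      using DERIV_real_sqrt[of "1 + q \<bullet> q"] by (simp add: has_field_derivative_def q_def add_pos_nonneg)
    ultimately have "((\<lambda>y. sqrt (1 + p (y, t) \<bullet> p (y, t))) has_derivative
        (\<lambda>v. inverse (sqrt (1 + q \<bullet> q)) / 2 * (2 * (q \<bullet> A v)))) (at x)"
      by (rule has_derivative_compose)
    moreover have "(\<lambda>v. inverse (sqrt (1 + q \<bullet> q)) / 2 * (2 * (q \<bullet> A v))) = (\<lambda>v. (q \<bullet> A v) / w)"
      unfolding w_def power2_norm_eq_inner divide_inverse by (rule ext) (simp only: mult_ac, simp)
    ultimately show ?thesis by simp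
  qed
  have fd: "((\<lambda>y. p (y, t) /\<^sub>R sqrt (1 + p (y, t) \<bullet> p (y, t))) has_derivative
      (\<lambda>v. A v /\<^sub>R w - ((q \<bullet> A v) / w ^ 3) *\<^sub>R q)) (at x)"
  proof -
    have "((\<lambda>y. inverse (sqrt (1 + p (y, t) \<bullet> p (y, t)))) has_derivative
        (\<lambda>v. - (inverse w * ((q \<bullet> A v) / w) * inverse w))) (at x)"
    proof -
      have e: "sqrt (1 + p (x, t) \<bullet> p (x, t)) = w"
        unfolding w_def q_def power2_norm_eq_inner ..
      show ?thesis using Deriv.has_derivative_inverse[OF _ wd, unfolded e] w(1) by simp
    qed
    from has_derivative_scaleR[OF this pd]
    have "((\<lambda>y. p (y, t) /\<^sub>R sqrt (1 + p (y, t) \<bullet> p (y, t))) has_derivative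
      (\<lambda>v. inverse w *\<^sub>R A v + (- (inverse w * ((q \<bullet> A v) / w) * inverse w)) *\<^sub>R q)) (at x)"
      by (simp add: q_def[symmetric] w_def power2_norm_eq_inner)
    moreover have "inverse w *\<^sub>R A v + (- (inverse w * ((q \<bullet> A v) / w) * inverse w)) *\<^sub>R q
        = A v /\<^sub>R w - ((q \<bullet> A v) / w ^ 3) *\<^sub>R q" for v
      by (simp add: power3_eq_cube divide_simps)
    ultimately show ?thesis by (simp only:)
  qed
  have "((\<lambda>y. gradient (\<lambda>y. U (y, t)) y /\<^sub>R sqrt (1 + (norm (gradient (\<lambda>y. U (y, t)) y))\<^sup>2)) has_derivative
      (\<lambda>v. A v /\<^sub>R w - ((q \<bullet> A v) / w ^ 3) *\<^sub>R q)) (at x)"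
  proof (rule has_derivative_transform_within_open[OF fd])
    show "open ((\<lambda>y. (y, t)) -` F)"
      by (intro open_vimage F(1) continuous_intros)
  qed (use F(3) grad in \<open>auto simp: power2_norm_eq_inner\<close>)
  then have "frechet_derivative (\<lambda>y. gradient (\<lambda>y. U (y, t)) y /\<^sub>R sqrt (1 + (norm (gradient (\<lambda>y. U (y, t)) y))\<^sup>2)) (at x)
      = (\<lambda>v. A v /\<^sub>R w - ((q \<bullet> A v) / w ^ 3) *\<^sub>R q)"
    by (rule frechet_derivative_at[symmetric])
  then have "divergence (\<lambda>y. gradient (\<lambda>y. U (y, t)) y /\<^sub>R sqrt (1 + (norm (gradient (\<lambda>y. U (y, t)) y))\<^sup>2)) x
      = (\<Sum>b\<in>Basis. (A b \<bullet> b) / w - (q \<bullet> b) * (A b \<bullet> q) / w ^ 3)"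
    unfolding divergence_def
    by (simp only: inner_diff_left inner_scaleR_left inner_commute[of q "A _"] divide_inverse mult_ac)
  also have "\<dots> = (\<Sum>b\<in>Basis. A b \<bullet> b) / w - (\<Sum>b\<in>Basis. (q \<bullet> b) * (A b \<bullet> q)) / w ^ 3"
    by (simp add: sum_subtractf sum_divide_distrib)
  also have "(\<Sum>b\<in>Basis. (q \<bullet> b) * (A b \<bullet> q)) = A q \<bullet> q"
    using arg_cong[OF linear_sum_Basis[OF linA, of q], of "\<lambda>z. z \<bullet> q"] by (simp add: inner_sum_left)
  finally have div: "w * divergence (\<lambda>y. gradient (\<lambda>y. U (y, t)) y /\<^sub>R sqrt (1 + (norm (gradient (\<lambda>y. U (y, t)) y))\<^sup>2)) x
      = (\<Sum>b\<in>Basis. A b \<bullet> b) - (A q \<bullet> q) / w\<^sup>2"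
    using w(1) by (simp add: right_diff_distrib power2_eq_square power3_eq_cube)
  have "((\<lambda>s. U (x, s)) has_real_derivative frechet_derivative U (at (x, t)) (0, 1)) (at t)"
    by (rule jet_time_line[OF J F(3)])
  from DERIV_unique[OF this eq] show ?thesis
    using div by (simp add: grad[OF F(3)] q_def[symmetric] w_def[symmetric] w(2) hessian_trace_def A_def)
qed

lemma open_finite_ereal: "open {y::ereal. \<bar>y\<bar> \<noteq> \<infinity>}"
proof -
  have "{y::ereal. \<bar>y\<bar> \<noteq> \<infinity>} = UNIV - {\<infinity>, -\<infinity>}" by auto
  then show ?thesis by (simp add: open_Diff finite_imp_closed)
qed

lemma open_finiteness_domain:
  fixes u :: "'a::euclidean_space \<times> real \<Rightarrow> ereal"
  assumes open_dom: "open \<Omega>" and cont: "continuous_on (closure \<Omega> \<times> {0..}) u"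
  shows "open {(x, t). x \<in> \<Omega> \<and> 0 < t \<and> \<bar>u (x, t)\<bar> \<noteq> \<infinity>}"
proof -
  have "open ((\<Omega> \<times> {0<..}) \<inter> u -` {y. \<bar>y\<bar> \<noteq> \<infinity>})"
    by (rule continuous_open_preimage[OF continuous_on_subset[OF cont] _ open_finite_ereal])
      (use closure_subset[of \<Omega>] open_dom in \<open>auto intro: open_Times\<close>)
  also have "(\<Omega> \<times> {0<..}) \<inter> u -` {y. \<bar>y\<bar> \<noteq> \<infinity>} = {(x, t). x \<in> \<Omega> \<and> 0 < t \<and> \<bar>u (x, t)\<bar> \<noteq> \<infinity>}"
    by auto
  finally show ?thesis .
qed

section \<open>The blow-up set of a solution and comparison with shrinking balls\<close>

text \<open>The equation is recorded in nondivergence form, through explicit first and second order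
  data of the finite part of \<open>u\<close>. It holds at positive interior times; at time 0 there
  is only continuity.\<close>

locale graph_flow =
  fixes \<Omega> :: "'a::euclidean_space set" and u :: "'a \<times> real \<Rightarrow> ereal"
    and p :: "'a \<times> real \<Rightarrow> 'a" and \<mu> :: "'a \<times> real \<Rightarrow> real" and p' :: "'a \<times> real \<Rightarrow> 'a \<times> real \<Rightarrow> 'a"
  assumes open_dom: "open \<Omega>"
    and cont: "continuous_on (closure \<Omega> \<times> {0..}) u"
    and jet: "jet_on {(x, t). x \<in> \<Omega> \<and> 0 < t \<and> \<bar>u (x, t)\<bar> \<noteq> \<infinity>} (\<lambda>z. real_of_ereal (u z)) p \<mu> p'"
    and equation: "\<And>x t. x \<in> \<Omega> \<Longrightarrow> 0 < t \<Longrightarrow> \<bar>u (x, t)\<bar> \<noteq> \<infinity> \<Longrightarrow>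
      \<mu> (x, t) = hessian_trace (p' (x, t)) - p' (x, t) (p (x, t), 0) \<bullet> p (x, t) / (1 + p (x, t) \<bullet> p (x, t))"
begin

lemma open_finite_set: "open {(x, t). x \<in> \<Omega> \<and> 0 < t \<and> \<bar>u (x, t)\<bar> \<noteq> \<infinity>}"
  by (rule open_finiteness_domain[OF open_dom cont])

lemma comparison:
  assumes dom: "cball x0 r \<subseteq> \<Omega>" "0 \<le> t1"
    and W: "jet_on S W g \<tau> g'" "open S" "cball x0 r \<times> {t1..t2} \<subseteq> S"
    and z0: "z0 \<in> cball x0 r \<times> {t1..t2}" "\<bar>u z0\<bar> = \<infinity>"
      "z0 \<in> closure {z \<in> cball x0 r \<times> {t1..t2}. \<bar>u z\<bar> \<noteq> \<infinity>}"
    and lim: "\<And>Y. Y \<in> cball x0 r \<times> {t1..t2} \<Longrightarrow> \<bar>u Y\<bar> = \<infinity> \<Longrightarrow>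
      Y \<in> closure {z \<in> cball x0 r \<times> {t1..t2}. \<bar>u z\<bar> \<noteq> \<infinity>} \<Longrightarrow> W z0 \<le> W Y \<Longrightarrow>
      dist (fst Y) x0 < r \<and> (snd Y = t1 \<longrightarrow> (\<forall>x\<in>cball x0 r. \<bar>u (x, t1)\<bar> = \<infinity>)) \<and>
      (\<exists>c>0. \<exists>\<delta>>0. \<forall>Y'\<in>cball x0 r \<times> {t1..t2}. dist Y' Y < \<delta> \<longrightarrow> (\<forall>q l. g Y' = l *\<^sub>R q \<and> \<bar>l\<bar> \<le> \<delta> \<longrightarrow>
        \<tau> Y' + c \<le> hessian_trace (g' Y') - g' Y' (q, 0) \<bullet> q / (1 + q \<bullet> q)))"
  shows False
proof (rule graph_comparison[OF _ jet open_finite_set _ _ _ W z0 lim])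
  show "continuous_on (cball x0 r \<times> {t1..t2}) u"
    by (rule continuous_on_subset[OF cont]) (use dom closure_subset[of \<Omega>] in fastforce)
qed (use dom equation in auto)

text \<open>The test function is W(y, t) = - |y - x|^2 - (2n + 1)(t - T). Its Hessian has trace -
  2n, and the term subtracted in the graph operator has a favourable sign, so the speed 2n + 1
  leaves a gap of 1. The set W \<ge> W(x, T) consists of balls that shrink to (x, T); since no
  infinite points occur in them before T, (x, T) is the only point at which the hypothesis of
  \<open>comparison\<close> has to be checked.\<close>

lemma shrinking_ball_comparison:
  assumes dom: "cball x r \<subseteq> \<Omega>" "0 \<le> t1"
    and z0: "T \<in> {t1..t2}" "\<bar>u (x, T)\<bar> = \<infinity>" "(x, T) \<in> closure {z \<in> cball x r \<times> {t1..t2}. \<bar>u z\<bar> \<noteq> \<infinity>}"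
    and r: "r > 0"
    and lim: "\<And>y t. y \<in> cball x r \<Longrightarrow> t \<in> {t1..t2} \<Longrightarrow> \<bar>u (y, t)\<bar> = \<infinity> \<Longrightarrow> t < T \<Longrightarrow> False"
    and base: "T = t1 \<Longrightarrow> \<forall>y\<in>cball x r. \<bar>u (y, t1)\<bar> = \<infinity>"
  shows False
proof -
  define n where "n = real DIM('a)"
  define W where "W = (\<lambda>z::'a \<times> real. - ((fst z - x) \<bullet> (fst z - x)) - (2 * n + 1) * (snd z - T))"
  have J: "jet_on UNIV W (\<lambda>z. (-2) *\<^sub>R (fst z - x)) (\<lambda>z. - (2 * n + 1)) (\<lambda>z h. (-2) *\<^sub>R fst h)"
    unfolding jet_on_def W_def
    by (auto intro!: derivative_eq_intros simp: inner_commute algebra_simps)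
  have ht: "hessian_trace (\<lambda>h. (-2) *\<^sub>R fst h :: 'a) = - 2 * n"
    by (simp add: hessian_trace_def n_def)
  show False
  proof (rule comparison[OF dom J _ _ _ z0(2,3)])
    fix Y assume Y: "Y \<in> cball x r \<times> {t1..t2}" "\<bar>u Y\<bar> = \<infinity>" "W (x, T) \<le> W Y"
    have nl: "\<not> snd Y < T"
      using lim[of "fst Y" "snd Y"] Y by auto
    have "(fst Y - x) \<bullet> (fst Y - x) + (2 * n + 1) * (snd Y - T) \<le> 0"
      using Y(3) by (simp add: W_def)
    moreover have "(2 * n + 1) * (snd Y - T) \<ge> 0" using nl by (simp add: n_def)
    ultimately have "(fst Y - x) \<bullet> (fst Y - x) = 0" "(2 * n + 1) * (snd Y - T) = 0"
      using inner_ge_zero[of "fst Y - x"] by linarith+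
    then have YT: "fst Y = x" "snd Y = T" by (auto simp: n_def)
    have ineq: "- (2 * n + 1) + 1 \<le> hessian_trace (\<lambda>h. (-2) *\<^sub>R fst h :: 'a) - (-2) *\<^sub>R fst (q, 0::real) \<bullet> q / (1 + q \<bullet> q)" for q :: 'a
      unfolding ht by (simp add: add_nonneg_nonneg)
    show "dist (fst Y) x < r \<and> (snd Y = t1 \<longrightarrow> (\<forall>y\<in>cball x r. \<bar>u (y, t1)\<bar> = \<infinity>)) \<and>
      (\<exists>c>0. \<exists>\<delta>>0. \<forall>Y'\<in>cball x r \<times> {t1..t2}. dist Y' Y < \<delta> \<longrightarrow> (\<forall>q l. (-2) *\<^sub>R (fst Y' - x) = l *\<^sub>R q \<and> \<bar>l\<bar> \<le> \<delta> \<longrightarrow>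
        - (2 * n + 1) + c \<le> hessian_trace (\<lambda>h. (-2) *\<^sub>R fst h :: 'a) - (-2) *\<^sub>R fst (q, 0::real) \<bullet> q / (1 + q \<bullet> q)))"
      using YT r base ineq by (metis dist_self zero_less_one)
  qed (use z0 r in auto)
qed

text \<open>Shrinking balls in a cylinder that starts at T itself: there are no earlier times in it,
  and its bottom disc is infinite by assumption.\<close>

lemma no_spontaneous_finiteness:
  assumes "x \<in> \<Omega>" "0 \<le> T" "eventually (\<lambda>y. \<bar>u (y, T)\<bar> = \<infinity>) (nhds x)"
  shows "(x, T) \<notin> closure {z. fst z \<in> \<Omega> \<and> T \<le> snd z \<and> \<bar>u z\<bar> \<noteq> \<infinity>}"
proof
  assume cl: "(x, T) \<in> closure {z. fst z \<in> \<Omega> \<and> T \<le> snd z \<and> \<bar>u z\<bar> \<noteq> \<infinity>}"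
  obtain r1 where r1: "r1 > 0" "cball x r1 \<subseteq> \<Omega>" using open_dom assms(1) open_contains_cball by blast
  obtain r2 where r2: "r2 > 0" "\<And>y. dist y x < r2 \<Longrightarrow> \<bar>u (y, T)\<bar> = \<infinity>"
    using assms(3) unfolding eventually_nhds_metric by blast
  define r where "r = min r1 (r2 / 2)"
  have r: "r > 0" "cball x r \<subseteq> \<Omega>" "\<forall>y\<in>cball x r. \<bar>u (y, T)\<bar> = \<infinity>"
    using r1 r2 subset_cball[of r r1 x] by (auto simp: r_def dist_commute)
  have "(x, T) \<in> ball x r \<times> {..<T + 1} \<inter> closure {z. fst z \<in> \<Omega> \<and> T \<le> snd z \<and> \<bar>u z\<bar> \<noteq> \<infinity>}"
    using cl r by auto
  also have "\<dots> \<subseteq> closure (ball x r \<times> {..<T + 1} \<inter> {z. fst z \<in> \<Omega> \<and> T \<le> snd z \<and> \<bar>u z\<bar> \<noteq> \<infinity>})"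
    by (rule open_Int_closure_subset) (auto intro: open_Times)
  also have "\<dots> \<subseteq> closure {z \<in> cball x r \<times> {T..T + 1}. \<bar>u z\<bar> \<noteq> \<infinity>}"
    by (rule closure_mono) auto
  finally have cl': "(x, T) \<in> closure {z \<in> cball x r \<times> {T..T + 1}. \<bar>u z\<bar> \<noteq> \<infinity>}" .
  show False
    by (rule shrinking_ball_comparison[OF r(2) assms(2) _ _ cl' r(1)]) (use r in auto)
qed

text \<open>Shrinking balls in a cylinder that ends at T. The points (x, s) with s increasing to T
  are finite and show that (x, T) is a limit of finite points.\<close>

lemma finiteness_persists:
  assumes "x \<in> \<Omega>" "0 \<le> t1" "t1 < T" and r: "r > 0" "cball x r \<subseteq> \<Omega>"
    and fin: "\<And>y t. y \<in> cball x r \<Longrightarrow> t1 \<le> t \<Longrightarrow> t < T \<Longrightarrow> \<bar>u (y, t)\<bar> \<noteq> \<infinity>"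
  shows "\<bar>u (x, T)\<bar> \<noteq> \<infinity>"
proof
  assume inf: "\<bar>u (x, T)\<bar> = \<infinity>"
  have cl: "(x, T) \<in> closure {z \<in> cball x r \<times> {t1..T}. \<bar>u z\<bar> \<noteq> \<infinity>}"
    unfolding closure_sequential
  proof (intro exI conjI allI)
    define s where "s = (\<lambda>k::nat. T - (T - t1) * inverse (real (Suc k)))"
    show "(\<lambda>k. (x, s k)) \<longlonglongrightarrow> (x, T)"
      unfolding s_def using tendsto_diff[OF tendsto_const tendsto_mult[OF tendsto_const LIMSEQ_inverse_real_of_nat], of T "T - t1"]
      by (intro tendsto_Pair) auto
    fix k
    have "(T - t1) * inverse (real (Suc k)) \<le> (T - t1) * 1" "(T - t1) * inverse (real (Suc k)) > 0"
      using assms(3) by (intro mult_left_mono, auto simp: inverse_le_1_iff)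
    then show "(x, s k) \<in> {z \<in> cball x r \<times> {t1..T}. \<bar>u z\<bar> \<noteq> \<infinity>}"
      using fin[of x "s k"] r by (auto simp: s_def)
  qed
  show False
    by (rule shrinking_ball_comparison[OF r(2) assms(2) _ inf cl r(1)]) (use assms in auto)
qed

end

section \<open>Parametrised hypersurfaces\<close>

lemma subspace_model_hyperplane: "subspace (model_hyperplane :: 'a::euclidean_space set)"
  unfolding model_hyperplane_def by (rule subspace_hyperplane2)

definition model_normal :: "'a::euclidean_space" where
  "model_normal = (SOME b. b \<in> Basis)"

lemma model_normal_in_Basis: "model_normal \<in> Basis"
  unfolding model_normal_def using nonempty_Basis by (simp add: some_in_eq)

lemma model_hyperplane_iff: "y \<in> model_hyperplane \<longleftrightarrow> y \<bullet> model_normal = 0"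
  by (simp add: model_hyperplane_def model_normal_def)

lemma norm_model_normal [simp]:
  "norm (model_normal :: 'a::euclidean_space) = 1" "(model_normal :: 'a) \<bullet> model_normal = 1"
  using model_normal_in_Basis[where 'a='a] by auto

lemma dim_model_hyperplane: "dim (model_hyperplane :: 'a::euclidean_space set) = DIM('a) - 1"
proof -
  have nz: "(model_normal :: 'a) \<noteq> 0" using model_normal_in_Basis nonzero_Basis by blast
  have "(model_hyperplane :: 'a set) = {x. model_normal \<bullet> x = 0}"
    by (auto simp: model_hyperplane_iff inner_commute)
  then show ?thesis using dim_hyperplane[OF nz] by (simp only:)
qed

text \<open>\<open>E\<close> lives in the parameter space: its image under the differential
  \<open>L\<close>, together with the normal, is an orthonormal basis of the ambient space.\<close>

definition adapted_frame :: "('a::euclidean_space \<Rightarrow> 'a) \<Rightarrow> 'a set \<Rightarrow> 'a \<Rightarrow> bool" where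
  "adapted_frame L E \<nu> \<longleftrightarrow> finite E \<and> E \<subseteq> model_hyperplane \<and> card E = dim (model_hyperplane :: 'a set) \<and>
     (\<forall>v\<in>E. \<forall>w\<in>E. L v \<bullet> L w = (if v = w then 1 else 0)) \<and> norm \<nu> = 1 \<and> (\<forall>v\<in>model_hyperplane. L v \<bullet> \<nu> = 0)"

text \<open>An orthonormal basis of the tangent space L(hyperplane) is pulled back along
  \<open>L\<close>, which is injective there; the normal exists because the tangent space has
  codimension one.\<close>

lemma adapted_frame_exists:
  fixes L :: "'a::euclidean_space \<Rightarrow> 'a"
  assumes lin: "linear L" and inj: "inj_on L model_hyperplane"
  shows "\<exists>E \<nu>. adapted_frame L E \<nu>"
proof -
  define S where "S = L ` model_hyperplane"
  have S: "subspace S" unfolding S_def by (rule linear_subspace_image[OF lin subspace_model_hyperplane])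
  have dimS: "dim S = DIM('a) - 1"
    unfolding S_def
    by (subst dim_image_eq[OF lin]) (use inj in \<open>simp_all add: span_eq_iff[THEN iffD2, OF subspace_model_hyperplane] dim_model_hyperplane\<close>)
  obtain Bs where Bs: "Bs \<subseteq> S" "pairwise orthogonal Bs" "\<And>x. x \<in> Bs \<Longrightarrow> norm x = 1" "independent Bs" "card Bs = dim S" "span Bs = S"
    using orthonormal_basis_subspace[OF S] by metis
  define E where "E = model_hyperplane \<inter> L -` Bs"
  have LE: "L ` E = Bs" using Bs(1) by (auto simp: E_def S_def)
  have injE: "inj_on L E" using inj by (rule inj_on_subset) (auto simp: E_def)
  have finB: "finite Bs" using Bs(4) independent_imp_finite by blast
  have finE: "finite E" using finB LE injE finite_imageD by metis
  have cardE: "card E = dim (model_hyperplane :: 'a set)"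
    using card_image[OF injE] LE Bs(5) dimS dim_model_hyperplane by metis
  have on: "L v \<bullet> L w = (if v = w then 1 else 0)" if "v \<in> E" "w \<in> E" for v w
  proof (cases "v = w")
    case True
    then show ?thesis using Bs(3)[of "L v"] LE that by (auto simp: norm_eq_1)
  next
    case False
    then have "L v \<noteq> L w" using injE that by (auto dest: inj_onD)
    then show ?thesis using Bs(2) LE that False by (auto simp: pairwise_def orthogonal_def)
  qed
  have "DIM('a) - 1 < DIM('a)" using DIM_positive[where 'a='a] by linarith
  then have "S \<noteq> UNIV" using dimS by (metis dim_UNIV less_irrefl)
  then have "span S \<subset> UNIV" using S by (auto simp: span_eq_iff[THEN iffD2, OF S])
  then obtain \<nu>0 where \<nu>0: "\<nu>0 \<noteq> 0" "\<And>y. y \<in> span S \<Longrightarrow> orthogonal \<nu>0 y"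
    using orthogonal_to_subspace_exists_gen[of S UNIV] by auto
  have "L v \<bullet> (\<nu>0 /\<^sub>R norm \<nu>0) = 0" if "v \<in> model_hyperplane" for v
    using \<nu>0(2)[of "L v"] that by (auto simp: S_def orthogonal_def inner_commute intro: span_base)
  moreover have "norm (\<nu>0 /\<^sub>R norm \<nu>0) = 1" using \<nu>0(1) by simp
  ultimately have "adapted_frame L E (\<nu>0 /\<^sub>R norm \<nu>0)"
    unfolding adapted_frame_def using finE cardE on by (auto simp: E_def)
  then show ?thesis by blast
qed

lemma adapted_frame_expand:
  fixes L :: "'a::euclidean_space \<Rightarrow> 'a"
  assumes "adapted_frame L E \<nu>"
  shows "x = (\<Sum>v\<in>E. (x \<bullet> L v) *\<^sub>R L v) + (x \<bullet> \<nu>) *\<^sub>R \<nu>"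
proof -
  note A = assms[unfolded adapted_frame_def]
  have inj: "inj_on L E" using A unfolding inj_on_def by (metis zero_neq_one)
  have on: "L v \<bullet> L v = 1" "L v \<bullet> \<nu> = 0" if "v \<in> E" for v using A that by auto
  have \<nu>: "\<nu> \<bullet> \<nu> = 1" using A by (simp add: norm_eq_1)
  have nin: "\<nu> \<notin> L ` E" using on \<nu> by force
  define Bs where "Bs = insert \<nu> (L ` E)"
  have fin: "finite Bs" using A by (simp add: Bs_def)
  have cardB: "card Bs = DIM('a)"
    using A nin card_image[OF inj] dim_model_hyperplane[where 'a='a] DIM_positive[where 'a='a] by (simp add: Bs_def)
  have orth: "pairwise orthogonal Bs"
    using A on unfolding Bs_def pairwise_def orthogonal_def by (auto simp: inner_commute)
  have nrm: "norm z = 1" if "z \<in> Bs" for z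
    using that on \<nu> by (auto simp: Bs_def norm_eq_1)
  have "0 \<notin> Bs" using nrm by force
  then have "independent Bs" using orth pairwise_orthogonal_independent by blast
  then have "UNIV \<subseteq> span Bs"
    using card_eq_dim[of Bs UNIV] cardB fin by (simp add: dim_UNIV)
  then have "(\<Sum>i\<in>Bs. (x \<bullet> i) *\<^sub>R i) = x"
    by (intro orthonormal_basis_expand orth nrm fin) auto
  moreover have "(\<Sum>i\<in>Bs. (x \<bullet> i) *\<^sub>R i) = (x \<bullet> \<nu>) *\<^sub>R \<nu> + (\<Sum>i\<in>L ` E. (x \<bullet> i) *\<^sub>R i)"
    unfolding Bs_def using nin A by simp
  moreover have "(\<Sum>i\<in>L ` E. (x \<bullet> i) *\<^sub>R i) = (\<Sum>v\<in>E. (x \<bullet> L v) *\<^sub>R L v)"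
    using sum.reindex[OF inj] by (simp add: o_def)
  ultimately show ?thesis by (simp add: add.commute)
qed

text \<open>Splits a trace into its tangential and its normal part; this is how a trace over the
  tangent space becomes the level set operator.\<close>

lemma adapted_frame_trace:
  fixes L :: "'a::euclidean_space \<Rightarrow> 'a"
  assumes A: "adapted_frame L E \<nu>" and lin: "linear N"
  shows "(\<Sum>b\<in>Basis. N b \<bullet> b) = (\<Sum>v\<in>E. N (L v) \<bullet> L v) + N \<nu> \<bullet> \<nu>"
proof -
  have part: "(\<Sum>b\<in>Basis. (b \<bullet> e) * (N e \<bullet> b)) = N e \<bullet> e" for e
    by (subst euclidean_inner[of "N e" e]) (simp add: inner_commute mult.commute)
  have "N b \<bullet> b = (\<Sum>v\<in>E. (b \<bullet> L v) * (N (L v) \<bullet> b)) + (b \<bullet> \<nu>) * (N \<nu> \<bullet> b)" for b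
    by (subst adapted_frame_expand[OF A, of b])
      (simp add: linear_add[OF lin] linear_sum[OF lin] linear_cmul[OF lin] inner_add_left inner_sum_left
        del: inner_add_right)
  then have "(\<Sum>b\<in>Basis. N b \<bullet> b) = (\<Sum>b\<in>Basis. \<Sum>v\<in>E. (b \<bullet> L v) * (N (L v) \<bullet> b)) + (\<Sum>b\<in>Basis. (b \<bullet> \<nu>) * (N \<nu> \<bullet> b))"
    by (simp add: sum.distrib)
  also have "(\<Sum>b\<in>Basis. \<Sum>v\<in>E. (b \<bullet> L v) * (N (L v) \<bullet> b)) = (\<Sum>v\<in>E. \<Sum>b\<in>Basis. (b \<bullet> L v) * (N (L v) \<bullet> b))"
    by (rule sum.swap)
  finally show ?thesis by (simp add: part)
qed

section \<open>The level set operator and the flow in charts\<close>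

text \<open>This is |DW|^2 times the level set operator W_t - tr D^2W + D^2W(DW, DW) / |DW|^2. The
  factor removes the singularity at critical points and makes the expression polynomial in the jet.
  It vanishes on a level set that moves by mean curvature with nonzero gradient.\<close>

definition mcf_defect :: "('a::euclidean_space \<times> real \<Rightarrow> 'a) \<Rightarrow> ('a \<times> real \<Rightarrow> real) \<Rightarrow>
    ('a \<times> real \<Rightarrow> 'a \<times> real \<Rightarrow> 'a) \<Rightarrow> 'a \<times> real \<Rightarrow> real" where
  "mcf_defect g \<tau> g' z = (g z \<bullet> g z) * (\<tau> z - hessian_trace (g' z)) + g' z (g z, 0) \<bullet> g z"

text \<open>
  Only the charts of the parameter manifold matter: \<open>charts\<close> consists of the
  chart domains \<open>D\<close> in the model hyperplane together with the flow \<open>X\<close> in that chart.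
\<close>

locale flow_family =
  fixes a b :: real and B :: "real \<Rightarrow> 'a::euclidean_space set"
    and charts :: "('a set \<times> ('a \<Rightarrow> real \<Rightarrow> 'a)) set"
  assumes ab: "a < b"
    and open_B: "\<And>t. t \<in> {a..b} \<Longrightarrow> open (B t)"
    and compact_B: "\<And>t. t \<in> {a..b} \<Longrightarrow> compact (closure (B t))"
    and boundary_B: "\<And>t. t \<in> {a..b} \<Longrightarrow> smooth_boundary (B t)"
    and chart_open: "\<And>D X. (D, X) \<in> charts \<Longrightarrow> openin (top_of_set model_hyperplane) D"
    and chart_smooth: "\<And>D X. (D, X) \<in> charts \<Longrightarrow> smooth_on (D \<times> {a..b}) (\<lambda>(y, t). X y t)"
    and immersion: "\<And>D X y t. (D, X) \<in> charts \<Longrightarrow> y \<in> D \<Longrightarrow> t \<in> {a..b} \<Longrightarrow> immersion_at (\<lambda>y. X y t) y"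
    and flow: "\<And>D X y t \<nu>. (D, X) \<in> charts \<Longrightarrow> y \<in> D \<Longrightarrow> t \<in> {a..b} \<Longrightarrow> unit_normal (\<lambda>y. X y t) y \<nu> \<Longrightarrow>
      (X y has_vector_derivative - mean_curvature (\<lambda>y. X y t) y \<nu> *\<^sub>R \<nu>) (at t within {a..b})"
    and cover: "\<And>t. t \<in> {a..b} \<Longrightarrow> (\<Union>(D, X)\<in>charts. (\<lambda>y. X y t) ` D) = frontier (B t)"
begin

text \<open>\<open>G\<close> extends the flow smoothly to a full space-time neighbourhood.
  Derivatives of \<open>X\<close> along the hyperplane, and one-sided time derivatives at
  \<open>a\<close> and \<open>b\<close>, can then be read off from ordinary derivatives of
  \<open>G\<close>.\<close>

definition patch :: "'a set \<Rightarrow> ('a \<Rightarrow> real \<Rightarrow> 'a) \<Rightarrow> 'a \<Rightarrow> real \<Rightarrow> real \<Rightarrow> ('a \<times> real \<Rightarrow> 'a) \<Rightarrow> bool" where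
  "patch D X y0 s0 r G \<longleftrightarrow> (D, X) \<in> charts \<and> y0 \<in> D \<and> s0 \<in> {a..b} \<and> r > 0 \<and>
     (\<forall>k. Ck_on k (ball y0 r \<times> ball s0 r) G) \<and>
     (\<forall>y\<in>model_hyperplane \<inter> ball y0 r. y \<in> D \<and> (\<forall>t\<in>{a..b} \<inter> ball s0 r. X y t = G (y, t)))"

lemma chart_subset: "(D, X) \<in> charts \<Longrightarrow> y \<in> D \<Longrightarrow> y \<in> model_hyperplane"
  using chart_open openin_imp_subset by blast

lemma patch_exists:
  assumes DX: "(D, X) \<in> charts" and y0: "y0 \<in> D" and s0: "s0 \<in> {a..b}"
  shows "\<exists>r G. patch D X y0 s0 r G"
proof -
  have "\<exists>U g. open U \<and> (y0, s0) \<in> U \<and> (\<forall>k. Ck_on k U g) \<and> (\<forall>y\<in>D \<times> {a..b} \<inter> U. (\<lambda>(y, t). X y t) y = g y)"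
    using chart_smooth[OF DX] y0 s0 unfolding smooth_on_def by (auto dest!: bspec[of _ _ "(y0, s0)"])
  then obtain U G where "open U \<and> (y0, s0) \<in> U \<and> (\<forall>k. Ck_on k U G) \<and> (\<forall>y\<in>D \<times> {a..b} \<inter> U. (\<lambda>(y, t). X y t) y = G y)"
    by (elim exE)
  then have U: "open U" "(y0, s0) \<in> U" "\<And>k. Ck_on k U G" "\<And>y t. y \<in> D \<Longrightarrow> t \<in> {a..b} \<Longrightarrow> (y, t) \<in> U \<Longrightarrow> X y t = G (y, t)"
    by (simp_all add: Ball_def)
  obtain r1 r2 where r1: "r1 > 0" "r2 > 0" "ball y0 r1 \<times> ball s0 r2 \<subseteq> U"
  proof -
    obtain U1 U2 where U12: "open U1" "open U2" "(y0, s0) \<in> U1 \<times> U2" "U1 \<times> U2 \<subseteq> U"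
      using open_prod_elim[OF U(1,2)] by blast
    obtain r1 r2 where "r1 > 0" "ball y0 r1 \<subseteq> U1" "r2 > 0" "ball s0 r2 \<subseteq> U2"
      using U12(1,2,3) openE[of U1 y0] openE[of U2 s0] by (metis mem_Sigma_iff)
    then show ?thesis using that[of r1 r2] U12(4) by blast
  qed
  obtain r3 where r3: "r3 > 0" "ball y0 r3 \<inter> model_hyperplane \<subseteq> D"
    using chart_open[OF DX] y0 by (auto simp: openin_contains_ball)
  define r where "r = min r1 (min r2 r3)"
  have r: "r > 0" "ball y0 r \<times> ball s0 r \<subseteq> U" "ball y0 r \<inter> model_hyperplane \<subseteq> D"
    using r1 r3 by (auto simp: r_def)
  have "Ck_on k (ball y0 r \<times> ball s0 r) G" for k by (rule Ck_on_subset[OF U(3) r(2)])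
  then have "patch D X y0 s0 r G"
    unfolding patch_def
  proof (intro conjI ballI)
    fix y t assume yt: "y \<in> model_hyperplane \<inter> ball y0 r" "t \<in> {a..b} \<inter> ball s0 r"
    then have "(y, t) \<in> U" using r(2) by blast
    then show "X y t = G (y, t)" using yt r(3) by (intro U(4)) auto
  qed (use DX y0 s0 r in auto)
  then show ?thesis by blast
qed

lemma patchD:
  assumes "patch D X y0 s0 r G"
  shows "(D, X) \<in> charts" "y0 \<in> D" "s0 \<in> {a..b}" "r > 0"
    "\<And>k. Ck_on k (ball y0 r \<times> ball s0 r) G"
    "\<And>y. y \<in> model_hyperplane \<Longrightarrow> dist y y0 < r \<Longrightarrow> y \<in> D"
    "\<And>y t. y \<in> model_hyperplane \<Longrightarrow> dist y y0 < r \<Longrightarrow> t \<in> {a..b} \<Longrightarrow> dist t s0 < r \<Longrightarrow> X y t = G (y, t)"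
  using assms unfolding patch_def by (auto simp: dist_commute)

context
  fixes D X y0 s0 r G y t
  assumes P: "patch D X y0 s0 r G"
    and y: "y \<in> model_hyperplane" "dist y y0 < r" and t: "t \<in> {a..b}" "dist t s0 < r"
begin

lemma patch_mem: "(y, t) \<in> ball y0 r \<times> ball s0 r" "open (ball y0 r \<times> ball s0 r)"
  using y t by (auto simp: dist_commute open_Times)

lemma patch_has_derivative: "(G has_derivative frechet_derivative G (at (y, t))) (at (y, t))"
  by (rule Ck_on_has_derivative[OF patchD(5)[OF P, of "Suc 0"] patch_mem(1)])

lemma patch_linear: "linear (\<lambda>v. frechet_derivative G (at (y, t)) (v, 0))"
proof -
  have "linear (frechet_derivative G (at (y, t)))"
    using patch_has_derivative has_derivative_linear by blast
  from linear_compose[OF _ this, of "\<lambda>v. (v, 0)"] show ?thesis by (auto simp: o_def linear_iff)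
qed

lemma patch_near:
  assumes "v \<in> model_hyperplane"
  obtains d where "d > 0" "\<And>s. \<bar>s\<bar> < d \<Longrightarrow> y + s *\<^sub>R v \<in> model_hyperplane"
    "\<And>s. \<bar>s\<bar> < d \<Longrightarrow> dist (y + s *\<^sub>R v) y0 < r"
proof
  define d where "d = (r - dist y y0) / (norm v + 1)"
  show "d > 0" using y by (simp add: d_def add_nonneg_pos)
  fix s :: real assume s: "\<bar>s\<bar> < d"
  show "y + s *\<^sub>R v \<in> model_hyperplane"
    by (rule subspace_add[OF subspace_model_hyperplane y(1) subspace_scale[OF subspace_model_hyperplane assms]])
  have "\<bar>s\<bar> * norm v \<le> \<bar>s\<bar> * (norm v + 1)" by (intro mult_left_mono) auto
  also have "\<dots> < r - dist y y0" using s by (simp add: d_def pos_less_divide_eq add_nonneg_pos)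
  finally show "dist (y + s *\<^sub>R v) y0 < r"
    using dist_triangle[of "y + s *\<^sub>R v" y0 y] by (simp add: dist_norm)
qed

lemma patch_line_derivative:
  assumes "(y + s *\<^sub>R v, t) \<in> ball y0 r \<times> ball s0 r"
  shows "((\<lambda>s. G (y + s *\<^sub>R v, t)) has_vector_derivative frechet_derivative G (at (y + s *\<^sub>R v, t)) (v, 0)) (at s)"
    "((\<lambda>s. frechet_derivative G (at (y + s *\<^sub>R v, t)) (w, 0)) has_vector_derivative
        frechet_derivative (\<lambda>z. frechet_derivative G (at z) (w, 0)) (at (y + s *\<^sub>R v, t)) (v, 0)) (at s)"
proof -
  have line: "((\<lambda>s. f (y + s *\<^sub>R v, t)) has_vector_derivative frechet_derivative f (at (y + s *\<^sub>R v, t)) (v, 0)) (at s)"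
    if "(f has_derivative frechet_derivative f (at (y + s *\<^sub>R v, t))) (at (y + s *\<^sub>R v, t))" for f :: "'a \<times> real \<Rightarrow> 'a"
  proof -
    have c: "((\<lambda>s. (y + s *\<^sub>R v, t)) has_derivative (\<lambda>h. (h *\<^sub>R v, 0))) (at s)"
      by (auto intro!: derivative_eq_intros)
    have "((\<lambda>s. f (y + s *\<^sub>R v, t)) has_derivative (\<lambda>h. frechet_derivative f (at (y + s *\<^sub>R v, t)) (h *\<^sub>R v, 0))) (at s)"
      using has_derivative_compose[OF c that] .
    also have "(\<lambda>h. frechet_derivative f (at (y + s *\<^sub>R v, t)) (h *\<^sub>R v, 0)) = (\<lambda>h. h *\<^sub>R frechet_derivative f (at (y + s *\<^sub>R v, t)) (v, 0))"
    proof
      fix h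
      have "(h *\<^sub>R v, 0) = h *\<^sub>R (v, 0::real)" by simp
      then show "frechet_derivative f (at (y + s *\<^sub>R v, t)) (h *\<^sub>R v, 0) = h *\<^sub>R frechet_derivative f (at (y + s *\<^sub>R v, t)) (v, 0)"
        using linear_cmul[OF has_derivative_linear[OF that], of h "(v, 0)"] by simp
    qed
    finally show ?thesis by (simp add: has_vector_derivative_def)
  qed
  show "((\<lambda>s. G (y + s *\<^sub>R v, t)) has_vector_derivative frechet_derivative G (at (y + s *\<^sub>R v, t)) (v, 0)) (at s)"
    by (rule line, rule Ck_on_has_derivative[OF patchD(5)[OF P, of "Suc 0"] assms])
  show "((\<lambda>s. frechet_derivative G (at (y + s *\<^sub>R v, t)) (w, 0)) has_vector_derivative
        frechet_derivative (\<lambda>z. frechet_derivative G (at z) (w, 0)) (at (y + s *\<^sub>R v, t)) (v, 0)) (at s)"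
    by (rule line, rule Ck_on_has_derivative[of 0 _ _ , OF _ assms])
      (use patchD(5)[OF P, of "Suc (Suc 0)"] in simp)
qed

lemma patch_dir_deriv:
  assumes v: "v \<in> model_hyperplane"
  shows "dir_deriv (\<lambda>y. X y t) y v = frechet_derivative G (at (y, t)) (v, 0)"
proof -
  obtain d where d: "d > 0" "\<And>s. \<bar>s\<bar> < d \<Longrightarrow> y + s *\<^sub>R v \<in> model_hyperplane"
    "\<And>s. \<bar>s\<bar> < d \<Longrightarrow> dist (y + s *\<^sub>R v) y0 < r"
    using patch_near[OF v] by blast
  have "((\<lambda>s. G (y + s *\<^sub>R v, t)) has_vector_derivative frechet_derivative G (at (y, t)) (v, 0)) (at 0)"
    using patch_line_derivative(1)[of 0 v] patch_mem by simp
  then have "((\<lambda>s. X (y + s *\<^sub>R v) t) has_vector_derivative frechet_derivative G (at (y, t)) (v, 0)) (at 0)"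
    by (rule has_vector_derivative_transform_within_open[of _ _ _ "ball 0 d"])
      (use d patchD(7)[OF P] t in auto)
  then show ?thesis unfolding dir_deriv_def by (rule vector_derivative_at)
qed

lemma patch_injective: "inj_on (\<lambda>v. frechet_derivative G (at (y, t)) (v, 0)) model_hyperplane"
proof -
  have "inj_on (dir_deriv (\<lambda>y. X y t) y) model_hyperplane"
    using immersion[OF patchD(1)[OF P] patchD(6)[OF P y] t(1)] by (simp add: immersion_at_def)
  moreover have "inj_on (dir_deriv (\<lambda>y. X y t) y) model_hyperplane \<longleftrightarrow>
      inj_on (\<lambda>v. frechet_derivative G (at (y, t)) (v, 0)) model_hyperplane"
    by (rule inj_on_cong) (rule patch_dir_deriv)
  ultimately show ?thesis by simp
qed

lemma patch_time_derivative:
  "((\<lambda>s. G (y, s)) has_vector_derivative frechet_derivative G (at (y, t)) (0, 1)) (at t)"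
proof -
  have c: "((\<lambda>s. (y, s)) has_derivative (\<lambda>h. (0, h))) (at t)"
    by (auto intro!: derivative_eq_intros)
  have "(\<lambda>h. frechet_derivative G (at (y, t)) (0, h)) = (\<lambda>h. h *\<^sub>R frechet_derivative G (at (y, t)) (0, 1))"
  proof
    fix h :: real
    have "(0, h) = h *\<^sub>R (0::'a, 1::real)" by simp
    then show "frechet_derivative G (at (y, t)) (0, h) = h *\<^sub>R frechet_derivative G (at (y, t)) (0, 1)"
      using linear_cmul[OF has_derivative_linear[OF patch_has_derivative], of h "(0, 1)"] by simp
  qed
  with has_derivative_compose[OF c patch_has_derivative] show ?thesis
    by (simp add: has_vector_derivative_def)
qed

end

lemma patch_second_dir_deriv:
  assumes P: "patch D X y0 s0 r G" and y: "y \<in> model_hyperplane" "dist y y0 < r"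
    and t: "t \<in> {a..b}" "dist t s0 < r" and v: "v \<in> model_hyperplane"
  shows "dir_deriv (\<lambda>z. dir_deriv (\<lambda>y. X y t) z v) y v =
    frechet_derivative (\<lambda>z. frechet_derivative G (at z) (v, 0)) (at (y, t)) (v, 0)"
proof -
  obtain d where d: "d > 0" "\<And>s. \<bar>s\<bar> < d \<Longrightarrow> y + s *\<^sub>R v \<in> model_hyperplane"
    "\<And>s. \<bar>s\<bar> < d \<Longrightarrow> dist (y + s *\<^sub>R v) y0 < r"
    using patch_near[OF P y t v] by blast
  have "((\<lambda>s. frechet_derivative G (at (y + s *\<^sub>R v, t)) (v, 0)) has_vector_derivative
      frechet_derivative (\<lambda>z. frechet_derivative G (at z) (v, 0)) (at (y, t)) (v, 0)) (at 0)"
    using patch_line_derivative(2)[OF P y t, of 0 v v] patch_mem(1)[OF P y t] by simp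
  then have "((\<lambda>s. dir_deriv (\<lambda>y. X y t) (y + s *\<^sub>R v) v) has_vector_derivative
      frechet_derivative (\<lambda>z. frechet_derivative G (at z) (v, 0)) (at (y, t)) (v, 0)) (at 0)"
    by (rule has_vector_derivative_transform_within_open[of _ _ _ "ball 0 d"])
      (use d patch_dir_deriv[OF P _ _ t v] in auto)
  then show ?thesis unfolding dir_deriv_def[of "\<lambda>z. dir_deriv (\<lambda>y. X y t) z v"] by (rule vector_derivative_at)
qed

text \<open>Translates the flow equation into derivatives of \<open>G\<close>: the velocity is
  normal, with coefficient the sum of the normal components of the second derivatives along an
  orthonormal frame. The velocity of \<open>G\<close> is identified with that of the flow by
  uniqueness of derivatives within a nondegenerate interval.\<close>

lemma patch_flow:
  assumes P: "patch D X y0 s0 r G" and y: "y \<in> model_hyperplane" "dist y y0 < r"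
    and t: "t \<in> {a..b}" "dist t s0 < r"
  shows "\<exists>E \<nu>. adapted_frame (\<lambda>v. frechet_derivative G (at (y, t)) (v, 0)) E \<nu> \<and>
    frechet_derivative G (at (y, t)) (0, 1) =
      (\<Sum>v\<in>E. frechet_derivative (\<lambda>z. frechet_derivative G (at z) (v, 0)) (at (y, t)) (v, 0) \<bullet> \<nu>) *\<^sub>R \<nu>"
proof -
  define L where "L = (\<lambda>v. frechet_derivative G (at (y, t)) (v, 0))"
  have dd: "dir_deriv (\<lambda>y. X y t) y v = L v" if "v \<in> model_hyperplane" for v
    unfolding L_def by (rule patch_dir_deriv[OF P y t that])
  obtain E0 \<nu> where A0: "adapted_frame L E0 \<nu>"
    using adapted_frame_exists[OF patch_linear[OF P y t] patch_injective[OF P y t]] unfolding L_def by blast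
  have "orthonormal_frame (\<lambda>y. X y t) y E0"
    unfolding orthonormal_frame_def
  proof (intro conjI ballI)
    show "finite E0" "E0 \<subseteq> model_hyperplane" "card E0 = dim (model_hyperplane :: 'a set)"
      using A0 unfolding adapted_frame_def by blast+
    fix v w assume vw: "v \<in> E0" "w \<in> E0"
    then have "L v \<bullet> L w = (if v = w then 1 else 0)" "v \<in> model_hyperplane" "w \<in> model_hyperplane"
      using A0 unfolding adapted_frame_def by blast+
    then show "dir_deriv (\<lambda>y. X y t) y v \<bullet> dir_deriv (\<lambda>y. X y t) y w = (if v = w then 1 else 0)"
      by (simp add: dd)
  qed
  then have oE: "orthonormal_frame (\<lambda>y. X y t) y (SOME E. orthonormal_frame (\<lambda>y. X y t) y E)"
    by (rule someI)
  \<comment> \<open>\<open>E\<close> has to be the very frame that is chosen inside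
    \<open>mean_curvature\<close>; \<open>E0\<close> guarantees that the choice is among existing
    frames.\<close>
  define E where "E = (SOME E. orthonormal_frame (\<lambda>y. X y t) y E)"
  note oE' = oE[folded E_def, unfolded orthonormal_frame_def]
  have EH: "E \<subseteq> model_hyperplane" using oE' by blast
  have LL: "L v \<bullet> L w = (if v = w then 1 else 0)" if "v \<in> E" "w \<in> E" for v w
  proof -
    have "dir_deriv (\<lambda>y. X y t) y v \<bullet> dir_deriv (\<lambda>y. X y t) y w = (if v = w then 1 else 0)"
      using oE' that by blast
    then show ?thesis using dd[of v] dd[of w] EH that by (simp add: subset_iff)
  qed
  have A: "adapted_frame L E \<nu>"
    unfolding adapted_frame_def
  proof (intro conjI)
    show "finite E" "E \<subseteq> model_hyperplane" "card E = dim (model_hyperplane :: 'a set)" using oE' by blast+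
    show "\<forall>v\<in>E. \<forall>w\<in>E. L v \<bullet> L w = (if v = w then 1 else 0)" using LL by blast
    show "norm \<nu> = 1" "\<forall>v\<in>model_hyperplane. L v \<bullet> \<nu> = 0" using A0 unfolding adapted_frame_def by blast+
  qed
  have "unit_normal (\<lambda>y. X y t) y \<nu>"
    using A0 dd unfolding unit_normal_def adapted_frame_def by auto
  from flow[OF patchD(1)[OF P] patchD(6)[OF P y] t(1) this]
  have X1: "(X y has_vector_derivative - mean_curvature (\<lambda>y. X y t) y \<nu> *\<^sub>R \<nu>) (at t within {a..b})" .
  have "(X y has_vector_derivative frechet_derivative G (at (y, t)) (0, 1)) (at t within {a..b})"
  proof (rule has_vector_derivative_transform_within)
    show "((\<lambda>s. G (y, s)) has_vector_derivative frechet_derivative G (at (y, t)) (0, 1)) (at t within {a..b})"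
      using patch_time_derivative[OF P y t] by (rule has_vector_derivative_at_within)
    show "0 < r - dist t s0" using t by simp
    fix s assume s: "s \<in> {a..b}" "dist s t < r - dist t s0"
    then have "dist s s0 < r" using dist_triangle[of s s0 t] by simp
    then show "G (y, s) = X y s" using patchD(7)[OF P y s(1)] by simp
  qed (use t in auto)
  with X1 have "frechet_derivative G (at (y, t)) (0, 1) = - mean_curvature (\<lambda>y. X y t) y \<nu> *\<^sub>R \<nu>"
    using vector_derivative_unique_within_closed_interval[OF ab] t(1) by (metis cbox_interval)
  also have "- mean_curvature (\<lambda>y. X y t) y \<nu> =
      (\<Sum>v\<in>E. frechet_derivative (\<lambda>z. frechet_derivative G (at z) (v, 0)) (at (y, t)) (v, 0) \<bullet> \<nu>)"
    unfolding mean_curvature_def second_fundamental_form_def E_def[symmetric]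
    using patch_second_dir_deriv[OF P y t] EH by (auto simp: sum_negf subset_iff intro!: sum.cong)
  finally show ?thesis using A unfolding L_def by blast
qed

text \<open>
  A flowing hypersurface lying in \<open>{W \<ge> W z}\<close> up to the time when it touches \<open>z\<close>: the gradient of
  \<open>W\<close> is normal there, so the flow equation turns the second variation into a trace of the Hessian.
\<close>

lemma touching:
  assumes P: "patch D X y0 s0 r G" and y: "y \<in> model_hyperplane" "dist y y0 < r"
    and t: "t \<in> {a..b}" "dist t s0 < r" "a < t"
    and W: "jet_on S W g \<tau> g'" "open S" "(X y t, t) \<in> S"
    and d: "d > 0"
    and min: "\<And>y' s. y' \<in> model_hyperplane \<Longrightarrow> dist y' y < d \<Longrightarrow> dist y' y0 < r \<Longrightarrow> s \<in> {a..b} \<Longrightarrow> dist s s0 < r \<Longrightarrow>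
      t - d < s \<Longrightarrow> s \<le> t \<Longrightarrow> W (X y t, t) \<le> W (X y' s, s)"
  shows "mcf_defect g \<tau> g' (X y t, t) \<le> 0"
proof -
  define x where "x = X y t"
  have xG: "x = G (y, t)" unfolding x_def by (rule patchD(7)[OF P y t(1,2)])
  define L where "L = (\<lambda>v. frechet_derivative G (at (y, t)) (v, 0))"
  define G2 where "G2 = (\<lambda>v. frechet_derivative (\<lambda>z. frechet_derivative G (at z) (v, 0)) (at (y, t)) (v, 0))"
  obtain E \<nu> where A: "adapted_frame L E \<nu>" and fl: "frechet_derivative G (at (y, t)) (0, 1) = (\<Sum>v\<in>E. G2 v \<bullet> \<nu>) *\<^sub>R \<nu>"
    using patch_flow[OF P y t(1,2)] unfolding L_def G2_def by blast
  have EH: "v \<in> model_hyperplane" if "v \<in> E" for v using A that by (auto simp: adapted_frame_def)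
  have lin': "linear (\<lambda>v. g' (x, t) (v, 0))"
    using linear_compose[OF _ jet_onD(3)[OF W(1,3)], of "\<lambda>v. (v, 0)"] by (auto simp: o_def linear_iff x_def)
  \<comment> \<open>First and second variation of W along the surface at the fixed time t, in the
    parameter direction v; the term with \<open>G2\<close> is the acceleration of the curve.\<close>
  have space: "g (x, t) \<bullet> L v = 0 \<and> g' (x, t) (L v, 0) \<bullet> L v + g (x, t) \<bullet> G2 v \<ge> 0" if v: "v \<in> model_hyperplane" for v
  proof -
    obtain d1 where d1: "d1 > 0" "\<And>s. \<bar>s\<bar> < d1 \<Longrightarrow> y + s *\<^sub>R v \<in> model_hyperplane"
      "\<And>s. \<bar>s\<bar> < d1 \<Longrightarrow> dist (y + s *\<^sub>R v) y0 < r"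
      using patch_near[OF P y t(1,2) v] by blast
    define c where "c = (\<lambda>s. (G (y + s *\<^sub>R v, t), t))"
    have mem: "(y + s *\<^sub>R v, t) \<in> ball y0 r \<times> ball s0 r" if "\<bar>s\<bar> < d1" for s
      using d1(3)[OF that] t by (simp add: dist_commute)
    have cder: "(c has_vector_derivative (frechet_derivative G (at (y + s *\<^sub>R v, t)) (v, 0), 0)) (at s)" if "\<bar>s\<bar> < d1" for s
      unfolding c_def by (intro has_vector_derivative_Pair patch_line_derivative(1)[OF P y t(1,2) mem[OF that]] derivative_intros)
    have c0: "c 0 = (x, t)" by (simp add: c_def xG)
    have "isCont c 0" using cder[of 0] d1(1) has_vector_derivative_continuous by fastforce
    then have "eventually (\<lambda>s. c s \<in> S) (nhds 0)"
      using W(2,3) c0 by (metis x_def isCont_def tendsto_at_iff_tendsto_nhds topological_tendstoD)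
    then obtain d2 where d2: "d2 > 0" "\<And>s. \<bar>s\<bar> < d2 \<Longrightarrow> c s \<in> S"
      by (auto simp: eventually_nhds_metric dist_real_def)
    define d3 where "d3 = min (min d1 d2) (d / (norm v + 1))"
    have d3: "d3 > 0" "d3 \<le> d1" "d3 \<le> d2" "d3 \<le> d / (norm v + 1)"
      using d1 d2 d by (auto simp: d3_def add_nonneg_pos)
    define f1 where "f1 = (\<lambda>s. - (g (c s) \<bullet> frechet_derivative G (at (y + s *\<^sub>R v, t)) (v, 0)))"
    have der1: "((\<lambda>s. - W (c s)) has_real_derivative f1 s) (at s)" if s: "\<bar>s\<bar> < d3" for s
    proof -
      have "c s \<in> S" using d2 d3 s by auto
      from has_derivative_compose[OF cder[unfolded has_vector_derivative_def, of s] jet_onD(1)[OF W(1) this]]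
      have "((\<lambda>s. W (c s)) has_derivative (\<lambda>h. h * (g (c s) \<bullet> frechet_derivative G (at (y + s *\<^sub>R v, t)) (v, 0)))) (at s)"
        using s d3 by (simp add: mult.commute)
      then have "((\<lambda>s. W (c s)) has_real_derivative g (c s) \<bullet> frechet_derivative G (at (y + s *\<^sub>R v, t)) (v, 0)) (at s)"
        by (simp add: has_field_derivative_def mult_commute_abs)
      from DERIV_minus[OF this] show ?thesis
        unfolding f1_def .
    qed
    have gd: "((\<lambda>s. g (c s)) has_derivative (\<lambda>h. h *\<^sub>R g' (x, t) (L v, 0))) (at 0)"
    proof -
      have "c 0 \<in> S" using W(3) c0 by (simp add: x_def)
      from has_derivative_compose[OF cder[unfolded has_vector_derivative_def, of 0] jet_onD(2)[OF W(1) this]]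
      have "((\<lambda>s. g (c s)) has_derivative (\<lambda>h. g' (x, t) (h *\<^sub>R L v, 0))) (at 0)"
        using d1(1) by (simp add: c0 L_def)
      then show ?thesis using linear_cmul[OF lin'] by simp
    qed
    have Gd: "((\<lambda>s. frechet_derivative G (at (y + s *\<^sub>R v, t)) (v, 0)) has_derivative (\<lambda>h. h *\<^sub>R G2 v)) (at 0)"
      using patch_line_derivative(2)[OF P y t(1,2) mem, of 0 v] d1(1)
      by (simp add: has_vector_derivative_def G2_def)
    have "(f1 has_derivative (\<lambda>h. h * - (g' (x, t) (L v, 0) \<bullet> L v + g (x, t) \<bullet> G2 v))) (at 0)"
      unfolding f1_def
      by (rule has_derivative_eq_rhs[OF has_derivative_minus[OF has_derivative_inner[OF gd Gd]]])
        (auto simp: fun_eq_iff c0 L_def algebra_simps)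
    then have der2: "(f1 has_real_derivative - (g' (x, t) (L v, 0) \<bullet> L v + g (x, t) \<bullet> G2 v)) (at 0)"
      by (simp add: has_field_derivative_def mult_commute_abs)
    have "- W (c s) \<le> - W (c 0)" if s: "\<bar>s\<bar> < d3" for s
    proof -
      have "\<bar>s\<bar> * norm v \<le> \<bar>s\<bar> * (norm v + 1)" by (intro mult_left_mono) auto
      also have "\<dots> < d3 * (norm v + 1)" using s by (intro mult_strict_right_mono) (auto simp: add_nonneg_pos)
      also have "\<dots> \<le> d" using d3(4) by (simp add: pos_le_divide_eq add_nonneg_pos)
      finally have "dist (y + s *\<^sub>R v) y < d" by (simp add: dist_norm)
      moreover have "y + s *\<^sub>R v \<in> model_hyperplane" "dist (y + s *\<^sub>R v) y0 < r" using d1 d3 s by auto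
      ultimately have "W (X y t, t) \<le> W (X (y + s *\<^sub>R v) t, t)" "X (y + s *\<^sub>R v) t = G (y + s *\<^sub>R v, t)"
        using min[of "y + s *\<^sub>R v" t] patchD(7)[OF P, of "y + s *\<^sub>R v" t] t d by auto
      then show ?thesis by (simp add: c_def xG[unfolded x_def, symmetric])
    qed
    from second_derivative_test_max[OF d3(1) der1 der2 this]
    show ?thesis by (simp add: f1_def c0 L_def)
  qed
  \<comment> \<open>Following the trajectory of \<open>y\<close> backwards: W along it is smallest
    at time t, so its derivative there is at most 0.\<close>
  have time: "g (x, t) \<bullet> frechet_derivative G (at (y, t)) (0, 1) + \<tau> (x, t) \<le> 0"
  proof -
    have c: "((\<lambda>s. (G (y, s), s)) has_vector_derivative (frechet_derivative G (at (y, t)) (0, 1), 1)) (at t)"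
      by (intro has_vector_derivative_Pair patch_time_derivative[OF P y t(1,2)] derivative_intros)
    have S: "(G (y, t), t) \<in> S" using W(3) xG x_def by simp
    have "((\<lambda>s. W (G (y, s), s)) has_real_derivative g (x, t) \<bullet> frechet_derivative G (at (y, t)) (0, 1) + \<tau> (x, t)) (at t)"
      unfolding has_field_derivative_def
      by (rule has_derivative_eq_rhs[OF has_derivative_compose[OF c[unfolded has_vector_derivative_def] jet_onD(1)[OF W(1) S]]])
        (simp add: fun_eq_iff xG algebra_simps)
    from DERIV_minus[OF this] have "- (g (x, t) \<bullet> frechet_derivative G (at (y, t)) (0, 1) + \<tau> (x, t)) \<ge> 0"
    proof (rule one_sided_max_derivative_nonneg[of _ _ _ "min d (min (t - a) (r - dist t s0))"])
      show "min d (min (t - a) (r - dist t s0)) > 0" using d t by auto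
      fix s assume s: "t - min d (min (t - a) (r - dist t s0)) < s" "s \<le> t"
      have "dist s s0 < r" using dist_triangle[of s s0 t] s by (auto simp: dist_real_def)
      moreover have "s \<in> {a..b}" using s t by auto
      ultimately have "W (X y t, t) \<le> W (X y s, s)" "X y s = G (y, s)"
        using min[of y s] patchD(7)[OF P y, of s] y d s by auto
      then show "- W (G (y, s), s) \<le> - W (G (y, t), t)" by (simp add: xG[unfolded x_def, symmetric])
    qed
    then show ?thesis by simp
  qed
  define k where "k = g (x, t) \<bullet> \<nu>"
  have gk: "g (x, t) = k *\<^sub>R \<nu>"
    using adapted_frame_expand[OF A, of "g (x, t)"] space EH by (simp add: k_def)
  have \<nu>: "\<nu> \<bullet> \<nu> = 1" using A by (simp add: adapted_frame_def norm_eq_1)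
  have "0 \<le> (\<Sum>v\<in>E. g' (x, t) (L v, 0) \<bullet> L v + g (x, t) \<bullet> G2 v)"
    by (rule sum_nonneg) (use space EH in blast)
  also have "\<dots> = (\<Sum>v\<in>E. g' (x, t) (L v, 0) \<bullet> L v) + k * (\<Sum>v\<in>E. G2 v \<bullet> \<nu>)"
    by (simp add: sum.distrib gk sum_distrib_left inner_commute)
  also have "k * (\<Sum>v\<in>E. G2 v \<bullet> \<nu>) = g (x, t) \<bullet> frechet_derivative G (at (y, t)) (0, 1)"
    by (simp add: gk fl \<nu>)
  also have "(\<Sum>v\<in>E. g' (x, t) (L v, 0) \<bullet> L v) = hessian_trace (g' (x, t)) - g' (x, t) (\<nu>, 0) \<bullet> \<nu>"
    unfolding hessian_trace_def using adapted_frame_trace[OF A lin'] by simp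
  finally have "\<tau> (x, t) - hessian_trace (g' (x, t)) + g' (x, t) (\<nu>, 0) \<bullet> \<nu> \<le> 0"
    using time by linarith
  \<comment> \<open>Multiplying by the squared length of the gradient produces the defect and covers
    a vanishing gradient as well.\<close>
  then have "k\<^sup>2 * (\<tau> (x, t) - hessian_trace (g' (x, t)) + g' (x, t) (\<nu>, 0) \<bullet> \<nu>) \<le> 0"
    by (simp add: mult_nonneg_nonpos)
  moreover have "g' (x, t) (k *\<^sub>R \<nu>, 0) = k *\<^sub>R g' (x, t) (\<nu>, 0)"
    using linear_cmul[OF lin', of k \<nu>] by simp
  ultimately show ?thesis
    unfolding mcf_defect_def x_def[symmetric] gk by (simp add: \<nu> power2_eq_square algebra_simps)
qed

end

lemma jet_on_scale:
  assumes "jet_on S W g \<tau> g'"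
  shows "jet_on S (\<lambda>z. c * W z) (\<lambda>z. c *\<^sub>R g z) (\<lambda>z. c * \<tau> z) (\<lambda>z h. c *\<^sub>R g' z h)"
  unfolding jet_on_def
proof (intro ballI conjI)
  fix z assume z: "z \<in> S"
  show "((\<lambda>z. c * W z) has_derivative (\<lambda>(\<xi>, s). (c *\<^sub>R g z) \<bullet> \<xi> + c * \<tau> z * s)) (at z)"
    by (rule has_derivative_eq_rhs[OF has_derivative_mult_right[OF jet_onD(1)[OF assms z]]])
      (auto simp: fun_eq_iff algebra_simps)
  show "((\<lambda>z. c *\<^sub>R g z) has_derivative (\<lambda>h. c *\<^sub>R g' z h)) (at z)"
    by (rule has_derivative_scaleR_right[OF jet_onD(2)[OF assms z]])
qed

text \<open>The defect is homogeneous of degree three; the odd degree lets c = -1 reverse its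
  sign.\<close>

lemma mcf_defect_scale:
  assumes "linear (g' z)"
  shows "mcf_defect (\<lambda>z. c *\<^sub>R g z) (\<lambda>z. c * \<tau> z) (\<lambda>z h. c *\<^sub>R g' z h) z = c ^ 3 * mcf_defect g \<tau> g' z"
proof -
  have "g' z (c *\<^sub>R g z, 0) = c *\<^sub>R g' z (g z, 0)"
    using linear_cmul[OF assms, of c "(g z, 0)"] by simp
  moreover have "hessian_trace (\<lambda>h. c *\<^sub>R g' z h) = c * hessian_trace (g' z)"
    by (simp add: hessian_trace_def sum_distrib_left)
  ultimately show ?thesis
    by (simp add: mcf_defect_def power3_eq_cube algebra_simps)
qed

lemma linear_slice:
  assumes "linear A"
  shows "linear (\<lambda>v. A (v, 0))"
  using linear_compose[OF _ assms, of "\<lambda>v. (v, 0)"] by (auto simp: o_def linear_iff)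

section \<open>Barriers near a smooth flow\<close>

text \<open>Pointwise estimate for \<sigma> w + \<epsilon> |x - p|^2 + \<epsilon> \<Lambda> (t -
  t0), with \<open>G\<close> the gradient of w and R = x - p. Its gradient g1 differs from \<sigma>
  G by 2\<epsilon> R, so the defect changes by O(\<epsilon>), and \<epsilon> \<Lambda> |g1|^2 has to
  win. In \<Lambda> the summand 2 DIM('a) offsets the Laplacian of |x - p|^2, the factor 4 / m^2
  inverts the lower bound m^2 / 4 for |g1|^2, K stems from the defect of w, 8M^2 from the mixed
  terms, 8M from the terms quadratic in R, and 1 makes the result strict.\<close>

lemma perturbed_defect:
  fixes A :: "'a::euclidean_space \<times> real \<Rightarrow> 'a" and G R :: 'a
  assumes lin: "linear A" and \<sigma>: "\<sigma> = 1 \<or> \<sigma> = -1" and \<epsilon>: "0 < \<epsilon>" "\<epsilon> \<le> 1"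
    and M: "norm G \<le> M" "\<bar>l\<bar> \<le> M" "\<And>u. norm (A (u, 0)) \<le> M * norm u"
    and m: "m > 0" "m \<le> norm G" "norm R \<le> 1" "norm R \<le> m / 4"
    and l: "l = \<tau> - hessian_trace A"
    and defect: "\<bar>(G \<bullet> G) * l + A (G, 0) \<bullet> G\<bar> \<le> K * \<epsilon>"
    and \<Lambda>: "\<Lambda> = 2 * real DIM('a) + 4 / m\<^sup>2 * (K + 8 * M\<^sup>2 + 8 * M + 1)" and K: "K \<ge> 0"
  shows "0 < ((\<sigma> *\<^sub>R G + (2 * \<epsilon>) *\<^sub>R R) \<bullet> (\<sigma> *\<^sub>R G + (2 * \<epsilon>) *\<^sub>R R)) * (\<sigma> * \<tau> + \<epsilon> * \<Lambda> - hessian_trace (\<lambda>h. \<sigma> *\<^sub>R A h + (2 * \<epsilon>) *\<^sub>R fst h))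
    + (\<sigma> *\<^sub>R A (\<sigma> *\<^sub>R G + (2 * \<epsilon>) *\<^sub>R R, 0) + (2 * \<epsilon>) *\<^sub>R (\<sigma> *\<^sub>R G + (2 * \<epsilon>) *\<^sub>R R)) \<bullet> (\<sigma> *\<^sub>R G + (2 * \<epsilon>) *\<^sub>R R)"
proof -
  define g1 where "g1 = \<sigma> *\<^sub>R G + (2 * \<epsilon>) *\<^sub>R R"
  define A0 where "A0 = (\<lambda>v. A (v, 0))"
  have lin0: "linear A0" unfolding A0_def by (rule linear_slice[OF lin])
  have s2: "\<sigma> * \<sigma> = 1" using \<sigma> by auto
  have Mpos: "M \<ge> 0" using M(2) by linarith
  have ht: "hessian_trace (\<lambda>h. \<sigma> *\<^sub>R A h + (2 * \<epsilon>) *\<^sub>R fst h) = \<sigma> * hessian_trace A + 2 * \<epsilon> * real DIM('a)"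
    by (simp add: hessian_trace_def sum_distrib_left inner_add_left sum.distrib)
  define Q where "Q = (\<lambda>v. (v \<bullet> v) * l + A0 v \<bullet> v)"
  \<comment> \<open>The quadratic form Q collects everything in the defect except the effect of the
    perturbation on the second derivatives and on time; it is expanded at g1 = \<sigma> G +
    2\<epsilon> R.\<close>
  have Qg1: "Q g1 = Q G + 2 * \<epsilon> * \<sigma> * (2 * l * (G \<bullet> R) + A0 G \<bullet> R + A0 R \<bullet> G) + 4 * \<epsilon>\<^sup>2 * Q R"
  proof -
    have q: "Q (x + y) = Q x + Q y + (2 * l * (x \<bullet> y) + A0 x \<bullet> y + A0 y \<bullet> x)" for x y
      by (simp add: Q_def linear_add[OF lin0] inner_add_left inner_add_right inner_commute algebra_simps)
    have qs: "Q (c *\<^sub>R x) = c\<^sup>2 * Q x" for c x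
      by (simp add: Q_def linear_cmul[OF lin0] power2_eq_square algebra_simps)
    have "\<sigma>\<^sup>2 = 1" using s2 by (simp add: power2_eq_square)
    then show ?thesis
      unfolding g1_def q qs by (simp add: linear_cmul[OF lin0] power_mult_distrib algebra_simps)
  qed
  have b1: "\<bar>2 * l * (G \<bullet> R) + A0 G \<bullet> R + A0 R \<bullet> G\<bar> \<le> 4 * M\<^sup>2"
  proof -
    have GR: "\<bar>G \<bullet> R\<bar> \<le> M"
      using Cauchy_Schwarz_ineq2[of G R] mult_mono[OF M(1) m(3)] Mpos by simp
    have "\<bar>2 * l * (G \<bullet> R)\<bar> \<le> 2 * (M * M)"
      using mult_mono[OF M(2) GR] Mpos by (simp add: abs_mult)
    moreover have "\<bar>A0 G \<bullet> R\<bar> \<le> M * M"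
    proof -
      have "\<bar>A0 G \<bullet> R\<bar> \<le> norm (A0 G) * norm R" by (rule Cauchy_Schwarz_ineq2)
      also have "\<dots> \<le> (M * norm G) * 1" using M(3)[of G] m(3) by (intro mult_mono) (auto simp: A0_def Mpos)
      also have "\<dots> \<le> M * M" using M(1) Mpos by (simp add: mult_left_mono)
      finally show ?thesis .
    qed
    moreover have "\<bar>A0 R \<bullet> G\<bar> \<le> M * M"
    proof -
      have "\<bar>A0 R \<bullet> G\<bar> \<le> norm (A0 R) * norm G" by (rule Cauchy_Schwarz_ineq2)
      also have "\<dots> \<le> (M * norm R) * M" using M(1) M(3)[of R] by (intro mult_mono) (auto simp: A0_def Mpos)
      also have "\<dots> \<le> (M * 1) * M" using m(3) Mpos by (intro mult_right_mono mult_left_mono) auto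
      finally show ?thesis by simp
    qed
    ultimately show ?thesis by (simp add: power2_eq_square abs_le_iff)
  qed
  have b2: "\<bar>Q R\<bar> \<le> 2 * M"
  proof -
    have RR: "R \<bullet> R \<le> 1" using m(3) by (simp add: power2_norm_eq_inner[symmetric] power_le_one)
    have "\<bar>(R \<bullet> R) * l\<bar> \<le> 1 * M" unfolding abs_mult using RR M(2) by (intro mult_mono) auto
    moreover have "\<bar>A0 R \<bullet> R\<bar> \<le> M"
    proof -
      have "\<bar>A0 R \<bullet> R\<bar> \<le> norm (A0 R) * norm R" by (rule Cauchy_Schwarz_ineq2)
      also have "\<dots> \<le> (M * norm R) * 1" using M(3)[of R] m(3) by (intro mult_mono) (auto simp: A0_def Mpos)
      also have "\<dots> \<le> M * 1" using m(3) Mpos mult_left_mono[of "norm R" 1 M] by simp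
      finally show ?thesis by simp
    qed
    ultimately show ?thesis unfolding Q_def by linarith
  qed
  have "\<bar>\<sigma> * Q g1\<bar> \<le> \<epsilon> * (K + 8 * M\<^sup>2 + 8 * M)"
  proof -
    have "\<bar>\<sigma> * Q g1\<bar> = \<bar>Q g1\<bar>" using \<sigma> by (auto simp: abs_mult)
    also have "\<dots> \<le> \<bar>Q G\<bar> + \<bar>2 * \<epsilon> * \<sigma> * (2 * l * (G \<bullet> R) + A0 G \<bullet> R + A0 R \<bullet> G)\<bar> + \<bar>4 * \<epsilon>\<^sup>2 * Q R\<bar>"
      unfolding Qg1 by linarith
    also have "\<bar>Q G\<bar> \<le> K * \<epsilon>" using defect by (simp add: Q_def A0_def)
    also have "\<bar>2 * \<epsilon> * \<sigma> * (2 * l * (G \<bullet> R) + A0 G \<bullet> R + A0 R \<bullet> G)\<bar> = 2 * \<epsilon> * \<bar>2 * l * (G \<bullet> R) + A0 G \<bullet> R + A0 R \<bullet> G\<bar>"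
      using \<sigma> \<epsilon> by (auto simp: abs_mult)
    also have "\<dots> \<le> 2 * \<epsilon> * (4 * M\<^sup>2)" using b1 \<epsilon> by (intro mult_left_mono) auto
    also have "\<bar>4 * \<epsilon>\<^sup>2 * Q R\<bar> = 4 * \<epsilon>\<^sup>2 * \<bar>Q R\<bar>" by (simp add: abs_mult)
    also have "\<dots> \<le> 4 * \<epsilon> * (2 * M)"
      using b2 \<epsilon> by (intro mult_mono) (auto simp: power2_eq_square mult_left_le)
    finally show ?thesis by (simp add: algebra_simps)
  qed
  \<comment> \<open>The smallness of R relative to m keeps |g1| above m / 2 for every \<epsilon>
    \<le> 1. The summand + 2 comes from the Hessian of |x - p|^2 in the gradient direction.\<close>
  moreover have "\<epsilon> * (g1 \<bullet> g1) * (\<Lambda> - 2 * real DIM('a) + 2) \<ge> \<epsilon> * (K + 8 * M\<^sup>2 + 8 * M + 1)"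
  proof -
    have "norm G \<le> norm g1 + norm ((2 * \<epsilon>) *\<^sub>R R)"
    proof -
      have "norm G = norm (\<sigma> *\<^sub>R G)" using \<sigma> by auto
      also have "\<dots> = norm (g1 - (2 * \<epsilon>) *\<^sub>R R)" by (simp add: g1_def)
      also have "\<dots> \<le> norm g1 + norm ((2 * \<epsilon>) *\<^sub>R R)" by (rule norm_triangle_ineq4)
      finally show ?thesis .
    qed
    moreover have "norm ((2 * \<epsilon>) *\<^sub>R R) \<le> 2 * (m / 4)"
      using m(4) \<epsilon> mult_mono[of "2 * \<epsilon>" 2 "norm R" "m / 4"] by simp
    ultimately have "m / 2 \<le> norm g1" using m by linarith
    then have "(m / 2)\<^sup>2 \<le> g1 \<bullet> g1"
      using m(1) by (simp add: power2_norm_eq_inner[symmetric] power_mono)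
    then have gg: "m\<^sup>2 / 4 \<le> g1 \<bullet> g1" by (simp add: power_divide)
    have c: "\<Lambda> - 2 * real DIM('a) + 2 \<ge> 4 / m\<^sup>2 * (K + 8 * M\<^sup>2 + 8 * M + 1)" unfolding \<Lambda> by simp
    have nn: "K + 8 * M\<^sup>2 + 8 * M + 1 \<ge> 0" using K Mpos by simp
    have "K + 8 * M\<^sup>2 + 8 * M + 1 = m\<^sup>2 / 4 * (4 / m\<^sup>2 * (K + 8 * M\<^sup>2 + 8 * M + 1))" using m(1) by simp
    also have "\<dots> \<le> (g1 \<bullet> g1) * (\<Lambda> - 2 * real DIM('a) + 2)"
      using gg c nn m(1) by (intro mult_mono) auto
    finally show ?thesis using \<epsilon> by (simp add: mult.assoc mult_left_mono)
  qed
  moreover have "\<epsilon> * (K + 8 * M\<^sup>2 + 8 * M) < \<epsilon> * (K + 8 * M\<^sup>2 + 8 * M + 1)" using \<epsilon> by simp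
  ultimately have "0 < \<sigma> * Q g1 + \<epsilon> * (g1 \<bullet> g1) * (\<Lambda> - 2 * real DIM('a) + 2)" by linarith
  also have "\<dots> = (g1 \<bullet> g1) * (\<sigma> * \<tau> + \<epsilon> * \<Lambda> - (\<sigma> * hessian_trace A + 2 * \<epsilon> * real DIM('a)))
      + (\<sigma> *\<^sub>R A (g1, 0) + (2 * \<epsilon>) *\<^sub>R g1) \<bullet> g1"
    unfolding Q_def l A0_def by (simp add: inner_add_left algebra_simps)
  finally show ?thesis unfolding g1_def ht .
qed

text \<open>Since the defect of w is bounded by K |w|, it is O(\<epsilon>) on the set |w| \<le>
  \<epsilon>, the same order as the perturbation. Hence \<rho> and \<Lambda> do not depend on
  \<epsilon>, and in applications \<epsilon> may be chosen last, against a separation constant that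
  is not known in advance.\<close>

lemma barrier:
  fixes w :: "'a::euclidean_space \<times> real \<Rightarrow> real"
  assumes J: "jet_on S w g \<tau> g'" and S: "open S" "(p, s0) \<in> S"
    and cont: "continuous_on S g" "continuous_on S \<tau>" "\<And>h. continuous_on S (\<lambda>z. g' z h)"
    and g0: "g (p, s0) \<noteq> 0" and K: "K \<ge> 0"
    and defect: "\<And>x t. (x, t) \<in> S \<Longrightarrow> t \<in> I \<Longrightarrow> \<bar>mcf_defect g \<tau> g' (x, t)\<bar> \<le> K * \<bar>w (x, t)\<bar>"
  shows "\<exists>\<rho> \<Lambda>. \<rho> > 0 \<and> \<Lambda> > 0 \<and> cball p \<rho> \<times> cball s0 \<rho> \<subseteq> S \<and>
    (\<forall>\<sigma> \<epsilon> x t. \<sigma> = 1 \<or> \<sigma> = -1 \<longrightarrow> 0 < \<epsilon> \<longrightarrow> \<epsilon> \<le> 1 \<longrightarrow> dist x p \<le> \<rho> \<longrightarrow> dist t s0 \<le> \<rho> \<longrightarrow> t \<in> I \<longrightarrow>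
      \<bar>w (x, t)\<bar> \<le> \<epsilon> \<longrightarrow>
      0 < mcf_defect (\<lambda>z. \<sigma> *\<^sub>R g z + (2 * \<epsilon>) *\<^sub>R (fst z - p)) (\<lambda>z. \<sigma> * \<tau> z + \<epsilon> * \<Lambda>)
        (\<lambda>z h. \<sigma> *\<^sub>R g' z h + (2 * \<epsilon>) *\<^sub>R fst h) (x, t))"
proof -
  define m where "m = norm (g (p, s0)) / 2"
  have m: "m > 0" using g0 by (simp add: m_def)
  have "isCont (\<lambda>z. norm (g z)) (p, s0)"
    using cont(1) S continuous_on_eq_continuous_at by (intro continuous_intros) blast
  then have "((\<lambda>z. norm (g z)) \<longlongrightarrow> norm (g (p, s0))) (nhds (p, s0))"
    using tendsto_at_iff_tendsto_nhds[of "\<lambda>z. norm (g z)"] by (simp add: isCont_def)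
  then have "eventually (\<lambda>z. norm (g z) > m) (nhds (p, s0))"
    by (rule order_tendstoD(1)) (use g0 in \<open>simp add: m_def\<close>)
  moreover have "eventually (\<lambda>z. z \<in> S) (nhds (p, s0))" using S by (rule eventually_nhds_in_open)
  ultimately have "eventually (\<lambda>z. norm (g z) > m \<and> z \<in> S) (nhds (p, s0))" by (rule eventually_conj)
  then obtain d where d: "d > 0" "\<And>z. dist z (p, s0) < d \<Longrightarrow> norm (g z) > m \<and> z \<in> S"
    unfolding eventually_nhds_metric by blast
  \<comment> \<open>A third of d, because the distances in space and time add up; 1 and m / 4 are
    the bounds on x - p required by \<open>perturbed_defect\<close>.\<close>
  define \<rho> where "\<rho> = min (d / 3) (min 1 (m / 4))"
  have \<rho>: "\<rho> > 0" "\<rho> \<le> 1" "\<rho> \<le> m / 4" "\<rho> \<le> d / 3" using d m by (auto simp: \<rho>_def)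
  have near: "dist (x, t) (p, s0) < d" if "dist x p \<le> \<rho>" "dist t s0 \<le> \<rho>" for x t
  proof -
    have "dist (x, t) (p, s0) \<le> dist x p + dist t s0"
      unfolding dist_Pair_Pair by (rule sqrt_sum_squares_le_sum) auto
    then show ?thesis using that \<rho> d by linarith
  qed
  define C where "C = cball p \<rho> \<times> cball s0 \<rho>"
  have CS: "C \<subseteq> S" using near d(2) unfolding C_def by (auto simp: dist_commute)
  have cC: "compact C" unfolding C_def by (intro compact_Times compact_cball)
  have bdd: "\<exists>M\<ge>0. \<forall>z\<in>C. norm (f z) \<le> M" if "continuous_on S f" for f :: "'a \<times> real \<Rightarrow> 'b::real_normed_vector"
  proof -
    have "bounded (f ` C)"
      by (intro compact_imp_bounded compact_continuous_image continuous_on_subset[OF that CS] cC)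
    then show ?thesis unfolding bounded_iff by (metis imageI norm_ge_zero order_trans linear)
  qed
  obtain M1 where M1: "M1 \<ge> 0" "\<And>z. z \<in> C \<Longrightarrow> norm (g z) \<le> M1" using bdd[OF cont(1)] by blast
  have "continuous_on S (\<lambda>z. \<tau> z - hessian_trace (g' z))"
    unfolding hessian_trace_def by (intro continuous_intros cont)
  then obtain M2 where M2: "M2 \<ge> 0" "\<And>z. z \<in> C \<Longrightarrow> \<bar>\<tau> z - hessian_trace (g' z)\<bar> \<le> M2" using bdd by force
  have "continuous_on S (\<lambda>z. \<Sum>b\<in>Basis. norm (g' z (b, 0)))"
    by (intro continuous_intros cont)
  then obtain M3 where M3: "M3 \<ge> 0" "\<And>z. z \<in> C \<Longrightarrow> \<bar>\<Sum>b\<in>Basis. norm (g' z (b, 0))\<bar> \<le> M3" using bdd by force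
  define M where "M = max M1 (max M2 M3)"
  define \<Lambda> where "\<Lambda> = 2 * real DIM('a) + 4 / m\<^sup>2 * (K + 8 * M\<^sup>2 + 8 * M + 1)"
  have "M \<ge> 0" using M1 by (simp add: M_def)
  then have \<Lambda>: "\<Lambda> > 0" unfolding \<Lambda>_def using K m by (intro add_pos_nonneg) (auto intro!: mult_nonneg_nonneg divide_nonneg_nonneg)
  show ?thesis
  proof (rule exI[of _ \<rho>], rule exI[of _ \<Lambda>], intro conjI allI impI \<rho>(1) \<Lambda>)
    show "cball p \<rho> \<times> cball s0 \<rho> \<subseteq> S" using CS by (simp add: C_def)
    fix \<sigma> \<epsilon> x t
    assume \<sigma>: "\<sigma> = 1 \<or> \<sigma> = (-1::real)" and \<epsilon>: "0 < \<epsilon>" "\<epsilon> \<le> (1::real)" and xt: "dist x p \<le> \<rho>" "dist t s0 \<le> \<rho>"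
      and t: "t \<in> I" and we: "\<bar>w (x, t)\<bar> \<le> \<epsilon>"
    have zC: "(x, t) \<in> C" using xt by (simp add: C_def dist_commute)
    then have zS: "(x, t) \<in> S" using CS by auto
    have lin: "linear (g' (x, t))" by (rule jet_onD(3)[OF J zS])
    show "0 < mcf_defect (\<lambda>z. \<sigma> *\<^sub>R g z + (2 * \<epsilon>) *\<^sub>R (fst z - p)) (\<lambda>z. \<sigma> * \<tau> z + \<epsilon> * \<Lambda>)
        (\<lambda>z h. \<sigma> *\<^sub>R g' z h + (2 * \<epsilon>) *\<^sub>R fst h) (x, t)"
      unfolding mcf_defect_def fst_conv
    proof (rule perturbed_defect[OF lin \<sigma> \<epsilon> _ _ _ m _ _ _ refl _ \<Lambda>_def K])
      show "norm (g (x, t)) \<le> M" "\<bar>\<tau> (x, t) - hessian_trace (g' (x, t))\<bar> \<le> M"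
        using M1(2)[OF zC] M2(2)[OF zC] by (auto simp: M_def)
      show "norm (g' (x, t) (u, 0)) \<le> M * norm u" for u
      proof -
        have "norm (g' (x, t) (u, 0)) = norm (\<Sum>b\<in>Basis. (u \<bullet> b) *\<^sub>R g' (x, t) (b, 0))"
          using linear_sum_Basis[OF linear_slice[OF lin], of u] by simp
        also have "\<dots> \<le> (\<Sum>b\<in>Basis. norm u * norm (g' (x, t) (b, 0)))"
          by (rule sum_norm_le) (auto intro!: mult_right_mono Basis_le_norm)
        also have "\<dots> = norm u * (\<Sum>b\<in>Basis. norm (g' (x, t) (b, 0)))" by (simp add: sum_distrib_left)
        also have "\<dots> \<le> norm u * M" using M3(2)[OF zC] by (intro mult_left_mono) (auto simp: M_def)
        finally show ?thesis by (simp add: mult.commute)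
      qed
      show "m \<le> norm (g (x, t))" using d(2)[OF near[OF xt]] by simp
      show "norm (x - p) \<le> 1" "norm (x - p) \<le> m / 4" using xt \<rho> by (auto simp: dist_norm)
      have "\<bar>mcf_defect g \<tau> g' (x, t)\<bar> \<le> K * \<bar>w (x, t)\<bar>" by (rule defect[OF zS t])
      also have "\<dots> \<le> K * \<epsilon>" by (rule mult_left_mono[OF we K])
      finally show "\<bar>(g (x, t) \<bullet> g (x, t)) * (\<tau> (x, t) - hessian_trace (g' (x, t))) + g' (x, t) (g (x, t), 0) \<bullet> g (x, t)\<bar> \<le> K * \<epsilon>"
        by (simp add: mcf_defect_def)
    qed
  qed
qed

lemma jet_on_barrier:
  assumes "jet_on S w g \<tau> g'"
  shows "jet_on S (\<lambda>z. \<sigma> * w z + \<epsilon> * ((fst z - p) \<bullet> (fst z - p)) + \<epsilon> * \<Lambda> * (snd z - t0))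
    (\<lambda>z. \<sigma> *\<^sub>R g z + (2 * \<epsilon>) *\<^sub>R (fst z - p)) (\<lambda>z. \<sigma> * \<tau> z + \<epsilon> * \<Lambda>) (\<lambda>z h. \<sigma> *\<^sub>R g' z h + (2 * \<epsilon>) *\<^sub>R fst h)"
  unfolding jet_on_def
proof (intro ballI conjI)
  fix z assume z: "z \<in> S"
  show "((\<lambda>z. \<sigma> * w z + \<epsilon> * ((fst z - p) \<bullet> (fst z - p)) + \<epsilon> * \<Lambda> * (snd z - t0)) has_derivative
      (\<lambda>(\<xi>, s). (\<sigma> *\<^sub>R g z + (2 * \<epsilon>) *\<^sub>R (fst z - p)) \<bullet> \<xi> + (\<sigma> * \<tau> z + \<epsilon> * \<Lambda>) * s)) (at z)"
    by (rule derivative_eq_intros jet_onD(1)[OF assms z] refl)+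
      (auto simp: fun_eq_iff inner_add_left inner_diff_left inner_diff_right inner_commute algebra_simps)
  show "((\<lambda>z. \<sigma> *\<^sub>R g z + (2 * \<epsilon>) *\<^sub>R (fst z - p)) has_derivative (\<lambda>h. \<sigma> *\<^sub>R g' z h + (2 * \<epsilon>) *\<^sub>R fst h)) (at z)"
    by (rule derivative_eq_intros jet_onD(2)[OF assms z] refl)+ auto
qed


section \<open>The height over a sheet of the flow\<close>

definition model_projection :: "'a::euclidean_space \<Rightarrow> 'a" where
  "model_projection z = z - (z \<bullet> model_normal) *\<^sub>R model_normal"

lemma model_projection_in: "model_projection z \<in> model_hyperplane"
  by (simp add: model_projection_def model_hyperplane_iff inner_diff_left)

lemma model_projection_add [simp]:
  "y \<in> model_hyperplane \<Longrightarrow> model_projection (y + h *\<^sub>R model_normal) = y"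
  by (simp add: model_projection_def model_hyperplane_iff inner_add_left)

lemma model_projection_id [simp]: "y \<in> model_hyperplane \<Longrightarrow> model_projection y = y"
  by (simp add: model_projection_def model_hyperplane_iff)

lemma bounded_linear_model_projection: "bounded_linear model_projection"
  unfolding model_projection_def
  by (intro bounded_linear_sub bounded_linear_ident bounded_linear_scaleR_const bounded_linear_inner_left)

lemma model_projection_dist:
  assumes "y \<in> model_hyperplane"
  shows "dist (model_projection z) y \<le> dist z y"
proof -
  have "norm (model_projection z - y) \<le> norm (z - y)"
  proof -
    define x where "x = z - y"
    have x: "model_projection z - y = x - (x \<bullet> model_normal) *\<^sub>R model_normal"
      using assms by (simp add: x_def model_projection_def inner_diff_left model_hyperplane_iff)
    have "(x - (x \<bullet> model_normal) *\<^sub>R model_normal) \<bullet> (x - (x \<bullet> model_normal) *\<^sub>R model_normal) = x \<bullet> x - (x \<bullet> model_normal)\<^sup>2"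
      by (simp add: inner_diff_left inner_diff_right inner_commute power2_eq_square)
    then have "(norm (model_projection z - y))\<^sup>2 \<le> (norm x)\<^sup>2"
      unfolding x power2_norm_eq_inner by simp
    then show ?thesis unfolding x_def[symmetric] by (rule power2_le_imp_le) simp
  qed
  then show ?thesis by (simp add: dist_norm)
qed

lemma Ck_on_Pair:
  fixes f :: "'a::euclidean_space \<Rightarrow> 'b::euclidean_space" and h :: "'a \<Rightarrow> 'c::euclidean_space"
  assumes "open S" "Ck_on k S f" "Ck_on k S h"
  shows "Ck_on k S (\<lambda>x. (f x, h x))"
proof -
  have "Ck_on k S (\<lambda>x. (f x, 0) + (0, h x))"
    by (intro Ck_on_add assms Ck_on_bounded_linear[of "\<lambda>y. (y, 0)"] Ck_on_bounded_linear[of "\<lambda>y. (0, y)"]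
        bounded_linear_Pair bounded_linear_ident bounded_linear_zero)
  then show ?thesis by simp
qed

text \<open>
  \<open>w (x, t)\<close> is the height of \<open>x\<close> over the sheet \<open>X\<close> at time \<open>t\<close>, measured along the vector field \<open>N\<close>,
  and \<open>\<eta> (x, t)\<close> is the parameter of its foot.
\<close>

definition (in flow_family) sheet :: "'a set \<Rightarrow> ('a \<Rightarrow> real \<Rightarrow> 'a) \<Rightarrow> 'a \<Rightarrow> real \<Rightarrow> ('a \<Rightarrow> 'a) \<Rightarrow> real \<Rightarrow> ('a \<times> real) set \<Rightarrow>
    ('a \<times> real \<Rightarrow> real) \<Rightarrow> ('a \<times> real \<Rightarrow> 'a) \<Rightarrow> ('a \<times> real \<Rightarrow> real) \<Rightarrow> ('a \<times> real \<Rightarrow> 'a \<times> real \<Rightarrow> 'a) \<Rightarrow>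
    ('a \<times> real \<Rightarrow> 'a) \<Rightarrow> real \<Rightarrow> bool" where
  "sheet D X y0 s0 N r S w g \<tau> g' \<eta> K \<longleftrightarrow>
     (D, X) \<in> charts \<and> y0 \<in> D \<and> s0 \<in> {a..b} \<and> r > 0 \<and> open S \<and> K \<ge> 0 \<and>
     jet_on S w g \<tau> g' \<and> continuous_on S g \<and> continuous_on S \<tau> \<and> (\<forall>h. continuous_on S (\<lambda>z. g' z h)) \<and>
     (\<forall>z\<in>S. g z \<noteq> 0) \<and> (\<forall>z\<in>S. \<eta> differentiable (at z)) \<and>
     (\<forall>z\<in>S. \<eta> z \<in> model_hyperplane \<and> dist (\<eta> z) y0 < r \<and> \<bar>w z\<bar> < r \<and> dist (snd z) s0 < r) \<and>
     (\<forall>x t. (x, t) \<in> S \<longrightarrow> t \<in> {a..b} \<longrightarrow> \<eta> (x, t) \<in> D \<and>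
        x = X (\<eta> (x, t)) t + w (x, t) *\<^sub>R N (X (\<eta> (x, t)) t)) \<and>
     (\<forall>y\<in>model_hyperplane. dist y y0 < r \<longrightarrow> y \<in> D \<and> (\<forall>t\<in>{a..b}. dist t s0 < r \<longrightarrow> (\<forall>h. \<bar>h\<bar> < r \<longrightarrow>
        (X y t + h *\<^sub>R N (X y t), t) \<in> S \<and> w (X y t + h *\<^sub>R N (X y t), t) = h \<and> \<eta> (X y t + h *\<^sub>R N (X y t), t) = y))) \<and>
     (\<forall>x t. (x, t) \<in> S \<longrightarrow> t \<in> {a..b} \<longrightarrow> \<bar>mcf_defect g \<tau> g' (x, t)\<bar> \<le> K * \<bar>w (x, t)\<bar>)"

text \<open>The map (y + h e, t) \<mapsto> (X y t + h N (X y t), t) is a local diffeomorphism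
  because N is transversal to the surface; w and \<eta> are read off from its inverse. On the
  surface itself w vanishes, so \<open>touching\<close> applies with w and with - w and the defect
  is zero there; a mean value estimate along the fibres then bounds it by K |w|.\<close>

lemma (in flow_family) sheet_exists:
  assumes DX: "(D, X) \<in> charts" "y0 \<in> D" "s0 \<in> {a..b}"
    and N: "\<And>k. Ck_on k UNIV N"
    and trans: "\<And>v. v \<in> model_hyperplane \<Longrightarrow> dir_deriv (\<lambda>y. X y s0) y0 v \<noteq> N (X y0 s0)"
  shows "\<exists>r S w g \<tau> g' \<eta> K. sheet D X y0 s0 N r S w g \<tau> g' \<eta> K"
proof -
  obtain r0 G where P: "patch D X y0 s0 r0 G" using patch_exists[OF DX] by blast
  have y0H: "y0 \<in> model_hyperplane" by (rule chart_subset[OF DX(1,2)])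
  define e where "e = (model_normal :: 'a)"
  define U where "U = ball y0 r0 \<times> ball s0 r0"
  have U: "open U" "(y0, s0) \<in> U" using patchD(4)[OF P] by (auto simp: U_def open_Times)
  have CkG: "Ck_on k U G" for k unfolding U_def by (rule patchD(5)[OF P])
  define \<pi> where "\<pi> = (\<lambda>z::'a \<times> real. (model_projection (fst z), snd z))"
  have bl\<pi>: "bounded_linear \<pi>"
    unfolding \<pi>_def by (intro bounded_linear_Pair bounded_linear_compose[OF bounded_linear_model_projection] bounded_linear_fst bounded_linear_snd)
  have \<pi>U: "\<pi> z \<in> U" if "z \<in> U" for z
    using that model_projection_dist[OF y0H, of "fst z"] by (auto simp: U_def \<pi>_def dist_commute)
  \<comment> \<open>The coordinate along e, complementary to the parameter hyperplane, is used as
    the height; \<open>\<pi>\<close> removes it before the surface is evaluated.\<close>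
  define E where "E = (\<lambda>z. (G (\<pi> z) + (fst z \<bullet> e) *\<^sub>R N (G (\<pi> z)), snd z))"
  have CkG\<pi>: "Ck_on k U (\<lambda>z. G (\<pi> z))" for k
    by (rule Ck_on_compose[OF U(1) U(1) _ CkG Ck_on_linear[OF bl\<pi> U(1)]]) (use \<pi>U in auto)
  have CkE: "Ck_on k U E" for k
    unfolding E_def
    by (intro Ck_on_Pair Ck_on_add Ck_on_scaleR CkG\<pi> U(1) Ck_on_linear[OF bounded_linear_snd U(1)]
        Ck_on_linear[OF bounded_linear_compose[OF bounded_linear_inner_left bounded_linear_fst] U(1)]
        Ck_on_compose[OF U(1) open_UNIV _ N CkG\<pi>]) auto
  define p where "p = X y0 s0"
  have pG: "p = G (y0, s0)" unfolding p_def by (rule patchD(7)[OF P y0H]) (use DX patchD(4)[OF P] in auto)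
  have \<pi>0: "\<pi> (y0, s0) = (y0, s0)" by (simp add: \<pi>_def y0H)
  have y0e: "y0 \<bullet> e = 0" using y0H by (simp add: e_def model_hyperplane_iff)
  define A where "A = frechet_derivative G (at (y0, s0))"
  have Gd: "(G has_derivative A) (at (y0, s0))"
    unfolding A_def by (rule Ck_on_has_derivative[OF CkG[of "Suc 0"] U(2)])
  have linA: "linear A" using Gd has_derivative_linear by blast
  have G\<pi>d: "((\<lambda>z. G (\<pi> z)) has_derivative (\<lambda>h. A (\<pi> h))) (at (y0, s0))"
    using has_derivative_compose[OF bounded_linear_imp_has_derivative[OF bl\<pi>], of G A "(y0, s0)" UNIV] Gd \<pi>0 by simp
  have Nd: "(N has_derivative frechet_derivative N (at p)) (at p)"
    by (rule Ck_on_has_derivative[OF N[of "Suc 0"]]) simp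
  have NGd: "((\<lambda>z. N (G (\<pi> z))) has_derivative (\<lambda>h. frechet_derivative N (at p) (A (\<pi> h)))) (at (y0, s0))"
    using has_derivative_compose[OF G\<pi>d, of N "frechet_derivative N (at p)"] Nd \<pi>0 pG by simp
  have Ed: "(E has_derivative (\<lambda>h. (A (\<pi> h) + (fst h \<bullet> e) *\<^sub>R N p, snd h))) (at (y0, s0))"
    unfolding E_def
    by (rule has_derivative_eq_rhs, rule has_derivative_Pair[OF has_derivative_add[OF G\<pi>d has_derivative_scaleR[OF has_derivative_inner_left[OF has_derivative_fst[OF has_derivative_ident]] NGd]] has_derivative_snd[OF has_derivative_ident]])
      (simp add: fun_eq_iff y0e \<pi>0 pG)
  have injE: "inj (frechet_derivative E (at (y0, s0)))"
  proof -
    have eq: "frechet_derivative E (at (y0, s0)) = (\<lambda>h. (A (\<pi> h) + (fst h \<bullet> e) *\<^sub>R N p, snd h))"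
      by (rule frechet_derivative_at[OF Ed, symmetric])
    have lin: "linear (\<lambda>h. (A (\<pi> h) + (fst h \<bullet> e) *\<^sub>R N p, snd h))"
      using Ed has_derivative_linear by blast
    have "h = 0" if h: "A (\<pi> h) + (fst h \<bullet> e) *\<^sub>R N p = 0" "snd h = 0" for h
    proof -
      define v where "v = model_projection (fst h)"
      have v: "v \<in> model_hyperplane" by (simp add: v_def model_projection_in)
      have \<pi>h: "\<pi> h = (v, 0)" using h(2) by (simp add: \<pi>_def v_def)
      have dd: "dir_deriv (\<lambda>y. X y s0) y0 u = A (u, 0)" if "u \<in> model_hyperplane" for u
        unfolding A_def by (rule patch_dir_deriv[OF P y0H _ DX(3) _ that]) (use patchD(4)[OF P] in auto)
      have c0: "fst h \<bullet> e = 0"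
      proof (rule ccontr)
        assume c: "fst h \<bullet> e \<noteq> 0"
        define u where "u = (- 1 / (fst h \<bullet> e)) *\<^sub>R v"
        have u: "u \<in> model_hyperplane" unfolding u_def by (rule subspace_scale[OF subspace_model_hyperplane v])
        have "A (v, 0) = - (fst h \<bullet> e) *\<^sub>R N p" using h(1) \<pi>h by (simp add: eq_neg_iff_add_eq_0)
        moreover have "A (u, 0) = (- 1 / (fst h \<bullet> e)) *\<^sub>R A (v, 0)"
          unfolding u_def by (rule linear_cmul[OF linear_slice[OF linA]])
        ultimately have "A (u, 0) = N p" using c by simp
        then show False using trans[OF u] dd[OF u] by (simp add: p_def)
      qed
      then have "A (v, 0) = A (0, 0)" using h(1) \<pi>h linear_0[OF linear_slice[OF linA]] by simp
      moreover have "inj_on (\<lambda>v. A (v, 0)) model_hyperplane"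
        unfolding A_def by (rule patch_injective[OF P y0H _ DX(3)]) (use patchD(4)[OF P] in auto)
      ultimately have "v = 0" using v subspace_0[OF subspace_model_hyperplane] by (auto dest: inj_onD)
      then have "fst h = 0" using c0 by (simp add: v_def model_projection_def e_def)
      then show ?thesis using h(2) by (simp add: prod_eq_iff)
    qed
    then show ?thesis unfolding eq linear_injective_0[OF lin] by (auto simp: zero_prod_def)
  qed
  obtain U' V \<Psi> where U': "open U'" "U' \<subseteq> U" "(y0, s0) \<in> U'" and V: "open V" "E (y0, s0) \<in> V"
    and hom: "homeomorphism U' V E \<Psi>" and Ck\<Psi>: "\<And>k. Ck_on k V \<Psi>"
    by (rule smooth_inverse_function[OF U CkE injE]) blast
  have E\<Psi>: "E (\<Psi> z) = z" "\<Psi> z \<in> U'" if "z \<in> V" for z using hom that by (auto simp: homeomorphism_def)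
  have \<Psi>E: "\<Psi> (E z) = z" "E z \<in> V" if "z \<in> U'" for z using hom that by (auto simp: homeomorphism_def)
  define w where "w = (\<lambda>z. fst (\<Psi> z) \<bullet> e)"
  define \<eta> where "\<eta> = (\<lambda>z. model_projection (fst (\<Psi> z)))"
  have Ckw: "Ck_on k V w" for k
    unfolding w_def by (intro Ck_on_inner Ck_on_const Ck_on_bounded_linear[OF bounded_linear_fst] Ck\<Psi> V(1))
  have Ck\<eta>: "Ck_on k V \<eta>" for k
    unfolding \<eta>_def by (intro Ck_on_bounded_linear[OF bounded_linear_compose[OF bounded_linear_model_projection bounded_linear_fst]] Ck\<Psi> V(1))
  define g where "g = space_gradient w"
  define \<tau> where "\<tau> = (\<lambda>z. frechet_derivative w (at z) (0, 1))"
  define g' where "g' = (\<lambda>z. frechet_derivative (space_gradient w) (at z))"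
  have J: "jet_on V w g \<tau> g'" unfolding g_def \<tau>_def g'_def by (rule jet_on_Ck[OF V(1) Ckw])
  have Ckg: "Ck_on k V g" for k unfolding g_def by (rule Ck_on_space_gradient[OF V(1) Ckw])
  have Ck\<tau>: "Ck_on k V \<tau>" for k unfolding \<tau>_def using Ckw[of "Suc k"] by simp
  have Ckg': "Ck_on k V (\<lambda>z. g' z h)" for k h
    unfolding g'_def using Ckg[of "Suc k"] unfolding g_def Ck_on.simps by blast
  have Ckd: "Ck_on k V (mcf_defect g \<tau> g')" for k
  proof (rule Ck_on_cong[OF V(1)])
    show "Ck_on k V (\<lambda>z. (g z \<bullet> g z) * (\<tau> z + (\<Sum>b\<in>Basis. (-1) * (g' z (b, 0) \<bullet> b))) + (\<Sum>b\<in>Basis. (g z \<bullet> b) *\<^sub>R g' z (b, 0)) \<bullet> g z)"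
      by (intro Ck_on_add Ck_on_mult Ck_on_inner Ck_on_sum Ck_on_scaleR Ck_on_const Ckg Ck\<tau> Ckg' V(1))
    fix z assume "z \<in> V"
    then have "linear (\<lambda>v. g' z (v, 0))" using jet_onD(3)[OF J] linear_slice by blast
    from linear_sum_Basis[OF this, of "g z"]
    show "(g z \<bullet> g z) * (\<tau> z + (\<Sum>b\<in>Basis. (-1) * (g' z (b, 0) \<bullet> b))) + (\<Sum>b\<in>Basis. (g z \<bullet> b) *\<^sub>R g' z (b, 0)) \<bullet> g z = mcf_defect g \<tau> g' z"
      by (simp add: mcf_defect_def hessian_trace_def sum_negf)
  qed
  obtain \<rho> where \<rho>: "\<rho> > 0" "cball (y0, s0) \<rho> \<subseteq> U'"
    using U'(1,3) open_contains_cball by blast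
  define Bl where "Bl = ball (y0, s0) \<rho>"
  define S where "S = V \<inter> \<Psi> -` Bl"
  have SV: "S \<subseteq> V" by (simp add: S_def)
  have oS: "open S"
    unfolding S_def Bl_def using Ck_on_continuous[OF Ck\<Psi>[of 0]] V(1) by (intro continuous_open_preimage) auto
  have Bl: "z \<in> U'" "E z \<in> S" if z: "z \<in> Bl" for z
  proof -
    show zU: "z \<in> U'" using \<rho>(2) z ball_subset_cball unfolding Bl_def by blast
    show "E z \<in> S" unfolding S_def using \<Psi>E[OF zU] z by simp
  qed
  have E_sheet: "E (y + h *\<^sub>R e, t) = (X y t + h *\<^sub>R N (X y t), t)"
    if "y \<in> model_hyperplane" "dist y y0 < r0" "t \<in> {a..b}" "dist t s0 < r0" for y h t
    using that patchD(7)[OF P that] by (simp add: E_def \<pi>_def e_def inner_add_left model_hyperplane_iff)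
  have inBl: "dist y y0 < r0 \<and> dist t s0 < r0" if "(y, t) \<in> Bl" for y t
    using that Bl(1)[OF that] U'(2) by (auto simp: U_def dist_commute)
  \<comment> \<open>A third of the radius, since parameter, time and height distances are added in
    \<open>near\<close>.\<close>
  define r where "r = \<rho> / 3"
  have r: "r > 0" using \<rho>(1) by (simp add: r_def)
  have near: "(y + h *\<^sub>R e, t) \<in> Bl" if "dist y y0 < r" "dist t s0 < r" "\<bar>h\<bar> < r" for y h t
  proof -
    have "dist (y + h *\<^sub>R e, t) (y0, s0) \<le> dist (y + h *\<^sub>R e) y0 + dist t s0"
      unfolding dist_Pair_Pair by (rule sqrt_sum_squares_le_sum) auto
    also have "dist (y + h *\<^sub>R e) y0 \<le> dist (y + h *\<^sub>R e) y + dist y y0" by (rule dist_triangle)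
    also have "dist (y + h *\<^sub>R e) y = \<bar>h\<bar>" by (simp add: dist_norm e_def)
    finally show ?thesis using that by (simp add: Bl_def r_def dist_commute)
  qed
  have foot: "\<eta> (x, t) \<in> model_hyperplane \<and> dist (\<eta> (x, t)) y0 < r0 \<and> dist t s0 < r0 \<and> (\<eta> (x, t), t) \<in> Bl \<and>
      \<Psi> (x, t) = (\<eta> (x, t) + w (x, t) *\<^sub>R e, t)" if xt: "(x, t) \<in> S" for x t
  proof -
    obtain z s where zs: "\<Psi> (x, t) = (z, s)" by (cases "\<Psi> (x, t)")
    have "E (z, s) = (x, t)" using E\<Psi>(1)[of "(x, t)"] xt SV zs by auto
    then have st: "s = t" by (simp add: E_def)
    have zB: "(z, t) \<in> Bl" using xt zs st by (simp add: S_def)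
    have "dist (model_projection z, t) (y0, s0) \<le> dist (z, t) (y0, s0)"
      unfolding dist_Pair_Pair by (intro real_sqrt_le_mono add_right_mono power_mono model_projection_dist y0H) auto
    then have "(model_projection z, t) \<in> Bl" using zB by (simp add: Bl_def dist_commute)
    moreover have "z = model_projection z + (z \<bullet> e) *\<^sub>R e" by (simp add: model_projection_def e_def)
    ultimately show ?thesis
      using inBl model_projection_in by (auto simp: \<eta>_def w_def zs st)
  qed
  have w_sheet: "(X y t + h *\<^sub>R N (X y t), t) \<in> S \<and> w (X y t + h *\<^sub>R N (X y t), t) = h \<and> \<eta> (X y t + h *\<^sub>R N (X y t), t) = y"
    if y: "y \<in> model_hyperplane" and t: "t \<in> {a..b}" and B: "(y + h *\<^sub>R e, t) \<in> Bl" "(y, t) \<in> Bl" for y t h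
  proof -
    have EE: "E (y + h *\<^sub>R e, t) = (X y t + h *\<^sub>R N (X y t), t)"
      by (rule E_sheet[OF y _ t]) (use inBl[OF B(2)] in auto)
    have "E (y + h *\<^sub>R e, t) \<in> S" by (rule Bl(2)[OF B(1)])
    moreover have "\<Psi> (E (y + h *\<^sub>R e, t)) = (y + h *\<^sub>R e, t)" using \<Psi>E(1) Bl(1)[OF B(1)] B(1) by blast
    ultimately show ?thesis
      unfolding EE using y by (simp add: w_def \<eta>_def e_def inner_add_left model_hyperplane_iff)
  qed
  \<comment> \<open>Along a fibre w equals the height coordinate and so has derivative 1; a
    vanishing gradient would make it 0.\<close>
  have gnz: "g z \<noteq> 0" if z: "z \<in> S" for z
  proof
    assume g0: "g z = 0"
    have zV: "z \<in> V" using z SV by auto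
    obtain x t where zx: "z = (x, t)" by (cases z)
    define y where "y = fst (\<Psi> z)"
    have \<Psi>z: "\<Psi> z = (y, t)" using foot[of x t] z by (simp add: y_def zx)
    have yB: "(y, t) \<in> Bl" using z \<Psi>z by (simp add: S_def)
    have c: "((\<lambda>h. E (y + h *\<^sub>R e, t)) has_derivative (\<lambda>h. (h *\<^sub>R N (G (model_projection y, t)), 0))) (at 0)"
    proof -
      have "(\<lambda>h. E (y + h *\<^sub>R e, t)) = (\<lambda>h. (G (model_projection y, t) + (y \<bullet> e + h) *\<^sub>R N (G (model_projection y, t)), t))"
        by (simp add: E_def \<pi>_def model_projection_def e_def inner_add_left algebra_simps)
      then show ?thesis by (auto intro!: derivative_eq_intros)
    qed
    have "E (y + 0 *\<^sub>R e, t) = z" using E\<Psi>(1)[OF zV] \<Psi>z by simp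
    then have "(w has_derivative (\<lambda>(\<xi>, s). g z \<bullet> \<xi> + \<tau> z * s)) (at (E (y + 0 *\<^sub>R e, t)))"
      using jet_onD(1)[OF J zV] by simp
    from has_derivative_compose[OF c this]
    have d0: "((\<lambda>h. w (E (y + h *\<^sub>R e, t))) has_derivative (\<lambda>h. 0)) (at 0)" by (simp add: g0)
    have "((\<lambda>h. y \<bullet> e + h) has_derivative (\<lambda>h. 0)) (at 0)"
    proof (rule has_derivative_transform_within_open[OF d0])
      show "open ((\<lambda>h. (y + h *\<^sub>R e, t)) -` Bl)"
        unfolding Bl_def by (intro open_vimage open_ball continuous_intros)
      show "0 \<in> (\<lambda>h. (y + h *\<^sub>R e, t)) -` Bl" using yB by simp
      fix h assume "h \<in> (\<lambda>h. (y + h *\<^sub>R e, t)) -` Bl"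
      then have "\<Psi> (E (y + h *\<^sub>R e, t)) = (y + h *\<^sub>R e, t)" using Bl(1) \<Psi>E(1) by blast
      then show "w (E (y + h *\<^sub>R e, t)) = y \<bullet> e + h" by (simp add: w_def e_def inner_add_left)
    qed
    moreover have "((\<lambda>h. y \<bullet> e + h) has_derivative (\<lambda>h. h)) (at 0)" by (auto intro!: derivative_eq_intros)
    ultimately have "(\<lambda>h::real. 0::real) = (\<lambda>h. h)" by (rule has_derivative_unique)
    then show False by (metis zero_neq_one)
  qed
  \<comment> \<open>w is zero on the whole surface near the point, so the surface lies in the
    superlevel sets of both w and - w, and the two inequalities from \<open>touching\<close>
    cancel.\<close>
  have zero_defect_after: "mcf_defect g \<tau> g' (X y t, t) = 0"
    if y: "y \<in> model_hyperplane" "(y, t) \<in> Bl" and t: "t \<in> {a..b}" "a < t" for y t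
  proof -
    obtain d where d: "d > 0" "ball (y, t) (2 * d) \<subseteq> Bl"
    proof -
      have "open Bl" by (simp add: Bl_def)
      then obtain d where "d > 0" "ball (y, t) d \<subseteq> Bl" using y(2) openE by blast
      then show ?thesis using that[of "d / 2"] by auto
    qed
    have wz: "w (X y' s, s) = 0 \<and> (X y' s, s) \<in> S" if "y' \<in> model_hyperplane" "dist y' y < d" "s \<in> {a..b}" "t - d < s" "s \<le> t" for y' s
    proof -
      have "dist (y', s) (y, t) \<le> dist y' y + dist s t"
        unfolding dist_Pair_Pair by (rule sqrt_sum_squares_le_sum) auto
      also have "\<dots> < 2 * d" using that by (simp add: dist_real_def)
      finally have "(y', s) \<in> Bl" using d(2) by (auto simp: dist_commute)
      then show ?thesis using w_sheet[OF that(1,3), of 0] by simp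
    qed
    have le: "mcf_defect (\<lambda>z. c *\<^sub>R g z) (\<lambda>z. c * \<tau> z) (\<lambda>z h. c *\<^sub>R g' z h) (X y t, t) \<le> 0" for c
    proof (rule touching[OF P y(1) _ t(1) _ t(2) jet_on_subset[OF jet_on_scale[OF J] SV] oS _ d(1)])
      show "c * w (X y t, t) \<le> c * w (X y' s, s)"
        if "y' \<in> model_hyperplane" "dist y' y < d" "s \<in> {a..b}" "t - d < s" "s \<le> t" for y' s
        using wz[OF that] wz[OF y(1) _ t(1)] d(1) by simp
    qed (use inBl[OF y(2)] wz[OF y(1) _ t(1)] d(1) in auto)
    have lin: "linear (g' (X y t, t))" using jet_onD(3)[OF J] wz[OF y(1) _ t(1)] d(1) SV by auto
    show ?thesis using le[of 1] le[of "-1"] 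
      unfolding mcf_defect_scale[where g' = g' and z = "(X y t, t)", OF lin] by simp
  qed
  \<comment> \<open>\<open>touching\<close> needs earlier times, so t = a is reached as a limit of
    later times along the same parameter.\<close>
  have zero_defect: "mcf_defect g \<tau> g' (X y t, t) = 0"
    if y: "y \<in> model_hyperplane" "(y, t) \<in> Bl" and t: "t \<in> {a..b}" for y t
  proof (cases "a < t")
    case False
    then have ta: "t = a" using t by simp
    define f where "f = (\<lambda>s. mcf_defect g \<tau> g' (E (y, s)))"
    have "continuous_on ((\<lambda>s. (y, s)) -` Bl) f"
    proof -
      have c1: "continuous_on ((\<lambda>s. (y, s)) -` Bl) (\<lambda>s. E (y, s))"
        by (rule continuous_on_compose2[OF Ck_on_continuous[OF CkE[of 0]]])
          (use Bl(1) U'(2) in \<open>auto intro!: continuous_intros\<close>)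
      show ?thesis unfolding f_def
        by (rule continuous_on_compose2[OF Ck_on_continuous[OF Ckd[of 0]] c1]) (use Bl(2) SV in auto)
    qed
    moreover have oB: "open ((\<lambda>s. (y, s)) -` Bl)" unfolding Bl_def by (intro open_vimage open_ball continuous_intros)
    ultimately have "isCont f a" using y(2) ta continuous_on_eq_continuous_at by blast
    then have lim: "(f \<longlongrightarrow> f a) (at_right a)" by (simp add: isCont_def filterlim_at_split)
    have ev: "eventually (\<lambda>s. f s = 0) (at_right a)"
    proof -
      have "eventually (\<lambda>s. s \<in> (\<lambda>s. (y, s)) -` Bl) (at_right a)"
        using oB y(2) ta eventually_at_in_open' [of "(\<lambda>s. (y, s)) -` Bl" a] by (auto simp: eventually_at_split)
      moreover have "eventually (\<lambda>s. s \<in> {a<..<b}) (at_right a)" by (rule eventually_at_right_real[OF ab])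
      ultimately show ?thesis
      proof eventually_elim
        case (elim s)
        then have "E (y, s) = (X y s, s)" using E_sheet[OF y(1), of s 0] inBl[of y s] by simp
        then show ?case unfolding f_def using zero_defect_after[OF y(1), of s] elim by simp
      qed
    qed
    have "f a = 0"
      by (rule tendsto_unique[OF trivial_limit_at_right_real lim tendsto_eventually[OF ev]])
    moreover have "E (y, a) = (X y a, a)" using E_sheet[OF y(1), of a 0] inBl[OF y(2)] ta ab by simp
    ultimately show ?thesis by (simp add: f_def ta)
  qed (use zero_defect_after that in auto)
  \<comment> \<open>K bounds the derivative of the defect in the fibre direction over a compact
    ball, in the straightened coordinates.\<close>
  obtain K where K: "K \<ge> 0" "\<And>z. z \<in> Bl \<Longrightarrow> \<bar>frechet_derivative (\<lambda>z. mcf_defect g \<tau> g' (E z)) (at z) (e, 0)\<bar> \<le> K"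
    and fder: "\<And>z. z \<in> Bl \<Longrightarrow> ((\<lambda>z. mcf_defect g \<tau> g' (E z)) has_derivative frechet_derivative (\<lambda>z. mcf_defect g \<tau> g' (E z)) (at z)) (at z)"
  proof -
    have Ckf: "Ck_on (Suc 0) U' (\<lambda>z. mcf_defect g \<tau> g' (E z))"
      by (rule Ck_on_compose[OF U'(1) V(1) _ Ckd Ck_on_subset[OF CkE U'(2)]]) (use \<Psi>E in auto)
    then have "continuous_on U' (\<lambda>z. frechet_derivative (\<lambda>z. mcf_defect g \<tau> g' (E z)) (at z) (e, 0))"
      by simp
    then have "continuous_on (cball (y0, s0) \<rho>) (\<lambda>z. frechet_derivative (\<lambda>z. mcf_defect g \<tau> g' (E z)) (at z) (e, 0))"
      by (rule continuous_on_subset[OF _ \<rho>(2)])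
    then have "bounded ((\<lambda>z. frechet_derivative (\<lambda>z. mcf_defect g \<tau> g' (E z)) (at z) (e, 0)) ` cball (y0, s0) \<rho>)"
      by (intro compact_imp_bounded compact_continuous_image compact_cball)
    then obtain K where K: "\<forall>x\<in>(\<lambda>z. frechet_derivative (\<lambda>z. mcf_defect g \<tau> g' (E z)) (at z) (e, 0)) ` cball (y0, s0) \<rho>. norm x \<le> K"
      unfolding bounded_iff by blast
    show ?thesis
    proof (rule that[of "max K 0"])
      fix z assume z: "z \<in> Bl"
      have "z \<in> cball (y0, s0) \<rho>" using z ball_subset_cball unfolding Bl_def by blast
      then have "norm (frechet_derivative (\<lambda>z. mcf_defect g \<tau> g' (E z)) (at z) (e, 0)) \<le> K"
        using K by blast
      then show "\<bar>frechet_derivative (\<lambda>z. mcf_defect g \<tau> g' (E z)) (at z) (e, 0)\<bar> \<le> max K 0" by simp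
      show "((\<lambda>z. mcf_defect g \<tau> g' (E z)) has_derivative frechet_derivative (\<lambda>z. mcf_defect g \<tau> g' (E z)) (at z)) (at z)"
        by (rule Ck_on_has_derivative[OF Ckf Bl(1)[OF z]])
    qed simp
  qed
  \<comment> \<open>Mean value theorem along the fibre from the foot, where the defect is zero, to
    the given point; the ball is convex, so the segment stays inside it.\<close>
  have bound: "\<bar>mcf_defect g \<tau> g' (x, t)\<bar> \<le> K * \<bar>w (x, t)\<bar>" if xt: "(x, t) \<in> S" and t: "t \<in> {a..b}" for x t
  proof -
    define y where "y = \<eta> (x, t)"
    define h where "h = w (x, t)"
    define f where "f = (\<lambda>s. mcf_defect g \<tau> g' (E (y + s *\<^sub>R e, t)))"
    have F: "y \<in> model_hyperplane" "(y, t) \<in> Bl" "\<Psi> (x, t) = (y + h *\<^sub>R e, t)"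
      using foot[OF xt] by (auto simp: y_def h_def)
    have yhB: "(y + h *\<^sub>R e, t) \<in> Bl" using xt F(3) by (simp add: S_def)
    have seg: "(y + s *\<^sub>R e, t) \<in> Bl" if s: "s \<in> closed_segment 0 h" for s
    proof -
      obtain c where c: "0 \<le> c" "c \<le> 1" "s = c * h" using s by (auto simp: in_segment)
      have "(1 - c) *\<^sub>R (y, t) + c *\<^sub>R (y + h *\<^sub>R e, t) \<in> Bl"
        using convex_ball[of "(y0, s0)" \<rho>] F(2) yhB c unfolding Bl_def by (intro convexD) auto
      moreover have "(1 - c) *\<^sub>R (y, t) + c *\<^sub>R (y + h *\<^sub>R e, t) = (y + s *\<^sub>R e, t)"
        by (simp add: c(3) algebra_simps)
      ultimately show ?thesis by simp
    qed
    have "norm (f h - f 0) \<le> K * norm (h - 0)"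
    proof (rule field_differentiable_bound[of "closed_segment 0 h"])
      fix s assume s: "s \<in> closed_segment 0 h"
      have c: "((\<lambda>s. (y + s *\<^sub>R e, t)) has_derivative (\<lambda>k. k *\<^sub>R (e, 0))) (at s)"
        by (auto intro!: derivative_eq_intros)
      have "(f has_derivative (\<lambda>k. frechet_derivative (\<lambda>z. mcf_defect g \<tau> g' (E z)) (at (y + s *\<^sub>R e, t)) (k *\<^sub>R (e, 0)))) (at s)"
        unfolding f_def using has_derivative_compose[OF c fder[OF seg[OF s]]] .
      then have "(f has_real_derivative frechet_derivative (\<lambda>z. mcf_defect g \<tau> g' (E z)) (at (y + s *\<^sub>R e, t)) (e, 0)) (at s)"
        unfolding linear_cmul[OF has_derivative_linear[OF fder[OF seg[OF s]]]] has_field_derivative_def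
        by (simp add: mult_commute_abs)
      then show "(f has_field_derivative frechet_derivative (\<lambda>z. mcf_defect g \<tau> g' (E z)) (at (y + s *\<^sub>R e, t)) (e, 0)) (at s within closed_segment 0 h)"
        by (rule has_field_derivative_at_within)
      show "norm (frechet_derivative (\<lambda>z. mcf_defect g \<tau> g' (E z)) (at (y + s *\<^sub>R e, t)) (e, 0)) \<le> K"
        using K(2)[OF seg[OF s]] by simp
    qed auto
    moreover have "f h = mcf_defect g \<tau> g' (x, t)"
      using E\<Psi>(1)[of "(x, t)"] xt SV F(3) by (auto simp: f_def)
    moreover have "f 0 = 0"
      using zero_defect[OF F(1,2) t] E_sheet[OF F(1) _ t, of 0] inBl[OF F(2)] by (simp add: f_def)
    ultimately show ?thesis by (simp add: h_def)
  qed
  define S' where "S' = S \<inter> (\<lambda>z. (\<eta> z, w z, snd z)) -` (ball y0 r \<times> {-r<..<r} \<times> ball s0 r)"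
  have S'S: "S' \<subseteq> S" "S' \<subseteq> V" using SV by (auto simp: S'_def)
  have oS': "open S'"
    unfolding S'_def using Ck_on_continuous[OF Ck\<eta>[of 0]] Ck_on_continuous[OF Ckw[of 0]] SV
    by (intro continuous_open_preimage oS open_Times open_ball open_greaterThanLessThan continuous_intros)
      (auto intro: continuous_on_subset)
  have inS': "z \<in> S' \<longleftrightarrow> z \<in> S \<and> dist (\<eta> z) y0 < r \<and> \<bar>w z\<bar> < r \<and> dist (snd z) s0 < r" for z
    by (auto simp: S'_def dist_commute)
  have "sheet D X y0 s0 N r S' w g \<tau> g' \<eta> K"
    unfolding sheet_def
  proof (intro conjI ballI allI impI)
    show "continuous_on S' g" "continuous_on S' \<tau>" "\<And>h. continuous_on S' (\<lambda>z. g' z h)"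
      using Ck_on_continuous[OF Ckg[of 0]] Ck_on_continuous[OF Ck\<tau>[of 0]] Ck_on_continuous[OF Ckg'[of 0]] S'S
      by (auto intro: continuous_on_subset)
    show "\<eta> differentiable at z" if "z \<in> S'" for z
      using Ck\<eta>[of "Suc 0"] that S'S by auto
    show "\<eta> z \<in> model_hyperplane" for z by (simp add: \<eta>_def model_projection_in)
    fix x t assume xt': "(x, t) \<in> S'" and t: "t \<in> {a..b}"
    have xt: "(x, t) \<in> S" using xt' S'S by blast
    note F = foot[OF xt]
    show "\<eta> (x, t) \<in> D" using F patchD(6)[OF P] by blast
    have "E (\<Psi> (x, t)) = (x, t)" using E\<Psi>(1) xt SV by blast
    then show "x = X (\<eta> (x, t)) t + w (x, t) *\<^sub>R N (X (\<eta> (x, t)) t)"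
      using F E_sheet[of "\<eta> (x, t)" t "w (x, t)"] t by simp
    show "\<bar>mcf_defect g \<tau> g' (x, t)\<bar> \<le> K * \<bar>w (x, t)\<bar>" by (rule bound[OF xt t])
  next
    fix y assume y: "y \<in> model_hyperplane" "dist y y0 < r"
    have "(y, s0) \<in> Bl" using near[OF y(2), of s0 0] r by simp
    then show "y \<in> D" using inBl patchD(6)[OF P y(1)] by blast
    fix t h assume t: "t \<in> {a..b}" "dist t s0 < r" and h: "\<bar>h\<bar> < r"
    note ws = w_sheet[OF y(1) t(1) near[OF y(2) t(2) h]] near[OF y(2) t(2), of 0]
    show "(X y t + h *\<^sub>R N (X y t), t) \<in> S'" "w (X y t + h *\<^sub>R N (X y t), t) = h" "\<eta> (X y t + h *\<^sub>R N (X y t), t) = y"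
      using ws r y t h by (auto simp: inS')
  qed (use DX r oS' K(1) jet_on_subset[OF J S'S(2)] gnz S'S(1) inS' in blast)+
  then show ?thesis by blast
qed

section \<open>Sheets of the flow do not merge\<close>

lemma local_defining_function_facts:
  assumes L: "local_defining_function \<Omega> U \<rho>" and op: "open \<Omega>"
  shows "open U" "\<And>k. Ck_on k U \<rho>" "\<And>x. x \<in> U \<Longrightarrow> (\<rho> has_derivative (\<lambda>v. gradient \<rho> x \<bullet> v)) (at x)"
    "continuous_on U (gradient \<rho>)" "\<And>x. x \<in> U \<Longrightarrow> gradient \<rho> x \<noteq> 0"
    "\<And>x. x \<in> U \<Longrightarrow> x \<in> \<Omega> \<longleftrightarrow> \<rho> x < 0" "\<And>x. x \<in> U \<Longrightarrow> x \<in> frontier \<Omega> \<Longrightarrow> \<rho> x = 0"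
proof -
  note L' = L[unfolded local_defining_function_def]
  show U: "open U" using L' by blast
  show Ck: "Ck_on k U \<rho>" for k using smooth_on_open_Ck[OF U] L' by blast
  show der: "(\<rho> has_derivative (\<lambda>v. gradient \<rho> x \<bullet> v)) (at x)" if "x \<in> U" for x
  proof -
    have d: "(\<rho> has_derivative frechet_derivative \<rho> (at x)) (at x)"
      by (rule Ck_on_has_derivative[OF Ck[of "Suc 0"] that])
    have "frechet_derivative \<rho> (at x) = (\<lambda>v. gradient \<rho> x \<bullet> v)"
    proof
      fix v
      show "frechet_derivative \<rho> (at x) v = gradient \<rho> x \<bullet> v"
        unfolding linear_sum_Basis[OF has_derivative_linear[OF d], of v] gradient_def
        by (simp add: inner_sum_left inner_sum_right inner_commute mult.commute)
    qed
    with d show ?thesis by simp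
  qed
  show "continuous_on U (gradient \<rho>)"
    unfolding gradient_def using Ck[of "Suc 0"] by (intro continuous_intros) auto
  show "gradient \<rho> x \<noteq> 0" if "x \<in> U" for x using L' that by blast
  show iff: "x \<in> \<Omega> \<longleftrightarrow> \<rho> x < 0" if "x \<in> U" for x using L' that by blast
  show "\<rho> x = 0" if x: "x \<in> U" "x \<in> frontier \<Omega>" for x
  proof (rule antisym)
    show "\<rho> x \<ge> 0" using x op iff[OF x(1)] by (auto simp: frontier_def interior_open not_less)
    have cont: "isCont \<rho> x" using der[OF x(1)] has_derivative_continuous by blast
    show "\<rho> x \<le> 0"
    proof (rule ccontr)
      assume "\<not> \<rho> x \<le> 0"
      then have "eventually (\<lambda>z. \<rho> z > 0) (nhds x)"
        using cont by (intro order_tendstoD(1)) (auto simp: isCont_def tendsto_at_iff_tendsto_nhds)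
      moreover have "eventually (\<lambda>z. z \<in> U) (nhds x)" using U x(1) by (rule eventually_nhds_in_open)
      ultimately have "eventually (\<lambda>z. z \<notin> \<Omega>) (nhds x)"
        by eventually_elim (use iff in auto)
      then obtain T where "open T" "x \<in> T" "\<And>z. z \<in> T \<Longrightarrow> z \<notin> \<Omega>" by (auto simp: eventually_nhds)
      moreover have "x \<in> closure \<Omega>" using x(2) by (simp add: frontier_def)
      ultimately show False using open_Int_closure_eq_empty[of T \<Omega>] by blast
    qed
  qed
qed

context flow_family
begin

lemma sheetD:
  assumes "sheet D X y0 s0 N r S w g \<tau> g' \<eta> K"
  shows "(D, X) \<in> charts" "y0 \<in> D" "s0 \<in> {a..b}" "r > 0" "open S" "K \<ge> 0" "jet_on S w g \<tau> g'"
    "continuous_on S g" "continuous_on S \<tau>" "\<And>h. continuous_on S (\<lambda>z. g' z h)" "\<And>z. z \<in> S \<Longrightarrow> g z \<noteq> 0"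
    "\<And>z. z \<in> S \<Longrightarrow> \<eta> differentiable (at z)"
    "\<And>z. z \<in> S \<Longrightarrow> \<eta> z \<in> model_hyperplane \<and> dist (\<eta> z) y0 < r \<and> \<bar>w z\<bar> < r \<and> dist (snd z) s0 < r"
    "\<And>x t. (x, t) \<in> S \<Longrightarrow> t \<in> {a..b} \<Longrightarrow> \<eta> (x, t) \<in> D"
    "\<And>x t. (x, t) \<in> S \<Longrightarrow> t \<in> {a..b} \<Longrightarrow> x = X (\<eta> (x, t)) t + w (x, t) *\<^sub>R N (X (\<eta> (x, t)) t)"
    "\<And>y. y \<in> model_hyperplane \<Longrightarrow> dist y y0 < r \<Longrightarrow> y \<in> D"
    "\<And>y t h. y \<in> model_hyperplane \<Longrightarrow> dist y y0 < r \<Longrightarrow> t \<in> {a..b} \<Longrightarrow> dist t s0 < r \<Longrightarrow> \<bar>h\<bar> < r \<Longrightarrow>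
      (X y t + h *\<^sub>R N (X y t), t) \<in> S \<and> w (X y t + h *\<^sub>R N (X y t), t) = h \<and> \<eta> (X y t + h *\<^sub>R N (X y t), t) = y"
    "\<And>x t. (x, t) \<in> S \<Longrightarrow> t \<in> {a..b} \<Longrightarrow> \<bar>mcf_defect g \<tau> g' (x, t)\<bar> \<le> K * \<bar>w (x, t)\<bar>"
  using assms unfolding sheet_def by blast+

lemma sheet_on:
  assumes sh: "sheet D X y0 s0 N r S w g \<tau> g' \<eta> K"
    and y: "y \<in> model_hyperplane" "dist y y0 < r" and t: "t \<in> {a..b}" "dist t s0 < r"
  shows "(X y t, t) \<in> S" "w (X y t, t) = 0" "\<eta> (X y t, t) = y"
  using sheetD(17)[OF sh y t, of 0] sheetD(4)[OF sh] by auto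

lemma sheet_base:
  assumes sh: "sheet D X y0 s0 N r S w g \<tau> g' \<eta> K"
  shows "y0 \<in> model_hyperplane" "(X y0 s0, s0) \<in> S" "w (X y0 s0, s0) = 0" "\<eta> (X y0 s0, s0) = y0"
proof -
  show H: "y0 \<in> model_hyperplane" by (rule chart_subset[OF sheetD(1,2)[OF sh]])
  show "(X y0 s0, s0) \<in> S" "w (X y0 s0, s0) = 0" "\<eta> (X y0 s0, s0) = y0"
    using sheet_on[OF sh H _ sheetD(3)[OF sh]] sheetD(4)[OF sh] by auto
qed

lemma sheet_continuous:
  assumes sh: "sheet D X y0 s0 N r S w g \<tau> g' \<eta> K"
  shows "continuous_on S w" "continuous_on S \<eta>"
proof -
  show "continuous_on S w"
    using jet_onD(1)[OF sheetD(7)[OF sh]] has_derivative_continuous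
    by (intro continuous_at_imp_continuous_on) blast
  show "continuous_on S \<eta>"
    using sheetD(12)[OF sh] differentiable_imp_continuous_within
    by (intro continuous_at_imp_continuous_on) blast
qed

lemma chart_continuous:
  assumes "(D, X) \<in> charts"
  shows "continuous_on (D \<times> {a..b}) (\<lambda>(y, t). X y t)"
  unfolding continuous_on_eq_continuous_within
proof
  fix z assume z: "z \<in> D \<times> {a..b}"
  then have "\<exists>U g. open U \<and> z \<in> U \<and> (\<forall>k. Ck_on k U g) \<and> (\<forall>y\<in>D \<times> {a..b} \<inter> U. (\<lambda>(y, t). X y t) y = g y)"
    using chart_smooth[OF assms] unfolding smooth_on_def by (rule bspec[rotated])
  then obtain U g where "open U \<and> z \<in> U \<and> (\<forall>k. Ck_on k U g) \<and> (\<forall>y\<in>D \<times> {a..b} \<inter> U. (\<lambda>(y, t). X y t) y = g y)"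
    by (elim exE)
  then have U: "open U" "z \<in> U" "Ck_on 0 U g" "\<And>y. y \<in> D \<times> {a..b} \<inter> U \<Longrightarrow> g y = (\<lambda>(y, t). X y t) y" by simp_all
  have "isCont g z" using U by (simp add: continuous_on_eq_continuous_at)
  then have "continuous (at z within D \<times> {a..b}) g" by (rule continuous_at_imp_continuous_at_within)
  then show "continuous (at z within D \<times> {a..b}) (\<lambda>(y, t). X y t)"
  proof (rule continuous_transform_within_openin)
    show "openin (top_of_set (D \<times> {a..b})) (D \<times> {a..b} \<inter> U)" using U(1) by (rule openin_open_Int)
  qed (use U z in auto)
qed

lemma chart_frontier: "(D, X) \<in> charts \<Longrightarrow> y \<in> D \<Longrightarrow> t \<in> {a..b} \<Longrightarrow> X y t \<in> frontier (B t)"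
  using cover by blast

lemma frontier_chart:
  assumes "t \<in> {a..b}" "x \<in> frontier (B t)"
  obtains D X y where "(D, X) \<in> charts" "y \<in> D" "x = X y t"
  using cover[OF assms(1)] assms(2) by blast

lemma trajectory_continuous:
  assumes "(D, X) \<in> charts" "y \<in> D"
  shows "continuous_on {a..b} (X y)"
proof -
  have "continuous_on {a..b} ((\<lambda>(y, t). X y t) \<circ> (\<lambda>t. (y, t)))"
    by (rule continuous_on_compose[OF _ continuous_on_subset[OF chart_continuous[OF assms(1)]]])
      (use assms in \<open>auto intro!: continuous_intros\<close>)
  then show ?thesis by (simp add: o_def)
qed

text \<open>For questions near one point a constant field is enough; the unit normal at that point
  serves.\<close>

lemma normal_transversal_exists:
  assumes DX: "(D, X) \<in> charts" "y0 \<in> D" "s0 \<in> {a..b}"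
  obtains n where "\<And>v. v \<in> model_hyperplane \<Longrightarrow> dir_deriv (\<lambda>y. X y s0) y0 v \<noteq> n"
proof -
  obtain r G where P: "patch D X y0 s0 r G" using patch_exists[OF DX] by blast
  have y: "y0 \<in> model_hyperplane" "dist y0 y0 < r" "dist s0 s0 < r"
    using chart_subset[OF DX(1,2)] patchD(4)[OF P] by auto
  obtain E \<nu> where A: "adapted_frame (\<lambda>v. frechet_derivative G (at (y0, s0)) (v, 0)) E \<nu>"
    using patch_flow[OF P y(1,2) DX(3) y(3)] by blast
  have "dir_deriv (\<lambda>y. X y s0) y0 v \<noteq> \<nu>" if v: "v \<in> model_hyperplane" for v
  proof
    assume "dir_deriv (\<lambda>y. X y s0) y0 v = \<nu>"
    then have "\<nu> \<bullet> \<nu> = 0"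
      using A v patch_dir_deriv[OF P y(1,2) DX(3) y(3) v] unfolding adapted_frame_def by auto
    then show False using A by (simp add: adapted_frame_def)
  qed
  then show thesis using that by blast
qed

lemma normal_to_patch:
  assumes P: "patch D X y0 s0 r G" and y: "y \<in> model_hyperplane" "dist y y0 < r"
    and t: "t \<in> {a..b}" "dist t s0 < r"
    and W: "(W has_derivative (\<lambda>v. c \<bullet> v)) (at (X y t))"
    and zero: "eventually (\<lambda>y'. y' \<in> model_hyperplane \<longrightarrow> W (X y' t) = 0) (nhds y)"
    and v: "v \<in> model_hyperplane"
  shows "c \<bullet> frechet_derivative G (at (y, t)) (v, 0) = 0"
proof -
  obtain d1 where d1: "d1 > 0" "\<And>s. \<bar>s\<bar> < d1 \<Longrightarrow> y + s *\<^sub>R v \<in> model_hyperplane"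
    "\<And>s. \<bar>s\<bar> < d1 \<Longrightarrow> dist (y + s *\<^sub>R v) y0 < r"
    using patch_near[OF P y t v] by blast
  have "((\<lambda>s. y + s *\<^sub>R v) \<longlongrightarrow> y + 0 *\<^sub>R v) (nhds 0)"
    by (intro tendsto_intros filterlim_ident)
  then have "eventually (\<lambda>s. y + s *\<^sub>R v \<in> model_hyperplane \<longrightarrow> W (X (y + s *\<^sub>R v) t) = 0) (nhds 0)"
    using zero by (auto simp: filterlim_iff)
  then obtain d2 where d2: "d2 > 0" "\<And>s. \<bar>s\<bar> < d2 \<Longrightarrow> y + s *\<^sub>R v \<in> model_hyperplane \<Longrightarrow> W (X (y + s *\<^sub>R v) t) = 0"
    by (auto simp: eventually_nhds_metric dist_real_def)
  have xG: "X y t = G (y, t)" by (rule patchD(7)[OF P y t])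
  have "((\<lambda>s. G (y + s *\<^sub>R v, t)) has_derivative (\<lambda>h. h *\<^sub>R frechet_derivative G (at (y, t)) (v, 0))) (at 0)"
    using patch_line_derivative(1)[OF P y t, of 0 v] patch_mem(1)[OF P y t] by (simp add: has_vector_derivative_def)
  from has_derivative_compose[OF this, of W "\<lambda>v. c \<bullet> v"] W
  have "((\<lambda>s. W (G (y + s *\<^sub>R v, t))) has_derivative (\<lambda>h. c \<bullet> (h *\<^sub>R frechet_derivative G (at (y, t)) (v, 0)))) (at 0)"
    by (simp add: xG)
  then have "((\<lambda>s. 0) has_derivative (\<lambda>h. c \<bullet> (h *\<^sub>R frechet_derivative G (at (y, t)) (v, 0)))) (at 0)"
  proof (rule has_derivative_transform_within_open[of _ _ _ _ "ball 0 (min d1 d2)"])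
    fix s :: real assume "s \<in> ball 0 (min d1 d2)"
    then have s: "\<bar>s\<bar> < d1" "\<bar>s\<bar> < d2" by (auto simp: dist_real_def)
    show "W (G (y + s *\<^sub>R v, t)) = 0"
      using patchD(7)[OF P d1(2,3)[OF s(1)] t] d2(2)[OF s(2) d1(2)[OF s(1)]] by simp
  qed (use d1 d2 in auto)
  from has_derivative_unique[OF this has_derivative_const]
  have "(\<lambda>h. c \<bullet> (h *\<^sub>R frechet_derivative G (at (y, t)) (v, 0))) = (\<lambda>h. 0)" .
  from fun_cong[OF this, of 1] show ?thesis by simp
qed

lemma jet_slice:
  assumes "jet_on S W g \<tau> g'" "(x, t) \<in> S"
  shows "((\<lambda>x. W (x, t)) has_derivative (\<lambda>v. g (x, t) \<bullet> v)) (at x)"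
proof -
  have c: "((\<lambda>x. (x, t)) has_derivative (\<lambda>h. (h, 0))) (at x)"
    by (auto intro!: derivative_eq_intros)
  show ?thesis using has_derivative_compose[OF c jet_onD(1)[OF assms]] by simp
qed

lemma sheet_vanishes_nearby:
  assumes sh: "sheet D X y0 s0 N r S w g \<tau> g' \<eta> K"
    and y: "y \<in> model_hyperplane" "dist y y0 < r" and t: "t \<in> {a..b}" "dist t s0 < r"
  shows "eventually (\<lambda>y'. y' \<in> model_hyperplane \<longrightarrow> w (X y' t, t) = 0) (nhds y)"
proof -
  have "eventually (\<lambda>y'. y' \<in> ball y0 r) (nhds y)"
    by (rule eventually_nhds_in_open) (use y in \<open>auto simp: dist_commute\<close>)
  then show ?thesis
    by eventually_elim (use sheet_on(2)[OF sh _ _ t] in \<open>auto simp: dist_commute\<close>)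
qed

lemma sheet_gradient_transversal:
  assumes sh: "sheet D X y0 s0 N r S w g \<tau> g' \<eta> K"
    and y: "y \<in> model_hyperplane" "dist y y0 < r" and t: "t \<in> {a..b}" "dist t s0 < r"
  shows "g (X y t, t) \<bullet> N (X y t) = 1"
proof -
  have J: "((\<lambda>x. w (x, t)) has_derivative (\<lambda>v. g (X y t, t) \<bullet> v)) (at (X y t))"
    by (rule jet_slice[OF sheetD(7)[OF sh] sheet_on(1)[OF sh y t]])
  have c: "((\<lambda>h. X y t + h *\<^sub>R N (X y t)) has_derivative (\<lambda>h. h *\<^sub>R N (X y t))) (at 0)"
    by (auto intro!: derivative_eq_intros)
  have "((\<lambda>h. w (X y t + h *\<^sub>R N (X y t), t)) has_derivative (\<lambda>h. g (X y t, t) \<bullet> (h *\<^sub>R N (X y t)))) (at 0)"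
    using has_derivative_compose[OF c, of "\<lambda>x. w (x, t)" "\<lambda>v. g (X y t, t) \<bullet> v"] J by simp
  then have "((\<lambda>h. h) has_derivative (\<lambda>h. g (X y t, t) \<bullet> (h *\<^sub>R N (X y t)))) (at 0)"
    by (rule has_derivative_transform_within_open[of _ _ _ _ "ball 0 r"])
      (use sheetD(17)[OF sh y t] sheetD(4)[OF sh] in auto)
  from has_derivative_unique[OF this has_derivative_ident]
  have "(\<lambda>h. g (X y t, t) \<bullet> (h *\<^sub>R N (X y t))) = (\<lambda>h. h)" .
  from fun_cong[OF this, of 1] show ?thesis by simp
qed

text \<open>This is where smoothness of the sets \<open>B t\<close> excludes further sheets through
  x at time t. If boundary points off the sheet tended to x, a local defining function of
  \<open>B t\<close> would vanish both at such a point and at its foot on the sheet, and Rolle's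
  theorem on the fibre between them would give a point where its gradient is orthogonal to the
  fibre. In the limit this contradicts transversality of \<open>N\<close> at x.\<close>

lemma sheet_zero_nearby:
  assumes sh: "sheet D X y0 s0 N r S w g \<tau> g' \<eta> K" and N: "continuous_on UNIV N"
    and xt: "(x, t) \<in> S" "t \<in> {a..b}" "w (x, t) = 0"
  shows "eventually (\<lambda>x'. x' \<in> frontier (B t) \<longrightarrow> (x', t) \<in> S \<and> w (x', t) = 0) (nhds x)"
proof (rule ccontr)
  assume "\<not> ?thesis"
  then have "\<not> eventually (\<lambda>x'. x' \<in> frontier (B t) \<longrightarrow> (x', t) \<in> S \<and> w (x', t) = 0) (nhds x)" .
  then have "\<exists>x'. dist x' x < inverse (real (Suc k)) \<and> x' \<in> frontier (B t) \<and> \<not> ((x', t) \<in> S \<and> w (x', t) = 0)" for k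
    unfolding eventually_nhds_metric by (metis inverse_positive_iff_positive of_nat_0_less_iff zero_less_Suc)
  then obtain xk where xk: "\<And>k. dist (xk k) x < inverse (real (Suc k))" "\<And>k. xk k \<in> frontier (B t)"
    "\<And>k. \<not> ((xk k, t) \<in> S \<and> w (xk k, t) = 0)" by metis
  have xk_lim: "xk \<longlonglongrightarrow> x"
  proof (rule metric_tendsto_imp_tendsto[OF LIMSEQ_inverse_real_of_nat])
    show "eventually (\<lambda>k. dist (xk k) x \<le> dist (inverse (real (Suc k))) 0) sequentially"
      using xk(1) by (intro always_eventually allI) (simp add: less_imp_le)
  qed
  define y where "y = \<eta> (x, t)"
  have y: "y \<in> model_hyperplane" "dist y y0 < r" "dist t s0 < r"
    using sheetD(13)[OF sh xt(1)] by (auto simp: y_def)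
  have xX: "x = X y t" using sheetD(15)[OF sh xt(1,2)] xt(3) by (simp add: y_def)
  have yD: "y \<in> D" by (rule sheetD(16)[OF sh y(1,2)])
  have xfr: "x \<in> frontier (B t)" using chart_frontier[OF sheetD(1)[OF sh] yD xt(2)] xX by simp
  obtain U \<rho> where U: "x \<in> U" "local_defining_function (B t) U \<rho>"
    using boundary_B[OF xt(2)] xfr unfolding smooth_boundary_def by blast
  note L = local_defining_function_facts[OF U(2) open_B[OF xt(2)]]
  have XU: "X y' t \<in> U \<Longrightarrow> y' \<in> D \<Longrightarrow> \<rho> (X y' t) = 0" for y'
    by (rule L(7)[OF _ chart_frontier[OF sheetD(1)[OF sh] _ xt(2)]])
  have contX: "continuous_on D (\<lambda>y. X y t)"
  proof -
    have "continuous_on D ((\<lambda>(y, t). X y t) \<circ> (\<lambda>y. (y, t)))"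
      by (rule continuous_on_compose[OF _ continuous_on_subset[OF chart_continuous[OF sheetD(1)[OF sh]]]])
        (use xt in \<open>auto intro!: continuous_intros\<close>)
    then show ?thesis by (simp add: o_def)
  qed
  \<comment> \<open>The gradients of the defining function and of w are both normal to the sheet at
    x, hence parallel and nonzero, and the one of w has product 1 with \<open>N\<close>.\<close>
  have grad: "gradient \<rho> x \<bullet> N x \<noteq> 0"
  proof -
    obtain r1 G where P: "patch D X y t r1 G" using patch_exists[OF sheetD(1)[OF sh] yD xt(2)] by blast
    have yy: "dist y y < r1" "dist t t < r1" using patchD(4)[OF P] by auto
    obtain E \<nu> where A: "adapted_frame (\<lambda>v. frechet_derivative G (at (y, t)) (v, 0)) E \<nu>"
      using patch_flow[OF P y(1) yy(1) xt(2) yy(2)] by blast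
    have EH: "E \<subseteq> model_hyperplane" using A by (simp add: adapted_frame_def)
    have "eventually (\<lambda>y'. y' \<in> model_hyperplane \<longrightarrow> \<rho> (X y' t) = 0) (nhds y)"
    proof -
      have "openin (top_of_set D) (D \<inter> (\<lambda>y. X y t) -` U)"
        using contX L(1) continuous_openin_preimage_gen by blast
      then have "openin (top_of_set model_hyperplane) (D \<inter> (\<lambda>y. X y t) -` U)"
        using chart_open[OF sheetD(1)[OF sh]] openin_trans by blast
      then obtain T where T: "open T" "D \<inter> (\<lambda>y. X y t) -` U = model_hyperplane \<inter> T"
        by (auto simp: openin_open)
      have "y \<in> T" using T(2) yD U(1) xX by blast
      then have "eventually (\<lambda>y'. y' \<in> T) (nhds y)" using T(1) by (intro eventually_nhds_in_open)
      then show ?thesis by eventually_elim (use T(2) XU in blast)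
    qed
    from normal_to_patch[OF P y(1) yy(1) xt(2) yy(2) _ this, of "gradient \<rho> x"] L(3)[OF U(1)]
    have n1: "gradient \<rho> x \<bullet> frechet_derivative G (at (y, t)) (v, 0) = 0" if "v \<in> E" for v
      using EH that xX by auto
    from normal_to_patch[OF P y(1) yy(1) xt(2) yy(2) _ sheet_vanishes_nearby[OF sh y(1,2) xt(2) y(3)], of "g (x, t)"]
      jet_slice[OF sheetD(7)[OF sh] xt(1)]
    have n2: "g (x, t) \<bullet> frechet_derivative G (at (y, t)) (v, 0) = 0" if "v \<in> E" for v
      using EH that xX by auto
    define k where "k = gradient \<rho> x \<bullet> \<nu>"
    define l where "l = g (x, t) \<bullet> \<nu>"
    have "gradient \<rho> x = k *\<^sub>R \<nu>" "g (x, t) = l *\<^sub>R \<nu>"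
      using adapted_frame_expand[OF A, of "gradient \<rho> x"] n1 adapted_frame_expand[OF A, of "g (x, t)"] n2
      by (simp_all add: k_def l_def)
    moreover have "g (x, t) \<bullet> N x = 1"
      using sheet_gradient_transversal[OF sh y(1,2) xt(2) y(3)] xX by simp
    moreover have "k \<noteq> 0" using L(5)[OF U(1)] calculation(1) by auto
    ultimately show ?thesis by auto
  qed
  have evS: "eventually (\<lambda>k. (xk k, t) \<in> S) sequentially"
    using topological_tendstoD[OF tendsto_Pair[OF xk_lim tendsto_const[of t]] sheetD(5)[OF sh] xt(1)] .
  have \<eta>lim: "(\<lambda>k. \<eta> (xk k, t)) \<longlonglongrightarrow> y" and wlim: "(\<lambda>k. w (xk k, t)) \<longlonglongrightarrow> 0"
    unfolding y_def xt(3)[symmetric]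
    by (rule continuous_on_tendsto_compose[OF sheet_continuous(2)[OF sh] tendsto_Pair[OF xk_lim tendsto_const[of t]] xt(1) evS],
        rule continuous_on_tendsto_compose[OF sheet_continuous(1)[OF sh] tendsto_Pair[OF xk_lim tendsto_const[of t]] xt(1) evS])
  have Xlim: "(\<lambda>k. X (\<eta> (xk k, t)) t) \<longlonglongrightarrow> x"
    unfolding xX
    by (rule continuous_on_tendsto_compose[OF contX \<eta>lim yD], rule eventually_mono[OF evS])
      (use sheetD(14)[OF sh _ xt(2)] in auto)
  have Nlim: "(\<lambda>k. N (X (\<eta> (xk k, t)) t)) \<longlonglongrightarrow> N x"
    by (rule continuous_on_tendsto_compose[OF N Xlim]) auto
  obtain \<delta> where \<delta>: "\<delta> > 0" "ball x \<delta> \<subseteq> U" using L(1) U(1) openE by blast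
  have "((\<lambda>k. dist (X (\<eta> (xk k, t)) t) x + \<bar>w (xk k, t)\<bar> * norm (N (X (\<eta> (xk k, t)) t))) \<longlongrightarrow> dist x x + \<bar>0\<bar> * norm (N x)) sequentially"
    by (intro tendsto_intros Xlim wlim Nlim)
  then have "eventually (\<lambda>k. dist (X (\<eta> (xk k, t)) t) x + \<bar>w (xk k, t)\<bar> * norm (N (X (\<eta> (xk k, t)) t)) < \<delta>) sequentially"
    using \<delta>(1) by (intro order_tendstoD(2)) auto
  with evS have "eventually (\<lambda>k. \<exists>s. \<bar>s\<bar> \<le> \<bar>w (xk k, t)\<bar> \<and> X (\<eta> (xk k, t)) t + s *\<^sub>R N (X (\<eta> (xk k, t)) t) \<in> U \<and>
      gradient \<rho> (X (\<eta> (xk k, t)) t + s *\<^sub>R N (X (\<eta> (xk k, t)) t)) \<bullet> N (X (\<eta> (xk k, t)) t) = 0) sequentially"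
  proof eventually_elim
    case (elim k)
    define x' where "x' = X (\<eta> (xk k, t)) t"
    define n where "n = N x'"
    define h where "h = w (xk k, t)"
    have xh: "xk k = x' + h *\<^sub>R n" using sheetD(15)[OF sh elim(1) xt(2)] by (simp add: x'_def n_def h_def)
    have inU: "x' + s *\<^sub>R n \<in> U" if "\<bar>s\<bar> \<le> \<bar>h\<bar>" for s
    proof -
      have "dist (x' + s *\<^sub>R n) x \<le> dist (x' + s *\<^sub>R n) x' + dist x' x" by (rule dist_triangle)
      also have "dist (x' + s *\<^sub>R n) x' = \<bar>s\<bar> * norm n" by (simp add: dist_norm)
      also have "\<dots> \<le> \<bar>h\<bar> * norm n" using that by (intro mult_right_mono) auto
      finally show ?thesis using elim(2) \<delta>(2) by (auto simp: x'_def n_def h_def dist_commute)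
    qed
    have h0: "h \<noteq> 0" using xk(3)[of k] elim(1) by (simp add: h_def)
    \<comment> \<open>The fibre segment from the foot to \<open>xk k\<close>, scaled to the unit
      interval; both endpoints are boundary points.\<close>
    define f where "f = (\<lambda>s. \<rho> (x' + (s * h) *\<^sub>R n))"
    have fd: "(f has_derivative (\<lambda>u. gradient \<rho> (x' + (s * h) *\<^sub>R n) \<bullet> ((u * h) *\<^sub>R n))) (at s)" if "0 \<le> s" "s \<le> 1" for s
    proof -
      have c: "((\<lambda>s. x' + (s * h) *\<^sub>R n) has_derivative (\<lambda>u. (u * h) *\<^sub>R n)) (at s)"
        by (auto intro!: derivative_eq_intros)
      have "\<bar>s * h\<bar> \<le> \<bar>h\<bar>" using that by (simp add: abs_mult mult_left_le_one_le)
      from has_derivative_compose[OF c L(3)[OF inU[OF this]]] show ?thesis by (simp add: f_def)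
    qed
    have "f 0 = 0" unfolding f_def using XU[of "\<eta> (xk k, t)"] inU[of 0] sheetD(14)[OF sh elim(1) xt(2)] by (simp add: x'_def)
    moreover have "f 1 = 0" unfolding f_def using L(7)[of "xk k"] inU[of h] xk(2)[of k] xh by simp
    moreover have "continuous_on {0..1} f"
      using fd has_derivative_continuous by (intro continuous_at_imp_continuous_on) force
    ultimately obtain s where s: "0 < s" "s < 1" "(\<lambda>u. gradient \<rho> (x' + (s * h) *\<^sub>R n) \<bullet> ((u * h) *\<^sub>R n)) = (\<lambda>v. 0)"
      using Rolle_deriv[of 0 1 f "\<lambda>s u. gradient \<rho> (x' + (s * h) *\<^sub>R n) \<bullet> ((u * h) *\<^sub>R n)"] fd by force
    have "gradient \<rho> (x' + (s * h) *\<^sub>R n) \<bullet> n = 0" using fun_cong[OF s(3), of 1] h0 by simp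
    moreover have "\<bar>s * h\<bar> \<le> \<bar>h\<bar>" using s by (simp add: abs_mult mult_left_le_one_le)
    ultimately show ?case using inU by (auto simp: x'_def[symmetric] n_def[symmetric] h_def[symmetric])
  qed
  then obtain k0 where "\<And>k. k \<ge> k0 \<Longrightarrow> \<exists>s. \<bar>s\<bar> \<le> \<bar>w (xk k, t)\<bar> \<and> X (\<eta> (xk k, t)) t + s *\<^sub>R N (X (\<eta> (xk k, t)) t) \<in> U \<and>
      gradient \<rho> (X (\<eta> (xk k, t)) t + s *\<^sub>R N (X (\<eta> (xk k, t)) t)) \<bullet> N (X (\<eta> (xk k, t)) t) = 0"
    by (auto simp: eventually_sequentially)
  then obtain sk where sk: "\<And>k. k \<ge> k0 \<Longrightarrow> \<bar>sk k\<bar> \<le> \<bar>w (xk k, t)\<bar> \<and> X (\<eta> (xk k, t)) t + sk k *\<^sub>R N (X (\<eta> (xk k, t)) t) \<in> U \<and>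
      gradient \<rho> (X (\<eta> (xk k, t)) t + sk k *\<^sub>R N (X (\<eta> (xk k, t)) t)) \<bullet> N (X (\<eta> (xk k, t)) t) = 0"
    by metis
  have evk: "eventually (\<lambda>k. k \<ge> k0) sequentially" by (rule eventually_ge_at_top)
  have "sk \<longlonglongrightarrow> 0"
    by (rule Lim_null_comparison[OF eventually_mono[OF evk] tendsto_rabs_zero[OF wlim]]) (use sk in auto)
  then have "(\<lambda>k. X (\<eta> (xk k, t)) t + sk k *\<^sub>R N (X (\<eta> (xk k, t)) t)) \<longlonglongrightarrow> x + 0 *\<^sub>R N x"
    by (intro tendsto_intros Xlim Nlim)
  then have "(\<lambda>k. gradient \<rho> (X (\<eta> (xk k, t)) t + sk k *\<^sub>R N (X (\<eta> (xk k, t)) t))) \<longlonglongrightarrow> gradient \<rho> x"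
    by (intro continuous_on_tendsto_compose[OF L(4) _ U(1)] eventually_mono[OF evk]) (use sk in auto)
  from tendsto_inner[OF this Nlim]
  have "(\<lambda>k. gradient \<rho> (X (\<eta> (xk k, t)) t + sk k *\<^sub>R N (X (\<eta> (xk k, t)) t)) \<bullet> N (X (\<eta> (xk k, t)) t)) \<longlonglongrightarrow> gradient \<rho> x \<bullet> N x" .
  moreover have "(\<lambda>k. gradient \<rho> (X (\<eta> (xk k, t)) t + sk k *\<^sub>R N (X (\<eta> (xk k, t)) t)) \<bullet> N (X (\<eta> (xk k, t)) t)) \<longlonglongrightarrow> 0"
    by (rule tendsto_eventually, rule eventually_mono[OF evk]) (use sk in auto)
  ultimately show False using grad LIMSEQ_unique by blast
qed

end

context flow_family
begin

section \<open>Coincidence of trajectories backwards in time\<close>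

lemma trajectory_derivative:
  assumes P: "patch D X y0 s0 r G" and y: "y \<in> model_hyperplane" "dist y y0 < r"
    and t: "t \<in> {a..b}" "dist t s0 < r"
  shows "(X y has_vector_derivative frechet_derivative G (at (y, t)) (0, 1)) (at t within {a..b})"
proof (rule has_vector_derivative_transform_within)
  show "((\<lambda>s. G (y, s)) has_vector_derivative frechet_derivative G (at (y, t)) (0, 1)) (at t within {a..b})"
    using patch_time_derivative[OF P y t] by (rule has_vector_derivative_at_within)
  show "0 < r - dist t s0" using t by simp
  fix s assume s: "s \<in> {a..b}" "dist s t < r - dist t s0"
  then have "dist s s0 < r" using dist_triangle[of s s0 t] by simp
  then show "G (y, s) = X y s" using patchD(7)[OF P y s(1)] by simp
qed (use t in auto)

text \<open>The hypothesis \<open>zero\<close> says that the first surface stays inside the second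
  sheet near the trajectory, so both have the same tangent plane. Both velocities are normal to that
  plane, while their difference is the tangent vector produced by the motion of the foot. A vector
  both tangent and normal is zero, so the foot does not move and the two trajectories
  coincide.\<close>

lemma foot_constant:
  assumes C1: "(D1, X1) \<in> charts" "y1 \<in> D1"
    and sh: "sheet D2 X2 y2 s0 N r S w g \<tau> g' \<eta> K"
    and c: "c < d" "{c..d} \<subseteq> {a..b}"
    and inS: "\<And>t. t \<in> {c..d} \<Longrightarrow> (X1 y1 t, t) \<in> S"
    and zero: "\<And>t. t \<in> {c..d} \<Longrightarrow> eventually (\<lambda>y'. y' \<in> model_hyperplane \<longrightarrow> w (X1 y' t, t) = 0) (nhds y1)"
    and t: "t \<in> {c..d}"
  shows "\<eta> (X1 y1 t, t) = \<eta> (X1 y1 d, d)" "X1 y1 t = X2 (\<eta> (X1 y1 d, d)) t"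
proof -
  have y1H: "y1 \<in> model_hyperplane" by (rule chart_subset[OF C1])
  have w0: "w (X1 y1 t, t) = 0" if "t \<in> {c..d}" for t
    using eventually_nhds_x_imp_x[OF zero[OF that]] y1H by blast
  define \<gamma> where "\<gamma> = (\<lambda>t. \<eta> (X1 y1 t, t))"
  have X12: "X1 y1 t = X2 (\<gamma> t) t" if "t \<in> {c..d}" for t
    using sheetD(15)[OF sh inS[OF that]] w0[OF that] that c(2) by (auto simp: \<gamma>_def)
  have \<gamma>H: "\<gamma> t \<in> model_hyperplane \<and> \<gamma> t \<in> D2 \<and> dist (\<gamma> t) y2 < r \<and> dist t s0 < r" if "t \<in> {c..d}" for t
    using sheetD(13,14)[OF sh inS[OF that]] that c(2) by (auto simp: \<gamma>_def)
  have der: "(\<gamma> has_vector_derivative 0) (at t within {c..d})" if t: "t \<in> {c..d}" for t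
  proof -
    have tI: "t \<in> {a..b}" using t c by auto
    define x where "x = X1 y1 t"
    obtain q1 H1 where Q1: "patch D1 X1 y1 t q1 H1" using patch_exists[OF C1 tI] by blast
    have q1: "dist y1 y1 < q1" "dist t t < q1" using patchD(4)[OF Q1] by auto
    define V1 where "V1 = frechet_derivative H1 (at (y1, t)) (0, 1)"
    have X1d: "(X1 y1 has_vector_derivative V1) (at t within {c..d})"
      unfolding V1_def
      by (rule has_vector_derivative_within_subset[OF trajectory_derivative[OF Q1 y1H q1(1) tI q1(2)] c(2)])
    obtain \<eta>' where \<eta>': "(\<eta> has_derivative \<eta>') (at (x, t))"
      using sheetD(12)[OF sh inS[OF t]] by (auto simp: differentiable_def x_def)
    define \<gamma>' where "\<gamma>' = \<eta>' (V1, 1)"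
    have \<gamma>d: "(\<gamma> has_vector_derivative \<gamma>') (at t within {c..d})"
    proof -
      have "((\<lambda>t. (X1 y1 t, t)) has_derivative (\<lambda>h. (h *\<^sub>R V1, h))) (at t within {c..d})"
        using X1d unfolding has_vector_derivative_def by (intro has_derivative_Pair has_derivative_ident)
      from has_derivative_compose[OF this, of \<eta> \<eta>'] \<eta>'
      have "(\<gamma> has_derivative (\<lambda>h. \<eta>' (h *\<^sub>R V1, h))) (at t within {c..d})" by (simp add: \<gamma>_def x_def)
      moreover have "\<eta>' (h *\<^sub>R V1, h) = h *\<^sub>R \<gamma>'" for h
        using linear_cmul[OF has_derivative_linear[OF \<eta>'], of h "(V1, 1)"] by (simp add: \<gamma>'_def)
      ultimately show ?thesis by (simp add: has_vector_derivative_def)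
    qed
    have uniq: "u = v" if "(f has_vector_derivative u) (at t within {c..d})" "(f has_vector_derivative v) (at t within {c..d})"
      for f :: "real \<Rightarrow> 'b::euclidean_space" and u v
      using vector_derivative_unique_within_closed_interval[OF c(1) _ that(1)[folded cbox_interval] that(2)[folded cbox_interval]] t
      by (simp add: cbox_interval)
    have \<gamma>'H: "\<gamma>' \<in> model_hyperplane"
    proof -
      have "((\<lambda>t. \<gamma> t \<bullet> model_normal) has_vector_derivative \<gamma>' \<bullet> model_normal) (at t within {c..d})"
        using bounded_linear.has_vector_derivative[OF bounded_linear_inner_left \<gamma>d] .
      moreover have "((\<lambda>t. \<gamma> t \<bullet> model_normal) has_vector_derivative 0) (at t within {c..d})"
        by (rule has_vector_derivative_transform[OF t _ has_vector_derivative_const[of 0]])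
          (use \<gamma>H in \<open>simp add: model_hyperplane_iff\<close>)
      ultimately show ?thesis using uniq by (auto simp: model_hyperplane_iff)
    qed
    define y where "y = \<gamma> t"
    have y: "y \<in> model_hyperplane" "y \<in> D2" "dist y y2 < r" "dist t s0 < r" using \<gamma>H[OF t] by (auto simp: y_def)
    have xX2: "x = X2 y t" using X12[OF t] by (simp add: x_def y_def)
    obtain q2 H2 where Q2: "patch D2 X2 y t q2 H2" using patch_exists[OF sheetD(1)[OF sh] y(2) tI] by blast
    have q2: "dist y y < q2" "dist t t < q2" "q2 > 0" using patchD(4)[OF Q2] by auto
    define L1 where "L1 = (\<lambda>v. frechet_derivative H1 (at (y1, t)) (v, 0))"
    define L2 where "L2 = (\<lambda>v. frechet_derivative H2 (at (y, t)) (v, 0))"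
    define V2 where "V2 = frechet_derivative H2 (at (y, t)) (0, 1)"
    have H2d: "(H2 has_derivative frechet_derivative H2 (at (y, t))) (at (y, t))"
      by (rule patch_has_derivative[OF Q2 y(1) q2(1) tI q2(2)])
    \<comment> \<open>Derivative of X1 y1 s = X2 (\<gamma> s) s with respect to s.\<close>
    have "V1 = L2 \<gamma>' + V2"
    proof (rule uniq[OF X1d])
      have "((\<lambda>t. (\<gamma> t, t)) has_derivative (\<lambda>h. (h *\<^sub>R \<gamma>', h))) (at t within {c..d})"
        using \<gamma>d unfolding has_vector_derivative_def by (intro has_derivative_Pair has_derivative_ident)
      from has_derivative_compose[OF this, of H2 "frechet_derivative H2 (at (y, t))"] H2d
      have "((\<lambda>s. H2 (\<gamma> s, s)) has_derivative (\<lambda>h. frechet_derivative H2 (at (y, t)) (h *\<^sub>R \<gamma>', h))) (at t within {c..d})"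
        by (simp add: y_def)
      moreover have "frechet_derivative H2 (at (y, t)) (h *\<^sub>R \<gamma>', h) = h *\<^sub>R (L2 \<gamma>' + V2)" for h
      proof -
        have "frechet_derivative H2 (at (y, t)) (h *\<^sub>R \<gamma>', h) = frechet_derivative H2 (at (y, t)) (h *\<^sub>R ((\<gamma>', 0) + (0, 1)))" by simp
        also have "\<dots> = h *\<^sub>R (L2 \<gamma>' + V2)"
          unfolding L2_def V2_def using has_derivative_linear[OF H2d] by (simp only: linear_cmul linear_add)
        finally show ?thesis .
      qed
      ultimately have d1: "((\<lambda>s. H2 (\<gamma> s, s)) has_vector_derivative L2 \<gamma>' + V2) (at t within {c..d})"
        by (simp add: has_vector_derivative_def)
      have "(\<gamma> \<longlongrightarrow> y) (at t within {c..d})"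
        using has_vector_derivative_continuous[OF \<gamma>d] by (simp add: continuous_within y_def)
      then have "eventually (\<lambda>s. dist (\<gamma> s) y < q2) (at t within {c..d})" using q2(3) by (rule tendstoD)
      then obtain e where e: "e > 0" "\<And>s. s \<in> {c..d} \<Longrightarrow> s \<noteq> t \<Longrightarrow> dist s t < e \<Longrightarrow> dist (\<gamma> s) y < q2"
        unfolding eventually_at by blast
      show "(X1 y1 has_vector_derivative L2 \<gamma>' + V2) (at t within {c..d})"
      proof (rule has_vector_derivative_transform_within[OF d1, of "min e q2"])
        fix s assume s: "s \<in> {c..d}" "dist s t < min e q2"
        have "dist (\<gamma> s) y < q2"
          using e(2)[OF s(1)] s(2) q2 by (cases "s = t") (auto simp: y_def)
        then have "X2 (\<gamma> s) s = H2 (\<gamma> s, s)"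
          using patchD(7)[OF Q2, of "\<gamma> s" s] \<gamma>H[OF s(1)] s c(2) by auto
        then show "H2 (\<gamma> s, s) = X1 y1 s" using X12[OF s(1)] by simp
      qed (use e q2 t in auto)
    qed
    moreover obtain E1 \<nu>1 k1 where A1: "adapted_frame L1 E1 \<nu>1" "V1 = k1 *\<^sub>R \<nu>1"
      using patch_flow[OF Q1 y1H q1(1) tI q1(2)] unfolding L1_def V1_def by blast
    moreover obtain E2 \<nu>2 k2 where A2: "adapted_frame L2 E2 \<nu>2" "V2 = k2 *\<^sub>R \<nu>2"
      using patch_flow[OF Q2 y(1) q2(1) tI q2(2)] unfolding L2_def V2_def by blast
    have J: "((\<lambda>x. w (x, t)) has_derivative (\<lambda>v. g (x, t) \<bullet> v)) (at x)"
      by (rule jet_slice[OF sheetD(7)[OF sh] inS[OF t, folded x_def]])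
    have n1: "g (x, t) \<bullet> L1 v = 0" if "v \<in> model_hyperplane" for v
      unfolding L1_def by (rule normal_to_patch[OF Q1 y1H q1(1) tI q1(2) J[unfolded x_def] zero[OF t] that, folded x_def])
    have n2: "g (x, t) \<bullet> L2 v = 0" if "v \<in> model_hyperplane" for v
      unfolding L2_def
      by (rule normal_to_patch[OF Q2 y(1) q2(1) tI q2(2) J[unfolded xX2] sheet_vanishes_nearby[OF sh y(1,3) tI y(4)] that, folded xX2])
    define l where "l = g (x, t) \<bullet> \<nu>1"
    have "g (x, t) = l *\<^sub>R \<nu>1"
      using adapted_frame_expand[OF A1(1), of "g (x, t)"] n1 A1(1) by (simp add: l_def adapted_frame_def subset_iff)
    moreover have "g (x, t) \<noteq> 0" using sheetD(11)[OF sh inS[OF t]] by (simp add: x_def)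
    ultimately have l: "l \<noteq> 0" "g (x, t) = l *\<^sub>R \<nu>1" by auto
    \<comment> \<open>L2 \<gamma>' = V1 - V2 is orthogonal to both normals and is itself a
      combination of them, hence orthogonal to itself.\<close>
    have "\<nu>1 \<bullet> L2 \<gamma>' = 0" using n2[OF \<gamma>'H] l by simp
    moreover have "\<nu>2 \<bullet> L2 \<gamma>' = 0" using A2(1) \<gamma>'H by (simp add: adapted_frame_def inner_commute)
    ultimately have "L2 \<gamma>' \<bullet> L2 \<gamma>' = 0"
      using \<open>V1 = L2 \<gamma>' + V2\<close> A1(2) A2(2) by (metis add_diff_cancel_right' diff_zero inner_diff_left inner_scaleR_left mult_zero_right)
    then have "L2 \<gamma>' = L2 0" using linear_0[OF patch_linear[OF Q2 y(1) q2(1) tI q2(2)]] by (simp add: L2_def)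
    then have "\<gamma>' = 0"
      using patch_injective[OF Q2 y(1) q2(1) tI q2(2)] \<gamma>'H subspace_0[OF subspace_model_hyperplane]
      unfolding L2_def[symmetric] by (auto dest: inj_onD)
    with \<gamma>d show ?thesis by simp
  qed
  obtain k where k: "\<And>s. s \<in> {c..d} \<Longrightarrow> \<gamma> s = k"
    using has_vector_derivative_zero_constant[of "{c..d}" \<gamma>] der by auto
  have "d \<in> {c..d}" using c by simp
  then show e: "\<eta> (X1 y1 t, t) = \<eta> (X1 y1 d, d)" using k[OF t] k by (simp add: \<gamma>_def)
  show "X1 y1 t = X2 (\<eta> (X1 y1 d, d)) t" using X12[OF t] e by (simp add: \<gamma>_def)
qed

text \<open>Let w be the height over the second sheet. If w vanishes along the first trajectory on a
  whole interval before \<open>s0\<close>, \<open>foot_constant\<close> gives the claim. Otherwise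
  the sheets are disjoint at some time arbitrarily close to \<open>s0\<close> and meet later. A
  perturbed height has an interior minimum over the first sheet; there \<open>touching\<close> makes
  the defect nonpositive while \<open>barrier\<close> makes it positive.\<close>

lemma no_merging_local:
  assumes C1: "(D1, X1) \<in> charts" "y1 \<in> D1" and C2: "(D2, X2) \<in> charts" "y2 \<in> D2"
    and s0: "s0 \<in> {a..b}" "a < s0" and eq: "X1 y1 s0 = X2 y2 s0"
  shows "\<exists>e>0. \<forall>s\<in>{a..s0}. s0 - e < s \<longrightarrow> X1 y1 s = X2 y2 s"
proof -
  obtain n where n: "\<And>v. v \<in> model_hyperplane \<Longrightarrow> dir_deriv (\<lambda>y. X2 y s0) y2 v \<noteq> n"
    using normal_transversal_exists[OF C2 s0(1)] by blast
  obtain r S w g \<tau> g' \<eta> K where sh: "sheet D2 X2 y2 s0 (\<lambda>_. n) r S w g \<tau> g' \<eta> K"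
    using sheet_exists[OF C2 s0(1) Ck_on_const n] by blast
  \<comment> \<open>The sheet over X1 supplies a foot map \<open>\<eta>1\<close>, which shows that
    the first parametrisation is injective near y1 at time \<open>s0\<close>.\<close>
  obtain n1 where n1: "\<And>v. v \<in> model_hyperplane \<Longrightarrow> dir_deriv (\<lambda>y. X1 y s0) y1 v \<noteq> n1"
    using normal_transversal_exists[OF C1 s0(1)] by blast
  obtain r1 S1 w1 g1 \<tau>1 g1' \<eta>1 K1 where sh1: "sheet D1 X1 y1 s0 (\<lambda>_. n1) r1 S1 w1 g1 \<tau>1 g1' \<eta>1 K1"
    using sheet_exists[OF C1 s0(1) Ck_on_const n1] by blast
  define p where "p = X2 y2 s0"
  have p1: "X1 y1 s0 = p" by (simp add: p_def eq)
  have pS: "(p, s0) \<in> S" "w (p, s0) = 0" "\<eta> (p, s0) = y2" using sheet_base[OF sh] by (auto simp: p_def)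
  note ex_bar = barrier[OF sheetD(7)[OF sh] sheetD(5)[OF sh] pS(1) sheetD(8-10)[OF sh] sheetD(11)[OF sh pS(1)] sheetD(6)[OF sh] sheetD(18)[OF sh]]
  then obtain \<rho> where "\<exists>\<Lambda>. \<rho> > 0 \<and> \<Lambda> > 0 \<and> cball p \<rho> \<times> cball s0 \<rho> \<subseteq> S \<and>
    (\<forall>\<sigma> \<epsilon> x t. \<sigma> = 1 \<or> \<sigma> = -1 \<longrightarrow> 0 < \<epsilon> \<longrightarrow> \<epsilon> \<le> 1 \<longrightarrow> dist x p \<le> \<rho> \<longrightarrow> dist t s0 \<le> \<rho> \<longrightarrow> t \<in> {a..b} \<longrightarrow>
      \<bar>w (x, t)\<bar> \<le> \<epsilon> \<longrightarrow>
      0 < mcf_defect (\<lambda>z. \<sigma> *\<^sub>R g z + (2 * \<epsilon>) *\<^sub>R (fst z - p)) (\<lambda>z. \<sigma> * \<tau> z + \<epsilon> * \<Lambda>)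
        (\<lambda>z h. \<sigma> *\<^sub>R g' z h + (2 * \<epsilon>) *\<^sub>R fst h) (x, t))" ..
  then obtain \<Lambda> where bar0: "\<rho> > 0 \<and> \<Lambda> > 0 \<and> cball p \<rho> \<times> cball s0 \<rho> \<subseteq> S \<and>
    (\<forall>\<sigma> \<epsilon> x t. \<sigma> = 1 \<or> \<sigma> = -1 \<longrightarrow> 0 < \<epsilon> \<longrightarrow> \<epsilon> \<le> 1 \<longrightarrow> dist x p \<le> \<rho> \<longrightarrow> dist t s0 \<le> \<rho> \<longrightarrow> t \<in> {a..b} \<longrightarrow>
      \<bar>w (x, t)\<bar> \<le> \<epsilon> \<longrightarrow>
      0 < mcf_defect (\<lambda>z. \<sigma> *\<^sub>R g z + (2 * \<epsilon>) *\<^sub>R (fst z - p)) (\<lambda>z. \<sigma> * \<tau> z + \<epsilon> * \<Lambda>)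
        (\<lambda>z h. \<sigma> *\<^sub>R g' z h + (2 * \<epsilon>) *\<^sub>R fst h) (x, t))" ..
  note \<rho> = bar0[THEN conjunct1] bar0[THEN conjunct2, THEN conjunct1] bar0[THEN conjunct2, THEN conjunct2, THEN conjunct1]
  note bar = bar0[THEN conjunct2, THEN conjunct2, THEN conjunct2, rule_format]
  obtain rp G1 where P1: "patch D1 X1 y1 s0 rp G1" using patch_exists[OF C1 s0(1)] by blast
  have y1H: "y1 \<in> model_hyperplane" by (rule chart_subset[OF C1])
  define R0 where "R0 = min \<rho> 1"
  have R0: "R0 > 0" "R0 \<le> \<rho>" "R0 \<le> 1" using \<rho> by (auto simp: R0_def)
  define F where "F = (\<lambda>(y, t). (X1 y t, t))"
  have contF: "continuous_on (D1 \<times> {a..b}) F"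
  proof -
    have "F = (\<lambda>z. ((\<lambda>(y, t). X1 y t) z, snd z))" by (auto simp: F_def)
    then show ?thesis by (auto intro!: continuous_intros chart_continuous[OF C1(1)] simp del: split_beta)
  qed
  obtain r' where r': "r' > 0" "r' < rp" "r' < r1" "r' \<le> \<rho>"
    "\<And>y t. y \<in> model_hyperplane \<Longrightarrow> dist y y1 \<le> r' \<Longrightarrow> t \<in> {a..b} \<Longrightarrow> dist t s0 \<le> r' \<Longrightarrow>
       y \<in> D1 \<and> (X1 y t, t) \<in> S \<and> dist (X1 y t) p < R0"
  proof -
    have "open (S \<inter> (ball p R0 \<times> UNIV))" using sheetD(5)[OF sh] by (intro open_Int open_Times) auto
    then have opn: "openin (top_of_set (D1 \<times> {a..b})) ((D1 \<times> {a..b}) \<inter> F -` (S \<inter> (ball p R0 \<times> UNIV)))"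
      by (rule continuous_openin_preimage_gen[OF contF])
    define Pre where "Pre = (D1 \<times> {a..b}) \<inter> F -` (S \<inter> (ball p R0 \<times> UNIV))"
    have "(y1, s0) \<in> Pre"
      using C1 s0 pS R0 by (simp add: F_def p1 Pre_def)
    with opn[folded Pre_def] have "\<exists>d>0. ball (y1, s0) d \<inter> (D1 \<times> {a..b}) \<subseteq> Pre"
      unfolding openin_contains_ball by (elim conjE) (rule bspec)
    then obtain d where d: "d > 0" "ball (y1, s0) d \<inter> (D1 \<times> {a..b}) \<subseteq> Pre" by (elim exE conjE)
    define r' where "r' = min (d / 3) (min (rp / 2) (min (r1 / 2) \<rho>))"
    have rr: "r' > 0" "r' < rp" "r' < r1" "r' \<le> \<rho>" "r' \<le> d / 3"
      using d patchD(4)[OF P1] sheetD(4)[OF sh1] \<rho> by (auto simp: r'_def)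
    show ?thesis
    proof (rule that[OF rr(1-4)])
      fix y t assume yt: "y \<in> model_hyperplane" "dist y y1 \<le> r'" "t \<in> {a..b}" "dist t s0 \<le> r'"
      have yD: "y \<in> D1" using patchD(6)[OF P1 yt(1)] yt(2) rr by auto
      have "dist (y, t) (y1, s0) \<le> dist y y1 + dist t s0"
        unfolding dist_Pair_Pair by (rule sqrt_sum_squares_le_sum) auto
      then have "(y, t) \<in> ball (y1, s0) d" using yt rr d by (simp add: dist_commute)
      then have "(y, t) \<in> Pre" using yD yt by (intro subsetD[OF d(2)]) auto
      then have "F (y, t) \<in> S \<inter> (ball p R0 \<times> UNIV)" by (simp add: Pre_def)
      then show "y \<in> D1 \<and> (X1 y t, t) \<in> S \<and> dist (X1 y t) p < R0"
        using yD by (auto simp: F_def dist_commute)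
    qed
  qed
  define V1 where "V1 = model_hyperplane \<inter> cball y1 r'"
  have V1: "compact V1" "connected V1" "y1 \<in> V1"
  proof -
    have cl: "closed (model_hyperplane :: 'a set)" by (rule closed_subspace[OF subspace_model_hyperplane])
    show "compact V1" unfolding V1_def using compact_Int_closed[OF compact_cball cl] by (simp add: Int_commute)
    show "connected V1" unfolding V1_def
      by (intro convex_connected convex_Int convex_cball subspace_imp_convex subspace_model_hyperplane)
    show "y1 \<in> V1" using y1H r'(1) by (simp add: V1_def)
  qed
  have V1D: "y \<in> model_hyperplane" "y \<in> D1" "(X1 y t, t) \<in> S" "dist (X1 y t) p < R0"
    if "y \<in> V1" "t \<in> {a..b}" "dist t s0 \<le> r'" for y t
    using r'(5)[of y t] that by (auto simp: V1_def dist_commute)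
  have wc: "continuous_on (V1 \<times> ({a..b} \<inter> cball s0 r')) (\<lambda>(y, t). w (X1 y t, t))"
  proof -
    have "continuous_on (V1 \<times> ({a..b} \<inter> cball s0 r')) (\<lambda>z. w (F z))"
      by (rule continuous_on_compose2[OF sheet_continuous(1)[OF sh] continuous_on_subset[OF contF]])
        (use V1D in \<open>auto simp: F_def dist_commute\<close>)
    moreover have "(\<lambda>z. w (F z)) = (\<lambda>(y, t). w (X1 y t, t))" by (auto simp: F_def)
    ultimately show ?thesis by (simp only:)
  qed
  have wct: "continuous_on V1 (\<lambda>y. w (X1 y t, t))" if "t \<in> {a..b}" "dist t s0 \<le> r'" for t
  proof -
    have "continuous_on V1 ((\<lambda>(y, t). w (X1 y t, t)) \<circ> (\<lambda>y. (y, t)))"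
      by (rule continuous_on_compose[OF _ continuous_on_subset[OF wc]])
        (use that in \<open>auto intro!: continuous_intros simp: dist_commute\<close>)
    then show ?thesis by (simp add: o_def)
  qed
  \<comment> \<open>On the connected disc \<open>V1\<close> the zero set of w at a fixed time is
    closed by continuity and open by \<open>sheet_zero_nearby\<close>: near a common point the
    boundary consists of the second sheet alone.\<close>
  have dicho: "(\<forall>y\<in>V1. w (X1 y t, t) \<noteq> 0) \<or> (\<forall>y\<in>V1. w (X1 y t, t) = 0)" if t: "t \<in> {a..b}" "dist t s0 \<le> r'" for t
  proof -
    define Z where "Z = {y \<in> V1. w (X1 y t, t) = 0}"
    have "closedin (top_of_set V1) Z"
      unfolding Z_def by (rule continuous_closedin_preimage_constant[OF wct[OF t]])
    moreover have "openin (top_of_set V1) Z"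
      unfolding openin_euclidean_subtopology_iff
    proof (intro conjI ballI)
      show "Z \<subseteq> V1" by (auto simp: Z_def)
      fix y assume y: "y \<in> Z"
      then have yV: "y \<in> V1" "w (X1 y t, t) = 0" by (auto simp: Z_def)
      obtain e where e: "e > 0" "\<And>x'. dist x' (X1 y t) < e \<Longrightarrow> x' \<in> frontier (B t) \<Longrightarrow> w (x', t) = 0"
        using sheet_zero_nearby[OF sh continuous_on_const V1D(3)[OF yV(1) t] t(1) yV(2)]
        unfolding eventually_nhds_metric by blast
      have "continuous_on V1 (\<lambda>y. X1 y t)"
      proof -
        have "continuous_on V1 ((\<lambda>z. fst (F z)) \<circ> (\<lambda>y. (y, t)))"
          by (rule continuous_on_compose[OF _ continuous_on_fst[OF continuous_on_subset[OF contF]]])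
            (use V1D t in \<open>auto intro!: continuous_intros\<close>)
        then show ?thesis by (simp add: o_def F_def)
      qed
      then obtain d where d: "d > 0" "\<And>y'. y' \<in> V1 \<Longrightarrow> dist y' y < d \<Longrightarrow> dist (X1 y' t) (X1 y t) < e"
        using yV(1) e(1) unfolding continuous_on_iff by blast
      have "y' \<in> Z" if "y' \<in> V1" "dist y' y < d" for y'
        using e(2)[OF d(2)[OF that] chart_frontier[OF C1(1) V1D(2)[OF that(1) t] t(1)]] that(1) by (simp add: Z_def)
      then show "\<exists>e>0. \<forall>x'\<in>V1. dist x' y < e \<longrightarrow> x' \<in> Z" using d(1) by blast
    qed
    ultimately have "Z = {} \<or> Z = V1" using V1(2) unfolding connected_clopen by blast
    then show ?thesis by (auto simp: Z_def)
  qed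
  show ?thesis
  proof (cases "\<exists>\<delta>>0. \<forall>t\<in>{a..s0}. s0 - \<delta> < t \<longrightarrow> w (X1 y1 t, t) = 0")
    case True
    then obtain \<delta> where \<delta>: "\<delta> > 0" "\<And>t. t \<in> {a..s0} \<Longrightarrow> s0 - \<delta> < t \<Longrightarrow> w (X1 y1 t, t) = 0" by blast
    define c where "c = max a (s0 - min \<delta> r' / 2)"
    have c: "c < s0" "{c..s0} \<subseteq> {a..b}" using s0 \<delta> r' by (auto simp: c_def)
    have cI: "t \<in> {a..b} \<and> dist t s0 \<le> r' \<and> t \<in> {a..s0} \<and> s0 - \<delta> < t" if "t \<in> {c..s0}" for t
      using that s0 \<delta> r' by (auto simp: c_def dist_real_def)
    have "X1 y1 t = X2 (\<eta> (X1 y1 s0, s0)) t" if t: "t \<in> {c..s0}" for t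
    proof (rule foot_constant(2)[OF C1 sh c _ _ t])
      fix t assume t: "t \<in> {c..s0}"
      show "(X1 y1 t, t) \<in> S" using V1D(3)[OF V1(3)] cI[OF t] by blast
      have "w (X1 y1 t, t) = 0" using \<delta>(2) cI[OF t] by blast
      then have z: "\<And>y. y \<in> V1 \<Longrightarrow> w (X1 y t, t) = 0" using dicho[of t] cI[OF t] V1(3) by blast
      have "eventually (\<lambda>y'. y' \<in> ball y1 r') (nhds y1)"
        by (rule eventually_nhds_in_open) (use r' in auto)
      then show "eventually (\<lambda>y'. y' \<in> model_hyperplane \<longrightarrow> w (X1 y' t, t) = 0) (nhds y1)"
        by eventually_elim (use z in \<open>auto simp: V1_def\<close>)
    qed
    then have "X1 y1 t = X2 y2 t" if "t \<in> {c..s0}" for t using that pS(3) p1 by simp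
    then show ?thesis using c(1) s0 by (intro exI[of _ "s0 - c"]) (auto simp: c_def)
  next
    case False
    text \<open>The sheets are disjoint at times close to \<open>s0\<close>; a barrier keeps them apart until \<open>s0\<close>.\<close>
    obtain R \<delta> where R: "R > 0" "R \<le> R0" "\<delta> > 0" "\<delta> \<le> r'"
      "\<And>y t. y \<in> model_hyperplane \<Longrightarrow> dist y y1 = r' \<Longrightarrow> t \<in> {a..b} \<Longrightarrow> dist t s0 < \<delta> \<Longrightarrow> R \<le> dist (X1 y t) p"
    proof (cases "{y \<in> model_hyperplane. dist y y1 = r'} = {}")
      case True
      then show ?thesis using that[of R0 r'] R0 r' by blast
    next
      case ne: False
      define C where "C = model_hyperplane \<inter> sphere y1 r'"
      have C: "compact C" "C \<noteq> {}" "C \<subseteq> V1"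
        using ne compact_Int_closed[OF compact_sphere closed_subspace[OF subspace_model_hyperplane]]
        by (auto simp: C_def V1_def Int_commute dist_commute)
      have cX: "continuous_on (V1 \<times> ({a..b} \<inter> cball s0 r')) (\<lambda>z. fst (F z))"
        by (rule continuous_on_fst[OF continuous_on_subset[OF contF]]) (use V1D in \<open>auto simp: dist_commute\<close>)
      have "continuous_on C ((\<lambda>z. dist (fst (F z)) p) \<circ> (\<lambda>y. (y, s0)))"
        by (rule continuous_on_compose[OF _ continuous_on_dist[OF continuous_on_subset[OF cX] continuous_on_const]])
          (use C s0 r' in \<open>auto intro!: continuous_intros\<close>)
      then have cC: "continuous_on C (\<lambda>y. dist (X1 y s0) p)" by (simp add: o_def F_def)
      obtain ym where ym: "ym \<in> C" "\<And>y. y \<in> C \<Longrightarrow> dist (X1 ym s0) p \<le> dist (X1 y s0) p"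
        using continuous_attains_inf[OF C(1,2) cC] by blast
      define m where "m = dist (X1 ym s0) p"
      have "m > 0"
      proof (rule ccontr)
        assume "\<not> m > 0"
        then have X: "X1 ym s0 = X1 y1 s0" by (simp add: m_def p1)
        have e: "\<eta>1 (X1 ym s0, s0) = ym"
          by (rule sheet_on(3)[OF sh1 _ _ s0(1)]) (use ym(1) r' in \<open>auto simp: C_def dist_commute\<close>)
        have "ym = y1" by (rule trans[OF e[unfolded X, symmetric] sheet_base(4)[OF sh1]])
        then show False using ym(1) r' by (auto simp: C_def)
      qed
      have "uniformly_continuous_on (V1 \<times> ({a..b} \<inter> cball s0 r')) (\<lambda>z. fst (F z))"
        by (rule compact_uniformly_continuous[OF cX]) (intro compact_Times V1 compact_Int_closed[OF compact_Icc] closed_cball)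
      then have "\<exists>d>0. \<forall>z\<in>V1 \<times> ({a..b} \<inter> cball s0 r'). \<forall>z'\<in>V1 \<times> ({a..b} \<inter> cball s0 r').
          dist z' z < d \<longrightarrow> dist (fst (F z')) (fst (F z)) < m / 2"
        unfolding uniformly_continuous_on_def by (elim allE[of _ "m / 2"]) (use \<open>m > 0\<close> in simp)
      then obtain d where d0: "d > 0 \<and> (\<forall>z\<in>V1 \<times> ({a..b} \<inter> cball s0 r'). \<forall>z'\<in>V1 \<times> ({a..b} \<inter> cball s0 r').
          dist z' z < d \<longrightarrow> dist (fst (F z')) (fst (F z)) < m / 2)" ..
      note d = d0[THEN conjunct1] d0[THEN conjunct2, rule_format]
      show ?thesis
      proof (rule that[of "min R0 (m / 2)" "min d r'"])
        fix y t assume yt: "y \<in> model_hyperplane" "dist y y1 = r'" "t \<in> {a..b}" "dist t s0 < min d r'"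
        have yC: "y \<in> C" using yt by (simp add: C_def dist_commute)
        have "dist (fst (F (y, t))) (fst (F (y, s0))) < m / 2"
          by (rule d(2)) (use yt yC C(3) s0 r' in \<open>auto simp: dist_commute dist_Pair_Pair\<close>)
        then have "dist (X1 y t) (X1 y s0) < m / 2" by (simp add: F_def)
        moreover have "m \<le> dist (X1 y s0) p" using ym(2)[OF yC] by (simp add: m_def)
        ultimately show "min R0 (m / 2) \<le> dist (X1 y t) p"
          using dist_triangle[of "X1 y s0" p "X1 y t"] by (simp add: dist_commute)
      qed (use R0 \<open>m > 0\<close> d r' in auto)
    qed
    have R1: "R \<le> 1" "R \<le> \<rho>" using R R0 by auto
    obtain \<delta>1 where \<delta>1: "\<delta>1 > 0" "\<And>t. t \<in> {a..b} \<Longrightarrow> dist t s0 < \<delta>1 \<Longrightarrow> dist (X1 y1 t) p < R / 2"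
    proof -
      have "\<exists>d>0. \<forall>t\<in>{a..b}. dist t s0 < d \<longrightarrow> dist (X1 y1 t) (X1 y1 s0) < R / 2"
        using trajectory_continuous[OF C1] s0(1) unfolding continuous_on_iff
        by (elim ballE[of _ _ s0] allE[of _ "R / 2"]) (use R(1) in simp_all)
      then show ?thesis using that p1 by auto
    qed
    \<comment> \<open>The last term limits the drift: over a time span \<delta>2 the summand
      \<Lambda> (t - s') stays below R^2 / 2.\<close>
    define \<delta>2 where "\<delta>2 = min (min \<delta> \<delta>1) (R\<^sup>2 / (2 * \<Lambda>))"
    have \<delta>2: "\<delta>2 > 0" "\<delta>2 \<le> \<delta>" "\<delta>2 \<le> \<delta>1" "\<Lambda> * \<delta>2 \<le> R\<^sup>2 / 2"
    proof -
      show "\<delta>2 > 0" "\<delta>2 \<le> \<delta>" "\<delta>2 \<le> \<delta>1" using R \<delta>1 \<rho> by (auto simp: \<delta>2_def)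
      have "\<Lambda> * \<delta>2 \<le> \<Lambda> * (R\<^sup>2 / (2 * \<Lambda>))" using \<rho>(2) by (intro mult_left_mono) (auto simp: \<delta>2_def)
      then show "\<Lambda> * \<delta>2 \<le> R\<^sup>2 / 2" using \<rho>(2) by simp
    qed
    obtain s' where s': "s' \<in> {a..s0}" "s0 - \<delta>2 < s'" "w (X1 y1 s', s') \<noteq> 0"
      using False \<delta>2(1) by blast
    have s's0: "s' < s0" using s' pS(2) p1 by (cases "s' = s0") auto
    have near: "t \<in> {a..b} \<and> dist t s0 < \<delta> \<and> dist t s0 < \<delta>1 \<and> dist t s0 \<le> r'" if "t \<in> {s'..s0}" for t
      using that s' s0 \<delta>2 R by (auto simp: dist_real_def)
    define T where "T = {t \<in> {s'..s0}. w (X1 y1 t, t) = 0}"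
    have wy: "continuous_on {s'..s0} (\<lambda>t. w (X1 y1 t, t))"
    proof -
      have "continuous_on {s'..s0} ((\<lambda>(y, t). w (X1 y t, t)) \<circ> (\<lambda>t. (y1, t)))"
        by (rule continuous_on_compose[OF _ continuous_on_subset[OF wc]])
          (use near V1(3) in \<open>auto intro!: continuous_intros simp: dist_commute\<close>)
      then show ?thesis by (simp add: o_def)
    qed
    have clT: "closed T" unfolding T_def
      using continuous_closed_preimage_constant[OF wy closed_atLeastAtMost] by simp
    have s0T: "s0 \<in> T" using s's0 pS(2) p1 by (simp add: T_def)
    \<comment> \<open>The first contact after the separated time s'. By \<open>dicho\<close> the
      entire discs are disjoint before \<tau>0 and the first disc lies entirely in the second sheet
      at \<tau>0.\<close>
    define \<tau>0 where "\<tau>0 = Inf T"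
    have bT: "bdd_below T" by (auto simp: T_def intro: bdd_belowI[of _ s'])
    have \<tau>T: "\<tau>0 \<in> T" unfolding \<tau>0_def using closed_contains_Inf[OF _ bT clT] s0T by blast
    have \<tau>0: "s' < \<tau>0" "\<tau>0 \<le> s0" using \<tau>T s'(3) by (auto simp: T_def less_le)
    have nz: "w (X1 y t, t) \<noteq> 0" if "y \<in> V1" "s' \<le> t" "t < \<tau>0" for y t
    proof -
      have tI: "t \<in> {s'..s0}" using that \<tau>0 by auto
      have "t \<notin> T" using that(3) cInf_lower[OF _ bT] unfolding \<tau>0_def by fastforce
      then have "w (X1 y1 t, t) \<noteq> 0" using tI by (simp add: T_def)
      then show ?thesis using dicho[of t] near[OF tI] V1(3) that(1) by blast
    qed
    have zz: "w (X1 y \<tau>0, \<tau>0) = 0" if "y \<in> V1" for y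
    proof -
      have tI: "\<tau>0 \<in> {s'..s0}" using \<tau>0 by auto
      show ?thesis using dicho[of \<tau>0] near[OF tI] V1(3) that \<tau>T by (auto simp: T_def)
    qed
    define \<sigma> where "\<sigma> = (if w (X1 y1 s', s') > 0 then 1 else -1 :: real)"
    have \<sigma>: "\<sigma> = 1 \<or> \<sigma> = -1" by (simp add: \<sigma>_def)
    \<comment> \<open>A continuous function without zeros on the connected set V1 x [s', \<tau>0)
      keeps the sign that it has at (y1, s').\<close>
    have pos: "\<sigma> * w (X1 y t, t) > 0" if yt: "y \<in> V1" "s' \<le> t" "t < \<tau>0" for y t
    proof (rule ccontr)
      define f where "f = (\<lambda>(y, t). \<sigma> * w (X1 y t, t))"
      assume "\<not> \<sigma> * w (X1 y t, t) > 0"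
      then have neg: "f (y, t) < 0" using nz[OF yt] \<sigma> by (auto simp: f_def not_less le_less)
      have pos0: "f (y1, s') > 0" using s'(3) by (auto simp: f_def \<sigma>_def)
      have "connected (V1 \<times> {s'..<\<tau>0})" by (intro connected_Times V1 connected_Ico)
      moreover have "continuous_on (V1 \<times> {s'..<\<tau>0}) f"
      proof -
        have "continuous_on (V1 \<times> {s'..<\<tau>0}) (\<lambda>z. \<sigma> * (\<lambda>(y, t). w (X1 y t, t)) z)"
          by (intro continuous_intros continuous_on_subset[OF wc]) (use near \<tau>0 in \<open>auto simp: dist_commute\<close>)
        then show ?thesis by (simp add: f_def case_prod_unfold)
      qed
      ultimately have "connected (f ` (V1 \<times> {s'..<\<tau>0}))" by (rule connected_continuous_image[rotated])
      moreover have "f (y, t) \<in> f ` (V1 \<times> {s'..<\<tau>0})" "f (y1, s') \<in> f ` (V1 \<times> {s'..<\<tau>0})"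
        using yt V1(3) \<tau>0 by auto
      ultimately have "0 \<in> f ` (V1 \<times> {s'..<\<tau>0})"
        using neg pos0 connected_contains_Icc[of "f ` (V1 \<times> {s'..<\<tau>0})" "f (y, t)" "f (y1, s')"] by auto
      then show False using nz \<sigma> by (auto simp: f_def)
    qed
    have nn: "\<sigma> * w (X1 y t, t) \<ge> 0" if "y \<in> V1" "s' \<le> t" "t \<le> \<tau>0" for y t
      using pos[of y t] zz[of y] that by (cases "t = \<tau>0") (auto simp: less_imp_le)
    obtain c where c: "c > 0" "\<And>y. y \<in> V1 \<Longrightarrow> c \<le> \<sigma> * w (X1 y s', s')"
    proof -
      have "continuous_on V1 (\<lambda>y. \<sigma> * w (X1 y s', s'))"
        by (intro continuous_intros wct) (use near[of s'] s's0 in auto)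
      then obtain y where y: "y \<in> V1" "\<And>y'. y' \<in> V1 \<Longrightarrow> \<sigma> * w (X1 y s', s') \<le> \<sigma> * w (X1 y' s', s')"
        using continuous_attains_inf[OF V1(1), of "\<lambda>y. \<sigma> * w (X1 y s', s')"] V1(3) by blast
      then show ?thesis using that[of "\<sigma> * w (X1 y s', s')"] pos[OF y(1), of s'] \<tau>0 by simp
    qed
    \<comment> \<open>Small compared with the separation c at time s', so that no minimum can sit at
      the initial time.\<close>
    define \<epsilon> where "\<epsilon> = min 1 (c / (2 * R\<^sup>2))"
    have \<epsilon>: "0 < \<epsilon>" "\<epsilon> \<le> 1" "\<epsilon> * R\<^sup>2 < c"
    proof -
      show "0 < \<epsilon>" "\<epsilon> \<le> 1" using c R by (auto simp: \<epsilon>_def)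
      have "\<epsilon> * R\<^sup>2 \<le> c / (2 * R\<^sup>2) * R\<^sup>2" by (intro mult_right_mono) (auto simp: \<epsilon>_def)
      also have "\<dots> < c" using c R by simp
      finally show "\<epsilon> * R\<^sup>2 < c" .
    qed
    define \<Phi> where "\<Phi> = (\<lambda>z::'a \<times> real. \<sigma> * w z + \<epsilon> * ((fst z - p) \<bullet> (fst z - p)) + \<epsilon> * \<Lambda> * (snd z - s'))"
    define Kc where "Kc = V1 \<times> {s'..\<tau>0}"
    have KcF: "Kc \<subseteq> D1 \<times> {a..b}" "F ` Kc \<subseteq> S"
    proof -
      have "y \<in> D1 \<and> t \<in> {a..b} \<and> (X1 y t, t) \<in> S" if "y \<in> V1" "s' \<le> t" "t \<le> \<tau>0" for y t
      proof -
        have "t \<in> {s'..s0}" using that \<tau>0 by auto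
        from near[OF this] show ?thesis using V1D(2,3)[OF that(1), of t] by blast
      qed
      then show "Kc \<subseteq> D1 \<times> {a..b}" "F ` Kc \<subseteq> S" by (auto simp: Kc_def F_def)
    qed
    have "continuous_on Kc (\<lambda>z. \<Phi> (F z))"
      unfolding \<Phi>_def
      by (intro continuous_intros continuous_on_compose2[OF sheet_continuous(1)[OF sh] continuous_on_subset[OF contF]]
          continuous_on_subset[OF contF]) (use KcF in auto)
    moreover have "compact Kc" "Kc \<noteq> {}" unfolding Kc_def using V1 \<tau>0 by (auto intro: compact_Times)
    ultimately obtain zm where zm: "zm \<in> Kc" "\<And>z. z \<in> Kc \<Longrightarrow> \<Phi> (F zm) \<le> \<Phi> (F z)"
      using continuous_attains_inf[of Kc "\<lambda>z. \<Phi> (F z)"] by blast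
    obtain ym tm where yt: "zm = (ym, tm)" by (cases zm)
    have ym: "ym \<in> V1" "s' \<le> tm" "tm \<le> \<tau>0" using zm(1) yt by (auto simp: Kc_def)
    have tmI: "tm \<in> {s'..s0}" using ym \<tau>0 by auto
    note nm = near[OF tmI]
    \<comment> \<open>The point (y1, \<tau>0) has height zero and its two remaining terms are at
      most \<epsilon> R^2 / 4 and \<epsilon> R^2 / 2. The minimum is therefore below \<epsilon> R^2,
      which rules out the initial time and the rim of the disc, where |x - p| is at least R.\<close>
    have val: "\<Phi> (X1 ym tm, tm) < \<epsilon> * R\<^sup>2"
    proof -
      have tI: "\<tau>0 \<in> {s'..s0}" using \<tau>0 by auto
      have "\<Phi> (F zm) \<le> \<Phi> (F (y1, \<tau>0))" by (rule zm(2)) (use V1(3) \<tau>0 in \<open>simp add: Kc_def\<close>)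
      also have "\<dots> = \<epsilon> * ((dist (X1 y1 \<tau>0) p)\<^sup>2 + \<Lambda> * (\<tau>0 - s'))"
        using zz[OF V1(3)] by (simp add: \<Phi>_def F_def dist_norm power2_norm_eq_inner algebra_simps)
      also have "\<dots> < \<epsilon> * R\<^sup>2"
      proof -
        have "dist (X1 y1 \<tau>0) p < R / 2" using \<delta>1(2) near[OF tI] by blast
        then have "(dist (X1 y1 \<tau>0) p)\<^sup>2 \<le> (R / 2)\<^sup>2" by (intro power_mono) auto
        moreover have "\<Lambda> * (\<tau>0 - s') \<le> \<Lambda> * \<delta>2" using \<rho>(2) s'(2) \<tau>0 by (intro mult_left_mono) auto
        moreover have "(R / 2)\<^sup>2 + R\<^sup>2 / 2 < R\<^sup>2" using R(1) by (simp add: power_divide)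
        ultimately show ?thesis using \<epsilon>(1) \<delta>2(4) by (intro mult_strict_left_mono) auto
      qed
      finally show ?thesis by (simp add: F_def yt)
    qed
    have nnm: "\<sigma> * w (X1 ym tm, tm) \<ge> 0" by (rule nn[OF ym])
    have \<Lambda>nn: "\<epsilon> * \<Lambda> * (tm - s') \<ge> 0" using \<epsilon> \<rho>(2) ym by simp
    have qnn: "\<epsilon> * ((X1 ym tm - p) \<bullet> (X1 ym tm - p)) \<ge> 0" using \<epsilon> by simp
    have tms': "tm \<noteq> s'"
    proof
      assume "tm = s'"
      then have "c \<le> \<sigma> * w (X1 ym tm, tm)" using c(2)[OF ym(1)] by simp
      then show False using val \<epsilon>(3) \<Lambda>nn qnn by (simp add: \<Phi>_def)
    qed
    have ymr: "dist ym y1 < r'"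
    proof (rule ccontr)
      assume "\<not> dist ym y1 < r'"
      then have "dist ym y1 = r'" using ym(1) by (auto simp: V1_def dist_commute)
      then have "R \<le> dist (X1 ym tm) p" using R(5) ym(1) nm by (auto simp: V1_def)
      then have "R\<^sup>2 \<le> (X1 ym tm - p) \<bullet> (X1 ym tm - p)"
        using R(1) power_mono[of R "dist (X1 ym tm) p" 2] by (simp add: dist_norm power2_norm_eq_inner)
      then have "\<epsilon> * R\<^sup>2 \<le> \<epsilon> * ((X1 ym tm - p) \<bullet> (X1 ym tm - p))" using \<epsilon> by (intro mult_left_mono) auto
      then show False using val nnm \<Lambda>nn by (simp add: \<Phi>_def)
    qed
    define d where "d = min (r' - dist ym y1) (tm - s')"
    have d: "d > 0" using ymr tms' ym by (auto simp: d_def)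
    have "mcf_defect (\<lambda>z. \<sigma> *\<^sub>R g z + (2 * \<epsilon>) *\<^sub>R (fst z - p)) (\<lambda>z. \<sigma> * \<tau> z + \<epsilon> * \<Lambda>)
        (\<lambda>z h. \<sigma> *\<^sub>R g' z h + (2 * \<epsilon>) *\<^sub>R fst h) (X1 ym tm, tm) \<le> 0"
    proof (rule touching[OF P1 _ _ _ _ _ jet_on_barrier[OF sheetD(7)[OF sh], of \<sigma> \<epsilon> p \<Lambda> s', folded \<Phi>_def] sheetD(5)[OF sh] _ d])
      show "ym \<in> model_hyperplane" using ym(1) by (simp add: V1_def)
      show "dist ym y1 < rp" using ymr r' by simp
      show "tm \<in> {a..b}" "dist tm s0 < rp" "(X1 ym tm, tm) \<in> S" using nm r' V1D[OF ym(1)] by auto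
      show "a < tm" using s' tms' ym by auto
      fix y' s assume H: "y' \<in> model_hyperplane" "dist y' ym < d" "tm - d < s" "s \<le> tm"
      have "dist y' y1 \<le> r'" using H(2) dist_triangle[of y' y1 ym] by (simp add: d_def)
      then have "(y', s) \<in> Kc" using H ym by (auto simp: Kc_def V1_def dist_commute d_def)
      from zm(2)[OF this] show "\<Phi> (X1 ym tm, tm) \<le> \<Phi> (X1 y' s, s)" by (simp add: F_def yt)
    qed
    moreover have "0 < mcf_defect (\<lambda>z. \<sigma> *\<^sub>R g z + (2 * \<epsilon>) *\<^sub>R (fst z - p)) (\<lambda>z. \<sigma> * \<tau> z + \<epsilon> * \<Lambda>)
        (\<lambda>z h. \<sigma> *\<^sub>R g' z h + (2 * \<epsilon>) *\<^sub>R fst h) (X1 ym tm, tm)"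
    proof (rule bar[OF \<sigma> \<epsilon>(1,2)])
      have "dist (X1 ym tm) p < R0" by (rule V1D(4)[OF ym(1)]) (use nm in auto)
      then show "dist (X1 ym tm) p \<le> \<rho>" using R0 by simp
      show "dist tm s0 \<le> \<rho>" "tm \<in> {a..b}" using nm r' by auto
      have "\<sigma> * w (X1 ym tm, tm) < \<epsilon> * R\<^sup>2" using val \<Lambda>nn qnn by (simp add: \<Phi>_def)
      also have "\<dots> \<le> \<epsilon> * 1" using \<epsilon> R(1) R1(1) by (intro mult_left_mono) (auto simp: power_le_one)
      finally show "\<bar>w (X1 ym tm, tm)\<bar> \<le> \<epsilon>" using nnm \<sigma> by auto
    qed
    ultimately show ?thesis by simp
  qed
qed

text \<open>The supremum m of the times of disagreement is a time of agreement by continuity, and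
  \<open>no_merging_local\<close> at m extends the agreement below m, contrary to the choice of
  m.\<close>

theorem no_merging:
  assumes C1: "(D1, X1) \<in> charts" "y1 \<in> D1" and C2: "(D2, X2) \<in> charts" "y2 \<in> D2"
    and s0: "s0 \<in> {a..b}" and eq: "X1 y1 s0 = X2 y2 s0" and s: "s \<in> {a..s0}"
  shows "X1 y1 s = X2 y2 s"
proof (rule ccontr)
  assume ne: "X1 y1 s \<noteq> X2 y2 s"
  define T where "T = {t \<in> {s..s0}. X1 y1 t \<noteq> X2 y2 t}"
  define m where "m = Sup T"
  have sT: "s \<in> T" using s ne by (simp add: T_def)
  have bd: "bdd_above T" by (auto simp: T_def intro: bdd_aboveI[of _ s0])
  have m: "s \<le> m" "m \<le> s0"
  proof -
    show "s \<le> m" unfolding m_def by (rule cSup_upper[OF sT bd])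
    show "m \<le> s0" unfolding m_def by (rule cSup_least) (use sT in \<open>auto simp: T_def\<close>)
  qed
  have mI: "m \<in> {a..b}" using m s s0 by auto
  have above: "X1 y1 t = X2 y2 t" if "m < t" "t \<le> s0" for t
  proof (rule ccontr)
    assume "X1 y1 t \<noteq> X2 y2 t"
    then have "t \<in> T" using that m by (simp add: T_def)
    then have "t \<le> m" unfolding m_def by (rule cSup_upper[OF _ bd])
    then show False using that by simp
  qed
  have mm: "X1 y1 m = X2 y2 m"
  proof (cases "m = s0")
    case False
    have cont: "continuous_on {a..b} (\<lambda>t. X1 y1 t - X2 y2 t)"
      by (rule continuous_on_diff[OF trajectory_continuous[OF C1] trajectory_continuous[OF C2]])
    have "closed {t \<in> {m..s0}. X1 y1 t - X2 y2 t = 0}"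
      by (intro continuous_closed_preimage_constant continuous_on_subset[OF cont] closed_atLeastAtMost)
        (use m s s0 in auto)
    then have "closure {m<..s0} \<subseteq> {t \<in> {m..s0}. X1 y1 t - X2 y2 t = 0}"
      by (intro closure_minimal) (use above in auto)
    then have "X1 y1 m - X2 y2 m = 0" using False m by (auto simp: closure_greaterThanAtMost)
    then show ?thesis by simp
  qed (use eq in simp)
  have sm: "s < m" using mm ne m by (cases "s = m") auto
  then have "a < m" using s by auto
  from no_merging_local[OF C1 C2 mI this mm] obtain e where e: "e > 0" "\<And>t. t \<in> {a..m} \<Longrightarrow> m - e < t \<Longrightarrow> X1 y1 t = X2 y2 t" by blast
  obtain t where t: "t \<in> T" "m - e < t" using less_cSup_iff[OF _ bd, of "m - e"] sT e(1) by (auto simp: m_def)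
  have "t \<le> m" using cSup_upper[OF t(1) bd] by (simp add: m_def)
  then show False using e(2)[of t] t s by (auto simp: T_def)
qed

end

section \<open>Compactness of the flow and absence of splitting\<close>

text \<open>A direction in which one defining function decreases enters the set, so the other cannot
  increase in it to first order. Two half-spaces related in this way have the same boundary
  hyperplane and the same side, so the gradients are positive multiples of each other.\<close>

lemma local_defining_functions_parallel:
  assumes 1: "local_defining_function \<Omega> U \<rho>" and 2: "local_defining_function \<Omega> V \<kappa>"
    and op: "open \<Omega>" and p: "p \<in> U" "p \<in> V" "\<rho> p = 0"
  shows "gradient \<rho> p /\<^sub>R norm (gradient \<rho> p) = gradient \<kappa> p /\<^sub>R norm (gradient \<kappa> p)"
proof -
  note L1 = local_defining_function_facts[OF 1 op] and L2 = local_defining_function_facts[OF 2 op]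
  define c where "c = gradient \<rho> p"
  define d where "d = gradient \<kappa> p"
  have nz: "c \<noteq> 0" "d \<noteq> 0" using L1(5)[OF p(1)] L2(5)[OF p(2)] by (auto simp: c_def d_def)
  have pn: "p \<notin> \<Omega>" using L1(6)[OF p(1)] p(3) by simp
  have k0: "\<kappa> p \<ge> 0" using pn L2(6)[OF p(2)] by auto
  have line: "((\<lambda>s. f (p + s *\<^sub>R v)) has_real_derivative e \<bullet> v) (at 0)"
    if "(f has_derivative (\<lambda>v. e \<bullet> v)) (at p)" for f e v
  proof -
    have c: "((\<lambda>s. p + s *\<^sub>R v) has_derivative (\<lambda>h. h *\<^sub>R v)) (at 0)" by (auto intro!: derivative_eq_intros)
    have "((\<lambda>s. f (p + s *\<^sub>R v)) has_derivative (\<lambda>h. e \<bullet> (h *\<^sub>R v))) (at 0)"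
      using has_derivative_compose[OF c, of f "\<lambda>v. e \<bullet> v"] that by simp
    then show ?thesis by (simp add: has_field_derivative_def mult_commute_abs)
  qed
  have le: "d \<bullet> v \<le> 0" if v: "c \<bullet> v < 0" for v
  proof (rule ccontr)
    assume "\<not> d \<bullet> v \<le> 0"
    then obtain e1 where e1: "e1 > 0" "\<And>h. 0 < h \<Longrightarrow> h < e1 \<Longrightarrow> \<kappa> (p + 0 *\<^sub>R v) < \<kappa> (p + (0 + h) *\<^sub>R v)"
      using DERIV_pos_inc_right[OF line[OF L2(3)[OF p(2)]]] by (auto simp: d_def not_le)
    obtain e2 where e2: "e2 > 0" "\<And>h. 0 < h \<Longrightarrow> h < e2 \<Longrightarrow> \<rho> (p + 0 *\<^sub>R v) > \<rho> (p + (0 + h) *\<^sub>R v)"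
      using DERIV_neg_dec_right[OF line[OF L1(3)[OF p(1)]]] v by (auto simp: c_def)
    have "((\<lambda>h. p + h *\<^sub>R v) \<longlongrightarrow> p + 0 *\<^sub>R v) (at_right 0)" by (intro tendsto_intros)
    then have "eventually (\<lambda>h. p + h *\<^sub>R v \<in> U \<inter> V) (at_right 0)"
      by (rule topological_tendstoD) (use L1(1) L2(1) p in auto)
    moreover have "eventually (\<lambda>h. 0 < h \<and> h < min e1 e2) (at_right (0::real))"
      using eventually_at_right_real[of 0 "min e1 e2"] e1 e2 by (auto elim: eventually_mono)
    ultimately have "eventually (\<lambda>h::real. False) (at_right 0)"
    proof eventually_elim
      case (elim h)
      then have "\<rho> (p + h *\<^sub>R v) < 0" "\<kappa> (p + h *\<^sub>R v) > 0" using e1(2)[of h] e2(2)[of h] p(3) k0 by auto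
      then show ?case using L1(6) L2(6) elim by fastforce
    qed
    then show False by (simp add: trivial_limit_at_right_real)
  qed
  define l where "l = (c \<bullet> d) / (c \<bullet> c)"
  have cc: "c \<bullet> c > 0" using nz by simp
  define v where "v = d - l *\<^sub>R c"
  have cv: "c \<bullet> v = 0" using cc by (simp add: v_def l_def inner_diff_right)
  \<comment> \<open>The part v of d orthogonal to c is only a limiting direction for
    \<open>le\<close>; tilting it by - \<delta> c makes the hypothesis strict.\<close>
  have "d \<bullet> v \<le> 0"
  proof (rule field_le_epsilon)
    fix e :: real assume e: "e > 0"
    define \<delta> where "\<delta> = e / (1 + \<bar>d \<bullet> c\<bar>)"
    have \<delta>: "\<delta> > 0" using e by (simp add: \<delta>_def add_pos_nonneg)
    have "d \<bullet> (v - \<delta> *\<^sub>R c) \<le> 0" by (rule le) (use cv \<delta> cc in \<open>simp add: inner_diff_right\<close>)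
    then have "d \<bullet> v \<le> \<delta> * (d \<bullet> c)" by (simp add: inner_diff_right)
    also have "\<dots> \<le> \<delta> * (1 + \<bar>d \<bullet> c\<bar>)" using \<delta> by (intro mult_left_mono) auto
    also have "\<dots> = e" by (simp add: \<delta>_def add_nonneg_eq_0_iff)
    finally show "d \<bullet> v \<le> 0 + e" by simp
  qed
  moreover have "d \<bullet> v = v \<bullet> v" using cv by (simp add: v_def inner_diff_left inner_diff_right inner_commute)
  ultimately have "v \<bullet> v = 0" using inner_ge_zero[of v] by linarith
  then have dl: "d = l *\<^sub>R c" by (simp add: v_def)
  have "d \<bullet> (- c) \<le> 0" by (rule le) (use cc in simp)
  then have "l * (c \<bullet> c) \<ge> 0" using dl by simp
  then have "l \<ge> 0" using cc by (simp add: zero_le_mult_iff)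
  moreover have "l \<noteq> 0" using dl nz by auto
  ultimately have "l > 0" by simp
  then show ?thesis unfolding c_def[symmetric] d_def[symmetric] dl by simp
qed

text \<open>Quantifies over all local defining functions, so that no normal field has to be chosen;
  the field points strictly outwards.\<close>

definition transversal_field :: "'a::euclidean_space set \<Rightarrow> ('a \<Rightarrow> 'a) \<Rightarrow> bool" where
  "transversal_field \<Omega> N \<longleftrightarrow>
     (\<forall>p U \<rho>. p \<in> frontier \<Omega> \<longrightarrow> p \<in> U \<longrightarrow> local_defining_function \<Omega> U \<rho> \<longrightarrow> gradient \<rho> p \<bullet> N p > 0)"

text \<open>The unit normal is continuous on the compact boundary, and Stone-Weierstrass gives a
  polynomial map within 1/2 of it. Its product with the unit normal then exceeds 1/2, and
  polynomials are smooth on the whole space.\<close>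

lemma transversal_field_exists:
  fixes \<Omega> :: "'a::euclidean_space set"
  assumes op: "open \<Omega>" and cp: "compact (closure \<Omega>)" and sm: "smooth_boundary \<Omega>"
  shows "\<exists>N :: 'a \<Rightarrow> 'a. (\<forall>k. Ck_on k UNIV N) \<and> transversal_field \<Omega> N"
proof -
  define M where "M = frontier \<Omega>"
  have cM: "compact M" unfolding M_def frontier_def using cp op by (simp add: compact_diff interior_open)
  define \<nu> where "\<nu> = (\<lambda>p. SOME n. \<exists>U \<rho>. p \<in> U \<and> local_defining_function \<Omega> U \<rho> \<and> n = gradient \<rho> p /\<^sub>R norm (gradient \<rho> p))"
  have \<nu>: "\<nu> p = gradient \<rho> p /\<^sub>R norm (gradient \<rho> p)"
    if p: "p \<in> M" "p \<in> U" "local_defining_function \<Omega> U \<rho>" for p U \<rho>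
  proof -
    have "\<exists>V \<kappa>. p \<in> V \<and> local_defining_function \<Omega> V \<kappa> \<and> \<nu> p = gradient \<kappa> p /\<^sub>R norm (gradient \<kappa> p)"
      unfolding \<nu>_def by (rule someI) (use p in blast)
    then obtain V \<kappa> where V: "p \<in> V" "local_defining_function \<Omega> V \<kappa>" "\<nu> p = gradient \<kappa> p /\<^sub>R norm (gradient \<kappa> p)" by blast
    have "\<kappa> p = 0" by (rule local_defining_function_facts(7)[OF V(2) op V(1)]) (use p in \<open>simp add: M_def\<close>)
    then show ?thesis using local_defining_functions_parallel[OF V(2) p(3) op V(1) p(2)] V(3) by simp
  qed
  have "continuous_on M \<nu>"
    unfolding continuous_on_eq_continuous_within
  proof
    fix p assume p: "p \<in> M"
    then obtain U \<rho> where U: "p \<in> U" "local_defining_function \<Omega> U \<rho>"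
      using sm unfolding smooth_boundary_def M_def by blast
    note L = local_defining_function_facts[OF U(2) op]
    have "continuous_on U (\<lambda>x. gradient \<rho> x /\<^sub>R norm (gradient \<rho> x))"
      by (intro continuous_intros L(4)) (use L(5) in auto)
    then have "isCont (\<lambda>x. gradient \<rho> x /\<^sub>R norm (gradient \<rho> x)) p"
      using L(1) U(1) by (simp add: continuous_on_eq_continuous_at)
    then have "continuous (at p within M) (\<lambda>x. gradient \<rho> x /\<^sub>R norm (gradient \<rho> x))"
      by (rule continuous_at_imp_continuous_at_within)
    then show "continuous (at p within M) \<nu>"
    proof (rule continuous_transform_within_openin)
      show "openin (top_of_set M) (M \<inter> U)" using L(1) by (rule openin_open_Int)
      show "gradient \<rho> x /\<^sub>R norm (gradient \<rho> x) = \<nu> x" if "x \<in> M \<inter> U" for x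
        using \<nu>[of x U \<rho>] that U(2) by auto
    qed (use p U in auto)
  qed
  from Stone_Weierstrass_polynomial_function[OF cM this, of "1/2"]
  obtain N where N: "polynomial_function N" "\<And>x. x \<in> M \<Longrightarrow> norm (\<nu> x - N x) < 1/2" by auto
  show ?thesis
  proof (intro exI[of _ N] conjI allI)
    show "Ck_on k UNIV N" for k by (rule Ck_on_polynomial_function[OF N(1) open_UNIV])
    show "transversal_field \<Omega> N"
      unfolding transversal_field_def
    proof (intro allI impI)
    fix p U \<rho> assume p: "p \<in> frontier \<Omega>" "p \<in> U" "local_defining_function \<Omega> U \<rho>"
    define c where "c = gradient \<rho> p"
    have c: "norm c > 0" using local_defining_function_facts(5)[OF p(3) op p(2)] by (simp add: c_def)
    have \<nu>p: "\<nu> p = c /\<^sub>R norm c" unfolding c_def by (rule \<nu>) (use p in \<open>auto simp: M_def\<close>)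
    then have "c = norm c *\<^sub>R \<nu> p" "norm (\<nu> p) = 1" using c by auto
    have "\<bar>\<nu> p \<bullet> (\<nu> p - N p)\<bar> \<le> norm (\<nu> p) * norm (\<nu> p - N p)" by (rule Cauchy_Schwarz_ineq2)
    then have "\<nu> p \<bullet> \<nu> p - \<nu> p \<bullet> N p < 1 / 2"
      using N(2)[of p] p(1) \<open>norm (\<nu> p) = 1\<close> by (auto simp: M_def inner_diff_right abs_le_iff)
    then have "\<nu> p \<bullet> N p > 0" using \<open>norm (\<nu> p) = 1\<close> by (simp add: norm_eq_1)
    then have "norm c * (\<nu> p \<bullet> N p) > 0" using c by simp
    also have "norm c * (\<nu> p \<bullet> N p) = c \<bullet> N p"
      by (subst (2) \<open>c = norm c *\<^sub>R \<nu> p\<close>) simp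
    finally show "gradient \<rho> p \<bullet> N p > 0" by (simp add: c_def)
    qed
  qed
qed

text \<open>The injectivity half of a tubular neighbourhood, by the same use of Rolle's theorem as
  in \<open>sheet_zero_nearby\<close>; compactness of the boundary makes the bound on the heights
  uniform.\<close>

lemma transversal_translates_disjoint:
  fixes \<Omega> :: "'a::euclidean_space set"
  assumes op: "open \<Omega>" and cp: "compact (closure \<Omega>)" and sm: "smooth_boundary \<Omega>" and contN: "continuous_on UNIV N"
    and N0: "transversal_field \<Omega> N"
  shows "\<exists>h0>0. \<forall>x h. x \<in> frontier \<Omega> \<longrightarrow> x + h *\<^sub>R N x \<in> frontier \<Omega> \<longrightarrow> \<bar>h\<bar> \<le> h0 \<longrightarrow> h = 0"
proof (rule ccontr)
  note N = N0[unfolded transversal_field_def, rule_format]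
  assume neg: "\<not> ?thesis"
  have "\<exists>x h. x \<in> frontier \<Omega> \<and> x + h *\<^sub>R N x \<in> frontier \<Omega> \<and> \<bar>h\<bar> \<le> inverse (real (Suc k)) \<and> h \<noteq> 0" for k
  proof -
    have "inverse (real (Suc k)) > 0" by simp
    then show ?thesis using neg by blast
  qed
  then obtain x h where xh: "\<And>k. x k \<in> frontier \<Omega>" "\<And>k. x k + h k *\<^sub>R N (x k) \<in> frontier \<Omega>"
    "\<And>k. \<bar>h k\<bar> \<le> inverse (real (Suc k))" "\<And>k. h k \<noteq> 0" by metis
  have h0: "h \<longlonglongrightarrow> 0"
    by (rule Lim_null_comparison[OF always_eventually LIMSEQ_inverse_real_of_nat]) (use xh(3) in auto)
  have "compact (frontier \<Omega>)" unfolding frontier_def using cp op by (simp add: compact_diff interior_open)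
  then obtain p r where p: "p \<in> frontier \<Omega>" "strict_mono r" "(x \<circ> r) \<longlonglongrightarrow> p"
    using xh(1) unfolding compact_def by blast
  obtain U \<rho> where U: "p \<in> U" "local_defining_function \<Omega> U \<rho>" using sm p(1) unfolding smooth_boundary_def by blast
  note L = local_defining_function_facts[OF U(2) op]
  obtain \<delta> where \<delta>: "\<delta> > 0" "ball p \<delta> \<subseteq> U" using L(1) U(1) openE by blast
  define y where "y = x \<circ> r"
  define k where "k = h \<circ> r"
  have ylim: "y \<longlonglongrightarrow> p" using p(3) by (simp add: y_def)
  have klim: "k \<longlonglongrightarrow> 0" using LIMSEQ_subseq_LIMSEQ[OF h0 p(2)] by (simp add: k_def)
  have Nlim: "(\<lambda>j. N (y j)) \<longlonglongrightarrow> N p"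
    by (rule continuous_on_tendsto_compose[OF contN ylim]) auto
  have "((\<lambda>j. dist (y j) p + \<bar>k j\<bar> * norm (N (y j))) \<longlongrightarrow> dist p p + \<bar>0\<bar> * norm (N p)) sequentially"
    by (intro tendsto_intros ylim klim Nlim)
  then have ev: "eventually (\<lambda>j. dist (y j) p + \<bar>k j\<bar> * norm (N (y j)) < \<delta>) sequentially"
    using \<delta>(1) by (intro order_tendstoD(2)) auto
  have "eventually (\<lambda>j. \<exists>s. \<bar>s\<bar> \<le> \<bar>k j\<bar> \<and> y j + s *\<^sub>R N (y j) \<in> U \<and> gradient \<rho> (y j + s *\<^sub>R N (y j)) \<bullet> N (y j) = 0) sequentially"
    using ev
  proof eventually_elim
    case (elim j)
    define n where "n = N (y j)"
    have inU: "y j + s *\<^sub>R n \<in> U" if "\<bar>s\<bar> \<le> \<bar>k j\<bar>" for s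
    proof -
      have "dist (y j + s *\<^sub>R n) p \<le> dist (y j + s *\<^sub>R n) (y j) + dist (y j) p" by (rule dist_triangle)
      also have "dist (y j + s *\<^sub>R n) (y j) = \<bar>s\<bar> * norm n" by (simp add: dist_norm)
      also have "\<dots> \<le> \<bar>k j\<bar> * norm n" using that by (intro mult_right_mono) auto
      finally show ?thesis using elim \<delta>(2) by (auto simp: n_def dist_commute)
    qed
    have k0: "k j \<noteq> 0" using xh(4) by (simp add: k_def)
    define f where "f = (\<lambda>s. \<rho> (y j + (s * k j) *\<^sub>R n))"
    have fd: "(f has_derivative (\<lambda>u. gradient \<rho> (y j + (s * k j) *\<^sub>R n) \<bullet> ((u * k j) *\<^sub>R n))) (at s)" if "0 \<le> s" "s \<le> 1" for s
    proof -
      have c: "((\<lambda>s. y j + (s * k j) *\<^sub>R n) has_derivative (\<lambda>u. (u * k j) *\<^sub>R n)) (at s)"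
        by (auto intro!: derivative_eq_intros)
      have "\<bar>s * k j\<bar> \<le> \<bar>k j\<bar>" using that by (simp add: abs_mult mult_left_le_one_le)
      from has_derivative_compose[OF c L(3)[OF inU[OF this]]] show ?thesis by (simp add: f_def)
    qed
    have "f 0 = 0" unfolding f_def using L(7)[of "y j"] inU[of 0] xh(1) by (simp add: y_def)
    moreover have "f 1 = 0" unfolding f_def using L(7)[of "y j + k j *\<^sub>R n"] inU[of "k j"] xh(2)
      by (simp add: y_def k_def n_def)
    moreover have "continuous_on {0..1} f"
      using fd has_derivative_continuous by (intro continuous_at_imp_continuous_on) force
    ultimately obtain s where s: "0 < s" "s < 1" "(\<lambda>u. gradient \<rho> (y j + (s * k j) *\<^sub>R n) \<bullet> ((u * k j) *\<^sub>R n)) = (\<lambda>v. 0)"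
      using Rolle_deriv[of 0 1 f "\<lambda>s u. gradient \<rho> (y j + (s * k j) *\<^sub>R n) \<bullet> ((u * k j) *\<^sub>R n)"] fd by force
    have "gradient \<rho> (y j + (s * k j) *\<^sub>R n) \<bullet> n = 0" using fun_cong[OF s(3), of 1] k0 by simp
    moreover have "\<bar>s * k j\<bar> \<le> \<bar>k j\<bar>" using s by (simp add: abs_mult mult_left_le_one_le)
    ultimately show ?case using inU by (auto simp: n_def[symmetric])
  qed
  then obtain j0 where "\<And>j. j \<ge> j0 \<Longrightarrow> \<exists>s. \<bar>s\<bar> \<le> \<bar>k j\<bar> \<and> y j + s *\<^sub>R N (y j) \<in> U \<and> gradient \<rho> (y j + s *\<^sub>R N (y j)) \<bullet> N (y j) = 0"
    by (auto simp: eventually_sequentially)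
  then obtain sk where sk: "\<And>j. j \<ge> j0 \<Longrightarrow> \<bar>sk j\<bar> \<le> \<bar>k j\<bar> \<and> y j + sk j *\<^sub>R N (y j) \<in> U \<and> gradient \<rho> (y j + sk j *\<^sub>R N (y j)) \<bullet> N (y j) = 0"
    by metis
  have evk: "eventually (\<lambda>j. j \<ge> j0) sequentially" by (rule eventually_ge_at_top)
  have "sk \<longlonglongrightarrow> 0"
    by (rule Lim_null_comparison[OF eventually_mono[OF evk] tendsto_rabs_zero[OF klim]]) (use sk in auto)
  then have "(\<lambda>j. y j + sk j *\<^sub>R N (y j)) \<longlonglongrightarrow> p + 0 *\<^sub>R N p"
    by (intro tendsto_intros ylim Nlim)
  then have "(\<lambda>j. gradient \<rho> (y j + sk j *\<^sub>R N (y j))) \<longlonglongrightarrow> gradient \<rho> p"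
    by (intro continuous_on_tendsto_compose[OF L(4) _ U(1)] eventually_mono[OF evk]) (use sk in auto)
  from tendsto_inner[OF this Nlim]
  have "(\<lambda>j. gradient \<rho> (y j + sk j *\<^sub>R N (y j)) \<bullet> N (y j)) \<longlonglongrightarrow> gradient \<rho> p \<bullet> N p" .
  moreover have "(\<lambda>j. gradient \<rho> (y j + sk j *\<^sub>R N (y j)) \<bullet> N (y j)) \<longlonglongrightarrow> 0"
    by (rule tendsto_eventually, rule eventually_mono[OF evk]) (use sk in auto)
  ultimately have "gradient \<rho> p \<bullet> N p = 0" by (rule LIMSEQ_unique)
  then show False using N[OF p(1) U] by simp
qed

lemma jet_on_exp_weight:
  assumes "jet_on S w g \<tau> g'"
  shows "jet_on S (\<lambda>z. c * exp (- k * (snd z - s0)) * w z) (\<lambda>z. (c * exp (- k * (snd z - s0))) *\<^sub>R g z)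
    (\<lambda>z. (c * exp (- k * (snd z - s0))) * (\<tau> z - k * w z))
    (\<lambda>z h. (c * exp (- k * (snd z - s0))) *\<^sub>R (g' z h - (k * snd h) *\<^sub>R g z))"
  unfolding jet_on_def
proof (intro ballI conjI)
  fix z assume z: "z \<in> S"
  have e: "((\<lambda>z. c * exp (- k * (snd z - s0))) has_derivative (\<lambda>h. c * exp (- k * (snd z - s0)) * (- k * snd h))) (at z)"
    by (auto intro!: derivative_eq_intros)
  show "((\<lambda>z. c * exp (- k * (snd z - s0)) * w z) has_derivative
      (\<lambda>(\<xi>, s). ((c * exp (- k * (snd z - s0))) *\<^sub>R g z) \<bullet> \<xi> + (c * exp (- k * (snd z - s0))) * (\<tau> z - k * w z) * s)) (at z)"
    by (rule has_derivative_eq_rhs[OF has_derivative_mult[OF e jet_onD(1)[OF assms z]]])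
      (auto simp: fun_eq_iff algebra_simps)
  show "((\<lambda>z. (c * exp (- k * (snd z - s0))) *\<^sub>R g z) has_derivative
      (\<lambda>h. (c * exp (- k * (snd z - s0))) *\<^sub>R (g' z h - (k * snd h) *\<^sub>R g z))) (at z)"
    by (rule has_derivative_eq_rhs[OF has_derivative_scaleR[OF e jet_onD(2)[OF assms z]]])
      (auto simp: fun_eq_iff algebra_simps)
qed

text \<open>A weight depending on time alone multiplies the spatial jet and adds only - k w to the
  time derivative. This zero order term is what can dominate the bound K |w| on the defect when k is
  large.\<close>

lemma mcf_defect_exp_weight:
  fixes e :: "'a::euclidean_space \<times> real \<Rightarrow> real"
  assumes "linear (g' z)"
  shows "mcf_defect (\<lambda>z. e z *\<^sub>R g z) (\<lambda>z. e z * (\<tau> z - k * w z)) (\<lambda>z h. e z *\<^sub>R (g' z h - (k * snd h) *\<^sub>R g z)) z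
    = e z ^ 3 * (mcf_defect g \<tau> g' z - k * w z * (g z \<bullet> g z))"
proof -
  have "g' z (e z *\<^sub>R g z, 0) = e z *\<^sub>R g' z (g z, 0)"
    using linear_cmul[OF assms, of "e z" "(g z, 0)"] by simp
  moreover have "hessian_trace (\<lambda>h. e z *\<^sub>R (g' z h - (k * snd h) *\<^sub>R g z)) = e z * hessian_trace (g' z)"
    by (simp add: hessian_trace_def sum_distrib_left)
  ultimately show ?thesis
    by (simp add: mcf_defect_def power3_eq_cube algebra_simps)
qed

section \<open>Finite covers of the flow by compact parameter pieces\<close>

context flow_family
begin

lemma boundary_gradient_normal:
  assumes DX: "(D, X) \<in> charts" "y \<in> D" "t \<in> {a..b}"
    and U: "X y t \<in> U" "local_defining_function (B t) U \<rho>" and v: "v \<in> model_hyperplane"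
  shows "gradient \<rho> (X y t) \<bullet> dir_deriv (\<lambda>y. X y t) y v = 0"
proof -
  note L = local_defining_function_facts[OF U(2) open_B[OF DX(3)]]
  obtain r G where P: "patch D X y t r G" using patch_exists[OF DX] by blast
  have y: "y \<in> model_hyperplane" "dist y y < r" "dist t t < r"
    using chart_subset[OF DX(1,2)] patchD(4)[OF P] by auto
  have contX: "continuous_on D (\<lambda>y. X y t)"
  proof -
    have "continuous_on D ((\<lambda>(y, t). X y t) \<circ> (\<lambda>y. (y, t)))"
      by (rule continuous_on_compose[OF _ continuous_on_subset[OF chart_continuous[OF DX(1)]]])
        (use DX in \<open>auto intro!: continuous_intros\<close>)
    then show ?thesis by (simp add: o_def)
  qed
  have "openin (top_of_set D) (D \<inter> (\<lambda>y. X y t) -` U)"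
    by (rule continuous_openin_preimage_gen[OF contX L(1)])
  then have "openin (top_of_set model_hyperplane) (D \<inter> (\<lambda>y. X y t) -` U)"
    by (rule openin_trans[OF _ chart_open[OF DX(1)]])
  then obtain T where T: "open T" "D \<inter> (\<lambda>y. X y t) -` U = model_hyperplane \<inter> T"
    by (auto simp: openin_open)
  have "y \<in> T" using T(2) DX(2) U(1) by blast
  then have "eventually (\<lambda>y'. y' \<in> T) (nhds y)" using T(1) by (intro eventually_nhds_in_open)
  then have "eventually (\<lambda>y'. y' \<in> model_hyperplane \<longrightarrow> \<rho> (X y' t) = 0) (nhds y)"
    by eventually_elim (use T(2) L(7) chart_frontier[OF DX(1) _ DX(3)] in blast)
  from normal_to_patch[OF P y(1,2) DX(3) y(3) L(3)[OF U(1)] this v]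
  show ?thesis using patch_dir_deriv[OF P y(1,2) DX(3) y(3) v] by simp
qed

lemma transversal_of_gradient:
  assumes DX: "(D, X) \<in> charts" "y \<in> D" "t \<in> {a..b}"
    and N0: "transversal_field (B t) N"
    and v: "v \<in> model_hyperplane"
  shows "dir_deriv (\<lambda>y. X y t) y v \<noteq> N (X y t)"
proof
  assume eq: "dir_deriv (\<lambda>y. X y t) y v = N (X y t)"
  have fr: "X y t \<in> frontier (B t)" by (rule chart_frontier[OF DX])
  obtain U \<rho> where U: "X y t \<in> U" "local_defining_function (B t) U \<rho>"
    using boundary_B[OF DX(3)] fr unfolding smooth_boundary_def by blast
  have "gradient \<rho> (X y t) \<bullet> N (X y t) > 0" using N0 fr U unfolding transversal_field_def by blast
  then show False using boundary_gradient_normal[OF DX U v] eq by simp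
qed

text \<open>The last boundary is compact, hence covered by the images of finitely many compact discs
  at time \<open>b\<close>. Every point of an earlier boundary lies on a trajectory, which reaches
  time \<open>b\<close> inside one of these images; by \<open>no_merging\<close> it coincides at all
  earlier times with the trajectory from the disc.\<close>

lemma finite_compact_cover:
  "\<exists>\<K> :: ('a set \<times> ('a \<Rightarrow> real \<Rightarrow> 'a) \<times> 'a set) set. finite \<K> \<and>
    (\<forall>D X C. (D, X, C) \<in> \<K> \<longrightarrow> (D, X) \<in> charts \<and> compact C \<and> C \<subseteq> D) \<and>
    (\<forall>t x. t \<in> {a..b} \<longrightarrow> x \<in> frontier (B t) \<longrightarrow> (\<exists>D X C y. (D, X, C) \<in> \<K> \<and> y \<in> C \<and> x = X y t))"
proof -
  have bI: "b \<in> {a..b}" using ab by simp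
  define good where "good = (\<lambda>U (k::'a set \<times> ('a \<Rightarrow> real \<Rightarrow> 'a) \<times> 'a set).
    (fst k, fst (snd k)) \<in> charts \<and> compact (snd (snd k)) \<and> snd (snd k) \<subseteq> fst k \<and>
    (\<forall>x\<in>U \<inter> frontier (B b). \<exists>y\<in>snd (snd k). x = fst (snd k) y b))"
  have ex: "\<exists>U k. open U \<and> p \<in> U \<and> good U k" if p: "p \<in> frontier (B b)" for p
  proof -
    obtain D X y where DX: "(D, X) \<in> charts" "y \<in> D" "p = X y b" using frontier_chart[OF bI p] by blast
    obtain n where n: "\<And>v. v \<in> model_hyperplane \<Longrightarrow> dir_deriv (\<lambda>y. X y b) y v \<noteq> n"
      using normal_transversal_exists[OF DX(1,2) bI] by blast
    obtain r S w g \<tau> g' \<eta> K where sh: "sheet D X y b (\<lambda>_. n) r S w g \<tau> g' \<eta> K"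
      using sheet_exists[OF DX(1,2) bI Ck_on_const n] by blast
    note sb = sheet_base[OF sh, folded DX(3)]
    define C where "C = model_hyperplane \<inter> cball y (r / 2)"
    have C: "compact C" unfolding C_def
      using compact_Int_closed[OF compact_cball closed_subspace[OF subspace_model_hyperplane]] by (simp add: Int_commute)
    have CD: "C \<subseteq> D" using sheetD(16)[OF sh] sheetD(4)[OF sh] by (auto simp: C_def dist_commute)
    have "isCont (\<lambda>x. \<eta> (x, b)) p"
    proof -
      have "isCont \<eta> (p, b)"
        using sheet_continuous(2)[OF sh] sheetD(5)[OF sh] sb(2) by (simp add: continuous_on_eq_continuous_at)
      then show ?thesis by (intro isCont_o2[of p "\<lambda>x. (x, b)" \<eta>]) (auto intro!: continuous_intros)
    qed
    then have "((\<lambda>x. \<eta> (x, b)) \<longlongrightarrow> y) (nhds p)"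
      using sb(4) tendsto_at_iff_tendsto_nhds[of "\<lambda>x. \<eta> (x, b)" p] by (simp add: isCont_def)
    then have "eventually (\<lambda>x. dist (\<eta> (x, b)) y < r / 2) (nhds p)"
      by (rule tendstoD) (use sheetD(4)[OF sh] in simp)
    with sheet_zero_nearby[OF sh continuous_on_const sb(2) bI sb(3)]
    have "eventually (\<lambda>x. x \<in> frontier (B b) \<longrightarrow> (\<exists>y\<in>C. x = X y b)) (nhds p)"
    proof eventually_elim
      case (elim x)
      show ?case
      proof
        assume x: "x \<in> frontier (B b)"
        have xS: "(x, b) \<in> S" "w (x, b) = 0" using elim(1) x by auto
        have "x = X (\<eta> (x, b)) b"
          using sheetD(15)[OF sh xS(1) bI, unfolded xS(2) scaleR_zero_left add_0_right] .
        moreover have "\<eta> (x, b) \<in> C" using sheetD(13)[OF sh] elim x by (auto simp: C_def dist_commute)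
        ultimately show "\<exists>y\<in>C. x = X y b" by blast
      qed
    qed
    then obtain U where "open U" "p \<in> U" "\<And>x. x \<in> U \<Longrightarrow> x \<in> frontier (B b) \<Longrightarrow> \<exists>y\<in>C. x = X y b"
      by (auto simp: eventually_nhds)
    then show ?thesis
      using DX(1) C CD by (intro exI[of _ U] exI[of _ "(D, X, C)"]) (auto simp: good_def)
  qed
  then obtain U k where Uk: "\<And>p. p \<in> frontier (B b) \<Longrightarrow> open (U p) \<and> p \<in> U p \<and> good (U p) (k p)" by metis
  have "compact (frontier (B b))"
    unfolding frontier_def using compact_B[OF bI] open_B[OF bI] by (simp add: compact_diff interior_open)
  then obtain F where F: "F \<subseteq> frontier (B b)" "finite F" "frontier (B b) \<subseteq> (\<Union>p\<in>F. U p)"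
  proof (rule compactE_image[of "frontier (B b)" "frontier (B b)" U])
    show "frontier (B b) \<subseteq> (\<Union>p\<in>frontier (B b). U p)" using Uk by blast
  qed (use Uk in auto)
  have A1: "(D, X) \<in> charts \<and> compact C \<and> C \<subseteq> D" if mem: "(D, X, C) \<in> k ` F" for D X C
  proof -
      obtain p where p: "p \<in> F" "(D, X, C) = k p" using mem by (elim imageE)
      then have "good (U p) (D, X, C)" using Uk[of p] F by auto
      then show ?thesis by (simp add: good_def)
    qed
  \<comment> \<open>The point is carried forward to time b along any chart, matched there with a
    chosen disc, and carried back by \<open>no_merging\<close>.\<close>
  have A2: "\<exists>D X C y. (D, X, C) \<in> k ` F \<and> y \<in> C \<and> x = X y t"
    if t: "t \<in> {a..b}" and x: "x \<in> frontier (B t)" for t x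
  proof -
    obtain D X y where DX: "(D, X) \<in> charts" "y \<in> D" "x = X y t" using frontier_chart[OF t x] by blast
    have fb: "X y b \<in> frontier (B b)" by (rule chart_frontier[OF DX(1,2) bI])
    then obtain p where p: "p \<in> F" "X y b \<in> U p" using F(3) by blast
    then have g: "good (U p) (k p)" using Uk[of p] F(1) by auto
    obtain D' X' C' where k: "k p = (D', X', C')" by (cases "k p")
    obtain y' where y': "y' \<in> C'" "X y b = X' y' b" using g p(2) fb by (auto simp: good_def k)
    have C2: "(D', X') \<in> charts" "y' \<in> D'" using g y'(1) by (auto simp: good_def k)
    have "X y t = X' y' t"
      by (rule no_merging[OF DX(1,2) C2 bI y'(2)]) (use t in simp)
    moreover have "(D', X', C') \<in> k ` F" using p(1) k by (metis imageI)
    ultimately show ?thesis using y'(1) DX(3) by auto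
  qed
  have "finite (k ` F)" using F by simp
  then show ?thesis using A1 A2 by (intro exI[of _ "k ` F"] conjI allI impI) auto
qed

lemma track_compact: "compact {(x, t). t \<in> {a..b} \<and> x \<in> frontier (B t)}"
proof -
  obtain \<K> :: "('a set \<times> ('a \<Rightarrow> real \<Rightarrow> 'a) \<times> 'a set) set" where K0: "finite \<K> \<and>
    (\<forall>D X C. (D, X, C) \<in> \<K> \<longrightarrow> (D, X) \<in> charts \<and> compact C \<and> C \<subseteq> D) \<and>
    (\<forall>t x. t \<in> {a..b} \<longrightarrow> x \<in> frontier (B t) \<longrightarrow> (\<exists>D X C y. (D, X, C) \<in> \<K> \<and> y \<in> C \<and> x = X y t))"
    using finite_compact_cover ..
  note K = K0[THEN conjunct1] K0[THEN conjunct2, THEN conjunct1, rule_format] K0[THEN conjunct2, THEN conjunct2, rule_format]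
  have "{(x, t). t \<in> {a..b} \<and> x \<in> frontier (B t)} = (\<Union>(D, X, C)\<in>\<K>. (\<lambda>z. (X (fst z) (snd z), snd z)) ` (C \<times> {a..b}))"
  proof (intro equalityI subsetI)
    fix z assume "z \<in> {(x, t). t \<in> {a..b} \<and> x \<in> frontier (B t)}"
    then obtain x t where z: "z = (x, t)" "t \<in> {a..b}" "x \<in> frontier (B t)" by auto
    from K(3)[OF z(2,3)] obtain D X C y where "(D, X, C) \<in> \<K>" "y \<in> C" "x = X y t" by blast
    note k = this
    have "z \<in> (\<lambda>z. (X (fst z) (snd z), snd z)) ` (C \<times> {a..b})"
      by (rule image_eqI[of _ _ "(y, t)"]) (use z k in auto)
    then show "z \<in> (\<Union>(D, X, C)\<in>\<K>. (\<lambda>z. (X (fst z) (snd z), snd z)) ` (C \<times> {a..b}))"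
      using k(1) by (intro UN_I[of "(D, X, C)"]) simp_all
  next
    fix z assume "z \<in> (\<Union>(D, X, C)\<in>\<K>. (\<lambda>z. (X (fst z) (snd z), snd z)) ` (C \<times> {a..b}))"
    then obtain D X C y t where k: "(D, X, C) \<in> \<K>" "y \<in> C" "t \<in> {a..b}" "z = (X y t, t)" by auto
    then have "(D, X) \<in> charts" "y \<in> D" using K(2)[OF k(1)] by auto
    then show "z \<in> {(x, t). t \<in> {a..b} \<and> x \<in> frontier (B t)}"
      using chart_frontier k(3,4) by simp
  qed
  also have "compact \<dots>"
  proof (intro compact_UN K(1), clarify)
    fix D X C assume k: "(D, X, C) \<in> \<K>"
    have "continuous_on (C \<times> {a..b}) (\<lambda>z. X (fst z) (snd z))"
      using continuous_on_subset[OF chart_continuous[of D X], of "C \<times> {a..b}"] K(2)[OF k]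
      by (auto simp: case_prod_unfold)
    then show "compact ((\<lambda>z. (X (fst z) (snd z), snd z)) ` (C \<times> {a..b}))"
      using K(2)[OF k] by (intro compact_continuous_image compact_Times continuous_intros) auto
  qed
  finally show ?thesis .
qed

text \<open>Infinitely many points fall into one of the finitely many pieces, and the parameters
  converge along a further subsequence because the piece is compact.\<close>

lemma representatives_subsequence:
  assumes tk: "\<And>k. tk k \<in> {a..b}" "\<And>k. xk k \<in> frontier (B (tk k))"
  shows "\<exists>(\<rho> :: nat \<Rightarrow> nat) D X y yk. strict_mono \<rho> \<and> (D, X) \<in> charts \<and> y \<in> D \<and> (\<forall>k. yk k \<in> D) \<and>
    (\<forall>k. xk (\<rho> k) = X (yk k) (tk (\<rho> k))) \<and> yk \<longlonglongrightarrow> y"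
proof -
  obtain \<K> :: "('a set \<times> ('a \<Rightarrow> real \<Rightarrow> 'a) \<times> 'a set) set" where K0: "finite \<K> \<and>
    (\<forall>D X C. (D, X, C) \<in> \<K> \<longrightarrow> (D, X) \<in> charts \<and> compact C \<and> C \<subseteq> D) \<and>
    (\<forall>t x. t \<in> {a..b} \<longrightarrow> x \<in> frontier (B t) \<longrightarrow> (\<exists>D X C y. (D, X, C) \<in> \<K> \<and> y \<in> C \<and> x = X y t))"
    using finite_compact_cover ..
  note K = K0[THEN conjunct1] K0[THEN conjunct2, THEN conjunct1, rule_format] K0[THEN conjunct2, THEN conjunct2, rule_format]
  have "\<exists>\<kappa> y. \<kappa> \<in> \<K> \<and> y \<in> snd (snd \<kappa>) \<and> xk k = fst (snd \<kappa>) y (tk k)" for k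
    using K(3)[OF tk(1,2), of k] by force
  then obtain \<kappa> y where \<kappa>y: "\<And>k. \<kappa> k \<in> \<K> \<and> y k \<in> snd (snd (\<kappa> k)) \<and> xk k = fst (snd (\<kappa> k)) (y k) (tk k)" by metis
  have "\<exists>\<kappa>0\<in>\<K>. \<not> finite {k \<in> (UNIV :: nat set). \<kappa> k = \<kappa>0}"
    by (rule pigeonhole_infinite_rel[of UNIV \<K> "\<lambda>k \<kappa>0. \<kappa> k = \<kappa>0"]) (use K(1) \<kappa>y in auto)
  then obtain \<kappa>0 where \<kappa>0: "\<kappa>0 \<in> \<K>" "infinite {k. \<kappa> k = \<kappa>0}" by auto
  obtain r :: "nat \<Rightarrow> nat" where r: "strict_mono r" "\<And>k. \<kappa> (r k) = \<kappa>0"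
    using infinite_enumerate[OF \<kappa>0(2)] by auto
  obtain D X C where k0: "\<kappa>0 = (D, X, C)" by (cases \<kappa>0)
  have DX: "(D, X) \<in> charts" "compact C" "C \<subseteq> D" using K(2) \<kappa>0(1) k0 by auto
  have yC: "y (r k) \<in> C" "xk (r k) = X (y (r k)) (tk (r k))" for k using \<kappa>y[of "r k"] r(2)[of k] k0 by auto
  then have "\<forall>k. (y \<circ> r) k \<in> C" by simp
  then obtain l q where q: "l \<in> C" "strict_mono q" "((y \<circ> r) \<circ> q) \<longlonglongrightarrow> l" using DX(2) unfolding compact_def by blast
  have "strict_mono (r \<circ> q)" by (rule strict_mono_o[OF r(1) q(2)])
  moreover have "l \<in> D" "\<forall>k. ((y \<circ> r) \<circ> q) k \<in> D" using q(1) yC(1) DX(3) by auto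
  moreover have "\<forall>k. xk ((r \<circ> q) k) = X (((y \<circ> r) \<circ> q) k) (tk ((r \<circ> q) k))" using yC(2) by simp
  ultimately show ?thesis using DX(1) q(3) by blast
qed

lemma chart_tendsto:
  assumes "(D, X) \<in> charts" "y \<in> D" "\<And>k. yk k \<in> D" "yk \<longlonglongrightarrow> y" "\<And>k. tk k \<in> {a..b}" "tk \<longlonglongrightarrow> t" "t \<in> {a..b}"
  shows "(\<lambda>k. X (yk k) (tk k)) \<longlonglongrightarrow> X y t"
proof -
  have "(\<lambda>k. (\<lambda>(y, t). X y t) (yk k, tk k)) \<longlonglongrightarrow> (\<lambda>(y, t). X y t) (y, t)"
    by (rule continuous_on_tendsto_compose[OF chart_continuous[OF assms(1)] tendsto_Pair[OF assms(4,6)]])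
      (use assms in auto)
  then show ?thesis by simp
qed

end

section \<open>Trajectories do not separate for a short time\<close>

context flow_family
begin

lemma trajectories_agree:
  assumes "(D1, X1) \<in> charts" "y1 \<in> D1" "(D2, X2) \<in> charts" "y2 \<in> D2" "X1 y1 b = X2 y2 b" "s \<in> {a..b}"
  shows "X1 y1 s = X2 y2 s"
proof -
  have bI: "b \<in> {a..b}" using ab by simp
  show ?thesis by (rule no_merging[OF assms(1-4) bI assms(5,6)])
qed

text \<open>Turns trajectories that agree at \<open>s0\<close> but differ at times decreasing to
  \<open>s0\<close> into two boundary points on one fibre of \<open>N\<close> at small nonzero
  height, the form in which the parabolic argument of \<open>heights_vanish\<close> applies.\<close>

lemma separation_gives_height:
  assumes s0: "s0 \<in> {a..b}" and CkN: "\<And>k. Ck_on k UNIV N"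
    and N: "transversal_field (B s0) N"
    and h0: "h0 > 0"
    and C: "\<And>k. (Dk k, Xk k) \<in> charts" "\<And>k. yk k \<in> Dk k" "\<And>k. (Dk' k, Xk' k) \<in> charts" "\<And>k. yk' k \<in> Dk' k"
    and sk: "\<And>k. sk k \<in> {a..b}" "\<And>k. s0 < sk k" "sk \<longlonglongrightarrow> s0"
    and eq: "\<And>k. Xk k (yk k) s0 = Xk' k (yk' k) s0" and ne: "\<And>k. Xk k (yk k) (sk k) \<noteq> Xk' k (yk' k) (sk k)"
  shows "\<exists>k x h. x \<in> frontier (B (sk k)) \<and> x + h *\<^sub>R N x \<in> frontier (B (sk k)) \<and> \<bar>h\<bar> \<le> h0 \<and> h \<noteq> 0"
proof -
  have bI: "b \<in> {a..b}" using ab by simp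
  \<comment> \<open>Representatives are chosen at the final time \<open>b\<close>, since agreement
    at \<open>b\<close> passes to all times in [a, b].\<close>
  obtain r1 D1 X1 z1 zk1 where r1: "strict_mono (r1 :: nat \<Rightarrow> nat) \<and> (D1, X1) \<in> charts \<and> z1 \<in> D1 \<and> (\<forall>k. zk1 k \<in> D1) \<and>
    (\<forall>k. Xk (r1 k) (yk (r1 k)) b = X1 (zk1 k) b) \<and> zk1 \<longlonglongrightarrow> z1"
    using representatives_subsequence[of "\<lambda>_. b" "\<lambda>k. Xk k (yk k) b"] chart_frontier[OF C(1,2) bI] bI by blast
  obtain r2 D2 X2 z2 zk2 where r2: "strict_mono (r2 :: nat \<Rightarrow> nat) \<and> (D2, X2) \<in> charts \<and> z2 \<in> D2 \<and> (\<forall>k. zk2 k \<in> D2) \<and>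
    (\<forall>k. Xk' (r1 (r2 k)) (yk' (r1 (r2 k))) b = X2 (zk2 k) b) \<and> zk2 \<longlonglongrightarrow> z2"
    using representatives_subsequence[of "\<lambda>_. b" "\<lambda>k. Xk' (r1 k) (yk' (r1 k)) b"] chart_frontier[OF C(3,4) bI] bI by blast
  define r where "r = r1 \<circ> r2"
  define u1 where "u1 = zk1 \<circ> r2"
  have r: "strict_mono r" unfolding r_def using r1 r2 strict_mono_o by blast
  have u1: "\<And>k. u1 k \<in> D1" "u1 \<longlonglongrightarrow> z1"
    using r1 r2 LIMSEQ_subseq_LIMSEQ[of zk1 z1 r2] by (auto simp: u1_def)
  have e1: "Xk (r k) (yk (r k)) s = X1 (u1 k) s" if "s \<in> {a..b}" for k s
    by (rule trajectories_agree[OF C(1,2) _ u1(1) _ that]) (use r1 in \<open>auto simp: r_def u1_def\<close>)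
  have e2: "Xk' (r k) (yk' (r k)) s = X2 (zk2 k) s" if "s \<in> {a..b}" for k s
    by (rule trajectories_agree[OF C(3,4) _ _ _ that, of D2]) (use r2 in \<open>auto simp: r_def\<close>)
  define t where "t = (\<lambda>k. sk (r k))"
  have t: "\<And>k. t k \<in> {a..b}" "\<And>k. s0 < t k" "t \<longlonglongrightarrow> s0"
    using sk LIMSEQ_subseq_LIMSEQ[OF sk(3) r] by (auto simp: t_def o_def)
  have C1: "(D1, X1) \<in> charts" "z1 \<in> D1" and C2: "(D2, X2) \<in> charts" "z2 \<in> D2" "\<And>k. zk2 k \<in> D2" "zk2 \<longlonglongrightarrow> z2"
    using r1 r2 by auto
  have p_eq: "X1 (u1 k) s0 = X2 (zk2 k) s0" for k using e1[OF s0] e2[OF s0] eq by metis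
  have neq: "X1 (u1 k) (t k) \<noteq> X2 (zk2 k) (t k)" for k using e1[OF t(1)] e2[OF t(1)] ne by (metis t_def)
  define p where "p = X2 z2 s0"
  have l1: "(\<lambda>k. X1 (u1 k) s0) \<longlonglongrightarrow> X1 z1 s0"
    by (rule chart_tendsto[OF C1 u1 s0 tendsto_const s0])
  have l2: "(\<lambda>k. X2 (zk2 k) s0) \<longlonglongrightarrow> p"
    unfolding p_def by (rule chart_tendsto[OF C2 s0 tendsto_const s0])
  have pX1: "X1 z1 s0 = p" using l1 l2 unfolding p_eq by (rule LIMSEQ_unique)
  obtain \<rho> S w g \<tau> g' \<eta> K where sh: "sheet D2 X2 z2 s0 N \<rho> S w g \<tau> g' \<eta> K"
    using sheet_exists[OF C2(1,2) s0 CkN transversal_of_gradient[OF C2(1,2) s0 N]] by blast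
  note sb = sheet_base[OF sh, folded p_def]
  have xl: "(\<lambda>k. (X1 (u1 k) (t k), t k)) \<longlonglongrightarrow> (p, s0)"
    using tendsto_Pair[OF chart_tendsto[OF C1 u1 t(1,3) s0] t(3)] pX1 by simp
  have ev1: "eventually (\<lambda>k. (X1 (u1 k) (t k), t k) \<in> S) sequentially"
    by (rule topological_tendstoD[OF xl sheetD(5)[OF sh] sb(2)])
  have wl: "(\<lambda>k. w (X1 (u1 k) (t k), t k)) \<longlonglongrightarrow> 0"
    using continuous_on_tendsto_compose[OF sheet_continuous(1)[OF sh] xl sb(2) ev1] sb(3) by simp
  have ev2: "eventually (\<lambda>k. dist (w (X1 (u1 k) (t k), t k)) 0 < h0) sequentially"
    by (rule tendstoD[OF wl h0])
  have ev3: "eventually (\<lambda>k. dist (zk2 k) z2 < \<rho>) sequentially"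
    by (rule tendstoD[OF C2(4) sheetD(4)[OF sh]])
  obtain k where k: "(X1 (u1 k) (t k), t k) \<in> S" "\<bar>w (X1 (u1 k) (t k), t k)\<bar> < h0" "dist (zk2 k) z2 < \<rho>"
    using eventually_conj[OF ev1 eventually_conj[OF ev2 ev3]] by (auto simp: eventually_sequentially dist_real_def)
  define y where "y = \<eta> (X1 (u1 k) (t k), t k)"
  define h where "h = w (X1 (u1 k) (t k), t k)"
  have y: "y \<in> D2" "y \<in> model_hyperplane" "dist y z2 < \<rho>"
    using sheetD(13,14)[OF sh k(1)] t(1) by (auto simp: y_def)
  have x1: "X1 (u1 k) (t k) = X2 y (t k) + h *\<^sub>R N (X2 y (t k))"
    using sheetD(15)[OF sh k(1) t(1)] unfolding y_def h_def .
  \<comment> \<open>Height zero would put the point on the second sheet with foot y; going back to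
    \<open>s0\<close> by \<open>no_merging\<close>, uniqueness of the foot makes y the parameter
    \<open>zk2 k\<close>, so the trajectories would not have separated.\<close>
  have hn: "h \<noteq> 0"
  proof
    assume "h = 0"
    then have m: "X1 (u1 k) (t k) = X2 y (t k)" using x1 by simp
    have "X1 (u1 k) s0 = X2 y s0"
      by (rule no_merging[OF C1(1) u1(1) C2(1) y(1) t(1) m]) (use s0 t(2)[of k] in auto)
    then have "X2 (zk2 k) s0 = X2 y s0" using p_eq by simp
    moreover have "\<eta> (X2 (zk2 k) s0, s0) = zk2 k"
      by (rule sheet_on(3)[OF sh chart_subset[OF C2(1,3)] k(3) s0]) (use sheetD(4)[OF sh] in simp)
    moreover have "\<eta> (X2 y s0, s0) = y"
      by (rule sheet_on(3)[OF sh y(2,3) s0]) (use sheetD(4)[OF sh] in simp)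
    ultimately have "zk2 k = y" by metis
    then show False using neq[of k] m by simp
  qed
  have "X2 y (t k) \<in> frontier (B (t k))" by (rule chart_frontier[OF C2(1) y(1) t(1)])
  moreover have "X2 y (t k) + h *\<^sub>R N (X2 y (t k)) \<in> frontier (B (t k))"
    unfolding x1[symmetric] by (rule chart_frontier[OF C1(1) u1(1) t(1)])
  moreover have "\<bar>h\<bar> \<le> h0" using k(2) by (simp add: h_def)
  ultimately show ?thesis
    using hn unfolding t_def by (intro exI[of _ "r k"] exI[of _ "X2 y (sk (r k))"] exI[of _ h] conjI)
qed

text \<open>
  The height over a sheet satisfies a linear parabolic inequality, so a height that vanishes at
  time \<open>s0\<close> cannot have a weighted maximum \<open>|h| exp (- k (s - s0))\<close> for large \<open>k\<close>.
\<close>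

lemma heights_vanish:
  assumes s0: "s0 \<in> {a..b}" and CkN: "\<And>k. Ck_on k UNIV N"
    and N: "transversal_field (B s0) N"
    and h0: "h0 > 0"
    and tub: "\<And>x h. x \<in> frontier (B s0) \<Longrightarrow> x + h *\<^sub>R N x \<in> frontier (B s0) \<Longrightarrow> \<bar>h\<bar> \<le> h0 \<Longrightarrow> h = 0"
    and sk: "\<And>k. sk k \<in> {a..b}" "\<And>k. s0 < sk k" "sk \<longlonglongrightarrow> s0"
    and bad: "\<And>k. \<exists>x h. x \<in> frontier (B (sk k)) \<and> x + h *\<^sub>R N x \<in> frontier (B (sk k)) \<and> \<bar>h\<bar> \<le> h0 \<and> h \<noteq> 0"
  shows False
proof -
  define \<Gamma> where "\<Gamma> = {(x, t). t \<in> {a..b} \<and> x \<in> frontier (B t)}"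
  have c\<Gamma>: "compact \<Gamma>" unfolding \<Gamma>_def by (rule track_compact)
  have contN: "continuous_on UNIV N" by (rule Ck_on_continuous[OF CkN[of 0]])
  \<comment> \<open>All pairs of boundary points on a common fibre, encoded by the base point, its
    time in [s0, sk k] and the height; compact because the track of the boundary is.\<close>
  define Q where "Q = (\<lambda>k. {(z, h). z \<in> \<Gamma> \<and> (fst z + h *\<^sub>R N (fst z), snd z) \<in> \<Gamma> \<and> h \<in> {-h0..h0} \<and> snd z \<in> {s0..sk k}})"
  have cQ: "compact (Q k)" for k
  proof -
    have cN: "continuous_on A (\<lambda>x. N (f x))" if "continuous_on A f" for A :: "(('a \<times> real) \<times> real) set" and f
      by (rule continuous_on_compose2[OF contN that]) auto
    have "closed ((\<lambda>q::('a \<times> real) \<times> real. (fst (fst q) + snd q *\<^sub>R N (fst (fst q)), snd (fst q))) -` \<Gamma>)"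
      by (rule continuous_closed_vimage[OF compact_imp_closed[OF c\<Gamma>]])
        (intro continuous_intros continuous_on_interior[OF cN[of UNIV]]; auto intro!: continuous_intros)
    moreover have "closed ((\<lambda>q::('a \<times> real) \<times> real. snd (fst q)) -` {s0..sk k})"
      by (rule continuous_closed_vimage[OF closed_atLeastAtMost]) (auto intro!: continuous_intros)
    moreover have "Q k = (\<Gamma> \<times> {-h0..h0}) \<inter> ((\<lambda>q. (fst (fst q) + snd q *\<^sub>R N (fst (fst q)), snd (fst q))) -` \<Gamma> \<inter> (\<lambda>q. snd (fst q)) -` {s0..sk k})"
      by (auto simp: Q_def)
    ultimately show ?thesis
      using compact_Int_closed[OF compact_Times[OF c\<Gamma> compact_Icc] closed_Int] by (simp only:)
  qed
  \<comment> \<open>The decay rate equals the index k, so it eventually exceeds any constant that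
    the limiting sheet will supply.\<close>
  define f where "f = (\<lambda>k::nat. \<lambda>q::('a \<times> real) \<times> real. \<bar>snd q\<bar> * exp (- real k * (snd (fst q) - s0)))"
  have "\<exists>q\<in>Q k. (\<forall>q'\<in>Q k. f k q' \<le> f k q) \<and> f k q > 0" for k
  proof -
    obtain x h where xh: "x \<in> frontier (B (sk k))" "x + h *\<^sub>R N x \<in> frontier (B (sk k))" "\<bar>h\<bar> \<le> h0" "h \<noteq> 0"
      using bad by blast
    have q0: "((x, sk k), h) \<in> Q k" using xh sk(1,2)[of k] by (auto simp: Q_def \<Gamma>_def)
    have "continuous_on (Q k) (f k)" unfolding f_def by (intro continuous_intros)
    then obtain q where q: "q \<in> Q k" "\<And>q'. q' \<in> Q k \<Longrightarrow> f k q' \<le> f k q"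
      using continuous_attains_sup[OF cQ, of k "f k"] q0 by blast
    have "f k ((x, sk k), h) > 0" using xh(4) by (simp add: f_def)
    then show ?thesis using q q0 by (intro bexI[of _ q]) force+
  qed
  then obtain q where q: "\<And>k. q k \<in> Q k" "\<And>k q'. q' \<in> Q k \<Longrightarrow> f k q' \<le> f k (q k)" "\<And>k. f k (q k) > 0" by metis
  define x2 where "x2 = (\<lambda>k. fst (fst (q k)))"
  define t where "t = (\<lambda>k. snd (fst (q k)))"
  define h where "h = (\<lambda>k. snd (q k))"
  define x1 where "x1 = (\<lambda>k. x2 k + h k *\<^sub>R N (x2 k))"
  have qk: "q k = ((x2 k, t k), h k)" for k by (simp add: x2_def t_def h_def)
  have mem: "t k \<in> {a..b}" "x2 k \<in> frontier (B (t k))" "x1 k \<in> frontier (B (t k))" "\<bar>h k\<bar> \<le> h0" "s0 \<le> t k" "t k \<le> sk k" for k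
    using q(1)[of k] by (auto simp: qk Q_def \<Gamma>_def x1_def abs_le_iff)
  have hn: "h k \<noteq> 0" for k using q(3)[of k] by (auto simp: f_def qk)
  \<comment> \<open>At time \<open>s0\<close> itself all heights are zero by \<open>tub\<close>,
    whereas the maximum is positive.\<close>
  have ts: "s0 < t k" for k
    using tub[of "x2 k" "h k"] mem[of k] hn[of k] by (cases "t k = s0") (auto simp: x1_def)
  have tl: "t \<longlonglongrightarrow> s0"
    by (rule tendsto_sandwich[OF _ _ tendsto_const sk(3)]) (use mem(5,6) in auto)
  obtain r1 D1 X1 z1 zk1 where r1: "strict_mono (r1 :: nat \<Rightarrow> nat) \<and> (D1, X1) \<in> charts \<and> z1 \<in> D1 \<and> (\<forall>k. zk1 k \<in> D1) \<and>
    (\<forall>k. x1 (r1 k) = X1 (zk1 k) (t (r1 k))) \<and> zk1 \<longlonglongrightarrow> z1"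
    using representatives_subsequence[of t x1, OF mem(1,3)] by blast
  obtain r2 D2 X2 z2 zk2 where r2: "strict_mono (r2 :: nat \<Rightarrow> nat) \<and> (D2, X2) \<in> charts \<and> z2 \<in> D2 \<and> (\<forall>k. zk2 k \<in> D2) \<and>
    (\<forall>k. x2 (r1 (r2 k)) = X2 (zk2 k) (t (r1 (r2 k)))) \<and> zk2 \<longlonglongrightarrow> z2"
    using representatives_subsequence[of "\<lambda>k. t (r1 k)" "\<lambda>k. x2 (r1 k)"] mem(1,2) by blast
  have "h k \<in> {-h0..h0}" for k using mem(4)[of k] unfolding abs_le_iff by auto
  then have "\<forall>k. h (r1 (r2 k)) \<in> {-h0..h0}" by blast
  then obtain hl r3 where r3: "hl \<in> {-h0..h0}" "strict_mono (r3 :: nat \<Rightarrow> nat)" "((\<lambda>k. h (r1 (r2 k))) \<circ> r3) \<longlonglongrightarrow> hl"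
    using compact_Icc[of "-h0" h0] unfolding compact_def by meson
  define r where "r = r1 \<circ> r2 \<circ> r3"
  have r: "strict_mono r" unfolding r_def by (intro strict_mono_o) (use r1 r2 r3(2) in auto)
  define u1 where "u1 = zk1 \<circ> (r2 \<circ> r3)"
  define u2 where "u2 = zk2 \<circ> r3"
  have C1: "(D1, X1) \<in> charts" "z1 \<in> D1" "\<And>k. u1 k \<in> D1" "u1 \<longlonglongrightarrow> z1"
    using r1 r2 r3 LIMSEQ_subseq_LIMSEQ[of zk1 z1 "r2 \<circ> r3"] strict_mono_o[of r2 r3] by (auto simp: u1_def)
  have C2: "(D2, X2) \<in> charts" "z2 \<in> D2" "\<And>k. u2 k \<in> D2" "u2 \<longlonglongrightarrow> z2"
    using r2 r3 LIMSEQ_subseq_LIMSEQ[of zk2 z2 r3] by (auto simp: u2_def)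
  have x1X: "x1 (r k) = X1 (u1 k) (t (r k))" for k using r1 by (simp add: r_def u1_def)
  have x2X: "x2 (r k) = X2 (u2 k) (t (r k))" for k using r2 by (simp add: r_def u2_def)
  have trl: "(\<lambda>k. t (r k)) \<longlonglongrightarrow> s0" using LIMSEQ_subseq_LIMSEQ[OF tl r] by (simp add: o_def)
  have hl: "(\<lambda>k. h (r k)) \<longlonglongrightarrow> hl" using r3(3) by (simp add: r_def o_def)
  define p where "p = X2 z2 s0"
  have x2l: "(\<lambda>k. x2 (r k)) \<longlonglongrightarrow> p"
    unfolding x2X p_def by (rule chart_tendsto[OF C2 mem(1) trl s0])
  have x1l: "(\<lambda>k. x1 (r k)) \<longlonglongrightarrow> X1 z1 s0"
    unfolding x1X by (rule chart_tendsto[OF C1 mem(1) trl s0])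
  have "(\<lambda>k. x1 (r k)) \<longlonglongrightarrow> p + hl *\<^sub>R N p"
    unfolding x1_def by (intro tendsto_intros x2l hl continuous_on_tendsto_compose[OF contN x2l]) auto
  then have pe: "X1 z1 s0 = p + hl *\<^sub>R N p" using x1l LIMSEQ_unique by blast
  \<comment> \<open>In the limit both points lie on the boundary at \<open>s0\<close> and differ by
    hl along \<open>N\<close>, so \<open>tub\<close> makes them equal; both sequences therefore end
    up in one sheet neighbourhood.\<close>
  have hl0: "hl = 0"
    by (rule tub[of p]) (use chart_frontier[OF C2(1,2) s0] chart_frontier[OF C1(1,2) s0] pe r3(1) in \<open>auto simp: p_def abs_le_iff\<close>)
  have pX1: "X1 z1 s0 = p" using pe hl0 by simp
  obtain \<rho> S w g \<tau> g' \<eta> K where sh: "sheet D2 X2 z2 s0 N \<rho> S w g \<tau> g' \<eta> K"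
    using sheet_exists[OF C2(1,2) s0 CkN transversal_of_gradient[OF C2(1,2) s0 N]] by blast
  note sb = sheet_base[OF sh, folded p_def]
  obtain rp G1 where P1: "patch D1 X1 z1 s0 rp G1" using patch_exists[OF C1(1,2) s0] by blast
  have x1l': "(\<lambda>k. (x1 (r k), t (r k))) \<longlonglongrightarrow> (p, s0)" using tendsto_Pair[OF x1l trl] pX1 by simp
  have evS: "eventually (\<lambda>k. (x1 (r k), t (r k)) \<in> S) sequentially"
    by (rule topological_tendstoD[OF x1l' sheetD(5)[OF sh] sb(2)])
  have gl: "(\<lambda>k. g (x1 (r k), t (r k)) \<bullet> g (x1 (r k), t (r k))) \<longlonglongrightarrow> g (p, s0) \<bullet> g (p, s0)"
    by (intro tendsto_inner continuous_on_tendsto_compose[OF sheetD(8)[OF sh] x1l' sb(2) evS])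
  define m where "m = g (p, s0) \<bullet> g (p, s0) / 2"
  have m: "m > 0" using sheetD(11)[OF sh sb(2)] by (simp add: m_def)
  have ev1: "eventually (\<lambda>k. g (x1 (r k), t (r k)) \<bullet> g (x1 (r k), t (r k)) > m) sequentially"
    by (rule order_tendstoD(1)[OF gl]) (use m in \<open>simp add: m_def\<close>)
  have ev2: "eventually (\<lambda>k. dist (h (r k)) 0 < min \<rho> h0) sequentially"
    using tendstoD[OF hl[unfolded hl0], of "min \<rho> h0"] sheetD(4)[OF sh] h0 by simp
  have ev3: "eventually (\<lambda>k. dist (u2 k) z2 < \<rho>) sequentially" by (rule tendstoD[OF C2(4) sheetD(4)[OF sh]])
  have ev4: "eventually (\<lambda>k. dist (u1 k) z1 < rp) sequentially" by (rule tendstoD[OF C1(4) patchD(4)[OF P1]])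
  have ev5: "eventually (\<lambda>k. dist (t (r k)) s0 < min \<rho> rp) sequentially"
    using tendstoD[OF trl, of "min \<rho> rp"] sheetD(4)[OF sh] patchD(4)[OF P1] by simp
  have ev6: "eventually (\<lambda>k. real k > K / m) sequentially"
    using filterlim_real_sequentially eventually_gt_at_top by (metis (no_types) eventually_compose_filterlim)
  obtain j where j: "(x1 (r j), t (r j)) \<in> S" "g (x1 (r j), t (r j)) \<bullet> g (x1 (r j), t (r j)) > m"
    "\<bar>h (r j)\<bar> < \<rho>" "\<bar>h (r j)\<bar> < h0" "dist (u2 j) z2 < \<rho>" "dist (u1 j) z1 < rp" "dist (t (r j)) s0 < \<rho>" "dist (t (r j)) s0 < rp"
    "real j > K / m"
    using eventually_happens'[OF sequentially_bot eventually_conj[OF evS eventually_conj[OF ev1 eventually_conj[OF ev2 eventually_conj[OF ev3 eventually_conj[OF ev4 eventually_conj[OF ev5 ev6]]]]]]]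
    by (auto simp: dist_real_def)
  define k where "k = r j"
  define y where "y = u1 j"
  have kj: "real k \<ge> real j" unfolding k_def using seq_suble[OF r, of j] by simp
  have yH: "y \<in> model_hyperplane" unfolding y_def by (rule chart_subset[OF C1(1,3)])
  have tI: "t k \<in> {a..b}" by (rule mem(1))
  have x1k: "x1 k = X1 y (t k)" using x1X[of j] by (simp add: k_def y_def)
  have wk: "w (X1 y (t k), t k) = h k"
  proof -
    have "w (X2 (u2 j) (t k) + h k *\<^sub>R N (X2 (u2 j) (t k)), t k) = h k"
      using sheetD(17)[OF sh chart_subset[OF C2(1,3)] j(5) tI] j(3,7) by (simp add: k_def)
    moreover have "x2 k = X2 (u2 j) (t k)" using x2X[of j] by (simp add: k_def)
    ultimately have "w (x2 k + h k *\<^sub>R N (x2 k), t k) = h k" by simp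
    then show ?thesis unfolding x1k[symmetric] x1_def .
  qed
  define \<sigma> where "\<sigma> = (if h k > 0 then 1 else -1 :: real)"
  have \<sigma>: "\<sigma> * h k = \<bar>h k\<bar>" "\<bar>\<sigma>\<bar> = 1" using hn[of k] by (auto simp: \<sigma>_def)
  \<comment> \<open>The sign turns the maximal weighted |h| into a minimum of e w over the first
    surface, the situation of \<open>touching\<close>.\<close>
  define e where "e = (\<lambda>z::'a \<times> real. (- \<sigma>) * exp (- real k * (snd z - s0)))"
  have xS: "(X1 y (t k), t k) \<in> S" using j(1) x1k by (simp add: k_def)
  obtain d0 where d0: "d0 > 0" "\<And>y' s. y' \<in> D1 \<Longrightarrow> s \<in> {a..b} \<Longrightarrow> dist y' y < d0 \<Longrightarrow> dist s (t k) < d0 \<Longrightarrow>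
      (X1 y' s, s) \<in> S \<and> \<bar>w (X1 y' s, s)\<bar> < h0"
  proof -
    define T where "T = S \<inter> w -` {-h0<..<h0}"
    have oT: "open T" unfolding T_def
      by (rule continuous_open_preimage[OF sheet_continuous(1)[OF sh] sheetD(5)[OF sh] open_greaterThanLessThan])
    have cF: "continuous_on (D1 \<times> {a..b}) (\<lambda>z. (X1 (fst z) (snd z), snd z))"
      using chart_continuous[OF C1(1)] by (auto intro!: continuous_intros simp: case_prod_unfold)
    have "openin (top_of_set (D1 \<times> {a..b})) ((D1 \<times> {a..b}) \<inter> (\<lambda>z. (X1 (fst z) (snd z), snd z)) -` T)"
      by (rule continuous_openin_preimage_gen[OF cF oT])
    moreover define Pre where "Pre = (D1 \<times> {a..b}) \<inter> (\<lambda>z. (X1 (fst z) (snd z), snd z)) -` T"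
    have yD: "y \<in> D1" unfolding y_def by (rule C1(3))
    have "(y, t k) \<in> Pre" using xS wk j(4) tI yD by (auto simp: Pre_def T_def k_def abs_less_iff)
    ultimately have "\<exists>d>0. ball (y, t k) d \<inter> (D1 \<times> {a..b}) \<subseteq> Pre"
      unfolding openin_contains_ball Pre_def[symmetric] by (elim conjE) (rule bspec)
    then obtain d where d: "d > 0" "ball (y, t k) d \<inter> (D1 \<times> {a..b}) \<subseteq> Pre" by (elim exE conjE)
    show ?thesis
    proof (rule that[of "d / 2"])
      fix y' s assume H: "y' \<in> D1" "s \<in> {a..b}" "dist y' y < d / 2" "dist s (t k) < d / 2"
      have "dist (y', s) (y, t k) \<le> dist y' y + dist s (t k)"
        unfolding dist_Pair_Pair by (rule sqrt_sum_squares_le_sum) auto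
      then have "(y', s) \<in> Pre" using H by (intro subsetD[OF d(2)]) (auto simp: dist_commute)
      then show "(X1 y' s, s) \<in> S \<and> \<bar>w (X1 y' s, s)\<bar> < h0" by (auto simp: Pre_def T_def)
    qed (use d in simp)
  qed
  \<comment> \<open>Keeps the competing times above \<open>s0\<close>, as membership in
    \<open>Q k\<close> demands.\<close>
  define d where "d = min d0 (t k - s0)"
  have d: "d > 0" using d0(1) ts[of k] by (simp add: d_def)
  have e_app: "(- \<sigma>) * exp (- real k * (snd z - s0)) = e z" for z by (simp add: e_def)
  note JW = jet_on_exp_weight[OF sheetD(7)[OF sh], of "- \<sigma>" "real k" s0, unfolded e_app]
  have "mcf_defect (\<lambda>z. e z *\<^sub>R g z) (\<lambda>z. e z * (\<tau> z - real k * w z)) (\<lambda>z h. e z *\<^sub>R (g' z h - (real k * snd h) *\<^sub>R g z)) (X1 y (t k), t k) \<le> 0"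
  proof (rule touching[OF P1 yH _ tI _ _ JW sheetD(5)[OF sh] xS d])
    show "dist y z1 < rp" "dist (t k) s0 < rp" using j by (auto simp: y_def k_def)
    show "a < t k" using ts[of k] s0 by auto
    fix y' s assume H: "y' \<in> model_hyperplane" "dist y' y < d" "dist y' z1 < rp" "s \<in> {a..b}" "dist s s0 < rp" "t k - d < s" "s \<le> t k"
    have yD: "y' \<in> D1" by (rule patchD(6)[OF P1 H(1,3)])
    have I: "(X1 y' s, s) \<in> S \<and> \<bar>w (X1 y' s, s)\<bar> < h0"
      by (rule d0(2)[OF yD H(4)]) (use H in \<open>auto simp: d_def dist_real_def\<close>)
    define v where "v = \<eta> (X1 y' s, s)"
    define hh where "hh = w (X1 y' s, s)"
    have v: "v \<in> D2" "X1 y' s = X2 v s + hh *\<^sub>R N (X2 v s)"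
      using sheetD(14,15)[OF sh conjunct1[OF I] H(4)] by (auto simp: v_def hh_def)
    have "X2 v s + hh *\<^sub>R N (X2 v s) \<in> frontier (B s)"
      using chart_frontier[OF C1(1) yD H(4)] unfolding v(2) .
    moreover have "\<bar>hh\<bar> \<le> h0" using I unfolding hh_def by simp
    moreover have "s0 \<le> s" using H(6) by (simp add: d_def)
    ultimately have "((X2 v s, s), hh) \<in> Q k"
      using chart_frontier[OF C2(1) v(1) H(4)] H(4,7) mem(6)[of k]
      by (auto simp: Q_def \<Gamma>_def)
    from q(2)[OF this] have le: "\<bar>hh\<bar> * exp (- real k * (s - s0)) \<le> \<bar>h k\<bar> * exp (- real k * (t k - s0))"
      by (simp add: f_def qk)
    have "- (\<bar>h k\<bar> * exp (- real k * (t k - s0))) \<le> - (\<bar>hh\<bar> * exp (- real k * (s - s0)))" using le by simp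
    also have "\<dots> \<le> - (\<sigma> * hh) * exp (- real k * (s - s0))"
      using \<sigma>(2) abs_ge_self[of "\<sigma> * hh"] by (simp add: abs_mult)
    finally show "e (X1 y (t k), t k) * w (X1 y (t k), t k) \<le> e (X1 y' s, s) * w (X1 y' s, s)"
      unfolding wk hh_def[symmetric] e_def \<sigma>(1)[symmetric] by (simp add: mult_ac)
  qed
  moreover have "linear (g' (X1 y (t k), t k))" by (rule jet_onD(3)[OF sheetD(7)[OF sh] xS])
  ultimately have "e (X1 y (t k), t k) ^ 3 * (mcf_defect g \<tau> g' (X1 y (t k), t k) - real k * h k * (g (X1 y (t k), t k) \<bullet> g (X1 y (t k), t k))) \<le> 0"
    unfolding mcf_defect_exp_weight[where g' = g' and z = "(X1 y (t k), t k)", OF \<open>linear (g' (X1 y (t k), t k))\<close>] wk by simp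
  moreover define A where "A = mcf_defect g \<tau> g' (X1 y (t k), t k)"
  moreover define gg where "gg = g (X1 y (t k), t k) \<bullet> g (X1 y (t k), t k)"
  moreover define E where "E = exp (- real k * (t k - s0))"
  ultimately have "(- \<sigma> * E) ^ 3 * (A - real k * h k * gg) \<le> 0" by (simp add: e_def)
  moreover have "(- \<sigma> * E) ^ 3 = - \<sigma> * E ^ 3" using \<sigma>(2) by (auto simp: power3_eq_cube abs_if split: if_splits)
  moreover define Z where "Z = A - real k * h k * gg"
  ultimately have "0 \<le> E ^ 3 * (\<sigma> * Z)" by (simp add: mult_ac)
  moreover have "E ^ 3 > 0" by (simp add: E_def)
  ultimately have "0 \<le> \<sigma> * Z" by (simp add: zero_le_mult_iff)
  then have "0 \<le> \<sigma> * A - real k * (\<sigma> * h k) * gg" by (simp add: Z_def right_diff_distrib mult_ac)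
  \<comment> \<open>The weight contributes k |h| |Dw|^2, the defect at most K |h|. As |Dw|^2 > m
    near the limit and k exceeds K / m, this is impossible for h different from 0.\<close>
  then have "real k * \<bar>h k\<bar> * gg \<le> \<sigma> * A" unfolding \<sigma>(1) by simp
  also have "\<dots> \<le> \<bar>A\<bar>" using \<sigma>(2) abs_ge_self[of "\<sigma> * A"] by (simp add: abs_mult)
  also have "\<dots> \<le> K * \<bar>h k\<bar>" using sheetD(18)[OF sh xS tI] by (simp add: A_def wk)
  finally have "real k * gg * \<bar>h k\<bar> \<le> K * \<bar>h k\<bar>" by (simp add: mult_ac)
  then have kg: "real k * gg \<le> K" using hn[of k] by simp
  have "gg > m" using j(2) x1k by (simp add: gg_def k_def)
  then have "real j * m \<le> real k * gg" using kj m by (intro mult_mono) auto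
  moreover have "K < real j * m" using j(9) m by (simp add: pos_divide_less_eq)
  ultimately show False using kg by simp
qed

text \<open>Argued by contradiction with one \<delta> for all pairs of trajectories: failures at
  times decreasing to \<open>s0\<close> yield nonzero heights at such times by
  \<open>separation_gives_height\<close>, and \<open>heights_vanish\<close> excludes these.\<close>

theorem no_splitting:
  assumes s0: "s0 \<in> {a..b}"
  shows "\<exists>\<delta>>0. \<forall>D1 X1 y1 D2 X2 y2 s. (D1, X1) \<in> charts \<longrightarrow> y1 \<in> D1 \<longrightarrow> (D2, X2) \<in> charts \<longrightarrow> y2 \<in> D2 \<longrightarrow>
    X1 y1 s0 = X2 y2 s0 \<longrightarrow> s \<in> {a..b} \<longrightarrow> s0 < s \<longrightarrow> s < s0 + \<delta> \<longrightarrow> X1 y1 s = X2 y2 s"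
proof (rule ccontr)
  assume neg: "\<not> ?thesis"
  from transversal_field_exists[OF open_B[OF s0] compact_B[OF s0] boundary_B[OF s0]]
  obtain N :: "'a \<Rightarrow> 'a" where NN: "(\<forall>k. Ck_on k UNIV N) \<and> transversal_field (B s0) N" ..
  have N: "\<And>k. Ck_on k UNIV N" "transversal_field (B s0) N" using NN by auto
  obtain h0 where h0: "h0 > 0" "\<And>x h. x \<in> frontier (B s0) \<Longrightarrow> x + h *\<^sub>R N x \<in> frontier (B s0) \<Longrightarrow> \<bar>h\<bar> \<le> h0 \<Longrightarrow> h = 0"
    using transversal_translates_disjoint[OF open_B[OF s0] compact_B[OF s0] boundary_B[OF s0] Ck_on_continuous[OF N(1)[of 0]] N(2)]
    by blast
  define bad where "bad = (\<lambda>s. \<exists>x h. x \<in> frontier (B s) \<and> x + h *\<^sub>R N x \<in> frontier (B s) \<and> \<bar>h\<bar> \<le> h0 \<and> h \<noteq> 0)"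
  \<comment> \<open>The heights found by \<open>separation_gives_height\<close> occur somewhere
    along a sequence of times; running it on failures within \<delta> / (k + 1) gives a bad time in
    every right neighbourhood of \<open>s0\<close>.\<close>
  have ex: "\<exists>s\<in>{a..b}. s0 < s \<and> s < s0 + \<delta> \<and> bad s" if \<delta>: "\<delta> > 0" for \<delta>
  proof (rule ccontr)
    assume nb: "\<not> ?thesis"
    define \<delta>k where "\<delta>k = (\<lambda>k::nat. \<delta> * inverse (real (Suc k)))"
    have \<delta>k: "\<delta>k k > 0" "\<delta>k k \<le> \<delta>" for k
    proof -
      show "\<delta>k k > 0" using \<delta> by (simp add: \<delta>k_def)
      have "\<delta> * inverse (real (Suc k)) \<le> \<delta> * 1" using \<delta> by (intro mult_left_mono) (auto simp: inverse_le_1_iff)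
      then show "\<delta>k k \<le> \<delta>" by (simp add: \<delta>k_def)
    qed
    have "\<exists>D1 X1 y1 D2 X2 y2 s. (D1, X1) \<in> charts \<and> y1 \<in> D1 \<and> (D2, X2) \<in> charts \<and> y2 \<in> D2 \<and>
      X1 y1 s0 = X2 y2 s0 \<and> s \<in> {a..b} \<and> s0 < s \<and> s < s0 + \<delta>k k \<and> X1 y1 s \<noteq> X2 y2 s" for k
      using neg \<delta>k(1)[of k] by blast
    then obtain D1 X1 y1 D2 X2 y2 s where *: "\<And>k. (D1 k, X1 k) \<in> charts \<and> y1 k \<in> D1 k \<and> (D2 k, X2 k) \<in> charts \<and> y2 k \<in> D2 k \<and>
      X1 k (y1 k) s0 = X2 k (y2 k) s0 \<and> s k \<in> {a..b} \<and> s0 < s k \<and> s k < s0 + \<delta>k k \<and> X1 k (y1 k) (s k) \<noteq> X2 k (y2 k) (s k)"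
      by metis
    have "\<delta>k \<longlonglongrightarrow> \<delta> * 0" unfolding \<delta>k_def by (intro tendsto_mult tendsto_const LIMSEQ_inverse_real_of_nat)
    then have u: "(\<lambda>k. s0 + \<delta>k k) \<longlonglongrightarrow> s0" using tendsto_add[OF tendsto_const[of s0], of \<delta>k 0] by simp
    have "s \<longlonglongrightarrow> s0"
      by (rule tendsto_sandwich[OF _ _ tendsto_const u]) (use * in \<open>auto intro!: always_eventually less_imp_le\<close>)
    then have "\<exists>k x h. x \<in> frontier (B (s k)) \<and> x + h *\<^sub>R N x \<in> frontier (B (s k)) \<and> \<bar>h\<bar> \<le> h0 \<and> h \<noteq> 0"
      using * by (intro separation_gives_height[where Dk = D1 and Xk = X1 and yk = y1 and Dk' = D2 and Xk' = X2 and yk' = y2 and sk = s, OF s0 N(1,2) h0(1)]) auto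
    then obtain k where "bad (s k)" by (auto simp: bad_def)
    then show False using nb *[of k] \<delta>k(2)[of k] by force
  qed
  have "\<exists>s\<in>{a..b}. s0 < s \<and> s < s0 + inverse (real (Suc k)) \<and> bad s" for k by (rule ex) simp
  then obtain s where s: "\<And>k. s k \<in> {a..b} \<and> s0 < s k \<and> s k < s0 + inverse (real (Suc k)) \<and> bad (s k)" by metis
  have u: "(\<lambda>k. s0 + inverse (real (Suc k))) \<longlonglongrightarrow> s0"
    using tendsto_add[OF tendsto_const[of s0] LIMSEQ_inverse_real_of_nat] by simp
  have "s \<longlonglongrightarrow> s0"
    by (rule tendsto_sandwich[OF _ _ tendsto_const u]) (use s in \<open>auto intro!: always_eventually less_imp_le\<close>)
  then show False
    by (intro heights_vanish[where sk = s, OF s0 N(1,2) h0(1)]) (use h0(2) s in \<open>auto simp: bad_def\<close>)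
qed

text \<open>The space-time version of \<open>sheet_zero_nearby\<close>. A nearby boundary point at
  time t is moved along its trajectory to time \<open>s0\<close>, where the fixed time statement
  puts it on the sheet; the way back to t is \<open>no_merging\<close> for t \<le> s0 and
  \<open>no_splitting\<close> for t > s0.\<close>

lemma single_sheet:
  assumes sh: "sheet D X y0 s0 N r S w g \<tau> g' \<eta> K" and N: "continuous_on UNIV N"
  shows "eventually (\<lambda>(x, s). s \<in> {a..b} \<longrightarrow> x \<in> frontier (B s) \<longrightarrow> (x, s) \<in> S \<and> w (x, s) = 0) (nhds (X y0 s0, s0))"
proof (rule ccontr)
  assume neg: "\<not> ?thesis"
  define p where "p = X y0 s0"
  have s0: "s0 \<in> {a..b}" by (rule sheetD(3)[OF sh])
  note sb = sheet_base[OF sh, folded p_def]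
  have "\<exists>z. dist z (p, s0) < inverse (real (Suc k)) \<and> snd z \<in> {a..b} \<and> fst z \<in> frontier (B (snd z)) \<and> \<not> (z \<in> S \<and> w z = 0)" for k
  proof -
    have "inverse (real (Suc k)) > 0" by simp
    then show ?thesis using neg unfolding eventually_nhds_metric p_def[symmetric] by (fastforce simp: case_prod_unfold)
  qed
  then obtain zk where zk: "\<And>k. dist (zk k) (p, s0) < inverse (real (Suc k)) \<and> snd (zk k) \<in> {a..b} \<and> fst (zk k) \<in> frontier (B (snd (zk k))) \<and>
    \<not> (zk k \<in> S \<and> w (zk k) = 0)" by metis
  have zl: "zk \<longlonglongrightarrow> (p, s0)"
  proof (rule metric_tendsto_imp_tendsto[OF LIMSEQ_inverse_real_of_nat])
    show "eventually (\<lambda>k. dist (zk k) (p, s0) \<le> dist (inverse (real (Suc k))) 0) sequentially"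
      using zk by (intro always_eventually allI) (simp add: less_imp_le)
  qed
  obtain \<rho> D1 X1 y1 yk where R: "strict_mono (\<rho> :: nat \<Rightarrow> nat) \<and> (D1, X1) \<in> charts \<and> y1 \<in> D1 \<and> (\<forall>k. yk k \<in> D1) \<and>
    (\<forall>k. fst (zk (\<rho> k)) = X1 (yk k) (snd (zk (\<rho> k)))) \<and> yk \<longlonglongrightarrow> y1"
    using representatives_subsequence[of "\<lambda>k. snd (zk k)" "\<lambda>k. fst (zk k)"] zk by blast
  define t where "t = (\<lambda>k. snd (zk (\<rho> k)))"
  have C1: "(D1, X1) \<in> charts" "y1 \<in> D1" "\<And>k. yk k \<in> D1" "yk \<longlonglongrightarrow> y1" using R by auto
  have zX: "zk (\<rho> k) = (X1 (yk k) (t k), t k)" for k using R by (simp add: t_def prod_eq_iff)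
  have tI: "t k \<in> {a..b}" for k using zk by (simp add: t_def)
  have zrl: "(\<lambda>k. zk (\<rho> k)) \<longlonglongrightarrow> (p, s0)" using LIMSEQ_subseq_LIMSEQ[OF zl] R by (simp add: o_def)
  have tl: "t \<longlonglongrightarrow> s0" using tendsto_snd[OF zrl] by (simp add: t_def)
  have "(\<lambda>k. X1 (yk k) (t k)) \<longlonglongrightarrow> X1 y1 s0" by (rule chart_tendsto[OF C1 tI tl s0])
  moreover have "(\<lambda>k. X1 (yk k) (t k)) \<longlonglongrightarrow> p" using tendsto_fst[OF zrl] by (simp add: zX)
  ultimately have pX1: "X1 y1 s0 = p" by (rule LIMSEQ_unique)
  have xl: "(\<lambda>k. X1 (yk k) s0) \<longlonglongrightarrow> p" using chart_tendsto[OF C1 s0 tendsto_const s0] pX1 by simp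
  have ev1: "eventually (\<lambda>k. X1 (yk k) s0 \<in> frontier (B s0) \<longrightarrow> (X1 (yk k) s0, s0) \<in> S \<and> w (X1 (yk k) s0, s0) = 0) sequentially"
    by (rule eventually_compose_filterlim[OF sheet_zero_nearby[OF sh N sb(2) s0 sb(3)] xl])
  from no_splitting[OF s0] obtain \<delta> where \<delta>: "\<delta> > 0 \<and> (\<forall>D1 X1 y1 D2 X2 y2 s. (D1, X1) \<in> charts \<longrightarrow> y1 \<in> D1 \<longrightarrow> (D2, X2) \<in> charts \<longrightarrow> y2 \<in> D2 \<longrightarrow>
      X1 y1 s0 = X2 y2 s0 \<longrightarrow> s \<in> {a..b} \<longrightarrow> s0 < s \<longrightarrow> s < s0 + \<delta> \<longrightarrow> X1 y1 s = X2 y2 s)" ..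
  have ev2: "eventually (\<lambda>k. dist (t k) s0 < min \<delta> r) sequentially"
    using tendstoD[OF tl, of "min \<delta> r"] \<delta>[THEN conjunct1] sheetD(4)[OF sh] by simp
  obtain k where k: "X1 (yk k) s0 \<in> frontier (B s0) \<longrightarrow> (X1 (yk k) s0, s0) \<in> S \<and> w (X1 (yk k) s0, s0) = 0" "dist (t k) s0 < min \<delta> r"
    using eventually_happens'[OF sequentially_bot eventually_conj[OF ev1 ev2]] by blast
  have kS: "(X1 (yk k) s0, s0) \<in> S" "w (X1 (yk k) s0, s0) = 0" using k(1) chart_frontier[OF C1(1,3) s0] by auto
  define y where "y = \<eta> (X1 (yk k) s0, s0)"
  have y: "y \<in> D" "y \<in> model_hyperplane" "dist y y0 < r"
    using sheetD(13,14)[OF sh kS(1)] s0 by (auto simp: y_def)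
  have e: "X1 (yk k) s0 = X y s0"
    using sheetD(15)[OF sh kS(1) s0, unfolded kS(2) scaleR_zero_left add_0_right] unfolding y_def .
  \<comment> \<open>The point on the sheet found at time \<open>s0\<close> and the original
    trajectory agree there; they are compared at the time \<open>t k\<close> on either side.\<close>
  have "X1 (yk k) (t k) = X y (t k)"
  proof (cases "t k \<le> s0")
    case True
    show ?thesis by (rule no_merging[OF C1(1,3) sheetD(1)[OF sh] y(1) s0 e]) (use True tI[of k] in auto)
  next
    case False
    have "s0 < t k" "t k < s0 + \<delta>" using False k(2) by (auto simp: dist_real_def)
    with \<delta>[THEN conjunct2, THEN spec[of _ D1], THEN spec[of _ X1], THEN spec[of _ "yk k"], THEN spec[of _ D],
        THEN spec[of _ X], THEN spec[of _ y], THEN spec[of _ "t k"]]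
    show ?thesis using C1(1,3) sheetD(1)[OF sh] y(1) e tI by blast
  qed
  then have "zk (\<rho> k) \<in> S \<and> w (zk (\<rho> k)) = 0"
    using sheet_on(1,2)[OF sh y(2,3) tI] k(2) by (simp add: zX)
  then show False using zk by blast
qed

end

section \<open>Continuity of the enclosed sets\<close>

lemma interior_frontier_open: "open S \<Longrightarrow> interior (frontier S) = {}"
  using open_Int_closure_eq_empty[OF open_interior, of "frontier S" S] interior_subset[of "frontier S"]
  by (auto simp: frontier_def interior_open)

context flow_family
begin

lemma frontier_disjoint: "t \<in> {a..b} \<Longrightarrow> x \<in> B t \<Longrightarrow> x \<notin> frontier (B t)"
  using open_B by (simp add: frontier_def interior_open)

lemma closure_eq: "t \<in> {a..b} \<Longrightarrow> x \<in> closure (B t) \<longleftrightarrow> x \<in> B t \<or> x \<in> frontier (B t)"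
  using open_B by (auto simp: frontier_def interior_open closure_subset[THEN subsetD])

lemma connected_inside_or_outside:
  assumes "t \<in> {a..b}" "connected C" "\<And>x. x \<in> C \<Longrightarrow> x \<notin> frontier (B t)"
  shows "C \<subseteq> B t \<or> C \<inter> B t = {}"
  using connected_Int_frontier[OF assms(2), of "B t"] assms(3) by blast

text \<open>The truth value \<sigma> s records which side of the sheet is inside at time s. It may
  depend on s at this stage, because nothing yet links the sets \<open>B s\<close> at different
  times.\<close>

lemma sheet_sides:
  assumes sh: "sheet D X y0 s0 N r S w g \<tau> g' \<eta> K" and N: "continuous_on UNIV N"
  shows "\<exists>U \<sigma>. open U \<and> (X y0 s0, s0) \<in> U \<and> U \<subseteq> S \<and> (\<forall>z s. (z, s) \<in> U \<longrightarrow> s \<in> {a..b} \<longrightarrow>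
    (z \<in> frontier (B s) \<longleftrightarrow> w (z, s) = 0) \<and> (w (z, s) \<noteq> 0 \<longrightarrow> (z \<in> B s \<longleftrightarrow> (0 < w (z, s)) = \<sigma> s)))"
proof -
  have DX: "(D, X) \<in> charts" "y0 \<in> D" and s0: "s0 \<in> {a..b}" and r: "r > 0" using sheetD[OF sh] by auto
  obtain V where V: "open V" "(X y0 s0, s0) \<in> V"
    "\<And>x s. (x, s) \<in> V \<Longrightarrow> s \<in> {a..b} \<Longrightarrow> x \<in> frontier (B s) \<Longrightarrow> (x, s) \<in> S \<and> w (x, s) = 0"
    using single_sheet[OF sh N] unfolding eventually_nhds by auto
  define \<Phi> where "\<Phi> = (\<lambda>q::'a \<times> real \<times> real. (X (fst q) (fst (snd q)) + snd (snd q) *\<^sub>R N (X (fst q) (fst (snd q))), fst (snd q)))"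
  define Q where "Q = D \<times> {a..b} \<times> (UNIV :: real set)"
  have cX: "continuous_on Q (\<lambda>q. X (fst q) (fst (snd q)))"
  proof -
    have "continuous_on Q ((\<lambda>(y, t). X y t) \<circ> (\<lambda>q. (fst q, fst (snd q))))"
      by (rule continuous_on_compose[OF _ continuous_on_subset[OF chart_continuous[OF DX(1)]]])
        (auto simp: Q_def intro!: continuous_intros)
    then show ?thesis by (simp add: o_def)
  qed
  have c\<Phi>: "continuous_on Q \<Phi>"
    unfolding \<Phi>_def by (intro continuous_intros cX continuous_on_compose2[OF N cX]) auto
  have "openin (top_of_set Q) (Q \<inter> \<Phi> -` V)" by (rule continuous_openin_preimage_gen[OF c\<Phi> V(1)])
  moreover define Pre where "Pre = Q \<inter> \<Phi> -` V"
  have "(y0, s0, 0) \<in> Pre" using DX s0 V(2) by (simp add: Pre_def Q_def \<Phi>_def)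
  ultimately have "\<exists>d>0. ball (y0, s0, 0) d \<inter> Q \<subseteq> Pre"
    unfolding openin_contains_ball Pre_def[symmetric] by (elim conjE) (rule bspec)
  then obtain d where d: "d > 0" "ball (y0, s0, 0) d \<inter> Q \<subseteq> Pre" by (elim exE conjE)
  define r' where "r' = min r (d / 3)"
  have r': "r' > 0" "r' \<le> r" using r d by (auto simp: r'_def)
  have inV: "(X y s + h *\<^sub>R N (X y s), s) \<in> V" if "y \<in> D" "dist y y0 < r'" "s \<in> {a..b}" "dist s s0 < r'" "\<bar>h\<bar> < r'" for y s h
  proof -
    have "dist (y, s, h) (y0, s0, 0) \<le> dist y y0 + dist (s, h) (s0, 0)"
      unfolding dist_Pair_Pair[of y "(s, h)"] by (rule sqrt_sum_squares_le_sum) auto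
    also have "dist (s, h) (s0, 0) \<le> dist s s0 + dist h 0"
      unfolding dist_Pair_Pair by (rule sqrt_sum_squares_le_sum) auto
    finally have "dist (y, s, h) (y0, s0, 0) < d" using that by (simp add: r'_def)
    then have "(y, s, h) \<in> Pre" using that by (intro subsetD[OF d(2)]) (auto simp: Q_def dist_commute)
    then show ?thesis by (simp add: Pre_def \<Phi>_def)
  qed
  define U where "U = (S \<inter> \<eta> -` ball y0 r') \<inter> (S \<inter> w -` {-r'<..<r'}) \<inter> (UNIV \<times> ball s0 r')"
  have U: "(z, s) \<in> U \<longleftrightarrow> (z, s) \<in> S \<and> dist (\<eta> (z, s)) y0 < r' \<and> \<bar>w (z, s)\<bar> < r' \<and> dist s s0 < r'" for z s
    by (auto simp: U_def dist_commute)
  have oU: "open U" unfolding U_def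
    by (intro open_Int open_Times continuous_open_preimage sheet_continuous[OF sh] sheetD(5)[OF sh]) auto
  have pU: "(X y s, s) \<in> U" if "y \<in> model_hyperplane" "dist y y0 < r'" "s \<in> {a..b}" "dist s s0 < r'" for y s
    using sheet_on[OF sh that(1) _ that(3)] that r' unfolding U by auto
  \<comment> \<open>The one-sided neighbourhood of the sheet at time s on the side e = 1 or e = - 1,
    as an image of a convex set.\<close>
  define P where "P = (\<lambda>s e. (\<lambda>q. X (fst q) s + (e * snd q) *\<^sub>R N (X (fst q) s)) ` ((model_hyperplane \<inter> ball y0 r') \<times> {0<..<r'}))"
  define \<sigma> where "\<sigma> = (\<lambda>s. P s 1 \<subseteq> B s)"
  have main: "(z \<in> frontier (B s) \<longleftrightarrow> w (z, s) = 0) \<and> (w (z, s) \<noteq> 0 \<longrightarrow> (z \<in> B s \<longleftrightarrow> (0 < w (z, s)) = \<sigma> s))"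
    if zU: "(z, s) \<in> U" and s: "s \<in> {a..b}" for z s
  proof -
    have ss: "dist s s0 < r'" using zU U by blast
    have rep: "\<eta> (x, s) \<in> model_hyperplane \<and> dist (\<eta> (x, s)) y0 < r' \<and> \<eta> (x, s) \<in> D \<and> \<bar>w (x, s)\<bar> < r' \<and>
        x = X (\<eta> (x, s)) s + w (x, s) *\<^sub>R N (X (\<eta> (x, s)) s)" if "(x, s) \<in> U" for x
      using that sheetD(13)[OF sh, of "(x, s)"] sheetD(14,15)[OF sh _ s, of x] unfolding U by blast
    have iff: "x \<in> frontier (B s) \<longleftrightarrow> w (x, s) = 0" if x: "(x, s) \<in> U" for x
    proof
      define y h where "y = \<eta> (x, s)" "h = w (x, s)"
      note R = rep[OF x, folded y_h_def]
      {
        assume "x \<in> frontier (B s)"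
        moreover have "(x, s) \<in> V" using inV[of y s h] R s ss by simp
        ultimately show "w (x, s) = 0" using V(3) s by blast
      }
      {
        assume "w (x, s) = 0"
        then have "h = 0" by (simp add: y_h_def)
        then have "x = X y s" using R by simp
        then show "x \<in> frontier (B s)" using chart_frontier[OF DX(1) _ s, of y] R by blast
      }
    qed
    have P1: "(x, s) \<in> U \<and> w (x, s) \<noteq> 0" if xP: "x \<in> P s e" and e: "e = 1 \<or> e = -1" for x e
    proof -
      obtain y h where y: "y \<in> model_hyperplane" "dist y y0 < r'" "0 < h" "h < r'" "x = X y s + (e * h) *\<^sub>R N (X y s)"
      proof -
        obtain q where "q \<in> (model_hyperplane \<inter> ball y0 r') \<times> {0<..<r'}" "x = X (fst q) s + (e * snd q) *\<^sub>R N (X (fst q) s)"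
          using xP unfolding P_def by blast
        then show thesis by (intro that[of "fst q" "snd q"]) (auto simp: dist_commute mem_Times_iff)
      qed
      have "\<bar>e * h\<bar> < r" using y(3,4) e r'(2) by (auto simp: abs_mult)
      from sheetD(17)[OF sh y(1) _ s _ this] have "(x, s) \<in> S \<and> w (x, s) = e * h \<and> \<eta> (x, s) = y"
        unfolding y(5) using y(2) ss r'(2) by simp
      then show ?thesis unfolding U using y e ss by auto
    qed
    have P2: "x \<in> P s (if 0 < w (x, s) then 1 else -1)" if x: "(x, s) \<in> U" "w (x, s) \<noteq> 0" for x
    proof -
      define y h where "y = \<eta> (x, s)" "h = w (x, s)"
      note R = rep[OF x(1), folded y_h_def]
      define e where "e = (if 0 < h then 1 else -1 :: real)"
      have "h = e * \<bar>h\<bar>" "\<bar>h\<bar> > 0" using x(2) by (auto simp: y_h_def e_def)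
      then have "x = X y s + (e * \<bar>h\<bar>) *\<^sub>R N (X y s)" using R by simp
      then have "x \<in> P s e" unfolding P_def using R \<open>\<bar>h\<bar> > 0\<close>
        by (intro image_eqI[where x = "(y, \<bar>h\<bar>)"]) (auto simp: dist_commute)
      then show ?thesis by (simp add: e_def y_h_def)
    qed
    \<comment> \<open>Each side is connected and free of boundary points, so it lies either inside
      or outside.\<close>
    have alt: "P s e \<subseteq> B s \<or> P s e \<inter> B s = {}" if e: "e = 1 \<or> e = -1" for e
    proof (rule connected_inside_or_outside[OF s])
      have sub: "(\<lambda>q. (fst q, s, e * snd q)) ` ((model_hyperplane \<inter> ball y0 r') \<times> {0<..<r'}) \<subseteq> Q"
        using sheetD(16)[OF sh] r'(2) s by (force simp: Q_def dist_commute)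
      have "continuous_on ((model_hyperplane \<inter> ball y0 r') \<times> {0<..<r'}) (\<lambda>q. fst (\<Phi> (fst q, s, e * snd q)))"
        by (rule continuous_on_fst, rule continuous_on_compose2[OF c\<Phi> _ sub]) (intro continuous_intros)
      moreover have "convex ((model_hyperplane \<inter> ball y0 r') \<times> {0<..<r'} :: ('a \<times> real) set)"
        by (intro convex_Times convex_Int convex_ball convex_real_interval subspace_imp_convex subspace_model_hyperplane)
      ultimately show "connected (P s e)"
        unfolding P_def by (intro connected_continuous_image convex_connected) (simp_all add: \<Phi>_def)
      show "x \<notin> frontier (B s)" if "x \<in> P s e" for x using P1[OF that e] iff by blast
    qed
    have y0H: "y0 \<in> model_hyperplane" by (rule sheet_base(1)[OF sh])
    define q where "q = X y0 s"
    have qU: "(q, s) \<in> U" unfolding q_def by (rule pU[OF y0H]) (use r' s ss in auto)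
    have qf: "q \<in> frontier (B s)" unfolding q_def by (rule chart_frontier[OF DX s])
    define W where "W = (\<lambda>x. (x, s)) -` U"
    have oW: "open W" unfolding W_def by (rule open_vimage[OF oU]) (intro continuous_intros)
    have qW: "q \<in> W" using qU by (simp add: W_def)
    have ex1: "\<exists>x. (x, s) \<in> U \<and> w (x, s) \<noteq> 0 \<and> x \<in> B s"
    proof -
      have "q \<in> closure (B s)" using qf by (simp add: frontier_def)
      then obtain x where "x \<in> W" "x \<in> B s" using oW qW open_Int_closure_eq_empty[of W "B s"] by blast
      then show ?thesis using iff[of x] frontier_disjoint[OF s] by (auto simp: W_def)
    qed
    \<comment> \<open>A local defining function vanishes at q with nonzero gradient and therefore
      takes positive values nearby, so the two sides are not both inside.\<close>
    have ex2: "\<exists>x. (x, s) \<in> U \<and> w (x, s) \<noteq> 0 \<and> x \<notin> B s"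
    proof -
      obtain U' \<rho> where U': "q \<in> U'" "local_defining_function (B s) U' \<rho>"
        using boundary_B[OF s] qf unfolding smooth_boundary_def by blast
      note L = local_defining_function_facts[OF U'(2) open_B[OF s]]
      have \<rho>q: "\<rho> q = 0" by (rule L(7)[OF U'(1) qf])
      have "\<exists>x\<in>W \<inter> U'. 0 < \<rho> x"
      proof (rule ccontr)
        assume neg: "\<not> ?thesis"
        then have "\<forall>x\<in>W \<inter> U'. \<rho> x \<le> \<rho> q" unfolding \<rho>q by (simp add: not_less)
        then have "(\<lambda>v. gradient \<rho> q \<bullet> v) = (\<lambda>v. 0)"
          by (intro differential_zero_maxmin[OF _ open_Int[OF oW L(1)] L(3)[OF U'(1)]]) (use qW U'(1) in auto)
        from fun_cong[OF this, of "gradient \<rho> q"] show False using L(5)[OF U'(1)] by simp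
      qed
      then obtain x where x: "x \<in> W" "x \<in> U'" "0 < \<rho> x" by blast
      then show ?thesis using iff[of x] L(6,7)[OF x(2)] by (auto simp: W_def)
    qed
    have A1: "P s 1 \<subseteq> B s \<or> P s (-1) \<subseteq> B s"
    proof -
      obtain x where x: "(x, s) \<in> U" "w (x, s) \<noteq> 0" "x \<in> B s" using ex1 by blast
      show ?thesis using P2[OF x(1,2)] x(3) alt[of 1] alt[of "-1"] by (auto split: if_splits)
    qed
    have A2: "\<not> (P s 1 \<subseteq> B s \<and> P s (-1) \<subseteq> B s)"
    proof -
      obtain x where x: "(x, s) \<in> U" "w (x, s) \<noteq> 0" "x \<notin> B s" using ex2 by blast
      show ?thesis using P2[OF x(1,2)] x(3) by (auto split: if_splits)
    qed
    have "z \<in> B s \<longleftrightarrow> (0 < w (z, s)) = \<sigma> s" if nz: "w (z, s) \<noteq> 0"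
      using P2[OF zU nz] A1 A2 alt[of 1] alt[of "-1"] unfolding \<sigma>_def by (auto split: if_splits)
    then show ?thesis using iff[OF zU] by blast
  qed
  show ?thesis
    by (intro exI[of _ U] exI[of _ \<sigma>] conjI allI impI oU main)
      (use pU[OF sheet_base(1)[OF sh] _ s0] r' U in auto)
qed

lemma track_closed: "closed {(x, t). t \<in> {a..b} \<and> x \<in> frontier (B t)}"
  by (rule compact_imp_closed[OF track_compact])

text \<open>The track of the boundaries lies in a ball. A point of \<open>B t\<close> outside this
  ball would start a radial ray that never meets the boundary, and the ray would stay in the bounded
  set \<open>B t\<close>.\<close>

lemma uniform_bound: "\<exists>R. \<forall>t\<in>{a..b}. B t \<subseteq> cball 0 R"
proof -
  obtain R where R: "\<And>z. z \<in> {(x, t). t \<in> {a..b} \<and> x \<in> frontier (B t)} \<Longrightarrow> norm z \<le> R" "0 < R"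
    using compact_imp_bounded[OF track_compact] unfolding bounded_pos by auto
  have "x \<in> cball 0 R" if t: "t \<in> {a..b}" and x: "x \<in> B t" for t x
  proof (rule ccontr)
    assume nx: "x \<notin> cball 0 R"
    define C where "C = (\<lambda>c::real. c *\<^sub>R x) ` {1..}"
    have "connected C" unfolding C_def by (intro connected_continuous_image continuous_intros connected_Ici)
    moreover have "z \<notin> frontier (B t)" if zC: "z \<in> C" for z
    proof
      assume "z \<in> frontier (B t)"
      then have "norm (z, t) \<le> R" using R(1)[of "(z, t)"] t by auto
      then have "norm z \<le> R" using norm_fst_le[of z t] by simp
      moreover obtain c where "c \<ge> 1" "z = c *\<^sub>R x" using zC by (auto simp: C_def)
      moreover have "1 * norm x \<le> c * norm x" using \<open>c \<ge> 1\<close> by (intro mult_right_mono) auto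
      ultimately show False using nx by simp
    qed
    ultimately have "C \<subseteq> B t \<or> C \<inter> B t = {}" by (rule connected_inside_or_outside[OF t])
    moreover have "x \<in> C" unfolding C_def by (rule image_eqI[where x = 1]) auto
    ultimately have CB: "C \<subseteq> closure (B t)" using x closure_subset by blast
    obtain R' where R': "\<And>z. z \<in> closure (B t) \<Longrightarrow> norm z \<le> R'"
      using compact_imp_bounded[OF compact_B[OF t]] unfolding bounded_iff by blast
    have "R < norm x" using nx by simp
    then have x0: "norm x > 0" using R(2) by linarith
    define c where "c = max 1 ((R' + 1) / norm x)"
    have "c *\<^sub>R x \<in> C" by (auto simp: C_def c_def)
    then have "norm (c *\<^sub>R x) \<le> R'" using CB R' by blast
    moreover have "R' + 1 \<le> c * norm x"
    proof -
      have "R' + 1 = (R' + 1) / norm x * norm x" using x0 by simp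
      also have "\<dots> \<le> c * norm x" using x0 by (intro mult_right_mono) (auto simp: c_def)
      finally show ?thesis .
    qed
    moreover have "norm (c *\<^sub>R x) = c * norm x" unfolding norm_scaleR by (simp add: c_def)
    ultimately show False by linarith
  qed
  then show ?thesis by blast
qed

lemma flat_sheet_exists:
  assumes t: "T \<in> {a..b}" and p: "p \<in> frontier (B T)"
  shows "\<exists>D X y0 n r S w g \<tau> g' \<eta> K. sheet D X y0 T (\<lambda>_. n) r S w g \<tau> g' \<eta> K \<and> p = X y0 T"
proof -
  obtain D X y0 where DX: "(D, X) \<in> charts" "y0 \<in> D" "p = X y0 T" using frontier_chart[OF t p] by blast
  obtain n where n: "\<And>v. v \<in> model_hyperplane \<Longrightarrow> dir_deriv (\<lambda>y. X y T) y0 v \<noteq> n"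
    using normal_transversal_exists[OF DX(1,2) t] by blast
  from sheet_exists[OF DX(1,2) t Ck_on_const, of n] n DX(3) show ?thesis by blast
qed

lemma frontier_sides:
  assumes t: "T \<in> {a..b}" and p: "p \<in> frontier (B T)"
  shows "\<exists>D X y0 n r S w g \<tau> g' \<eta> K U \<sigma>. sheet D X y0 T (\<lambda>_. n) r S w g \<tau> g' \<eta> K \<and> p = X y0 T \<and>
    open U \<and> (p, T) \<in> U \<and> U \<subseteq> S \<and> (\<forall>z s. (z, s) \<in> U \<longrightarrow> s \<in> {a..b} \<longrightarrow>
    (z \<in> frontier (B s) \<longleftrightarrow> w (z, s) = 0) \<and> (w (z, s) \<noteq> 0 \<longrightarrow> (z \<in> B s \<longleftrightarrow> (0 < w (z, s)) = \<sigma> s)))"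
proof -
  obtain D X y0 n r S w g \<tau> g' \<eta> K where sh: "sheet D X y0 T (\<lambda>_. n) r S w g \<tau> g' \<eta> K" and p: "p = X y0 T"
    using flat_sheet_exists[OF assms] by blast
  from sheet_sides[OF sh continuous_on_const] p sh show ?thesis by blast
qed

lemma sign_near:
  fixes w :: "'c::metric_space \<times> real \<Rightarrow> real"
  assumes S: "open S" "(z, T) \<in> S" and w: "continuous_on S w" "w (z, T) \<noteq> (0::real)" and U: "open U" "(z, T) \<in> U"
  shows "eventually (\<lambda>s. (z, s) \<in> U \<and> w (z, s) \<noteq> 0 \<and> (0 < w (z, s) \<longleftrightarrow> 0 < w (z, T))) (nhds T)"
proof -
  have "isCont w (z, T)" using S w(1) by (simp add: continuous_on_eq_continuous_at)
  then have wl: "(w \<longlongrightarrow> w (z, T)) (nhds (z, T))" by (simp add: isCont_def tendsto_at_iff_tendsto_nhds)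
  have l: "filterlim (\<lambda>s. (z, s)) (nhds (z, T)) (nhds T)" by (intro tendsto_Pair tendsto_const filterlim_ident)
  have wl': "((\<lambda>s. w (z, s)) \<longlongrightarrow> w (z, T)) (nhds T)" by (rule filterlim_compose[OF wl l])
  have e1: "eventually (\<lambda>s. (z, s) \<in> U) (nhds T)" by (rule topological_tendstoD[OF l U])
  have e2: "eventually (\<lambda>s. w (z, s) \<noteq> 0 \<and> (0 < w (z, s) \<longleftrightarrow> 0 < w (z, T))) (nhds T)"
  proof (cases "0 < w (z, T)")
    case True
    then show ?thesis using order_tendstoD(1)[OF wl' True] by (auto elim: eventually_mono)
  next
    case False
    then have neg: "w (z, T) < 0" using w(2) by simp
    show ?thesis using order_tendstoD(2)[OF wl' neg] neg by (auto elim!: eventually_mono)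
  qed
  show ?thesis using e1 e2 by eventually_elim blast
qed

text \<open>A ball that meets no boundary for nearby times is entirely inside or entirely outside at
  each such time. Both memberships are taken at the same time s; the comparison of different times
  is left to \<open>membership_stable\<close>.\<close>

lemma off_frontier_ball:
  assumes T: "T \<in> {a..b}" and x: "x \<notin> frontier (B T)"
  shows "\<exists>e>0. \<forall>z s. dist z x < e \<longrightarrow> dist s T < e \<longrightarrow> s \<in> {a..b} \<longrightarrow> z \<notin> frontier (B s) \<and> (z \<in> B s \<longleftrightarrow> x \<in> B s)"
proof -
  have "open (- {(x, t). t \<in> {a..b} \<and> x \<in> frontier (B t)})" using track_closed by (rule open_Compl)
  moreover have "(x, T) \<in> - {(x, t). t \<in> {a..b} \<and> x \<in> frontier (B t)}" using x by simp
  ultimately obtain W1 W2 where W: "open W1" "open W2" "(x, T) \<in> W1 \<times> W2"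
    "W1 \<times> W2 \<subseteq> - {(x, t). t \<in> {a..b} \<and> x \<in> frontier (B t)}" by (rule open_prod_elim)
  obtain e1 e2 where e: "e1 > 0" "ball x e1 \<subseteq> W1" "e2 > 0" "ball T e2 \<subseteq> W2"
    using W(1,2,3) openE[of W1 x] openE[of W2 T] by (metis mem_Sigma_iff)
  have nf: "z \<notin> frontier (B s)" if "z \<in> ball x e1" "dist s T < e2" "s \<in> {a..b}" for z s
  proof -
    have "z \<in> W1" "s \<in> W2" using that e by (auto simp: dist_commute subset_iff)
    then show ?thesis using subsetD[OF W(4), of "(z, s)"] that(3) by auto
  qed
  have iff: "z \<in> B s \<longleftrightarrow> x \<in> B s" if z: "z \<in> ball x e1" "dist s T < e2" "s \<in> {a..b}" for z s
  proof -
    have "ball x e1 \<subseteq> B s \<or> ball x e1 \<inter> B s = {}"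
      by (rule connected_inside_or_outside[OF z(3) connected_ball]) (rule nf[OF _ z(2,3)])
    moreover have "x \<in> ball x e1" using e(1) by simp
    ultimately show ?thesis using z(1) by blast
  qed
  show ?thesis
  proof (intro exI[of _ "min e1 e2"] conjI allI impI)
    fix z s assume "dist z x < min e1 e2" "dist s T < min e1 e2" "s \<in> {a..b}"
    then have H: "z \<in> ball x e1" "dist s T < e2" "s \<in> {a..b}" by (simp_all add: dist_commute)
    show "z \<notin> frontier (B s)" by (rule nf[OF H])
    show "z \<in> B s \<longleftrightarrow> x \<in> B s" by (rule iff[OF H])
  qed (use e in simp)
qed

text \<open>Let a point be called stable if its membership in \<open>B s\<close> is the same as at T
  for all s near T. Off the boundary stability is locally constant in space. Across the boundary it
  passes from one side of the sheet to the other, because both sides are governed by the same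
  \<sigma> s. The space is connected and points far away are stable, being outside every
  \<open>B s\<close>, so stability holds everywhere off the boundary.\<close>

lemma membership_stable:
  assumes T: "T \<in> {a..b}" and x: "x \<notin> frontier (B T)"
  shows "eventually (\<lambda>s. s \<in> {a..b} \<longrightarrow> (x \<in> B s \<longleftrightarrow> x \<in> B T)) (nhds T)"
proof -
  define Ag where "Ag = (\<lambda>x. eventually (\<lambda>s. s \<in> {a..b} \<longrightarrow> (x \<in> B s \<longleftrightarrow> x \<in> B T)) (nhds T))"
  \<comment> \<open>Boundary points are included through their neighbours off the boundary; that
    makes \<open>E True\<close> and \<open>E False\<close> an open cover of the whole space, and
    they are disjoint because the boundary has empty interior.\<close>
  define E where "E = (\<lambda>P. {x. \<exists>W. open W \<and> x \<in> W \<and> (\<forall>z\<in>W. z \<notin> frontier (B T) \<longrightarrow> (Ag z \<longleftrightarrow> P))})"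
  have dense: "\<exists>z\<in>W. z \<notin> frontier (B T)" if "open W" "W \<noteq> {}" for W
    using interior_frontier_open[OF open_B[OF T]] interior_maximal[OF _ that(1), of "frontier (B T)"] that(2) by blast
  have oE: "open (E P)" for P
    unfolding E_def by (subst open_subopen) blast
  have "E True \<union> E False = UNIV"
  proof -
    have "x \<in> E True \<union> E False" for x
    proof (cases "x \<in> frontier (B T)")
      case False
      from off_frontier_ball[OF T this] obtain e where e: "e > 0"
        "\<And>z s. dist z x < e \<Longrightarrow> dist s T < e \<Longrightarrow> s \<in> {a..b} \<Longrightarrow> (z \<in> B s \<longleftrightarrow> x \<in> B s)" by blast
      have "Ag z \<longleftrightarrow> Ag x" if z: "dist z x < e" for z
      proof -
        have ev: "eventually (\<lambda>s. dist s T < e) (nhds T)" using e(1) eventually_nhds_metric by blast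
        have "z \<in> B T \<longleftrightarrow> x \<in> B T" using e(2)[OF z _ T] e(1) by simp
        then show ?thesis unfolding Ag_def
          by (intro eventually_cong[OF ev]) (use e(2)[OF z] in auto)
      qed
      then have "\<forall>z\<in>ball x e. z \<notin> frontier (B T) \<longrightarrow> (Ag z \<longleftrightarrow> Ag x)" by (metis dist_commute mem_ball)
      moreover have "x \<in> ball x e" using e(1) by simp
      ultimately have "x \<in> E (Ag x)" unfolding E_def using open_ball by blast
      then show ?thesis by (cases "Ag x") auto
    next
      case True
      from frontier_sides[OF T this] obtain D X y0 n r S w g \<tau> g' \<eta> K U \<sigma>
        where sh: "sheet D X y0 T (\<lambda>_. n) r S w g \<tau> g' \<eta> K" and U: "open U" "(x, T) \<in> U" "U \<subseteq> S"
          and sd: "\<forall>z s. (z, s) \<in> U \<longrightarrow> s \<in> {a..b} \<longrightarrow>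
            (z \<in> frontier (B s) \<longleftrightarrow> w (z, s) = 0) \<and> (w (z, s) \<noteq> 0 \<longrightarrow> (z \<in> B s \<longleftrightarrow> (0 < w (z, s)) = \<sigma> s))" by blast
      \<comment> \<open>Near the sheet, membership is the sign of w compared with \<sigma>; the sign
        of w at a fixed point is stable, so stability of the point amounts to stability of \<sigma>,
        whichever side the point is on.\<close>
      define P where "P = eventually (\<lambda>s. s \<in> {a..b} \<longrightarrow> \<sigma> s = \<sigma> T) (nhds T)"
      have "Ag z \<longleftrightarrow> P" if z: "(z, T) \<in> U" "z \<notin> frontier (B T)" for z
      proof -
        have w0: "w (z, T) \<noteq> 0" using sd z T by blast
        have "(z, T) \<in> S" using z U(3) by blast
        note ev = sign_near[OF sheetD(5)[OF sh] this sheet_continuous(1)[OF sh] w0 U(1) z(1)]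
        show ?thesis unfolding Ag_def P_def
        proof (rule eventually_cong[OF ev])
          fix s assume H: "(z, s) \<in> U \<and> w (z, s) \<noteq> 0 \<and> (0 < w (z, s) \<longleftrightarrow> 0 < w (z, T))"
          have "s \<in> {a..b} \<Longrightarrow> z \<in> B s \<longleftrightarrow> (0 < w (z, T)) = \<sigma> s" using sd H by blast
          moreover have "z \<in> B T \<longleftrightarrow> (0 < w (z, T)) = \<sigma> T" using sd z w0 T by blast
          ultimately show "(s \<in> {a..b} \<longrightarrow> (z \<in> B s \<longleftrightarrow> z \<in> B T)) \<longleftrightarrow> (s \<in> {a..b} \<longrightarrow> \<sigma> s = \<sigma> T)" by blast
        qed
      qed
      moreover have "open ((\<lambda>z. (z, T)) -` U)" by (rule open_vimage[OF U(1)]) (intro continuous_intros)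
      ultimately have "x \<in> E P" unfolding E_def using U(2)
        by (intro CollectI exI[of _ "(\<lambda>z. (z, T)) -` U"]) auto
      then show ?thesis by (cases P) auto
    qed
    then show ?thesis by blast
  qed
  moreover have "E True \<inter> E False = {}"
  proof (rule ccontr)
    assume "E True \<inter> E False \<noteq> {}"
    then obtain z W W' where z: "open W" "z \<in> W" "\<forall>z\<in>W. z \<notin> frontier (B T) \<longrightarrow> (Ag z \<longleftrightarrow> True)"
      "open W'" "z \<in> W'" "\<forall>z\<in>W'. z \<notin> frontier (B T) \<longrightarrow> (Ag z \<longleftrightarrow> False)" unfolding E_def by blast
    then show False using dense[of "W \<inter> W'"] open_Int[of W W'] by blast
  qed
  moreover have "E True \<noteq> {}"
  proof -
    \<comment> \<open>The starting point of the connectedness argument: outside a common ball no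
      point belongs to any \<open>B s\<close>.\<close>
    obtain R where R: "\<And>t. t \<in> {a..b} \<Longrightarrow> B t \<subseteq> cball 0 R" using uniform_bound by blast
    obtain v :: 'a where "norm v = max 0 (R + 1)" using vector_choose_size[of "max 0 (R + 1)"] by auto
    then have v: "v \<in> - cball 0 R" by auto
    have "Ag z" if z: "z \<in> - cball 0 R" for z
    proof -
      have "z \<notin> B s" if "s \<in> {a..b}" for s using R[OF that] z by blast
      then show ?thesis unfolding Ag_def using T by (intro always_eventually) auto
    qed
    then have "v \<in> E True" unfolding E_def using v by (intro CollectI exI[of _ "- cball 0 R"]) auto
    then show ?thesis by blast
  qed
  ultimately have "E False = {}"
    using connected_UNIV[where 'a = 'a] oE[of True] oE[of False] unfolding connected_def by blast
  then have "x \<in> E True" using \<open>E True \<union> E False = UNIV\<close> by blast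
  then show ?thesis using x unfolding E_def Ag_def by blast
qed

lemma off_frontier_stable:
  assumes T: "T \<in> {a..b}" and x: "x \<notin> frontier (B T)"
  shows "\<exists>e>0. \<forall>z s. dist z x < e \<longrightarrow> dist s T < e \<longrightarrow> s \<in> {a..b} \<longrightarrow> z \<notin> frontier (B s) \<and> (z \<in> B s \<longleftrightarrow> x \<in> B T)"
proof -
  from off_frontier_ball[OF assms] obtain e where e: "e > 0"
    "\<forall>z s. dist z x < e \<longrightarrow> dist s T < e \<longrightarrow> s \<in> {a..b} \<longrightarrow> z \<notin> frontier (B s) \<and> (z \<in> B s \<longleftrightarrow> x \<in> B s)" by blast
  from membership_stable[OF assms] obtain d where d: "d > 0"
    "\<forall>s. dist s T < d \<longrightarrow> s \<in> {a..b} \<longrightarrow> (x \<in> B s \<longleftrightarrow> x \<in> B T)" unfolding eventually_nhds_metric by blast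
  show ?thesis
  proof (intro exI[of _ "min e d"] conjI allI impI)
    fix z s assume H: "dist z x < min e d" "dist s T < min e d" "s \<in> {a..b}"
    have "z \<notin> frontier (B s) \<and> (z \<in> B s \<longleftrightarrow> x \<in> B s)" by (rule e(2)[rule_format]) (use H in simp_all)
    moreover have "x \<in> B s \<longleftrightarrow> x \<in> B T" by (rule d(2)[rule_format]) (use H in simp_all)
    ultimately show "z \<notin> frontier (B s)" "z \<in> B s \<longleftrightarrow> x \<in> B T" by simp_all
  qed (use e d in simp)
qed

lemma closed_enclosed: "closed {(x, t). t \<in> {a..b} \<and> x \<in> closure (B t)}"
proof -
  have "\<exists>W. open W \<and> z \<in> W \<and> W \<subseteq> - {(x, t). t \<in> {a..b} \<and> x \<in> closure (B t)}"
    if z: "z \<in> - {(x, t). t \<in> {a..b} \<and> x \<in> closure (B t)}" for z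
  proof (cases "snd z \<in> {a..b}")
    case False
    have "open (UNIV \<times> - {a..b} :: ('a \<times> real) set)" by (intro open_Times) auto
    then show ?thesis using False by (intro exI[of _ "UNIV \<times> - {a..b}"]) (auto simp: mem_Times_iff)
  next
    case True
    obtain x t where xt: "z = (x, t)" by fastforce
    have t: "t \<in> {a..b}" "x \<notin> B t" "x \<notin> frontier (B t)" using z True closure_eq[of t x] by (auto simp: xt)
    from off_frontier_stable[OF t(1,3)] obtain e where e: "e > 0"
      "\<And>z s. dist z x < e \<Longrightarrow> dist s t < e \<Longrightarrow> s \<in> {a..b} \<Longrightarrow> z \<notin> frontier (B s) \<and> (z \<in> B s \<longleftrightarrow> x \<in> B t)" by blast
    have "open (ball x e \<times> ball t e)" by (intro open_Times open_ball)
    moreover have "ball x e \<times> ball t e \<subseteq> - {(x, t). t \<in> {a..b} \<and> x \<in> closure (B t)}"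
      using e(2) t(2) closure_eq by (auto simp: dist_commute)
    ultimately show ?thesis using e(1) unfolding xt by (intro exI[of _ "ball x e \<times> ball t e"]) auto
  qed
  then have "open (- {(x, t). t \<in> {a..b} \<and> x \<in> closure (B t)})" by (subst open_subopen) blast
  then show ?thesis by (simp add: closed_def)
qed

text \<open>Once membership is stable, \<sigma> s equals \<sigma> T for s near T, and the side
  becomes a constant sign: near (p, T) the set \<open>B s\<close> is where \<sigma> w is
  negative.\<close>

lemma frontier_sign:
  assumes T: "T \<in> {a..b}" and p: "p \<in> frontier (B T)"
  shows "\<exists>D X y0 n r S w g \<tau> g' \<eta> K \<sigma> e. sheet D X y0 T (\<lambda>_. n) r S w g \<tau> g' \<eta> K \<and> p = X y0 T \<and>
    (\<sigma> = 1 \<or> \<sigma> = - (1::real)) \<and> 0 < e \<and> (\<forall>z s. dist z p < e \<longrightarrow> dist s T < e \<longrightarrow> s \<in> {a..b} \<longrightarrow>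
    (z, s) \<in> S \<and> (z \<in> frontier (B s) \<longleftrightarrow> w (z, s) = 0) \<and> (z \<in> B s \<longleftrightarrow> \<sigma> * w (z, s) < 0))"
proof -
  from frontier_sides[OF assms] obtain D X y0 n r S w g \<tau> g' \<eta> K U \<sigma>
    where sh: "sheet D X y0 T (\<lambda>_. n) r S w g \<tau> g' \<eta> K" and pX: "p = X y0 T" and U: "open U" "(p, T) \<in> U" "U \<subseteq> S"
      and sd: "\<forall>z s. (z, s) \<in> U \<longrightarrow> s \<in> {a..b} \<longrightarrow>
        (z \<in> frontier (B s) \<longleftrightarrow> w (z, s) = 0) \<and> (w (z, s) \<noteq> 0 \<longrightarrow> (z \<in> B s \<longleftrightarrow> (0 < w (z, s)) = \<sigma> s))" by blast
  have oU: "open ((\<lambda>z. (z, T)) -` U)" by (rule open_vimage[OF U(1)]) (intro continuous_intros)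
  have "\<exists>z. (z, T) \<in> U \<and> z \<notin> frontier (B T)"
    using interior_frontier_open[OF open_B[OF T]] interior_maximal[OF _ oU, of "frontier (B T)"] U(2) by blast
  then obtain z where z: "(z, T) \<in> U" "z \<notin> frontier (B T)" by blast
  have w0: "w (z, T) \<noteq> 0" using sd z T by blast
  have "(z, T) \<in> S" using z U(3) by blast
  note ev = sign_near[OF sheetD(5)[OF sh] this sheet_continuous(1)[OF sh] w0 U(1) z(1)]
  have "eventually (\<lambda>s. s \<in> {a..b} \<longrightarrow> \<sigma> s = \<sigma> T) (nhds T)"
    using ev membership_stable[OF T z(2)]
  proof eventually_elim
    case (elim s)
    have "s \<in> {a..b} \<Longrightarrow> z \<in> B s \<longleftrightarrow> (0 < w (z, T)) = \<sigma> s" using sd elim by blast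
    moreover have "z \<in> B T \<longleftrightarrow> (0 < w (z, T)) = \<sigma> T" using sd z w0 T by blast
    ultimately show ?case using elim by blast
  qed
  then obtain d where d: "d > 0" "\<forall>s. dist s T < d \<longrightarrow> s \<in> {a..b} \<longrightarrow> \<sigma> s = \<sigma> T" unfolding eventually_nhds_metric by blast
  obtain W1 W2 where W: "open W1" "open W2" "(p, T) \<in> W1 \<times> W2" "W1 \<times> W2 \<subseteq> U" by (rule open_prod_elim[OF U(1,2)])
  obtain e1 e2 where e: "e1 > 0" "ball p e1 \<subseteq> W1" "e2 > 0" "ball T e2 \<subseteq> W2"
    using W(1,2,3) openE[of W1 p] openE[of W2 T] by (metis mem_Sigma_iff)
  define \<epsilon> where "\<epsilon> = (if \<sigma> T then -1 else 1 :: real)"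
  have res: "(z, s) \<in> S \<and> (z \<in> frontier (B s) \<longleftrightarrow> w (z, s) = 0) \<and> (z \<in> B s \<longleftrightarrow> \<epsilon> * w (z, s) < 0)"
    if H: "dist z p < min d (min e1 e2)" "dist s T < min d (min e1 e2)" "s \<in> {a..b}" for z s
  proof -
    have "z \<in> W1" "s \<in> W2" using H e by (auto simp: dist_commute subset_iff)
    then have zU: "(z, s) \<in> U" using W(4) by blast
    have sg: "\<sigma> s = \<sigma> T" using d H by auto
    have f: "z \<in> frontier (B s) \<longleftrightarrow> w (z, s) = 0" using sd zU H(3) by blast
    have "z \<in> B s \<longleftrightarrow> \<epsilon> * w (z, s) < 0"
    proof (cases "w (z, s) = 0")
      case True
      then show ?thesis using f frontier_disjoint[OF H(3)] by auto
    next
      case False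
      then have "z \<in> B s \<longleftrightarrow> (0 < w (z, s)) = \<sigma> T" using sd zU H(3) sg by blast
      then show ?thesis using False by (auto simp: \<epsilon>_def)
    qed
    then show ?thesis using f zU U(3) by blast
  qed
  have "\<epsilon> = 1 \<or> \<epsilon> = -1" "0 < min d (min e1 e2)" using d e by (auto simp: \<epsilon>_def)
  with sh pX res show ?thesis by blast
qed

end

section \<open>Avoidance\<close>

text \<open>If DW = l q, then l^2 + |DW|^2 = l^2 (1 + |q|^2), so the graph operator with slope q is
  the level set operator regularised by l. A negative defect at Y is the case l = 0, and continuity
  in (l, z) carries the strict inequality to small l and nearby points.\<close>

lemma defect_to_graph_inequality:
  assumes J: "jet_on S W g \<tau> g'" and S: "open S" "Y \<in> S"
    and cont: "continuous_on S g" "continuous_on S \<tau>" "\<And>h. continuous_on S (\<lambda>z. g' z h)"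
    and neg: "mcf_defect g \<tau> g' Y < 0"
  shows "\<exists>c>0. \<exists>\<delta>>0. \<forall>Y'. dist Y' Y < \<delta> \<longrightarrow> (\<forall>q l. g Y' = l *\<^sub>R q \<and> \<bar>l\<bar> \<le> \<delta> \<longrightarrow>
    \<tau> Y' + c \<le> hessian_trace (g' Y') - g' Y' (q, 0) \<bullet> q / (1 + q \<bullet> q))"
proof -
  define H where "H = (\<lambda>z. hessian_trace (g' z))"
  define I where "I = (\<lambda>z. \<Sum>b\<in>Basis. (g z \<bullet> b) * (g' z (b, 0) \<bullet> g z))"
  have II: "g' z (g z, 0) \<bullet> g z = I z" if "z \<in> S" for z
  proof -
    have "linear (\<lambda>v. g' z (v, 0))"
      by (rule linear_slice[OF jet_onD(3)[OF J that]])
    from linear_sum_Basis[OF this, of "g z"] show ?thesis by (simp add: I_def inner_sum_left)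
  qed
  have cH: "continuous_on S H" unfolding H_def hessian_trace_def by (intro continuous_intros cont(3))
  have cI: "continuous_on S I" unfolding I_def by (intro continuous_intros cont)
  \<comment> \<open>The regularised defect, with l as first component of the argument; for l = 0 it
    is \<open>mcf_defect\<close>.\<close>
  define F where "F = (\<lambda>q::real \<times> ('a \<times> real). ((fst q)\<^sup>2 + g (snd q) \<bullet> g (snd q)) * (\<tau> (snd q) - H (snd q)) + I (snd q))"
  define M where "M = (\<lambda>q::real \<times> ('a \<times> real). (fst q)\<^sup>2 + g (snd q) \<bullet> g (snd q))"
  have cs: "continuous_on (UNIV \<times> S) (\<lambda>q::real \<times> ('a \<times> real). k (snd q))" if "continuous_on S k" for k :: "'a \<times> real \<Rightarrow> 'c::topological_space"
    by (rule continuous_on_compose2[OF that]) (auto intro!: continuous_intros)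
  have cF: "continuous_on (UNIV \<times> S) F" unfolding F_def by (intro continuous_intros cs cont cH cI)
  have cM: "continuous_on (UNIV \<times> S) M" unfolding M_def by (intro continuous_intros cs cont)
  have mem: "(0, Y) \<in> UNIV \<times> S" "open (UNIV \<times> S :: (real \<times> 'a \<times> real) set)" using S by (auto intro: open_Times)
  have F0: "F (0, Y) = mcf_defect g \<tau> g' Y" by (simp add: F_def mcf_defect_def II[OF S(2)] H_def)
  have g0: "g Y \<noteq> 0"
  proof
    assume "g Y = 0"
    then have "mcf_defect g \<tau> g' Y = 0" by (simp add: mcf_defect_def)
    then show False using neg by simp
  qed
  have lim: "(k \<longlongrightarrow> k (0, Y)) (nhds (0, Y))" if "continuous_on (UNIV \<times> S) k" for k :: "real \<times> 'a \<times> real \<Rightarrow> real"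
    using that mem by (simp add: continuous_on_eq_continuous_at isCont_def tendsto_at_iff_tendsto_nhds[of k "(0, Y)", symmetric])
  define m where "m = - F (0, Y) / 2"
  define C where "C = g Y \<bullet> g Y + 1"
  have m: "m > 0" "C > 0" using neg F0 by (auto simp: m_def C_def add_nonneg_pos)
  have e1: "eventually (\<lambda>q. F q < - m) (nhds (0, Y))"
    by (rule order_tendstoD(2)[OF lim[OF cF]]) (use neg F0 in \<open>simp add: m_def\<close>)
  have e2: "eventually (\<lambda>q. M q < C) (nhds (0, Y))"
    by (rule order_tendstoD(2)[OF lim[OF cM]]) (simp add: M_def C_def)
  have e3: "eventually (\<lambda>q::real \<times> ('a \<times> real). 0 < M (0, snd q)) (nhds (0, Y))"
  proof -
    have "continuous_on (UNIV \<times> S) (\<lambda>q::real \<times> ('a \<times> real). M (0, snd q))"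
      unfolding M_def by (simp, intro continuous_intros cs cont)
    from order_tendstoD(1)[OF lim[OF this], of 0] show ?thesis using g0 by (simp add: M_def)
  qed
  have e4: "eventually (\<lambda>q::real \<times> ('a \<times> real). q \<in> UNIV \<times> S) (nhds (0, Y))" by (rule eventually_nhds_in_open[OF mem(2,1)])
  from eventually_conj[OF e1 eventually_conj[OF e2 eventually_conj[OF e3 e4]]]
  obtain d where d: "d > 0" "\<And>q. dist q (0, Y) < d \<Longrightarrow> F q < - m \<and> M q < C \<and> 0 < M (0, snd q) \<and> q \<in> UNIV \<times> S"
    unfolding eventually_nhds_metric by blast
  have "\<tau> Y' + m / C \<le> hessian_trace (g' Y') - g' Y' (q, 0) \<bullet> q / (1 + q \<bullet> q)"
    if H: "dist Y' Y < d / 3" "g Y' = l *\<^sub>R q" "\<bar>l\<bar> \<le> d / 3" for Y' q l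
  proof -
    have "dist (l, Y') (0, Y) \<le> dist l 0 + dist Y' Y"
      unfolding dist_Pair_Pair by (rule sqrt_sum_squares_le_sum) auto
    then have "dist (l, Y') (0, Y) < d" using H d(1) by simp
    from d(2)[OF this] have D: "F (l, Y') < - m" "M (l, Y') < C" "0 < g Y' \<bullet> g Y'" "Y' \<in> S" by (auto simp: M_def)
    have Me: "M (l, Y') = l\<^sup>2 * (1 + q \<bullet> q)" by (simp add: M_def H(2) power2_eq_square algebra_simps)
    have Mp: "M (l, Y') > 0" using D(3) by (simp add: M_def add_nonneg_pos)
    have "linear (g' Y')" by (rule jet_onD(3)[OF J D(4)])
    then have "g' Y' (l *\<^sub>R q, 0) = l *\<^sub>R g' Y' (q, 0)" using linear_cmul[of "g' Y'" l "(q, 0)"] by simp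
    then have Ie: "I Y' = l\<^sup>2 * (g' Y' (q, 0) \<bullet> q)" using II[OF D(4)] by (simp add: H(2) power2_eq_square)
    define x where "x = \<tau> Y' - H Y'"
    define k where "k = g' Y' (q, 0) \<bullet> q"
    have l0: "l\<^sup>2 > 0" "1 + q \<bullet> q > 0" using D(3) H(2) by (auto simp: add_pos_nonneg)
    \<comment> \<open>Here l is nonzero, because DW does not vanish near Y. The gap m for F becomes
      the gap m / C after division by the factor l^2 + |DW|^2 < C.\<close>
    have "F (l, Y') = M (l, Y') * x + l\<^sup>2 * k" by (simp add: F_def M_def Ie x_def k_def)
    also have "\<dots> = M (l, Y') * (x + k / (1 + q \<bullet> q))"
      using l0 by (simp add: Me field_simps)
    finally have "M (l, Y') * (x + k / (1 + q \<bullet> q)) < - m" using D(1) by simp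
    then have "m < M (l, Y') * (- (x + k / (1 + q \<bullet> q)))" unfolding mult_minus_right by linarith
    moreover from this have "- (x + k / (1 + q \<bullet> q)) > 0" using m(1) Mp by (metis less_trans zero_less_mult_pos)
    ultimately have "m < C * (- (x + k / (1 + q \<bullet> q)))"
      using D(2) by (meson less_trans mult_strict_right_mono)
    then have "m / C < - (x + k / (1 + q \<bullet> q))" using m(2) by (simp add: pos_divide_less_eq mult.commute)
    then show ?thesis by (simp add: x_def k_def H_def)
  qed
  then show ?thesis using d(1) m by (intro exI[of _ "m / C"] conjI exI[of _ "d / 3"]) auto
qed

locale avoidance = graph_flow \<Omega> u Du Dt DDu + flow_family a b B charts
  for \<Omega> :: "'a::euclidean_space set" and u :: "'a \<times> real \<Rightarrow> ereal"
    and Du :: "'a \<times> real \<Rightarrow> 'a" and Dt :: "'a \<times> real \<Rightarrow> real" and DDu :: "'a \<times> real \<Rightarrow> 'a \<times> real \<Rightarrow> 'a"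
    and a b :: real and B :: "real \<Rightarrow> 'a set" and charts :: "('a set \<times> ('a \<Rightarrow> real \<Rightarrow> 'a)) set" +
  assumes a_nonneg: "0 \<le> a" and inside: "\<And>t. t \<in> {a..b} \<Longrightarrow> closure (B t) \<subseteq> \<Omega>"
begin

lemma finite_near:
  assumes "x \<in> \<Omega>" "0 \<le> t" "\<bar>u (x, t)\<bar> \<noteq> \<infinity>"
  shows "\<exists>d>0. \<forall>y s. dist y x < d \<longrightarrow> dist s t < d \<longrightarrow> 0 \<le> s \<longrightarrow> \<bar>u (y, s)\<bar> \<noteq> \<infinity>"
proof -
  have "continuous_on (\<Omega> \<times> {0..}) u"
    by (rule continuous_on_subset[OF cont]) (use closure_subset in blast)
  from continuous_openin_preimage_gen[OF this open_finite_ereal]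
  have "openin (top_of_set (\<Omega> \<times> {0..})) ((\<Omega> \<times> {0..}) \<inter> u -` {y. \<bar>y\<bar> \<noteq> \<infinity>})" .
  moreover define Pre where "Pre = (\<Omega> \<times> {0..}) \<inter> u -` {y. \<bar>y\<bar> \<noteq> \<infinity>}"
  have "(x, t) \<in> Pre" using assms by (simp add: Pre_def)
  ultimately have "\<exists>d>0. ball (x, t) d \<inter> (\<Omega> \<times> {0..}) \<subseteq> Pre"
    unfolding openin_contains_ball Pre_def[symmetric] by (elim conjE) (rule bspec)
  then obtain d where d: "d > 0" "ball (x, t) d \<inter> (\<Omega> \<times> {0..}) \<subseteq> Pre" by (elim exE conjE)
  obtain r where r: "r > 0" "ball x r \<subseteq> \<Omega>" using open_dom assms(1) openE by blast
  show ?thesis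
  proof (intro exI[of _ "min r (d / 2)"] conjI allI impI)
    fix y s assume H: "dist y x < min r (d / 2)" "dist s t < min r (d / 2)" "0 \<le> s"
    have "dist (y, s) (x, t) \<le> dist y x + dist s t"
      unfolding dist_Pair_Pair by (rule sqrt_sum_squares_le_sum) auto
    then have "(y, s) \<in> ball (x, t) d" using H by (simp add: dist_commute)
    moreover have "y \<in> \<Omega>" using H r(2) by (auto simp: dist_commute subset_iff)
    ultimately have "(y, s) \<in> Pre" using d(2) H(3) by blast
    then show "\<bar>u (y, s)\<bar> \<noteq> \<infinity>" by (simp add: Pre_def)
  qed (use r d in simp)
qed

lemma compact_enclosed: "compact {(x, t). t \<in> {a..b} \<and> x \<in> closure (B t)}"
proof -
  obtain R where R: "\<And>t. t \<in> {a..b} \<Longrightarrow> B t \<subseteq> cball 0 R" using uniform_bound by blast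
  have eq: "{(x, t). t \<in> {a..b} \<and> x \<in> closure (B t)} = (cball 0 R \<times> {a..b}) \<inter> {(x, t). t \<in> {a..b} \<and> x \<in> closure (B t)}"
    using closure_minimal[OF R closed_cball] by auto
  show ?thesis
    by (subst eq) (rule compact_Int_closed[OF compact_Times[OF compact_cball compact_Icc] closed_enclosed])
qed

text \<open>The common end of both avoidance arguments, at a first contact point p. The hypothesis
  \<open>cl\<close> supplies finite points near (p, T) at times up to T; \<open>lim\<close> says
  that up to T no relevant infinite point is enclosed, where at time T itself only the open set
  counts. So in a backward cylinder the relevant infinite points have height \<sigma> w \<ge> 0,
  strictly before T, and minus the perturbed height serves as the test function W.\<close>

lemma barrier_contradiction:
  assumes T: "a < T" "T \<le> b" and p: "p \<in> frontier (B T)"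
    and inf: "\<bar>u (p, T)\<bar> = \<infinity>"
    and cl: "\<And>r s. 0 < r \<Longrightarrow> a \<le> s \<Longrightarrow> s < T \<Longrightarrow> cball p r \<subseteq> \<Omega> \<Longrightarrow>
      (p, T) \<in> closure {z \<in> cball p r \<times> {s..T}. \<bar>u z\<bar> \<noteq> \<infinity>}"
    and lim: "\<And>x t. a \<le> t \<Longrightarrow> t \<le> T \<Longrightarrow> x \<in> closure (B t) \<Longrightarrow> (t = T \<Longrightarrow> x \<in> B t) \<Longrightarrow> \<bar>u (x, t)\<bar> = \<infinity> \<Longrightarrow>
      (x, t) \<in> closure {z. fst z \<in> \<Omega> \<and> a \<le> snd z \<and> \<bar>u z\<bar> \<noteq> \<infinity>} \<Longrightarrow> False"
  shows False
proof -
  have TI: "T \<in> {a..b}" using T by simp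
  from frontier_sign[OF TI p] obtain D X y0 n r0 S w g \<tau> g' \<eta> K \<sigma> e
    where sh: "sheet D X y0 T (\<lambda>_. n) r0 S w g \<tau> g' \<eta> K" and pX: "p = X y0 T"
      and \<sigma>: "\<sigma> = 1 \<or> \<sigma> = - (1::real)" and e: "0 < e"
      and side0: "\<forall>z s. dist z p < e \<longrightarrow> dist s T < e \<longrightarrow> s \<in> {a..b} \<longrightarrow>
        (z, s) \<in> S \<and> (z \<in> frontier (B s) \<longleftrightarrow> w (z, s) = 0) \<and> (z \<in> B s \<longleftrightarrow> \<sigma> * w (z, s) < 0)"
    by (elim exE conjE)
  note side = side0[rule_format]
  have pS: "(p, T) \<in> S" using sheet_base(2)[OF sh] pX by simp
  from barrier[OF sheetD(7)[OF sh] sheetD(5)[OF sh] pS sheetD(8-10)[OF sh] sheetD(11)[OF sh pS] sheetD(6)[OF sh] sheetD(18)[OF sh]]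
  obtain \<rho> where "\<exists>\<Lambda>. \<rho> > 0 \<and> \<Lambda> > 0 \<and> cball p \<rho> \<times> cball T \<rho> \<subseteq> S \<and>
    (\<forall>\<sigma> \<epsilon> x t. \<sigma> = 1 \<or> \<sigma> = -1 \<longrightarrow> 0 < \<epsilon> \<longrightarrow> \<epsilon> \<le> 1 \<longrightarrow> dist x p \<le> \<rho> \<longrightarrow> dist t T \<le> \<rho> \<longrightarrow> t \<in> {a..b} \<longrightarrow>
      \<bar>w (x, t)\<bar> \<le> \<epsilon> \<longrightarrow>
      0 < mcf_defect (\<lambda>z. \<sigma> *\<^sub>R g z + (2 * \<epsilon>) *\<^sub>R (fst z - p)) (\<lambda>z. \<sigma> * \<tau> z + \<epsilon> * \<Lambda>)
        (\<lambda>z h. \<sigma> *\<^sub>R g' z h + (2 * \<epsilon>) *\<^sub>R fst h) (x, t))" ..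
  then obtain \<Lambda> where bar0: "\<rho> > 0 \<and> \<Lambda> > 0 \<and> cball p \<rho> \<times> cball T \<rho> \<subseteq> S \<and>
    (\<forall>\<sigma> \<epsilon> x t. \<sigma> = 1 \<or> \<sigma> = -1 \<longrightarrow> 0 < \<epsilon> \<longrightarrow> \<epsilon> \<le> 1 \<longrightarrow> dist x p \<le> \<rho> \<longrightarrow> dist t T \<le> \<rho> \<longrightarrow> t \<in> {a..b} \<longrightarrow>
      \<bar>w (x, t)\<bar> \<le> \<epsilon> \<longrightarrow>
      0 < mcf_defect (\<lambda>z. \<sigma> *\<^sub>R g z + (2 * \<epsilon>) *\<^sub>R (fst z - p)) (\<lambda>z. \<sigma> * \<tau> z + \<epsilon> * \<Lambda>)
        (\<lambda>z h. \<sigma> *\<^sub>R g' z h + (2 * \<epsilon>) *\<^sub>R fst h) (x, t))" ..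
  note \<rho> = bar0[THEN conjunct1] bar0[THEN conjunct2, THEN conjunct1] bar0[THEN conjunct2, THEN conjunct2, THEN conjunct1]
  note bar = bar0[THEN conjunct2, THEN conjunct2, THEN conjunct2, rule_format]
  have "p \<in> \<Omega>" using inside[OF TI] p by (auto simp: frontier_def)
  then obtain r1 where r1: "r1 > 0" "cball p r1 \<subseteq> \<Omega>" using open_dom open_contains_cball by blast
  define r where "r = min (min 1 r1) (min (e / 2) \<rho>)"
  have r: "r > 0" "r \<le> 1" "r < e" "r \<le> \<rho>" "cball p r \<subseteq> \<Omega>"
    using r1 e \<rho>(1) by (auto simp: r_def)
  \<comment> \<open>The time span is short enough for the drift \<Lambda> (T - s') to stay below
    r^2, the value of |y - p|^2 on the lateral boundary.\<close>
  define \<delta> where "\<delta> = min (e / 2) (min \<rho> (r\<^sup>2 / (2 * \<Lambda>)))"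
  have \<delta>: "\<delta> > 0" "\<delta> < e" "\<delta> \<le> \<rho>" "\<Lambda> * \<delta> < r\<^sup>2"
  proof -
    show "\<delta> > 0" "\<delta> < e" "\<delta> \<le> \<rho>" using e \<rho>(1,2) r(1) by (auto simp: \<delta>_def)
    have "\<Lambda> * \<delta> \<le> \<Lambda> * (r\<^sup>2 / (2 * \<Lambda>))" using \<rho>(2) by (intro mult_left_mono) (auto simp: \<delta>_def)
    also have "\<dots> = r\<^sup>2 / 2" using \<rho>(2) by simp
    also have "\<dots> < r\<^sup>2" using r(1) by simp
    finally show "\<Lambda> * \<delta> < r\<^sup>2" .
  qed
  define s' where "s' = max a (T - \<delta>)"
  have s': "a \<le> s'" "s' < T" "T - s' \<le> \<delta>" using T \<delta>(1) by (auto simp: s'_def)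
  define Kc where "Kc = cball p r \<times> {s'..T}"
  have near: "dist z p < e" "dist s T < e" "dist z p \<le> \<rho>" "dist s T \<le> \<rho>" "dist z p \<le> r" "s \<in> {a..b}" "s' \<le> s" "s \<le> T" "z \<in> \<Omega>" "(z, s) \<in> S"
    if "(z, s) \<in> Kc" for z s
  proof -
    show *: "dist z p < e" "dist s T < e" "dist z p \<le> \<rho>" "dist s T \<le> \<rho>" "dist z p \<le> r" "s \<in> {a..b}" "s' \<le> s" "s \<le> T" "z \<in> \<Omega>"
      using that r \<delta> s' T(2) by (auto simp: Kc_def dist_commute dist_real_def)
    show "(z, s) \<in> S" using side[OF *(1,2,6)] by blast
  qed
  define Fi where "Fi = {z \<in> Kc. \<bar>u z\<bar> \<noteq> \<infinity>}"
  have Fi_sub: "closure Fi \<subseteq> closure {z. fst z \<in> \<Omega> \<and> a \<le> snd z \<and> \<bar>u z\<bar> \<noteq> \<infinity>}"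
  proof (rule closure_mono, rule subsetI)
    fix z assume z: "z \<in> Fi"
    obtain y s where ys: "z = (y, s)" by (cases z)
    have "(y, s) \<in> Kc" "\<bar>u (y, s)\<bar> \<noteq> \<infinity>" using z by (auto simp: Fi_def ys)
    with near(9,7)[OF this(1)] s'(1) show "z \<in> {z. fst z \<in> \<Omega> \<and> a \<le> snd z \<and> \<bar>u z\<bar> \<noteq> \<infinity>}" by (simp add: ys)
  qed
  \<comment> \<open>Only infinite points that are limits of finite ones are constrained; the
    penalised maxima accumulate only at such points.\<close>
  have pos: "0 \<le> \<sigma> * w (y, s) \<and> (s < T \<longrightarrow> 0 < \<sigma> * w (y, s))"
    if Y: "(y, s) \<in> Kc" "\<bar>u (y, s)\<bar> = \<infinity>" "(y, s) \<in> closure Fi" for y s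
  proof -
    note nr = near[OF Y(1)]
    note sd = side[OF nr(1,2,6)]
    have no: "\<not> (y \<in> closure (B s) \<and> (s = T \<longrightarrow> y \<in> B s))"
    proof
      assume "y \<in> closure (B s) \<and> (s = T \<longrightarrow> y \<in> B s)"
      then show False using lim[of s y] nr(6-8) Y(2) subsetD[OF Fi_sub Y(3)] by auto
    qed
    have nB: "y \<notin> B s" using no closure_subset by blast
    then have nn: "0 \<le> \<sigma> * w (y, s)" using sd by simp
    moreover have "0 < \<sigma> * w (y, s)" if "s < T"
    proof -
      have "y \<notin> frontier (B s)" using no that by (auto simp: frontier_def)
      then have "w (y, s) \<noteq> 0" using sd by simp
      then show ?thesis using nn \<sigma> by auto
    qed
    ultimately show ?thesis by blast
  qed
  \<comment> \<open>The infinite limit points at the bottom time. They lie strictly outside the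
    closed enclosed set, so compactness gives a positive lower bound c for \<sigma> w on
    them.\<close>
  define C where "C = ((cball p r \<times> {s'}) \<inter> u -` {y. \<bar>y\<bar> = \<infinity>}) \<inter> closure Fi"
  have Csub: "z \<in> Kc" if "z \<in> C" for z using that s'(2) by (auto simp: C_def Kc_def)
  have "compact C"
  proof -
    have "cball p r \<times> {s'} \<subseteq> closure \<Omega> \<times> {0..}"
      using r(5) closure_subset[of \<Omega>] s'(1) a_nonneg by auto
    from continuous_on_subset[OF cont this] have "continuous_on (cball p r \<times> {s'}) u" .
    moreover have "closed {y::ereal. \<bar>y\<bar> = \<infinity>}"
      using open_finite_ereal unfolding closed_def by (simp add: Collect_neg_eq[symmetric])
    ultimately have "closed ((cball p r \<times> {s'}) \<inter> u -` {y. \<bar>y\<bar> = \<infinity>})"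
      by (intro continuous_closed_preimage closed_Times) auto
    then have "closed C" unfolding C_def by (rule closed_Int[OF _ closed_closure])
    then have "compact ((cball p r \<times> {s'}) \<inter> C)" by (intro compact_Int_closed compact_Times) auto
    moreover have "(cball p r \<times> {s'}) \<inter> C = C" by (auto simp: C_def)
    ultimately show ?thesis by simp
  qed
  have "\<exists>c>0. \<forall>z\<in>C. c \<le> \<sigma> * w z"
  proof (cases "C = {}")
    case False
    have "C \<subseteq> S" using Csub near(10) by fastforce
    then have "continuous_on C (\<lambda>z. \<sigma> * w z)"
      by (intro continuous_intros continuous_on_subset[OF sheet_continuous(1)[OF sh]])
    then obtain zm where zm: "zm \<in> C" "\<And>z. z \<in> C \<Longrightarrow> \<sigma> * w zm \<le> \<sigma> * w z"
      using continuous_attains_inf[OF \<open>compact C\<close> False] by blast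
    have "0 < \<sigma> * w zm"
      using pos[of "fst zm" "snd zm"] Csub[OF zm(1)] zm(1) s'(2) by (auto simp: C_def)
    then show ?thesis using zm(2) by blast
  qed (auto intro: exI[of _ 1])
  then obtain c where c: "c > 0" "\<And>z. z \<in> C \<Longrightarrow> c \<le> \<sigma> * w z" by blast
  \<comment> \<open>Below c, so that bottom points fall short of W(p, T), and at most 1, as
    \<open>barrier\<close> requires.\<close>
  define \<epsilon> where "\<epsilon> = min 1 (c / 2)"
  have \<epsilon>: "\<epsilon> > 0" "\<epsilon> \<le> 1" "\<epsilon> < c" using c(1) by (auto simp: \<epsilon>_def)
  have r2: "r\<^sup>2 \<le> 1" using r(1,2) by (simp add: power_le_one)
  define W where "W = (\<lambda>z. - \<sigma> * w z + - \<epsilon> * ((fst z - p) \<bullet> (fst z - p)) + - \<epsilon> * \<Lambda> * (snd z - s'))"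
  define gW where "gW = (\<lambda>z::'a \<times> real. - \<sigma> *\<^sub>R g z + (2 * - \<epsilon>) *\<^sub>R (fst z - p))"
  define \<tau>W where "\<tau>W = (\<lambda>z. - \<sigma> * \<tau> z + - \<epsilon> * \<Lambda>)"
  define hW where "hW = (\<lambda>z h. - \<sigma> *\<^sub>R g' z h + (2 * - \<epsilon>) *\<^sub>R fst h)"
  have JW: "jet_on S W gW \<tau>W hW"
    unfolding W_def gW_def \<tau>W_def hW_def by (rule jet_on_barrier[OF sheetD(7)[OF sh]])
  have cW: "continuous_on S gW" "continuous_on S \<tau>W" "\<And>h. continuous_on S (\<lambda>z. hW z h)"
    unfolding gW_def \<tau>W_def hW_def by (intro continuous_intros sheetD(8-10)[OF sh])+
  have KS: "cball p r \<times> {s'..T} \<subseteq> S" using near(10) unfolding Kc_def by blast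
  have w0: "w (p, T) = 0" using sheet_base(3)[OF sh] pX by simp
  show False
  proof (rule comparison[OF r(5) _ JW sheetD(5)[OF sh] KS _ inf cl[OF r(1) s'(1,2) r(5)]])
    show "0 \<le> s'" using s'(1) a_nonneg by simp
    show "(p, T) \<in> cball p r \<times> {s'..T}" using r(1) s'(2) by simp
    fix Y assume Y: "Y \<in> cball p r \<times> {s'..T}" "\<bar>u Y\<bar> = \<infinity>"
      "Y \<in> closure {z \<in> cball p r \<times> {s'..T}. \<bar>u z\<bar> \<noteq> \<infinity>}" "W (p, T) \<le> W Y"
    obtain y s where ys: "Y = (y, s)" by (cases Y)
    have YK: "(y, s) \<in> Kc" "\<bar>u (y, s)\<bar> = \<infinity>" "(y, s) \<in> closure Fi" using Y ys by (auto simp: Kc_def Fi_def)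
    note nr = near[OF YK(1)]
    note ps = pos[OF YK]
    \<comment> \<open>Rewriting of W(p, T) \<le> W Y. As the right-hand side is less than \<epsilon>
      r^2 \<le> \<epsilon>, it excludes the lateral boundary and the bottom and gives |w| \<le>
      \<epsilon>.\<close>
    have sum: "\<sigma> * w (y, s) + \<epsilon> * ((y - p) \<bullet> (y - p)) + \<epsilon> * \<Lambda> * (s - s') \<le> \<epsilon> * \<Lambda> * (T - s')"
      using Y(4) w0 by (simp add: W_def ys)
    have up: "\<epsilon> * \<Lambda> * (T - s') < \<epsilon> * r\<^sup>2"
    proof -
      have "\<Lambda> * (T - s') \<le> \<Lambda> * \<delta>" using \<rho>(2) s'(3) by (intro mult_left_mono) auto
      then have "\<Lambda> * (T - s') < r\<^sup>2" using \<delta>(4) by simp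
      then show ?thesis using \<epsilon>(1) by simp
    qed
    have q1: "0 \<le> \<epsilon> * ((y - p) \<bullet> (y - p))" using \<epsilon> by simp
    have q2: "0 \<le> \<epsilon> * \<Lambda> * (s - s')" using \<epsilon> \<rho>(2) nr(7) by simp
    have "\<epsilon> * r\<^sup>2 \<le> \<epsilon> * 1" using \<epsilon> r2 by (intro mult_left_mono) auto
    then have we: "\<sigma> * w (y, s) < \<epsilon>" using sum up q1 q2 by simp
    have R1: "dist y p < r"
    proof (rule ccontr)
      assume "\<not> dist y p < r"
      then have "r\<^sup>2 \<le> (dist y p)\<^sup>2" using r(1) by (intro power_mono) auto
      then have "r\<^sup>2 \<le> (y - p) \<bullet> (y - p)" by (simp add: dist_norm power2_norm_eq_inner)
      then have "\<epsilon> * r\<^sup>2 \<le> \<epsilon> * ((y - p) \<bullet> (y - p))" using \<epsilon> by (intro mult_left_mono) auto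
      then show False using sum up ps q2 by linarith
    qed
    have R2: "s \<noteq> s'"
    proof
      assume "s = s'"
      then have "(y, s) \<in> C" using YK by (auto simp: C_def Kc_def)
      from c(2)[OF this] show False using we \<epsilon>(3) by simp
    qed
    have "\<bar>w (y, s)\<bar> = \<bar>\<sigma> * w (y, s)\<bar>" using \<sigma> by (auto simp: abs_mult)
    then have "\<bar>w (y, s)\<bar> \<le> \<epsilon>" using ps we by simp
    from bar[OF \<sigma> \<epsilon>(1,2) nr(3,4,6) this]
    have dp: "0 < mcf_defect (\<lambda>z. \<sigma> *\<^sub>R g z + (2 * \<epsilon>) *\<^sub>R (fst z - p)) (\<lambda>z. \<sigma> * \<tau> z + \<epsilon> * \<Lambda>)
        (\<lambda>z h. \<sigma> *\<^sub>R g' z h + (2 * \<epsilon>) *\<^sub>R fst h) (y, s)" .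
    define G where "G = (\<lambda>z::'a \<times> real. \<sigma> *\<^sub>R g z + (2 * \<epsilon>) *\<^sub>R (fst z - p))"
    define G\<tau> where "G\<tau> = (\<lambda>z. \<sigma> * \<tau> z + \<epsilon> * \<Lambda>)"
    define GG where "GG = (\<lambda>z h. \<sigma> *\<^sub>R g' z h + (2 * \<epsilon>) *\<^sub>R fst h)"
    have "jet_on S (\<lambda>z. \<sigma> * w z + \<epsilon> * ((fst z - p) \<bullet> (fst z - p)) + \<epsilon> * \<Lambda> * (snd z - s')) G G\<tau> GG"
      unfolding G_def G\<tau>_def GG_def by (rule jet_on_barrier[OF sheetD(7)[OF sh]])
    then have lin: "linear (GG (y, s))" using nr(10) by (rule jet_onD(3))
    have "gW = (\<lambda>z. (-1) *\<^sub>R G z)" "\<tau>W = (\<lambda>z. (-1) * G\<tau> z)" "hW = (\<lambda>z h. (-1) *\<^sub>R GG z h)"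
      by (auto simp: gW_def \<tau>W_def hW_def G_def G\<tau>_def GG_def fun_eq_iff)
    then have "mcf_defect gW \<tau>W hW (y, s) = (-1) ^ 3 * mcf_defect G G\<tau> GG (y, s)"
      by (simp only: mcf_defect_scale[where g' = GG and z = "(y, s)", OF lin])
    then have "mcf_defect gW \<tau>W hW (y, s) < 0" using dp unfolding G_def G\<tau>_def GG_def by simp
    from defect_to_graph_inequality[OF JW sheetD(5)[OF sh] nr(10) cW this]
    show "dist (fst Y) p < r \<and> (snd Y = s' \<longrightarrow> (\<forall>x\<in>cball p r. \<bar>u (x, s')\<bar> = \<infinity>)) \<and>
      (\<exists>c>0. \<exists>\<delta>>0. \<forall>Y'\<in>cball p r \<times> {s'..T}. dist Y' Y < \<delta> \<longrightarrow> (\<forall>q l. gW Y' = l *\<^sub>R q \<and> \<bar>l\<bar> \<le> \<delta> \<longrightarrow>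
        \<tau>W Y' + c \<le> hessian_trace (hW Y') - hW Y' (q, 0) \<bullet> q / (1 + q \<bullet> q)))"
      using R1 R2 unfolding ys fst_conv snd_conv by blast
  qed
qed

text \<open>The enclosed region in space-time is compact, so the earliest time at which it meets a
  closed set is attained.\<close>

lemma first_contact:
  assumes Q: "closed Q" and ne: "\<exists>t\<in>{a..b}. \<exists>x\<in>closure (B t). (x, t) \<in> Q" and base: "\<forall>x\<in>closure (B a). (x, a) \<notin> Q"
  shows "\<exists>T x. a < T \<and> T \<le> b \<and> x \<in> closure (B T) \<and> (x, T) \<in> Q \<and> (\<forall>t y. a \<le> t \<longrightarrow> t < T \<longrightarrow> y \<in> closure (B t) \<longrightarrow> (y, t) \<notin> Q)"
proof -
  define E where "E = {(x, t). t \<in> {a..b} \<and> x \<in> closure (B t)} \<inter> Q"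
  have "compact E" unfolding E_def by (rule compact_Int_closed[OF compact_enclosed Q])
  moreover have "E \<noteq> {}"
  proof -
    from ne obtain t x where "t \<in> {a..b}" "x \<in> closure (B t)" "(x, t) \<in> Q" by blast
    then have "(x, t) \<in> E" by (simp add: E_def)
    then show ?thesis by blast
  qed
  ultimately have "\<exists>z\<in>E. \<forall>z'\<in>E. snd z \<le> snd z'"
    by (rule continuous_attains_inf) (intro continuous_intros)
  then obtain z where z: "z \<in> E" "\<And>z'. z' \<in> E \<Longrightarrow> snd z \<le> snd z'" by blast
  obtain x T where xT: "z = (x, T)" by (cases z)
  have H: "T \<in> {a..b}" "x \<in> closure (B T)" "(x, T) \<in> Q" using z(1) xT by (auto simp: E_def)
  have "T \<noteq> a" using H base by auto
  moreover have "(y, t) \<notin> Q" if "a \<le> t" "t < T" "y \<in> closure (B t)" for t y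
    using z(2)[of "(y, t)"] that H(1) xT by (auto simp: E_def)
  ultimately show ?thesis using H by (intro exI[of _ T] exI[of _ x]) auto
qed

text \<open>Stability of membership off the boundary gives a full backward cylinder inside the
  moving sets, which is what the shrinking ball results need.\<close>

lemma interior_cylinder:
  assumes T: "a < T" "T \<le> b" and x: "x \<in> B T"
  shows "\<exists>e>0. a < T - e \<and> cball x e \<subseteq> \<Omega> \<and> (\<forall>y t. dist y x \<le> e \<longrightarrow> T - e \<le> t \<longrightarrow> t \<le> T \<longrightarrow> y \<in> B t)"
proof -
  have TI: "T \<in> {a..b}" using T by simp
  from off_frontier_stable[OF TI frontier_disjoint[OF TI x]] obtain e where e: "e > 0"
    "\<And>z s. dist z x < e \<Longrightarrow> dist s T < e \<Longrightarrow> s \<in> {a..b} \<Longrightarrow> z \<in> B s" using x by blast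
  have "x \<in> \<Omega>" using inside[OF TI] x closure_subset by blast
  then obtain r where r: "r > 0" "cball x r \<subseteq> \<Omega>" using open_dom open_contains_cball by blast
  define d where "d = min (e / 2) (min r ((T - a) / 2))"
  have d: "0 < d" "d < e" "d \<le> r" using e r T by (auto simp: d_def)
  have "d \<le> (T - a) / 2" unfolding d_def by (rule min.coboundedI2[OF min.cobounded2])
  then have dT: "a < T - d" using T by (simp add: field_simps)
  have "y \<in> B t" if H: "dist y x \<le> d" "T - d \<le> t" "t \<le> T" for y t
    by (rule e(2)) (use H d dT T in \<open>auto simp: dist_real_def\<close>)
  then show ?thesis using d dT r by (intro exI[of _ d]) auto
qed

text \<open>At the first time T with an infinite point in the closed enclosed set, points of the
  open set \<open>B T\<close> are still finite by \<open>finiteness_persists\<close>, so the contact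
  lies on the boundary. It is approached by finite points of \<open>B T\<close>, which gives the
  accumulation that \<open>barrier_contradiction\<close> asks for.\<close>

theorem finite_set_avoidance:
  assumes base: "\<forall>x\<in>closure (B a). \<bar>u (x, a)\<bar> \<noteq> \<infinity>" and t: "t \<in> {a..b}" and x: "x \<in> closure (B t)"
  shows "\<bar>u (x, t)\<bar> \<noteq> \<infinity>"
proof
  assume bad: "\<bar>u (x, t)\<bar> = \<infinity>"
  define E where "E = {(x, t). t \<in> {a..b} \<and> x \<in> closure (B t)}"
  define Q where "Q = E \<inter> u -` {y. \<bar>y\<bar> = \<infinity>}"
  have "continuous_on E u"
    by (rule continuous_on_subset[OF cont]) (use inside closure_subset[of \<Omega>] a_nonneg in \<open>force simp: E_def\<close>)
  moreover have "closed {y::ereal. \<bar>y\<bar> = \<infinity>}"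
    using open_finite_ereal unfolding closed_def by (simp add: Collect_neg_eq[symmetric])
  ultimately have "closed Q" unfolding Q_def
    using closed_enclosed by (intro continuous_closed_preimage) (simp_all add: E_def)
  from first_contact[OF this] obtain T p where T: "a < T" "T \<le> b" and p: "p \<in> closure (B T)" "(p, T) \<in> Q"
    and before: "\<And>t y. a \<le> t \<Longrightarrow> t < T \<Longrightarrow> y \<in> closure (B t) \<Longrightarrow> (y, t) \<notin> Q"
    using bad t x base by (fastforce simp: Q_def E_def)
  have TI: "T \<in> {a..b}" using T by simp
  have fin: "\<bar>u (y, t)\<bar> \<noteq> \<infinity>" if "a \<le> t" "t < T" "y \<in> closure (B t)" for t y
    using before[OF that] that T by (auto simp: Q_def E_def)
  have int: "\<bar>u (y, T)\<bar> \<noteq> \<infinity>" if y: "y \<in> B T" for y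
  proof -
    obtain e where e: "e > 0" "a < T - e" "cball y e \<subseteq> \<Omega>" "\<And>z t. dist z y \<le> e \<Longrightarrow> T - e \<le> t \<Longrightarrow> t \<le> T \<Longrightarrow> z \<in> B t"
      using interior_cylinder[OF T y] by blast
    show ?thesis
    proof (rule finiteness_persists[where r = e and ?t1.0 = "T - e"])
      show "y \<in> \<Omega>" using e(1,3) by auto
      show "\<bar>u (z, t)\<bar> \<noteq> \<infinity>" if "z \<in> cball y e" "T - e \<le> t" "t < T" for z t
      proof -
        have "z \<in> B t" using that by (intro e(4)) (auto simp: dist_commute)
        then show ?thesis using that e(2) closure_subset[of "B t"] by (intro fin) auto
      qed
    qed (use e a_nonneg in auto)
  qed
  have inf: "\<bar>u (p, T)\<bar> = \<infinity>" using p(2) by (simp add: Q_def)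
  have "p \<notin> B T" by (rule notI) (rule notE[OF int inf])
  then have pf: "p \<in> frontier (B T)" using p(1) unfolding closure_eq[OF TI] by simp
  show False
  proof (rule barrier_contradiction[OF T pf inf])
    fix r s :: real assume r: "0 < r" "a \<le> s" "s < T"
    show "(p, T) \<in> closure {z \<in> cball p r \<times> {s..T}. \<bar>u z\<bar> \<noteq> \<infinity>}"
      unfolding closure_approachable
    proof (intro allI impI)
      fix d :: real assume d: "d > 0"
      obtain y where y: "y \<in> B T" "dist y p < min d r" using p(1) d r unfolding closure_approachable by (metis min_less_iff_conj)
      then show "\<exists>z\<in>{z \<in> cball p r \<times> {s..T}. \<bar>u z\<bar> \<noteq> \<infinity>}. dist z (p, T) < d"
        using int r by (intro bexI[of _ "(y, T)"]) (auto simp: dist_Pair_Pair dist_commute)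
    qed
  next
    fix x t assume "a \<le> t" "t \<le> T" "x \<in> closure (B t)" "t = T \<Longrightarrow> x \<in> B t" "\<bar>u (x, t)\<bar> = \<infinity>"
    then show False using fin[of t x] int[of x] by (cases "t = T") auto
  qed
qed

text \<open>The closure of the finite points is taken in space-time: this makes the set closed for
  \<open>first_contact\<close>, and it detects finite points that would appear only after the
  contact time. Such points are excluded by \<open>no_spontaneous_finiteness\<close>.\<close>

theorem infinite_set_avoidance:
  defines "F \<equiv> {z. fst z \<in> \<Omega> \<and> a \<le> snd z \<and> \<bar>u z\<bar> \<noteq> \<infinity>}"
  assumes base: "\<forall>x\<in>closure (B a). (x, a) \<notin> closure F" and t: "t \<in> {a..b}" and x: "x \<in> closure (B t)"
  shows "(x, t) \<notin> closure F"
proof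
  assume bad: "(x, t) \<in> closure F"
  from first_contact[OF closed_closure] obtain T p where T: "a < T" "T \<le> b" and p: "p \<in> closure (B T)" "(p, T) \<in> closure F"
    and before: "\<And>t y. a \<le> t \<Longrightarrow> t < T \<Longrightarrow> y \<in> closure (B t) \<Longrightarrow> (y, t) \<notin> closure F"
    using bad t x base by blast
  have TI: "T \<in> {a..b}" and T0: "0 \<le> T" using T a_nonneg by auto
  have inf: "\<bar>u (y, t)\<bar> = \<infinity>" if "a \<le> t" "t < T" "y \<in> closure (B t)" for t y
  proof -
    have "y \<in> \<Omega>" using inside[of t] that T by auto
    moreover have "(y, t) \<notin> F" using before[OF that] closure_subset by blast
    ultimately show ?thesis using that(1) by (simp add: F_def)
  qed
  \<comment> \<open>Finiteness is an open condition, so a finite point of \<open>B T\<close> would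
    be finite at slightly earlier times while still enclosed.\<close>
  have infT: "\<bar>u (y, T)\<bar> = \<infinity>" if y: "y \<in> B T" for y
  proof (rule ccontr)
    assume nf: "\<bar>u (y, T)\<bar> \<noteq> \<infinity>"
    obtain e where e: "e > 0" "a < T - e" "cball y e \<subseteq> \<Omega>" "\<And>z t. dist z y \<le> e \<Longrightarrow> T - e \<le> t \<Longrightarrow> t \<le> T \<Longrightarrow> z \<in> B t"
      using interior_cylinder[OF T y] by blast
    have y\<Omega>: "y \<in> \<Omega>" using e(1,3) by auto
    obtain d where d: "d > 0" "\<And>z s. dist z y < d \<Longrightarrow> dist s T < d \<Longrightarrow> 0 \<le> s \<Longrightarrow> \<bar>u (z, s)\<bar> \<noteq> \<infinity>"
      using finite_near[OF y\<Omega> T0 nf] by blast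
    define s where "s = T - min e (d / 2)"
    have s: "a \<le> s" "s < T" "T - e \<le> s" "dist s T < d" using e d by (auto simp: s_def dist_real_def)
    have "y \<in> B s" using e(1,4) s by simp
    then have "\<bar>u (y, s)\<bar> = \<infinity>" using inf[OF s(1,2)] closure_subset by blast
    then show False using d s a_nonneg by auto
  qed
  \<comment> \<open>Finite points near (y, T) cannot occur before T, where the cylinder is enclosed;
    so they would have to appear at times from T on, although u(., T) is infinite around y.\<close>
  have int: "(y, T) \<notin> closure F" if y: "y \<in> B T" for y
  proof
    assume cl: "(y, T) \<in> closure F"
    obtain e where e: "e > 0" "a < T - e" "cball y e \<subseteq> \<Omega>" "\<And>z t. dist z y \<le> e \<Longrightarrow> T - e \<le> t \<Longrightarrow> t \<le> T \<Longrightarrow> z \<in> B t"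
      using interior_cylinder[OF T y] by blast
    have y\<Omega>: "y \<in> \<Omega>" using e(1,3) by auto
    have "eventually (\<lambda>z. \<bar>u (z, T)\<bar> = \<infinity>) (nhds y)"
      unfolding eventually_nhds_metric using e(1,4) infT by (intro exI[of _ e]) auto
    from no_spontaneous_finiteness[OF y\<Omega> T0 this]
    have "(y, T) \<notin> closure {z. fst z \<in> \<Omega> \<and> T \<le> snd z \<and> \<bar>u z\<bar> \<noteq> \<infinity>}" .
    moreover have "(y, T) \<in> closure {z. fst z \<in> \<Omega> \<and> T \<le> snd z \<and> \<bar>u z\<bar> \<noteq> \<infinity>}"
      unfolding closure_approachable
    proof (intro allI impI)
      fix d :: real assume "d > 0"
      then obtain z where z: "z \<in> F" "dist z (y, T) < min d e"
        using cl e(1) unfolding closure_approachable by (metis min_less_iff_conj)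
      have zd: "dist (fst z) y < e" "dist (snd z) T < e"
        using z(2) dist_fst_le[of z "(y, T)"] dist_snd_le[of z "(y, T)"] by auto
      have "T \<le> snd z"
      proof (rule ccontr)
        assume nT: "\<not> T \<le> snd z"
        then have "fst z \<in> B (snd z)" using zd by (intro e(4)) (auto simp: dist_real_def)
        then have "\<bar>u (fst z, snd z)\<bar> = \<infinity>"
          using z(1) nT closure_subset[of "B (snd z)"] by (intro inf) (auto simp: F_def)
        then show False using z(1) by (simp add: F_def)
      qed
      then show "\<exists>z\<in>{z. fst z \<in> \<Omega> \<and> T \<le> snd z \<and> \<bar>u z\<bar> \<noteq> \<infinity>}. dist z (y, T) < d"
        using z by (intro bexI[of _ z]) (auto simp: F_def)
    qed
    ultimately show False by blast
  qed
  have pf: "p \<in> frontier (B T)" using closure_eq[OF TI] p int by blast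
  have p\<Omega>: "p \<in> \<Omega>" using inside[OF TI] p(1) by blast
  have pinf: "\<bar>u (p, T)\<bar> = \<infinity>"
  proof (rule ccontr)
    assume "\<bar>u (p, T)\<bar> \<noteq> \<infinity>"
    from finite_near[OF p\<Omega> T0 this] obtain d where d: "d > 0" "\<And>z s. dist z p < d \<Longrightarrow> dist s T < d \<Longrightarrow> 0 \<le> s \<Longrightarrow> \<bar>u (z, s)\<bar> \<noteq> \<infinity>" by blast
    obtain y where "y \<in> B T" "dist y p < d" using p(1) d(1) unfolding closure_approachable by blast
    then show False using d infT[of y] T0 by auto
  qed
  show False
  proof (rule barrier_contradiction[OF T pf pinf])
    fix r s :: real assume r: "0 < r" "a \<le> s" "s < T" "cball p r \<subseteq> \<Omega>"
    show "(p, T) \<in> closure {z \<in> cball p r \<times> {s..T}. \<bar>u z\<bar> \<noteq> \<infinity>}"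
    proof (rule ccontr)
      assume "\<not> ?thesis"
      then obtain d where d0: "d > 0" "\<not> (\<exists>z\<in>{z \<in> cball p r \<times> {s..T}. \<bar>u z\<bar> \<noteq> \<infinity>}. dist z (p, T) < d)"
        unfolding closure_approachable not_all not_imp by (elim exE conjE)
      have d: "\<bar>u z\<bar> = \<infinity>" if z: "z \<in> cball p r \<times> {s..T}" "dist z (p, T) < d" for z
      proof (rule ccontr)
        assume "\<bar>u z\<bar> \<noteq> \<infinity>"
        with z(1) have "z \<in> {z \<in> cball p r \<times> {s..T}. \<bar>u z\<bar> \<noteq> \<infinity>}" by (intro CollectI conjI)
        with z(2) have "\<exists>z\<in>{z \<in> cball p r \<times> {s..T}. \<bar>u z\<bar> \<noteq> \<infinity>}. dist z (p, T) < d" by (rule bexI)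
        with d0(2) show False by (rule notE)
      qed
      \<comment> \<open>If no finite points accumulated from times up to T, \<open>u\<close> would
        be infinite around p at time T. Then none could appear afterwards either, contradicting that
        (p, T) is a limit of finite points.\<close>
      have "eventually (\<lambda>y. \<bar>u (y, T)\<bar> = \<infinity>) (nhds p)"
        unfolding eventually_nhds_metric
      proof (intro exI[of _ "min d r"] conjI allI impI)
        fix y assume y: "dist y p < min d r"
        show "\<bar>u (y, T)\<bar> = \<infinity>"
          by (rule d) (use y r in \<open>simp_all add: dist_Pair_Pair dist_commute\<close>)
      qed (use d0(1) r(1) in simp)
      from no_spontaneous_finiteness[OF p\<Omega> T0 this]
      have "(p, T) \<notin> closure {z. fst z \<in> \<Omega> \<and> T \<le> snd z \<and> \<bar>u z\<bar> \<noteq> \<infinity>}" .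
      then obtain d' where d': "d' > 0" "\<not> (\<exists>z\<in>{z. fst z \<in> \<Omega> \<and> T \<le> snd z \<and> \<bar>u z\<bar> \<noteq> \<infinity>}. dist z (p, T) < d')"
        unfolding closure_approachable not_all not_imp by (elim exE conjE)
      define d'' where "d'' = min (min d d') (min r (T - s))"
      have "d'' > 0" using d0(1) d'(1) r by (simp add: d''_def)
      then obtain z where z: "z \<in> F" "dist z (p, T) < d''" using p(2) unfolding closure_approachable by blast
      have zd: "dist (fst z) p < r" "dist (snd z) T < T - s"
        using z(2) dist_fst_le[of z "(p, T)"] dist_snd_le[of z "(p, T)"] by (auto simp: d''_def)
      have dz: "dist z (p, T) < d'" using z(2) by (simp add: d''_def)
      have "z \<notin> {z. fst z \<in> \<Omega> \<and> T \<le> snd z \<and> \<bar>u z\<bar> \<noteq> \<infinity>}"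
        by (rule contrapos_nn[OF d'(2)]) (erule bexI[rotated], rule dz)
      then have zT: "snd z < T" using z(1) by (simp add: F_def not_le)
      have "z \<in> cball p r \<times> {s..T}" using zd zT by (auto simp: mem_Times_iff dist_commute dist_real_def)
      then show False using d[of z] z by (simp add: F_def d''_def)
    qed
  next
    fix x t assume "a \<le> t" "t \<le> T" "x \<in> closure (B t)" "t = T \<Longrightarrow> x \<in> B t"
      "(x, t) \<in> closure {z. fst z \<in> \<Omega> \<and> a \<le> snd z \<and> \<bar>u z\<bar> \<noteq> \<infinity>}"
    then show False using before[of t x] int[of x] by (cases "t = T") (auto simp: F_def)
  qed
qed

end

section \<open>From classical flows to charts, and the weak solution property\<close>

lemma classical_flow_family:
  fixes B :: "real \<Rightarrow> 'a::euclidean_space set"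
  assumes ab: "a < b" and B: "\<forall>t\<in>{a..b}. open (B t) \<and> compact (closure (B t)) \<and> closure (B t) \<subseteq> \<Omega> \<and> smooth_boundary (B t)"
    and flow: "classical_mcf {a..b} (\<lambda>t. frontier (B t))"
  shows "\<exists>charts. flow_family a b B charts"
proof -
  from flow[unfolded classical_mcf_def] obtain T :: "real topology" where
    "\<exists>(A :: (real set \<times> (real \<Rightarrow> 'a)) set) (X :: real \<Rightarrow> real \<Rightarrow> 'a).
      smooth_manifold T A \<and>
      (\<forall>(U, \<phi>)\<in>A. smooth_on (\<phi> ` U \<times> {a..b}) (\<lambda>(y, t). X (inv_into U \<phi> y) t)) \<and>
      (\<forall>t\<in>{a..b}. (\<lambda>q. X q t) ` topspace T = frontier (B t)) \<and>
      (\<forall>(U, \<phi>)\<in>A. \<forall>q\<in>U. \<forall>t\<in>{a..b}.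
         let F = (\<lambda>y. X (inv_into U \<phi> y) t) in
           immersion_at F (\<phi> q) \<and>
           (\<forall>\<nu>. unit_normal F (\<phi> q) \<nu> \<longrightarrow>
              (X q has_vector_derivative - mean_curvature F (\<phi> q) \<nu> *\<^sub>R \<nu>) (at t within {a..b})))" ..
  then obtain A :: "(real set \<times> (real \<Rightarrow> 'a)) set" where
    "\<exists>(X :: real \<Rightarrow> real \<Rightarrow> 'a).
      smooth_manifold T A \<and>
      (\<forall>(U, \<phi>)\<in>A. smooth_on (\<phi> ` U \<times> {a..b}) (\<lambda>(y, t). X (inv_into U \<phi> y) t)) \<and>
      (\<forall>t\<in>{a..b}. (\<lambda>q. X q t) ` topspace T = frontier (B t)) \<and>
      (\<forall>(U, \<phi>)\<in>A. \<forall>q\<in>U. \<forall>t\<in>{a..b}.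
         let F = (\<lambda>y. X (inv_into U \<phi> y) t) in
           immersion_at F (\<phi> q) \<and>
           (\<forall>\<nu>. unit_normal F (\<phi> q) \<nu> \<longrightarrow>
              (X q has_vector_derivative - mean_curvature F (\<phi> q) \<nu> *\<^sub>R \<nu>) (at t within {a..b})))" ..
  then obtain X :: "real \<Rightarrow> real \<Rightarrow> 'a" where X0:
      "smooth_manifold T A \<and>
      (\<forall>(U, \<phi>)\<in>A. smooth_on (\<phi> ` U \<times> {a..b}) (\<lambda>(y, t). X (inv_into U \<phi> y) t)) \<and>
      (\<forall>t\<in>{a..b}. (\<lambda>q. X q t) ` topspace T = frontier (B t)) \<and>
      (\<forall>(U, \<phi>)\<in>A. \<forall>q\<in>U. \<forall>t\<in>{a..b}.
         let F = (\<lambda>y. X (inv_into U \<phi> y) t) in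
           immersion_at F (\<phi> q) \<and>
           (\<forall>\<nu>. unit_normal F (\<phi> q) \<nu> \<longrightarrow>
              (X q has_vector_derivative - mean_curvature F (\<phi> q) \<nu> *\<^sub>R \<nu>) (at t within {a..b})))" ..
  note M = X0[THEN conjunct1]
  have sm: "smooth_on (\<phi> ` U \<times> {a..b}) (\<lambda>(y, t). X (inv_into U \<phi> y) t)" if "(U, \<phi>) \<in> A" for U \<phi>
    using bspec[OF X0[THEN conjunct2, THEN conjunct1] that] by simp
  note im = X0[THEN conjunct2, THEN conjunct2, THEN conjunct1, THEN bspec]
  have fl: "immersion_at (\<lambda>y. X (inv_into U \<phi> y) t) (\<phi> q) \<and>
      (\<forall>\<nu>. unit_normal (\<lambda>y. X (inv_into U \<phi> y) t) (\<phi> q) \<nu> \<longrightarrow>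
        (X q has_vector_derivative - mean_curvature (\<lambda>y. X (inv_into U \<phi> y) t) (\<phi> q) \<nu> *\<^sub>R \<nu>) (at t within {a..b}))"
    if "(U, \<phi>) \<in> A" "q \<in> U" "t \<in> {a..b}" for U \<phi> q t
    using bspec[OF X0[THEN conjunct2, THEN conjunct2, THEN conjunct2] that(1)] that(2,3) by (simp add: Let_def)
  have top: "topspace T = \<Union> (fst ` A)"
    and chart: "\<And>U \<phi>. (U, \<phi>) \<in> A \<Longrightarrow> openin T U \<and> openin (top_of_set model_hyperplane) (\<phi> ` U) \<and>
        homeomorphic_map (subtopology T U) (top_of_set (\<phi> ` U)) \<phi>"
    using M unfolding smooth_manifold_def by auto
  \<comment> \<open>A chart is injective on its domain, so the trajectory of a chart parameter is
    the trajectory of the manifold point.\<close>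
  have inv: "inv_into U \<phi> (\<phi> q) = q" if "(U, \<phi>) \<in> A" "q \<in> U" for U \<phi> q
  proof -
    have "topspace (subtopology T U) = U" using chart[OF that(1)] openin_subset by (auto simp: topspace_subtopology)
    then have "inj_on \<phi> U" using homeomorphic_imp_injective_map[of "subtopology T U" "top_of_set (\<phi> ` U)" \<phi>] chart[OF that(1)] by simp
    then show ?thesis using that(2) by (rule inv_into_f_f)
  qed
  define charts where "charts = (\<lambda>(U, \<phi>). (\<phi> ` U, \<lambda>y t. X (inv_into U \<phi> y) t)) ` A"
  have charts: "\<exists>U \<phi>. (U, \<phi>) \<in> A \<and> D = \<phi> ` U \<and> Y = (\<lambda>y t. X (inv_into U \<phi> y) t)" if "(D, Y) \<in> charts" for D Y
    using that unfolding charts_def by auto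
  have "flow_family a b B charts"
  proof
    fix D Y assume DY: "(D, Y) \<in> charts"
    obtain U \<phi> where U: "(U, \<phi>) \<in> A" "D = \<phi> ` U" "Y = (\<lambda>y t. X (inv_into U \<phi> y) t)" using charts[OF DY] by blast
    show "openin (top_of_set model_hyperplane) D" using chart[OF U(1)] U(2) by blast
    show "smooth_on (D \<times> {a..b}) (\<lambda>(y, t). Y y t)" using sm[OF U(1)] unfolding U(2,3) .
    fix y t assume y: "y \<in> D" "t \<in> {a..b}"
    obtain q where q: "q \<in> U" "y = \<phi> q" using y(1) U(2) by blast
    show "immersion_at (\<lambda>y. Y y t) y" using fl[OF U(1) q(1) y(2)] unfolding U(3) q(2) by blast
    show "(Y y has_vector_derivative - mean_curvature (\<lambda>y. Y y t) y \<nu> *\<^sub>R \<nu>) (at t within {a..b})"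
      if n: "unit_normal (\<lambda>y. Y y t) y \<nu>" for \<nu>
    proof -
      have "Y y = X q" unfolding U(3) q(2) inv[OF U(1) q(1)] ..
      then show ?thesis using fl[OF U(1) q(1) y(2)] n unfolding q(2) by (simp add: U(3))
    qed
  next
    fix t assume t: "t \<in> {a..b}"
    have "(\<Union>(D, Y)\<in>charts. (\<lambda>y. Y y t) ` D) = (\<Union>(U, \<phi>)\<in>A. (\<lambda>q. X q t) ` U)"
      unfolding charts_def using inv by (force simp: image_iff)
    also have "\<dots> = (\<lambda>q. X q t) ` topspace T" unfolding top by force
    finally show "(\<Union>(D, Y)\<in>charts. (\<lambda>y. Y y t) ` D) = frontier (B t)" using im[OF t] by simp
  qed (use ab B in auto)
  then show ?thesis ..
qed

theorem theorem3p5: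
  fixes \<Omega> :: "(real ^ 'n) set"
    and u :: "real ^ 'n \<Rightarrow> real \<Rightarrow> ereal"
    and A :: "real \<Rightarrow> (real ^ 'n) set"
  assumes "open \<Omega>"
    and "smooth_boundary \<Omega>"
    and "\<forall>p\<in>frontier \<Omega>. boundary_mean_curvature \<Omega> p \<ge> 0"
    and "continuous_on (closure \<Omega> \<times> {0..}) (\<lambda>(x, t). u x t)"
    and "smooth_on {(x, t). x \<in> \<Omega> \<and> 0 < t \<and> \<bar>u x t\<bar> < \<infinity>} (\<lambda>(x, t). real_of_ereal (u x t))"
    and "\<And>x t. x \<in> \<Omega> \<Longrightarrow> 0 < t \<Longrightarrow> \<bar>u x t\<bar> < \<infinity> \<Longrightarrow>
           (let Du = gradient (\<lambda>y. real_of_ereal (u y t)) in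
            ((\<lambda>s. real_of_ereal (u x s)) has_real_derivative
               sqrt (1 + (norm (Du x))\<^sup>2) *
               divergence (\<lambda>y. Du y /\<^sub>R sqrt (1 + (norm (Du y))\<^sup>2)) x) (at t))"
    and "\<And>t. 0 \<le> t \<Longrightarrow> A t = {x \<in> closure \<Omega>. \<bar>u x t\<bar> < \<infinity>}"
  shows "mcf_weak_solution \<Omega> A \<and>
         (\<forall>t\<ge>0. boundary_values \<Omega> A t = {x \<in> frontier \<Omega>. \<bar>u x t\<bar> < \<infinity>})"
proof -
  note op = assms(1) and cont = assms(4) and smooth = assms(5) and pde = assms(6) and A = assms(7)
  have lt: "\<bar>y\<bar> < \<infinity> \<longleftrightarrow> \<bar>y\<bar> \<noteq> \<infinity>" for y :: ereal by (cases y) auto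
  define v where "v = (\<lambda>(x, t). u x t)"
  have vu: "v (x, t) = u x t" for x t by (simp add: v_def)
  have cv: "continuous_on (closure \<Omega> \<times> {0..}) v" using cont by (simp add: v_def)
  define F where "F = {(x, t). x \<in> \<Omega> \<and> 0 < t \<and> \<bar>v (x, t)\<bar> \<noteq> \<infinity>}"
  define U where "U = (\<lambda>z. real_of_ereal (v z))"
  have oF: "open F" unfolding F_def by (rule open_finiteness_domain[OF op cv])
  have "smooth_on F U" using smooth unfolding F_def U_def lt by (simp add: v_def case_prod_unfold)
  then have Ck: "Ck_on 2 F U" by (rule smooth_on_open_Ck[OF oF])
  have gf: "graph_flow \<Omega> v (space_gradient U) (\<lambda>z. frechet_derivative U (at z) (0, 1)) (\<lambda>z. frechet_derivative (space_gradient U) (at z))"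
  proof
    show "jet_on {(x, t). x \<in> \<Omega> \<and> 0 < t \<and> \<bar>v (x, t)\<bar> \<noteq> \<infinity>} (\<lambda>z. real_of_ereal (v z)) (space_gradient U)
        (\<lambda>z. frechet_derivative U (at z) (0, 1)) (\<lambda>z. frechet_derivative (space_gradient U) (at z))"
      using jet_on_Ck[OF oF Ck] unfolding F_def U_def .
    fix x t assume xt: "x \<in> \<Omega>" "0 < t" "\<bar>v (x, t)\<bar> \<noteq> \<infinity>"
    have "(x, t) \<in> F" using xt by (simp add: F_def)
    then show "frechet_derivative U (at (x, t)) (0, 1) = hessian_trace (frechet_derivative (space_gradient U) (at (x, t))) -
        frechet_derivative (space_gradient U) (at (x, t)) (space_gradient U (x, t), 0) \<bullet> space_gradient U (x, t) /
        (1 + space_gradient U (x, t) \<bullet> space_gradient U (x, t))"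
      by (rule graph_equation_jet[OF oF Ck]) (use pde[of x t] xt in \<open>simp add: U_def v_def lt Let_def\<close>)
  qed (use op cv in auto)
  interpret graph_flow \<Omega> v "space_gradient U" "\<lambda>z. frechet_derivative U (at z) (0, 1)" "\<lambda>z. frechet_derivative (space_gradient U) (at z)"
    by (rule gf)
  have At: "x \<in> A t \<longleftrightarrow> x \<in> closure \<Omega> \<and> \<bar>v (x, t)\<bar> \<noteq> \<infinity>" if "0 \<le> t" for x t
    using A[OF that] by (simp add: vu lt)
  have rel: "relatively_open_family \<Omega> A"
    unfolding relatively_open_family_def
  proof (intro allI impI)
    fix t :: real assume t: "0 \<le> t"
    have "continuous_on (closure \<Omega>) (\<lambda>x. v (x, t))"
      by (rule continuous_on_compose2[OF cv]) (use t in \<open>auto intro!: continuous_intros\<close>)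
    from continuous_openin_preimage_gen[OF this open_finite_ereal]
    show "openin (top_of_set (closure \<Omega>)) (A t)" by (rule back_subst[where P = "openin _"]) (use At[OF t] in auto)
  qed
  have rel': "relatively_open_family \<Omega> (\<lambda>t. closure \<Omega> - closure (A t))"
    unfolding relatively_open_family_def Diff_eq by (intro allI impI openin_open_Int open_Compl closed_closure)
  have av: "\<exists>charts. avoidance \<Omega> v (space_gradient U) (\<lambda>z. frechet_derivative U (at z) (0, 1))
      (\<lambda>z. frechet_derivative (space_gradient U) (at z)) a b B charts"
    if ab: "0 \<le> a" "a < b" and B: "\<forall>t\<in>{a..b}. open (B t) \<and> compact (closure (B t)) \<and> closure (B t) \<subseteq> \<Omega> \<and> smooth_boundary (B t)"
      and fl: "classical_mcf {a..b} (\<lambda>t. frontier (B t))" for a b B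
  proof -
    obtain charts where "flow_family a b B charts" using classical_flow_family[OF ab(2) B fl] ..
    then have "avoidance \<Omega> v (space_gradient U) (\<lambda>z. frechet_derivative U (at z) (0, 1))
      (\<lambda>z. frechet_derivative (space_gradient U) (at z)) a b B charts"
      unfolding avoidance_def avoidance_axioms_def using gf ab B by blast
    then show ?thesis ..
  qed
  have "mcf_supersolution \<Omega> A"
    unfolding mcf_supersolution_def
  proof (intro conjI rel allI impI subsetI)
    fix a b :: real and B x
    assume H: "0 \<le> a \<and> a < b \<and> (\<forall>t\<in>{a..b}. open (B t) \<and> compact (closure (B t)) \<and> closure (B t) \<subseteq> \<Omega> \<and> smooth_boundary (B t)) \<and>
        classical_mcf {a..b} (\<lambda>t. frontier (B t))" and base: "closure (B a) \<subseteq> A a" and x: "x \<in> B b"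
    then obtain charts where C: "avoidance \<Omega> v (space_gradient U) (\<lambda>z. frechet_derivative U (at z) (0, 1))
      (\<lambda>z. frechet_derivative (space_gradient U) (at z)) a b B charts" using av by blast
    have xc: "x \<in> closure (B b)" using x closure_subset by blast
    have "\<bar>v (x, b)\<bar> \<noteq> \<infinity>"
      by (rule avoidance.finite_set_avoidance[OF C _ _ xc]) (use base At[of a] H in auto)
    moreover have "x \<in> closure \<Omega>" using xc H closure_subset by fastforce
    ultimately show "x \<in> A b" using At[of b] H by simp
  qed
  moreover have "mcf_supersolution \<Omega> (\<lambda>t. closure \<Omega> - closure (A t))"
    unfolding mcf_supersolution_def
  proof (intro conjI rel' allI impI subsetI)
    fix a b :: real and B x
    assume H: "0 \<le> a \<and> a < b \<and> (\<forall>t\<in>{a..b}. open (B t) \<and> compact (closure (B t)) \<and> closure (B t) \<subseteq> \<Omega> \<and> smooth_boundary (B t)) \<and>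
        classical_mcf {a..b} (\<lambda>t. frontier (B t))" and base: "closure (B a) \<subseteq> closure \<Omega> - closure (A a)" and x: "x \<in> B b"
    then obtain charts where C: "avoidance \<Omega> v (space_gradient U) (\<lambda>z. frechet_derivative U (at z) (0, 1))
      (\<lambda>z. frechet_derivative (space_gradient U) (at z)) a b B charts" using av by blast
    define G where "G = {z. fst z \<in> \<Omega> \<and> a \<le> snd z \<and> \<bar>v z\<bar> \<noteq> \<infinity>}"
    have bI: "b \<in> {a..b}" "a \<in> {a..b}" using H by auto
    have Bb: "B b \<subseteq> \<Omega>" using H bI closure_subset by blast
    \<comment> \<open>Initially the closed set avoids the closure of \<open>A a\<close>, a statement
      about a single time. It says that \<open>u\<close> is infinite around each of its points at
      time a, and \<open>no_spontaneous_finiteness\<close> turns this into the space-time statement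
      required by \<open>infinite_set_avoidance\<close>.\<close>
    have nG: "(y, b) \<notin> closure G" if y: "y \<in> closure (B b)" for y
      unfolding G_def
    proof (rule avoidance.infinite_set_avoidance[OF C _ bI(1) y], rule ballI)
      fix y assume y: "y \<in> closure (B a)"
      have y\<Omega>: "y \<in> \<Omega>" using y H bI(2) by blast
      have "y \<in> \<Omega> \<inter> - closure (A a)" using y y\<Omega> base by blast
      moreover have "open (\<Omega> \<inter> - closure (A a))" using op by (intro open_Int open_Compl) auto
      ultimately have "eventually (\<lambda>z. z \<in> \<Omega> \<inter> - closure (A a)) (nhds y)" by (intro eventually_nhds_in_open)
      then have "eventually (\<lambda>z. \<bar>v (z, a)\<bar> = \<infinity>) (nhds y)"
        by eventually_elim (use At[of a] H closure_subset[of \<Omega>] closure_subset[of "A a"] in blast)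
      then show "(y, a) \<notin> closure {z. fst z \<in> \<Omega> \<and> a \<le> snd z \<and> \<bar>v z\<bar> \<noteq> \<infinity>}"
        using H by (intro no_spontaneous_finiteness[OF y\<Omega>]) auto
    qed
    \<comment> \<open>The whole open set \<open>B b\<close> is free of finite points, and an open
      set disjoint from \<open>A b\<close> is disjoint from its closure.\<close>
    have "y \<notin> A b" if y: "y \<in> B b" for y
    proof -
      have "(y, b) \<notin> G" using nG[OF subsetD[OF closure_subset y]] subsetD[OF closure_subset, of "(y, b)" G] by blast
      then show ?thesis using At[of b y] H y Bb by (auto simp: G_def)
    qed
    moreover have "open (B b)" using H bI by blast
    ultimately have "x \<notin> closure (A b)" using x open_Int_closure_eq_empty[of "B b" "A b"] by blast
    then show "x \<in> closure \<Omega> - closure (A b)" using x Bb closure_subset by blast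
  qed
  ultimately have "mcf_weak_solution \<Omega> A"
    using rel by (simp add: mcf_weak_solution_def mcf_subsolution_def)
  moreover have "boundary_values \<Omega> A t = {x \<in> frontier \<Omega>. \<bar>u x t\<bar> < \<infinity>}" if "0 \<le> t" for t
    using A[OF that] by (auto simp: boundary_values_def frontier_def)
  ultimately show ?thesis by blast
qed

end
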